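(* Let $q\in(0,1)$, $a\in\mathbb{R}$, $t=q^a-q^{-a}$, let $\mathcal{B}=\mathcal{O}_q(S_t^2)$ and let $C:\mathcal{B}\to\mathcal{D}_2^+\oplus\mathcal{D}_2^-$ be the $1$-cocycle $C(b)=b\,e_a-\epsilon(b)e_a$, where $e_a$ is the cyclic vector of $\mathcal{M}_{q+q^{-1},a}$ and $\mathcal{D}_2^+\oplus\mathcal{D}_2^-\subset\mathcal{M}_{q+q^{-1},a}$ carries the invariant inner product described in the context. Then $C$ is proper, that is, $$C^{n*}C^n:=\sum_{j=-n}^{n}\bigl\|C\bigl(u^n_{\eta^n_{[a+2j]},\eta^n_{[a]}}\bigr)\bigr\|^2\longrightarrow\infty\qquad(n\to\infty).$$ In particular $C$ is not a coboundary, i.e. there is no $\xi\in\mathcal{D}_2^+\oplus\mathcal{D}_2^-$ with $C(b)=b\,\xi-\epsilon(b)\xi$ for all $b\in\mathcal{B}$.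
   Context: Notation: $i=\sqrt{-1}$, $[c]=\frac{q^c-q^{-c}}{q-q^{-1}}$, $\{c\}=q^c+q^{-c}$ for $c\in\mathbb{R}$. Sweedler notation is used. Inner products are linear in the second variable. Hopf $*$-algebras. $\mathcal{A}=\mathcal{O}_q(SU(2))$ is the unital $*$-algebra generated by $\alpha,\gamma$ with $\alpha^*\alpha+\gamma^*\gamma=1$, $\alpha\alpha^*+q^2\gamma\gamma^*=1$, $\gamma^*\gamma=\gamma\gamma^*$, $\alpha\gamma=q\gamma\alpha$, $\alpha\gamma^*=q\gamma^*\alpha$; the matrix $U_{1/2}=\begin{bmatrix}\alpha&-q\gamma^*\\ \gamma&\alpha^*\end{bmatrix}=(u_{ij})$ is a unitary corepresentation, $\Delta(u_{ij})=\sum_k u_{ik}\otimes u_{kj}$, $\epsilon(u_{ij})=\delta_{ij}$. $U_q(\mathfrak{su}(2))$ is generated by $k^{\pm1},e,f$ with $ke=q^2ek$, $kf=q^{-2}fk$, $[e,f]=\frac{k-k^{-1}}{q-q^{-1}}$, $\Delta(k)=k\otimes k$, $\Delta(e)=e\otimes1+k\otimes e$, $\Delta(f)=1\otimes f+f\otimes k^{-1}$, $\epsilon(k)=1$, $\epsilon(e)=\epsilon(f)=0$, $k^*=k$, $e^*=fk$, $f^*=k^{-1}e$. The unitary pairing $(\cdot,\cdot):\mathcal{A}\otimes U_q(\mathfrak{su}(2))\to\mathbb{C}$ (with $(a,hk)=(a_{(1)},h)(a_{(2)},k)$, $(ab,h)=(a,h_{(1)})(b,h_{(2)})$) is determined by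 $(U_{1/2},k)=\mathrm{diag}(q,q^{-1})$, $(U_{1/2},e)=\begin{bmatrix}0&q^{1/2}\\ 0&0\end{bmatrix}$, $(U_{1/2},f)=\begin{bmatrix}0&0\\ q^{-1/2}&0\end{bmatrix}$. It embeds $U_q(\mathfrak{su}(2))$ in $\mathcal{U}=\mathrm{Hom}(\mathcal{A},\mathbb{C})=\prod_s\mathbb{B}(H_s)$, where $H_s$ ($s\in\frac12\mathbb{Z}_{\ge0}$) is the $(2s+1)$-dimensional irreducible unitary corepresentation, with associated representation $\pi_s$ and matrix coefficients $u^s_{\xi,\eta}$, $(u^s_{\xi,\eta},h)=\langle\xi,\pi_s(h)\eta\rangle$. For $b\in\mathcal{A}$, $h\in\mathcal{U}$: $h\rhd b=b_{(1)}(b_{(2)},h)$, $b\lhd h=(b_{(1)},h)b_{(2)}$. Podleś sphere. $B_t=-q^{1/2}k^{-1}e+q^{1/2}f-i(q-q^{-1})^{-1}t\,k^{-1}$, so $\epsilon(iB_t)=[a]$. $\pi_s(iB_t)$ is self-adjoint with simple eigenvalues $[a+2j]$, $j=-s,\dots,s$, and orthonormal eigenvectors $\eta^s_{[a+2j]}$. $\mathcal{B}=\mathcal{O}_q(S^2_t)=\{b\in\mathcal{A}: h\rhd b=\epsilon(h)b\ \forall h\in\mathbb{C}[B_t]\}$, a unital left coideal $*$-subalgebra; it is the span of the $u^n_{\xi,\eta^n_{[a]}}$, $n\in\mathbb{Z}_{\ge0}$, $\xi\in H_n$. Stabilizer dual. $\mathcal{I}_c=\bigoplus_{n\in\mathbb{Z}}\mathbb{C}\Phi_n\subset\mathcal{U}$,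 where $\Phi_n$ acts in each $H_s$ as the projection onto the $[a+2n]$-eigenspace of $iB_t$. $\mathcal{B}\bowtie\mathcal{I}_c$ is the $*$-algebra spanned by products $b\omega$ ($b\in\mathcal{B},\omega\in\mathcal{I}_c$) with $\omega b=(b\lhd S^{-1}(\omega_{(2)}))\omega_{(1)}$; $\epsilon(b\omega)=\epsilon(b)\epsilon(\omega)$, $\epsilon(\Phi_n)=\delta_{n,0}$. Modules. $\mathcal{B}\bowtie\mathcal{I}_c$ acts on $\mathcal{B}$ by $b\cdot b'=bb'$, $\omega\cdot b'=b'\lhd S^{-1}(\omega)$. Let $\mathcal{B}_0=\{b\in\mathcal{B}: b\lhd S^{-1}(\omega)=\epsilon(\omega)b\ \forall\omega\in\mathcal{I}_c\}$. The matrix coefficients of spin $1$ in $\mathcal{B}_0$ form a line, containing a unique $Y$ with $\epsilon(Y)=1$, and $\mathcal{B}_0=\mathbb{C}[Y]$. Put $A_a=(q+q^{-1}+(q+q^{-1})^{-1}t^2)\,Y-(q+q^{-1})^{-1}t^2$, so $\epsilon(A_a)=q+q^{-1}$. For $0<\lambda\le q+q^{-1}$ let $\mathcal{M}_{\lambda,a}=\mathcal{B}/\mathcal{B}(A_a-\lambda)$ (quotient module), with $e_a$ the class of $1$. For every $n$, $\Phi_n\mathcal{M}_{q+q^{-1},a}$ is one-dimensional and $\Phi_0\mathcal{M}_{q+q^{-1},a}=\mathbb{C}e_a$. $\mathcal{D}_2^{+}$ (resp. $\mathcal{D}_2^-$) is the submodule $\bigoplus_{n>0}\Phi_n\mathcal{M}_{q+q^{-1},a}$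 (resp. $\bigoplus_{n<0}$). Inner product. For $0<\lambda<q+q^{-1}$ let $\langle\cdot,\cdot\rangle$ be the unique inner product on $\mathcal{M}_{\lambda,a}$ making it a $*$-representation of $\mathcal{B}\bowtie\mathcal{I}_c$ with $\langle e_a,e_a\rangle=1$, and set $\langle\cdot,\cdot\rangle_\lambda=\{a+2\}\{a\}^{-1}(q+q^{-1}-\lambda)^{-1}(\{2a+1\}+\lambda)^{-1}\langle\cdot,\cdot\rangle$. The inner product on $\mathcal{D}_2^+\oplus\mathcal{D}_2^-$ is the limit: every element has the form $C(b)=(b-\epsilon(b))e_a$ with $b\in\mathcal{B}$, and $\langle C(b),C(b')\rangle=\lim_{\lambda\to q+q^{-1}}\langle (b-\epsilon(b))e_a,(b'-\epsilon(b'))e_a\rangle_\lambda$, the right side computed in $\mathcal{M}_{\lambda,a}$. *)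

theory Defs
  imports Complex_Main "HOL-Library.Poly_Mapping" "HOL-Library.Product_Plus"
    "HOL-Library.Set_Algebras"
begin

section \<open>Free complex algebras\<close>

text \<open>
  \<^typ>\<open>'m \<Rightarrow>\<^sub>0 complex\<close> is the monoid algebra of the (additively written) monoid \<^typ>\<open>'m\<close>.
  Taking for \<^typ>\<open>'m\<close> the words in a set of letters gives the free unital algebra \<open>F\<close> on these
  letters, and taking pairs of words gives the algebra \<open>F \<otimes> F\<close>.
\<close>

datatype 'g fword = FWord (letters: "'g list")

instantiation fword :: (type) monoid_add
begin
definition zero_fword :: "'a fword" where "0 = FWord []"
definition plus_fword :: "'a fword \<Rightarrow> 'a fword \<Rightarrow> 'a fword"
  where "v + w = FWord (letters v @ letters w)"
instance by standard (auto simp: zero_fword_def plus_fword_def)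
end

definition cst :: "complex \<Rightarrow> ('m::monoid_add \<Rightarrow>\<^sub>0 complex)"
  where "cst c = Poly_Mapping.single 0 c"

definition scl :: "complex \<Rightarrow> ('m::monoid_add \<Rightarrow>\<^sub>0 complex) \<Rightarrow> ('m \<Rightarrow>\<^sub>0 complex)"
  where "scl c x = cst c * x"

definition mon :: "'m \<Rightarrow> ('m \<Rightarrow>\<^sub>0 complex)"
  where "mon w = Poly_Mapping.single w 1"

interpretation fa: vector_space "scl :: complex \<Rightarrow> ('m::monoid_add \<Rightarrow>\<^sub>0 complex) \<Rightarrow> _"
proof
  show "scl a (scl b x) = scl (a * b) x" for a b and x :: "'m \<Rightarrow>\<^sub>0 complex"
    by (simp add: scl_def cst_def mult.assoc[symmetric] mult_single)
  show "scl 1 x = x" for x :: "'m \<Rightarrow>\<^sub>0 complex"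
    by (simp add: scl_def cst_def)
qed (simp_all add: scl_def cst_def algebra_simps single_add)

text \<open>Extension of a map given on the basis, linear with respect to the scaling \<open>sc\<close> of the target.\<close>

definition lin_ext :: "(complex \<Rightarrow> 'r \<Rightarrow> 'r) \<Rightarrow> ('m \<Rightarrow> 'r) \<Rightarrow> ('m \<Rightarrow>\<^sub>0 complex) \<Rightarrow> 'r::comm_monoid_add"
  where "lin_ext sc \<phi> p = (\<Sum>w\<in>Poly_Mapping.keys p. sc (Poly_Mapping.lookup p w) (\<phi> w))"

definition tensor :: "('m \<Rightarrow>\<^sub>0 complex) \<Rightarrow> ('m \<Rightarrow>\<^sub>0 complex) \<Rightarrow> ('m::monoid_add \<times> 'm \<Rightarrow>\<^sub>0 complex)"
  where "tensor x y = lin_ext scl (\<lambda>v. lin_ext scl (\<lambda>w. mon (v, w)) y) x"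


section \<open>The Hopf *-algebra \<open>\<O>\<^sub>q(SU(2))\<close>\<close>

text \<open>
  \<open>\<A> = \<O>\<^sub>q(SU(2))\<close> is the quotient \<open>F / RelIdeal q\<close> of the free unital algebra \<open>F\<close> on
  \<open>\<alpha>, \<alpha>\<^sup>*, \<gamma>, \<gamma>\<^sup>*\<close> by the *-ideal \<open>RelIdeal q\<close> generated by the defining relations. Elements of \<open>\<A>\<close> are
  handled through representatives in \<open>F\<close>: an equation \<open>x = y\<close> in \<open>\<A>\<close> reads \<open>x - y \<in> RelIdeal q\<close>, a
  subspace of \<open>\<A>\<close> is given by its full preimage in \<open>F\<close>, and a functional on \<open>\<A>\<close> is a functional
  on \<open>F\<close> that vanishes on \<open>RelIdeal q\<close>. The structure maps below all descend to the quotient.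
\<close>

datatype gen = Gen_a | Gen_a_st | Gen_c | Gen_c_st

type_synonym falg = "gen fword \<Rightarrow>\<^sub>0 complex"
type_synonym falg2 = "(gen fword \<times> gen fword) \<Rightarrow>\<^sub>0 complex"

abbreviation gelt :: "gen \<Rightarrow> falg" where "gelt g \<equiv> mon (FWord [g])"
abbreviation al :: falg where "al \<equiv> gelt Gen_a"
abbreviation als :: falg where "als \<equiv> gelt Gen_a_st"
abbreviation ga :: falg where "ga \<equiv> gelt Gen_c"
abbreviation gas :: falg where "gas \<equiv> gelt Gen_c_st"

abbreviation qc :: "real \<Rightarrow> complex" where "qc q \<equiv> complex_of_real q"

primrec star_gen :: "gen \<Rightarrow> gen" where
  "star_gen Gen_a = Gen_a_st"
| "star_gen Gen_a_st = Gen_a"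
| "star_gen Gen_c = Gen_c_st"
| "star_gen Gen_c_st = Gen_c"

definition star :: "falg \<Rightarrow> falg"
  where "star = lin_ext (\<lambda>c. scl (cnj c)) (\<lambda>w. mon (FWord (rev (map star_gen (letters w)))))"

definition rels :: "real \<Rightarrow> falg set" where
  "rels q = {als * al + gas * ga - 1,
             al * als + scl ((qc q)\<^sup>2) (ga * gas) - 1,
             gas * ga - ga * gas,
             al * ga - scl (qc q) (ga * al),
             al * gas - scl (qc q) (gas * al)}"

definition RelIdeal :: "real \<Rightarrow> falg set"
  where "RelIdeal q = fa.span {x * r * y | x r y. r \<in> rels q \<union> star ` rels q}"

text \<open>The kernel of \<open>F \<otimes> F \<rightarrow> \<A> \<otimes> \<A>\<close>.\<close>

definition RelIdeal2 :: "real \<Rightarrow> falg2 set"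
  where "RelIdeal2 q = fa.span ({tensor x y | x y. x \<in> RelIdeal q} \<union> {tensor x y | x y. y \<in> RelIdeal q})"

text \<open>
  The matrix corepresentation \<open>U\<^bsub>1/2\<^esub>\<close> has the entries \<open>u\<^sub>1\<^sub>1 = \<alpha>\<close>, \<open>u\<^sub>1\<^sub>2 = - q \<gamma>\<^sup>*\<close>, \<open>u\<^sub>2\<^sub>1 = \<gamma>\<close>, \<open>u\<^sub>2\<^sub>2 = \<alpha>\<^sup>*\<close>.
  Hence \<open>\<Delta>(u\<^sub>i\<^sub>j) = \<Sum>\<^sub>k u\<^sub>i\<^sub>k \<otimes> u\<^sub>k\<^sub>j\<close>, \<open>\<epsilon>(u\<^sub>i\<^sub>j) = \<delta>\<^sub>i\<^sub>j\<close>, \<open>S(u\<^sub>i\<^sub>j) = u\<^sub>j\<^sub>i\<^sup>*\<close> give the values on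
  the four generators that follow.
\<close>

primrec cop_gen :: "real \<Rightarrow> gen \<Rightarrow> falg2" where
  "cop_gen q Gen_a = tensor al al - scl (qc q) (tensor gas ga)"
| "cop_gen q Gen_a_st = tensor als als - scl (qc q) (tensor ga gas)"
| "cop_gen q Gen_c = tensor ga al + tensor als ga"
| "cop_gen q Gen_c_st = tensor gas als + tensor al gas"

definition cop :: "real \<Rightarrow> falg \<Rightarrow> falg2"
  where "cop q = lin_ext scl (\<lambda>w. prod_list (map (cop_gen q) (letters w)))"

primrec eps_gen :: "gen \<Rightarrow> complex" where
  "eps_gen Gen_a = 1"
| "eps_gen Gen_a_st = 1"
| "eps_gen Gen_c = 0"
| "eps_gen Gen_c_st = 0"

definition eps :: "falg \<Rightarrow> complex"
  where "eps = lin_ext (*) (\<lambda>w. prod_list (map eps_gen (letters w)))"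

primrec antipode_gen :: "real \<Rightarrow> gen \<Rightarrow> falg" where
  "antipode_gen q Gen_a = als"
| "antipode_gen q Gen_a_st = al"
| "antipode_gen q Gen_c = scl (- qc q) ga"
| "antipode_gen q Gen_c_st = scl (- (1 / qc q)) gas"

primrec antipode_inv_gen :: "real \<Rightarrow> gen \<Rightarrow> falg" where
  "antipode_inv_gen q Gen_a = als"
| "antipode_inv_gen q Gen_a_st = al"
| "antipode_inv_gen q Gen_c = scl (- (1 / qc q)) ga"
| "antipode_inv_gen q Gen_c_st = scl (- qc q) gas"

definition antipode :: "real \<Rightarrow> falg \<Rightarrow> falg"
  where "antipode q = lin_ext scl (\<lambda>w. prod_list (rev (map (antipode_gen q) (letters w))))"

definition antipode_inv :: "real \<Rightarrow> falg \<Rightarrow> falg"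
  where "antipode_inv q = lin_ext scl (\<lambda>w. prod_list (rev (map (antipode_inv_gen q) (letters w))))"


section \<open>The dual \<open>\<U> = Hom(\<A>, \<complex>)\<close>\<close>

definition Udual :: "real \<Rightarrow> (falg \<Rightarrow> complex) set"
  where "Udual q = {h. Vector_Spaces.linear scl (*) h \<and> (\<forall>x\<in>RelIdeal q. h x = 0)}"

definition conv :: "real \<Rightarrow> (falg \<Rightarrow> complex) \<Rightarrow> (falg \<Rightarrow> complex) \<Rightarrow> falg \<Rightarrow> complex"
  where "conv q g h b = lin_ext (*) (\<lambda>(v, w). g (mon v) * h (mon w)) (cop q b)"

primrec conv_pow :: "real \<Rightarrow> (falg \<Rightarrow> complex) \<Rightarrow> nat \<Rightarrow> falg \<Rightarrow> complex" where
  "conv_pow q h 0 = eps"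
| "conv_pow q h (Suc m) = conv q h (conv_pow q h m)"

text \<open>The involution of \<open>\<U>\<close> for a unitary pairing, \<open>(b, h\<^sup>*) = conj (S(b)\<^sup>*, h)\<close>.\<close>

definition dstar :: "real \<Rightarrow> (falg \<Rightarrow> complex) \<Rightarrow> falg \<Rightarrow> complex"
  where "dstar q h b = cnj (h (star (antipode q b)))"

text \<open>\<open>h \<rhd> b = b\<^sub>(\<^sub>1\<^sub>) (b\<^sub>(\<^sub>2\<^sub>), h)\<close> and \<open>b \<lhd> h = (b\<^sub>(\<^sub>1\<^sub>), h) b\<^sub>(\<^sub>2\<^sub>)\<close>.\<close>

definition lact :: "real \<Rightarrow> (falg \<Rightarrow> complex) \<Rightarrow> falg \<Rightarrow> falg"
  where "lact q h b = lin_ext scl (\<lambda>(v, w). scl (h (mon w)) (mon v)) (cop q b)"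

definition ract :: "real \<Rightarrow> falg \<Rightarrow> (falg \<Rightarrow> complex) \<Rightarrow> falg"
  where "ract q b h = lin_ext scl (\<lambda>(v, w). scl (h (mon v)) (mon w)) (cop q b)"

text \<open>
  The images in \<open>\<U>\<close> of the generators of \<open>U\<^sub>q(su(2))\<close>. On words they are determined by
  \<open>(ab, h) = (a, h\<^sub>(\<^sub>1\<^sub>)) (b, h\<^sub>(\<^sub>2\<^sub>))\<close> and the coproducts \<open>\<Delta>(k) = k \<otimes> k\<close>,
  \<open>\<Delta>(e) = e \<otimes> 1 + k \<otimes> e\<close>, \<open>\<Delta>(f) = 1 \<otimes> f + f \<otimes> k\<^sup>-\<^sup>1\<close>; the unit of \<open>\<U>\<close> is \<open>\<epsilon>\<close>. On generators,
  \<open>(u\<^sub>1\<^sub>2, e) = q\<^bsup>1/2\<^esup>\<close> becomes \<open>(\<gamma>\<^sup>*, e) = - q\<^bsup>-1/2\<^esup>\<close>.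
\<close>

primrec k_gen :: "real \<Rightarrow> gen \<Rightarrow> complex" where
  "k_gen q Gen_a = qc q"
| "k_gen q Gen_a_st = 1 / qc q"
| "k_gen q Gen_c = 0"
| "k_gen q Gen_c_st = 0"

primrec kinv_gen :: "real \<Rightarrow> gen \<Rightarrow> complex" where
  "kinv_gen q Gen_a = 1 / qc q"
| "kinv_gen q Gen_a_st = qc q"
| "kinv_gen q Gen_c = 0"
| "kinv_gen q Gen_c_st = 0"

primrec e_gen :: "real \<Rightarrow> gen \<Rightarrow> complex" where
  "e_gen q Gen_a = 0"
| "e_gen q Gen_a_st = 0"
| "e_gen q Gen_c = 0"
| "e_gen q Gen_c_st = - (1 / qc (sqrt q))"

primrec f_gen :: "real \<Rightarrow> gen \<Rightarrow> complex" where
  "f_gen q Gen_a = 0"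
| "f_gen q Gen_a_st = 0"
| "f_gen q Gen_c = 1 / qc (sqrt q)"
| "f_gen q Gen_c_st = 0"

primrec e_word :: "real \<Rightarrow> gen list \<Rightarrow> complex" where
  "e_word q [] = 0"
| "e_word q (g # w) = e_gen q g * prod_list (map eps_gen w) + k_gen q g * e_word q w"

primrec f_word :: "real \<Rightarrow> gen list \<Rightarrow> complex" where
  "f_word q [] = 0"
| "f_word q (g # w) = eps_gen g * f_word q w + f_gen q g * prod_list (map (kinv_gen q) w)"

definition U_kinv :: "real \<Rightarrow> falg \<Rightarrow> complex"
  where "U_kinv q = lin_ext (*) (\<lambda>w. prod_list (map (kinv_gen q) (letters w)))"

definition U_e :: "real \<Rightarrow> falg \<Rightarrow> complex"
  where "U_e q = lin_ext (*) (\<lambda>w. e_word q (letters w))"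

definition U_f :: "real \<Rightarrow> falg \<Rightarrow> complex"
  where "U_f q = lin_ext (*) (\<lambda>w. f_word q (letters w))"


section \<open>Corepresentations\<close>

text \<open>
  A vector of \<open>\<complex>\<^sup>N\<close> is a function on the naturals that vanishes from \<open>N\<close> on; only the entries
  \<open>u i j\<close> with \<open>i, j < N\<close> of a matrix \<open>u\<close> matter.
\<close>

definition cvec :: "nat \<Rightarrow> (nat \<Rightarrow> complex) set"
  where "cvec N = {x. \<forall>i\<ge>N. x i = 0}"

definition cinner :: "nat \<Rightarrow> (nat \<Rightarrow> complex) \<Rightarrow> (nat \<Rightarrow> complex) \<Rightarrow> complex"
  where "cinner N x y = (\<Sum>i<N. cnj (x i) * y i)"

definition csubspace :: "nat \<Rightarrow> (nat \<Rightarrow> complex) set \<Rightarrow> bool"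
  where "csubspace N V \<longleftrightarrow> V \<subseteq> cvec N \<and> (\<lambda>_. 0) \<in> V \<and>
    (\<forall>x\<in>V. \<forall>y\<in>V. \<forall>c. (\<lambda>i. x i + c * y i) \<in> V)"

text \<open>The representation \<open>\<pi>\<close> of \<open>\<U>\<close> associated with \<open>u\<close>: \<open>\<pi>(h)\<^sub>i\<^sub>j = (u\<^sub>i\<^sub>j, h)\<close>.\<close>

definition rep :: "nat \<Rightarrow> (nat \<Rightarrow> nat \<Rightarrow> falg) \<Rightarrow> (falg \<Rightarrow> complex) \<Rightarrow> (nat \<Rightarrow> complex) \<Rightarrow> (nat \<Rightarrow> complex)"
  where "rep N u h x = (\<lambda>i. if i < N then \<Sum>j<N. h (u i j) * x j else 0)"

definition mcoef :: "nat \<Rightarrow> (nat \<Rightarrow> nat \<Rightarrow> falg) \<Rightarrow> (nat \<Rightarrow> complex) \<Rightarrow> (nat \<Rightarrow> complex) \<Rightarrow> falg"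
  where "mcoef N u x y = (\<Sum>i<N. \<Sum>j<N. scl (cnj (x i) * y j) (u i j))"

definition unitary_corep :: "real \<Rightarrow> nat \<Rightarrow> (nat \<Rightarrow> nat \<Rightarrow> falg) \<Rightarrow> bool"
  where "unitary_corep q N u \<longleftrightarrow>
    (\<forall>i<N. \<forall>j<N.
        cop q (u i j) - (\<Sum>k<N. tensor (u i k) (u k j)) \<in> RelIdeal2 q \<and>
        eps (u i j) = (if i = j then 1 else 0) \<and>
        (\<Sum>k<N. star (u k i) * u k j) - (if i = j then 1 else 0) \<in> RelIdeal q \<and>
        (\<Sum>k<N. u i k * star (u j k)) - (if i = j then 1 else 0) \<in> RelIdeal q)"

text \<open>A subspace is a subcomodule iff it is invariant under all functionals \<open>h \<in> \<U>\<close>.\<close>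

definition irred_unitary_corep :: "real \<Rightarrow> nat \<Rightarrow> (nat \<Rightarrow> nat \<Rightarrow> falg) \<Rightarrow> bool"
  where "irred_unitary_corep q N u \<longleftrightarrow> N > 0 \<and> unitary_corep q N u \<and>
    (\<forall>V. csubspace N V \<and> (\<forall>h\<in>Udual q. rep N u h ` V \<subseteq> V) \<longrightarrow> V = {\<lambda>_. 0} \<or> V = cvec N)"


section \<open>The Podles sphere and its stabilizer dual\<close>

definition qnum :: "real \<Rightarrow> real \<Rightarrow> real"
  where "qnum q c = (q powr c - q powr (- c)) / (q - 1 / q)"

definition qbrace :: "real \<Rightarrow> real \<Rightarrow> real"
  where "qbrace q c = q powr c + q powr (- c)"

definition tpar :: "real \<Rightarrow> real \<Rightarrow> real"
  where "tpar q a = q powr a - q powr (- a)"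

definition Bt :: "real \<Rightarrow> real \<Rightarrow> falg \<Rightarrow> complex"
  where "Bt q a x = - qc (sqrt q) * conv q (U_kinv q) (U_e q) x + qc (sqrt q) * U_f q x
     - \<i> * qc (1 / (q - 1 / q)) * qc (tpar q a) * U_kinv q x"

definition iBt :: "real \<Rightarrow> real \<Rightarrow> falg \<Rightarrow> complex"
  where "iBt q a x = \<i> * Bt q a x"

definition alg_Bt :: "real \<Rightarrow> real \<Rightarrow> (falg \<Rightarrow> complex) set"
  where "alg_Bt q a = {h. \<exists>d c. h = (\<lambda>x. \<Sum>m\<le>d::nat. c m * conv_pow q (Bt q a) m x)}"

text \<open>The counit of \<open>\<U>\<close> is evaluation at \<open>1\<close>.\<close>

definition podles :: "real \<Rightarrow> real \<Rightarrow> falg set"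
  where "podles q a = {b. \<forall>h\<in>alg_Bt q a. lact q h b - scl (h 1) b \<in> RelIdeal q}"

definition eigenspace :: "real \<Rightarrow> real \<Rightarrow> nat \<Rightarrow> (nat \<Rightarrow> nat \<Rightarrow> falg) \<Rightarrow> real \<Rightarrow> (nat \<Rightarrow> complex) set"
  where "eigenspace q a N u r =
    {x \<in> cvec N. rep N u (iBt q a) x = (\<lambda>i. complex_of_real r * x i)}"

definition orth_proj :: "nat \<Rightarrow> (nat \<Rightarrow> complex) set \<Rightarrow> ((nat \<Rightarrow> complex) \<Rightarrow> (nat \<Rightarrow> complex)) \<Rightarrow> bool"
  where "orth_proj N V P \<longleftrightarrow>
    (\<forall>x\<in>cvec N. P x \<in> V \<and> (\<forall>y\<in>V. cinner N y (\<lambda>i. x i - P x i) = 0))"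

text \<open>
  Every irreducible unitary corepresentation is equivalent to one of the \<open>H\<^sub>s\<close>, so the element
  \<open>\<Phi>\<^sub>n \<in> \<U> = \<Prod>\<^sub>s B(H\<^sub>s)\<close> is pinned down by its action in all of them.
\<close>

definition Phi :: "real \<Rightarrow> real \<Rightarrow> int \<Rightarrow> falg \<Rightarrow> complex"
  where "Phi q a n = (THE h. h \<in> Udual q \<and>
    (\<forall>N u. irred_unitary_corep q N u \<longrightarrow>
       orth_proj N (eigenspace q a N u (qnum q (a + 2 * of_int n))) (rep N u h)))"

definition Ic :: "real \<Rightarrow> real \<Rightarrow> (falg \<Rightarrow> complex) set"
  where "Ic q a = {h. \<exists>T c. finite T \<and> h = (\<lambda>x. \<Sum>n\<in>T. c n * Phi q a n x)}"

text \<open>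
  \<open>\<omega> \<cdot> b = b \<lhd> S\<^sup>-\<^sup>1(\<omega>)\<close>, with the antipode of \<open>\<U>\<close> given by \<open>(b, S(h)) = (S(b), h)\<close>.
\<close>

definition Ic_act :: "real \<Rightarrow> (falg \<Rightarrow> complex) \<Rightarrow> falg \<Rightarrow> falg"
  where "Ic_act q h b = ract q b (\<lambda>x. h (antipode_inv q x))"

definition podles0 :: "real \<Rightarrow> real \<Rightarrow> falg set"
  where "podles0 q a = {b \<in> podles q a. \<forall>h\<in>Ic q a. Ic_act q h b - scl (h 1) b \<in> RelIdeal q}"

text \<open>\<open>Y\<close> is unique in \<open>\<A>\<close>; the choice is only that of a representative in \<open>F\<close>.\<close>

definition Y_elt :: "real \<Rightarrow> real \<Rightarrow> falg"
  where "Y_elt q a = (SOME y. y \<in> podles0 q a \<and> eps y = 1 \<and>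
    (\<exists>u. irred_unitary_corep q 3 u \<and> (\<exists>x\<in>cvec 3. \<exists>z\<in>cvec 3. y - mcoef 3 u x z \<in> RelIdeal q)))"

abbreviation Q2 :: "real \<Rightarrow> real" where "Q2 q \<equiv> q + 1 / q"

definition A_elt :: "real \<Rightarrow> real \<Rightarrow> falg"
  where "A_elt q a = scl (complex_of_real (Q2 q + (1 / Q2 q) * (tpar q a)\<^sup>2)) (Y_elt q a)
     - cst (complex_of_real ((1 / Q2 q) * (tpar q a)\<^sup>2))"


section \<open>The modules \<open>\<M>\<^bsub>\<lambda>,a\<^esub>\<close>\<close>

text \<open>
  \<open>LeftIdeal q a l\<close> is the preimage in \<open>F\<close> of the left ideal \<open>\<B> (A\<^sub>a - \<lambda>)\<close> of \<open>\<B>\<close>. The elements of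
  \<open>\<M>\<^bsub>\<lambda>,a\<^esub>\<close> are the cosets \<open>b + LeftIdeal q a l\<close>, \<open>b \<in> \<B>\<close>; the addition of cosets is the addition of sets.
\<close>

definition LeftIdeal :: "real \<Rightarrow> real \<Rightarrow> real \<Rightarrow> falg set"
  where "LeftIdeal q a l = {b * (A_elt q a - cst (complex_of_real l)) + x | b x. b \<in> podles q a \<and> x \<in> RelIdeal q}"

definition Mmod :: "real \<Rightarrow> real \<Rightarrow> real \<Rightarrow> falg set set"
  where "Mmod q a l = (\<lambda>b. b +o LeftIdeal q a l) ` podles q a"

definition e_vec :: "real \<Rightarrow> real \<Rightarrow> real \<Rightarrow> falg set"
  where "e_vec q a l = 1 +o LeftIdeal q a l"

definition B_mact :: "real \<Rightarrow> real \<Rightarrow> real \<Rightarrow> falg \<Rightarrow> falg set \<Rightarrow> falg set"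
  where "B_mact q a l b X = (\<Union>x\<in>X. (b * x) +o LeftIdeal q a l)"

definition M_scl :: "real \<Rightarrow> real \<Rightarrow> real \<Rightarrow> complex \<Rightarrow> falg set \<Rightarrow> falg set"
  where "M_scl q a l c X = (\<Union>x\<in>X. scl c x +o LeftIdeal q a l)"

definition Ic_mact :: "real \<Rightarrow> real \<Rightarrow> real \<Rightarrow> (falg \<Rightarrow> complex) \<Rightarrow> falg set \<Rightarrow> falg set"
  where "Ic_mact q a l h X = (\<Union>x\<in>X. Ic_act q h x +o LeftIdeal q a l)"

text \<open>
  Inner products are linear in the second variable. Since \<open>\<B> \<bowtie> \<I>\<^sub>c\<close> is spanned by the products
  \<open>b \<omega>\<close>, the condition for a *-representation is stated for these: \<open>(b \<omega>)\<^sup>* = \<omega>\<^sup>* b\<^sup>*\<close> acts as the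
  adjoint of \<open>b \<omega>\<close>.
\<close>

definition inner_on :: "real \<Rightarrow> real \<Rightarrow> real \<Rightarrow> (falg set \<Rightarrow> falg set \<Rightarrow> complex) \<Rightarrow> bool"
  where "inner_on q a l ip \<longleftrightarrow>
    (\<forall>X\<in>Mmod q a l. \<forall>Y\<in>Mmod q a l. \<forall>Z\<in>Mmod q a l. ip X (Y + Z) = ip X Y + ip X Z) \<and>
    (\<forall>X\<in>Mmod q a l. \<forall>Y\<in>Mmod q a l. \<forall>c. ip X (M_scl q a l c Y) = c * ip X Y) \<and>
    (\<forall>X\<in>Mmod q a l. \<forall>Y\<in>Mmod q a l. ip Y X = cnj (ip X Y)) \<and>
    (\<forall>X\<in>Mmod q a l. X \<noteq> LeftIdeal q a l \<longrightarrow> Re (ip X X) > 0)"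

definition invariant_inner :: "real \<Rightarrow> real \<Rightarrow> real \<Rightarrow> (falg set \<Rightarrow> falg set \<Rightarrow> complex) \<Rightarrow> bool"
  where "invariant_inner q a l ip \<longleftrightarrow> inner_on q a l ip \<and>
    (\<forall>b\<in>podles q a. \<forall>h\<in>Ic q a. \<forall>X\<in>Mmod q a l. \<forall>Y\<in>Mmod q a l.
       ip (B_mact q a l b (Ic_mact q a l h X)) Y
         = ip X (Ic_mact q a l (dstar q h) (B_mact q a l (star b) Y))) \<and>
    ip (e_vec q a l) (e_vec q a l) = 1"

text \<open>
  \<open>\<Oplus>\<^bsub>n \<in> T\<^esub> \<Phi>\<^sub>n \<M>\<close> at \<open>\<lambda> = q + q\<^sup>-\<^sup>1\<close>. The summand \<open>LeftIdeal\<close> is the zero of \<open>\<M>\<close>; it is needed because the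
  empty sum of sets is \<open>{0}\<close>.
\<close>

definition weight_sum :: "real \<Rightarrow> real \<Rightarrow> int set \<Rightarrow> falg set set"
  where "weight_sum q a T = {LeftIdeal q a (Q2 q) + (\<Sum>n\<in>T'. Ic_mact q a (Q2 q) (Phi q a n) (m n)) | T' m.
     finite T' \<and> T' \<subseteq> T \<and> (\<forall>n\<in>T'. m n \<in> Mmod q a (Q2 q))}"

definition D2p :: "real \<Rightarrow> real \<Rightarrow> falg set set"
  where "D2p q a = weight_sum q a {n. n > 0}"

definition D2m :: "real \<Rightarrow> real \<Rightarrow> falg set set"
  where "D2m q a = weight_sum q a {n. n < 0}"

definition D2 :: "real \<Rightarrow> real \<Rightarrow> falg set set"
  where "D2 q a = D2p q a + D2m q a"


section \<open>The cocycle and the limit inner product\<close>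

text \<open>\<open>b \<xi> - \<epsilon>(b) \<xi>\<close> in \<open>\<M>\<close> at \<open>\<lambda> = q + q\<^sup>-\<^sup>1\<close>.\<close>

definition cobdry :: "real \<Rightarrow> real \<Rightarrow> falg set \<Rightarrow> falg \<Rightarrow> falg set"
  where "cobdry q a X b = B_mact q a (Q2 q) b X + M_scl q a (Q2 q) (- eps b) X"

definition cocycle :: "real \<Rightarrow> real \<Rightarrow> falg \<Rightarrow> falg set"
  where "cocycle q a = cobdry q a (e_vec q a (Q2 q))"

definition scaled_ip :: "real \<Rightarrow> real \<Rightarrow> (real \<Rightarrow> falg set \<Rightarrow> falg set \<Rightarrow> complex) \<Rightarrow>
    real \<Rightarrow> falg set \<Rightarrow> falg set \<Rightarrow> complex"
  where "scaled_ip q a ip l X Y =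
    complex_of_real (qbrace q (a + 2) / qbrace q a / (Q2 q - l) / (qbrace q (2 * a + 1) + l)) * ip l X Y"

definition shifted_vec :: "real \<Rightarrow> real \<Rightarrow> real \<Rightarrow> falg \<Rightarrow> falg set"
  where "shifted_vec q a l b = B_mact q a l (b - cst (eps b)) (e_vec q a l)"

definition D2_inner :: "real \<Rightarrow> real \<Rightarrow> (real \<Rightarrow> falg set \<Rightarrow> falg set \<Rightarrow> complex) \<Rightarrow>
    falg set \<Rightarrow> falg set \<Rightarrow> complex"
  where "D2_inner q a ip X Y = (THE c. \<forall>b\<in>podles q a. \<forall>b'\<in>podles q a.
     cocycle q a b = X \<and> cocycle q a b' = Y \<longrightarrow>
     ((\<lambda>l. scaled_ip q a ip l (shifted_vec q a l b) (shifted_vec q a l b')) \<longlongrightarrow> c) (at_left (Q2 q)))"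

definition D2_norm :: "real \<Rightarrow> real \<Rightarrow> (real \<Rightarrow> falg set \<Rightarrow> falg set \<Rightarrow> complex) \<Rightarrow> falg set \<Rightarrow> real"
  where "D2_norm q a ip X = sqrt (Re (D2_inner q a ip X X))"

definition eigenvectors :: "real \<Rightarrow> real \<Rightarrow> nat \<Rightarrow> (nat \<Rightarrow> nat \<Rightarrow> falg) \<Rightarrow> (int \<Rightarrow> nat \<Rightarrow> complex) \<Rightarrow> bool"
  where "eigenvectors q a n u \<eta> \<longleftrightarrow>
    (\<forall>j\<in>{- int n..int n}. \<eta> j \<in> eigenspace q a (2 * n + 1) u (qnum q (a + 2 * of_int j)) \<and>
       (\<forall>k\<in>{- int n..int n}. cinner (2 * n + 1) (\<eta> j) (\<eta> k) = (if j = k then 1 else 0)))"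

end

theory Submission
  imports Defs
begin

text \<open>
  Let \<open>\<psi>\<^sub>n\<close> be the spherical function of spin \<open>n\<close> with \<open>\<epsilon>(\<psi>\<^sub>n) = 1\<close>, so that \<open>\<psi>\<^sub>1 = Y\<close>, and put
  \<open>D\<^sub>n(\<lambda>) = (1 - \<langle>e\<^sub>a, \<psi>\<^sub>n e\<^sub>a\<rangle>\<^sub>\<lambda>) / (q + q\<^sup>-\<^sup>1 - \<lambda>)\<close>. Unitarity of the corepresentation of spin \<open>n\<close> and invariance of the
  inner product give \<open>\<Sum>\<^sub>j \<parallel>(u\<^sub>j - \<epsilon>(u\<^sub>j)) e\<^sub>a\<parallel>\<^sup>2 = 2 Re (1 - \<langle>e\<^sub>a, \<psi>\<^sub>n e\<^sub>a\<rangle>)\<close>, hence \<open>C\<^sup>n\<^sup>*C\<^sup>n\<close> is a fixed positive multiple of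
  \<open>g\<^sub>n = lim D\<^sub>n\<close>. Because \<open>\<eta>\<^sup>n \<otimes> \<eta>\<^sup>1\<close> is again an \<open>[a]\<close>-eigenvector of \<open>iB\<^sub>t\<close>, the product \<open>\<psi>\<^sub>n \<psi>\<^sub>1\<close> is a convex
  combination \<open>\<Sum>\<^sub>m c\<^sub>m \<psi>\<^sub>m\<close>, \<open>m \<le> n + 1\<close>, while \<open>\<psi>\<^sub>1 e\<^sub>a = (1 - (q + q\<^sup>-\<^sup>1 - \<lambda>) / \<kappa>) e\<^sub>a\<close> with
  \<open>\<kappa> = q + q\<^sup>-\<^sup>1 + t\<^sup>2 / (q + q\<^sup>-\<^sup>1)\<close>. Together
  \<open>c\<^sub>n\<^sub>+\<^sub>1 (D\<^sub>n\<^sub>+\<^sub>1 - D\<^sub>n) = \<langle>e\<^sub>a, \<psi>\<^sub>n e\<^sub>a\<rangle> / \<kappa> + \<Sum>\<^sub>m\<^sub><\<^sub>n c\<^sub>m (D\<^sub>n - D\<^sub>m)\<close>, whence by induction the limits exist and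
  \<open>g\<^sub>n\<^sub>+\<^sub>1 \<ge> g\<^sub>n + 1 / \<kappa>\<close>.

  If \<open>C\<close> were the coboundary of \<open>\<xi> = b\<^sub>0 e\<^sub>a\<close>, the same unitarity and the parallelogram law would bound
  \<open>C\<^sup>n\<^sup>*C\<^sup>n\<close> by \<open>4 lim \<parallel>b\<^sub>0 e\<^sub>a\<parallel>\<^sup>2\<close>.
\<close>

section \<open>The free algebra\<close>

text \<open>No normal form modulo \<open>RelIdeal q\<close> is at hand at the start, so equality in
  the quotient is tested by functionals: \<open>separation\<close> shows that \<open>Udual q\<close>
  detects the ideal, and the work goes into producing explicit members of \<open>Udual q\<close>.
  They are given by recursion on the letters of a word, as dictated by the coproduct, and checked
  against the invariance of one bilinear form. \<open>density\<close> then replaces all of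
  \<open>Udual q\<close> by words in e, f and weight projections, whence irreducibles of equal
  dimension are equivalent. This matters because \<open>u\<close> and \<open>\<eta>\<close> are
  arbitrary models, \<open>Phi\<close> is a definite description over all irreducibles, and
  \<open>Y_elt\<close> refers to any model of spin 1. The projections \<open>Phi\<close> come from a
  calculus \<open>Fc\<close> that diagonalises iB_t letter by letter, without eigenvectors in higher
  spin. Nonnegativity of the fusion coefficients rests on k^-1 being group-like and positive: psi_n
  has the left vector k^-1 \<eta>, and each irreducible component of \<eta> \<otimes> \<eta>
  contributes a squared modulus times a positive number. No coefficient is computed; positivity of
  the top one falls out of the limit.\<close>

lemma lookup_scl [simp]: "Poly_Mapping.lookup (scl c p) w = c * Poly_Mapping.lookup p w"
proof -
  have "scl c p = Poly_Mapping.map ((*) c) p"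
    by (simp add: scl_def cst_def mult_map_scale_conv_mult)
  then show ?thesis by (simp add: map.rep_eq when_def)
qed

lemma mon_expand: "p = (\<Sum>w\<in>Poly_Mapping.keys p. scl (Poly_Mapping.lookup p w) (mon w))"
  for p :: "'m::monoid_add \<Rightarrow>\<^sub>0 complex"
proof (rule poly_mapping_eqI)
  fix k
  have "(\<Sum>w\<in>Poly_Mapping.keys p. Poly_Mapping.lookup p w * (if w = k then 1 else 0)) = Poly_Mapping.lookup p k"
    by (simp add: if_distrib sum.delta in_keys_iff cong: if_cong)
  then show "Poly_Mapping.lookup p k
      = Poly_Mapping.lookup (\<Sum>w\<in>Poly_Mapping.keys p. scl (Poly_Mapping.lookup p w) (mon w)) k"
    by (simp add: lookup_sum mon_def lookup_single when_def)
qed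

lemma pm_induct [case_names zero add scl mon]:
  fixes p :: "'m::monoid_add \<Rightarrow>\<^sub>0 complex"
  assumes "P 0" "\<And>x y. P x \<Longrightarrow> P y \<Longrightarrow> P (x + y)" "\<And>c x. P x \<Longrightarrow> P (scl c x)" "\<And>w. P (mon w)"
  shows "P p"
proof -
  have "P (\<Sum>w\<in>S. scl (Poly_Mapping.lookup p w) (mon w))" if "finite S" for S
    using that by (induction S rule: finite_induct) (auto intro: assms)
  then show ?thesis by (subst mon_expand) auto
qed

lemma scl_mult_left [simp]: "scl c x * y = scl c (x * y)"
  by (simp add: scl_def mult.assoc)

text \<open>The algebra of words is noncommutative and \<open>scl\<close> is a left multiplication,
  so centrality of the scalars has to be proved; on a word both products agree because 0 is neutral
  on both sides.\<close>

lemma cst_commute: "cst c * x = x * cst c" for x :: "'m::monoid_add \<Rightarrow>\<^sub>0 complex"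
proof (induction x rule: pm_induct)
  case (scl d x)
  have "cst c * cst d = cst d * (cst c :: 'm \<Rightarrow>\<^sub>0 complex)" by (simp add: cst_def mult_single mult.commute)
  then show ?case using scl by (simp add: scl_def mult.assoc[symmetric]) (simp add: mult.assoc)
qed (simp_all add: algebra_simps cst_def mon_def mult_single)

lemma scl_mult_right [simp]: "x * scl c y = scl c (x * y)"
  for x :: "'m::monoid_add \<Rightarrow>\<^sub>0 complex"
  by (metis scl_def cst_commute mult.assoc)

lemma scl_sum: "scl c (\<Sum>i\<in>I. f i) = (\<Sum>i\<in>I. scl c (f i))"
  by (rule fa.scale_sum_right)

lemma scl_scl [simp]: "scl a (scl b x) = scl (a * b) x" by (rule fa.scale_scale)
lemma scl_one [simp]: "scl 1 x = x" by (rule fa.scale_one)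
lemma scl_zero [simp]: "scl 0 x = 0" "scl c 0 = 0" by simp_all
lemma scl_add: "scl c (x + y) = scl c x + scl c y" by (rule fa.scale_right_distrib)
lemma scl_diff: "scl c (x - y) = scl c x - scl c y" by (rule fa.scale_right_diff_distrib)
lemma cst_eq: "cst c = scl c 1" by (simp add: scl_def)
lemma mon_mult: "mon (v + w) = mon v * mon w" for v :: "'m::monoid_add"
  by (simp add: mon_def mult_single)

lemma mon_zero: "mon 0 = 1" by (simp add: mon_def)

lemma vs_complex: "vector_space ((*) :: complex \<Rightarrow> complex \<Rightarrow> complex)"
  by unfold_locales (auto simp: algebra_simps)

lemma vs_scl: "vector_space (scl :: complex \<Rightarrow> ('m::monoid_add \<Rightarrow>\<^sub>0 complex) \<Rightarrow> _)"
  by unfold_locales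

text \<open>\<open>star\<close> is conjugate linear. With the conjugate scaling on the target it
  becomes an ordinary \<open>lin_ext\<close>, which is why the extension lemmas below allow an
  arbitrary scaling.\<close>

lemma vs_cscl: "vector_space (\<lambda>c. scl (cnj c) :: ('m::monoid_add \<Rightarrow>\<^sub>0 complex) \<Rightarrow> _)"
  by unfold_locales (auto simp: scl_add fa.scale_left_distrib)

context
  fixes sc :: "complex \<Rightarrow> 'r::ab_group_add \<Rightarrow> 'r"
  assumes vs: "vector_space sc"
begin

interpretation V: vector_space sc by (rule vs)

lemma lin_ext_superset:
  assumes "finite S" "Poly_Mapping.keys p \<subseteq> S"
  shows "lin_ext sc \<phi> p = (\<Sum>w\<in>S. sc (Poly_Mapping.lookup p w) (\<phi> w))"
  unfolding lin_ext_def by (rule sum.mono_neutral_left) (use assms in \<open>auto simp: in_keys_iff\<close>)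

lemma lin_ext_zero [simp]: "lin_ext sc \<phi> 0 = 0"
  by (simp add: lin_ext_def)

lemma lin_ext_add: "lin_ext sc \<phi> (p + r) = lin_ext sc \<phi> p + lin_ext sc \<phi> r"
proof -
  let ?S = "Poly_Mapping.keys p \<union> Poly_Mapping.keys r"
  have "Poly_Mapping.keys (p + r) \<subseteq> ?S" by (rule Poly_Mapping.keys_add)
  then show ?thesis
    by (simp add: lin_ext_superset[of ?S] lookup_add V.scale_left_distrib sum.distrib)
qed

lemma lin_ext_scl: "lin_ext sc \<phi> (scl c p) = sc c (lin_ext sc \<phi> p)"
proof -
  have "Poly_Mapping.keys (scl c p) \<subseteq> Poly_Mapping.keys p" by (auto simp: in_keys_iff)
  then show ?thesis
    by (simp add: lin_ext_superset[of "Poly_Mapping.keys p"] V.scale_sum_right)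
qed

lemma lin_ext_mon [simp]: "lin_ext sc \<phi> (mon w) = \<phi> w"
  by (simp add: lin_ext_def mon_def)

text \<open>The bilinear map \<open>f\<close> stands for the product or for the opposite product, so
  that homomorphisms (\<open>cop\<close>, \<open>eps\<close>) and antihomomorphisms
  (\<open>star\<close>, \<open>antipode\<close>) are served by one statement.\<close>

lemma lin_ext_mult:
  fixes f :: "'r \<Rightarrow> 'r \<Rightarrow> 'r"
  assumes f: "\<And>x y z. f (x + y) z = f x z + f y z" "\<And>x y z. f x (y + z) = f x y + f x z"
    "\<And>c x y. f (sc c x) y = sc c (f x y)" "\<And>c x y. f x (sc c y) = sc c (f x y)"
    and \<phi>: "\<And>v w. \<phi> (v + w) = f (\<phi> v) (\<phi> w)"
  shows "lin_ext sc \<phi> (p * r) = f (lin_ext sc \<phi> p) (lin_ext sc \<phi> r)"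
proof -
  have f0: "f 0 z = 0" "f z 0 = 0" for z
    using f(1)[of 0 0 z] f(2)[of z 0 0] by auto
  have *: "lin_ext sc \<phi> (mon v * r) = f (\<phi> v) (lin_ext sc \<phi> r)" for v
    by (induction r rule: pm_induct)
      (simp_all add: f f0 distrib_left lin_ext_add lin_ext_scl mon_mult[symmetric] \<phi>)
  show ?thesis
    by (induction p rule: pm_induct)
      (simp_all add: f f0 distrib_right lin_ext_add lin_ext_scl *)
qed

end

lemma lin_ext_mult_scl:
  assumes "\<And>v w. \<phi> (v + w) = \<phi> v * \<phi> w"
  shows "lin_ext scl \<phi> (p * r) = lin_ext scl \<phi> p * lin_ext scl \<phi> r"
  by (rule lin_ext_mult[OF vs_scl]) (simp_all add: assms distrib_left distrib_right)

lemma lin_ext_mult_complex: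
  assumes "\<And>v w. \<phi> (v + w) = \<phi> v * \<phi> w"
  shows "lin_ext (*) \<phi> (p * r) = lin_ext (*) \<phi> p * (lin_ext (*) \<phi> r :: complex)"
  by (rule lin_ext_mult[OF vs_complex]) (simp_all add: assms algebra_simps)


text \<open>Linearity in the form of rewrite rules; \<open>linear_iff_lfun\<close> connects it with
  the notion used in \<open>Udual\<close>.\<close>

definition lfun :: "(('m::monoid_add \<Rightarrow>\<^sub>0 complex) \<Rightarrow> complex) \<Rightarrow> bool"
  where "lfun h \<longleftrightarrow> (\<forall>x y. h (x + y) = h x + h y) \<and> (\<forall>c x. h (scl c x) = c * h x)"

lemma lfunI: "(\<And>x y. h (x + y) = h x + h y) \<Longrightarrow> (\<And>c x. h (scl c x) = c * h x) \<Longrightarrow> lfun h"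
  by (simp add: lfun_def)

lemma lfunD: assumes "lfun h"
  shows lfun_add: "h (x + y) = h x + h y" and lfun_scl: "h (scl c x) = c * h x"
  using assms by (auto simp: lfun_def)

lemma lfun_zero: assumes "lfun h" shows "h 0 = 0"
  using lfun_scl[OF assms, of 0 0] by simp

lemma lfun_minus: assumes "lfun h" shows "h (- x) = - h x"
  using lfun_scl[OF assms, of "-1" x] by simp

lemma lfun_diff: assumes "lfun h" shows "h (x - y) = h x - h y"
  using lfun_add[OF assms, of x "- y"] lfun_minus[OF assms, of y] by simp

lemma lfun_sum: assumes "lfun h" shows "h (\<Sum>i\<in>I. f i) = (\<Sum>i\<in>I. h (f i))"
  by (induction I rule: infinite_finite_induct) (simp_all add: lfun_zero[OF assms] lfun_add[OF assms])

lemma lfun_cst: assumes "lfun h" shows "h (cst c) = c * h 1"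
  by (simp add: cst_eq lfun_scl[OF assms])

lemmas lfun_simps = lfun_add lfun_scl lfun_zero lfun_minus lfun_diff lfun_sum lfun_cst

lemma linear_iff_lfun: "Vector_Spaces.linear scl (*) h \<longleftrightarrow> lfun h"
proof
  assume "Vector_Spaces.linear scl (*) h"
  then interpret Vector_Spaces.linear scl "(*)" h .
  show "lfun h" by (simp add: lfun_def add scale)
next
  assume h: "lfun h"
  interpret vector_space "(*) :: complex \<Rightarrow> complex \<Rightarrow> complex" by (rule vs_complex)
  show "Vector_Spaces.linear scl (*) h"
    by unfold_locales (simp_all add: lfun_simps[OF h])
qed

lemma lfun_lin_ext: "lfun (lin_ext (*) \<phi>)"
  by (simp add: lfun_def lin_ext_add[OF vs_complex] lin_ext_scl[OF vs_complex])

section \<open>Tensors over pairs of words and their contractions by functionals\<close>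

lemma tensor_add_left: "tensor (x + x') y = tensor x y + tensor x' y"
  by (simp add: tensor_def lin_ext_add[OF vs_scl])

lemma tensor_scl_left: "tensor (scl c x) y = scl c (tensor x y)"
  by (simp add: tensor_def lin_ext_scl[OF vs_scl])

lemma tensor_mon: "tensor (mon v) (mon w) = mon (v, w)"
  by (simp add: tensor_def vs_scl)

lemma tensor_zero_left: "tensor 0 y = 0"
  by (simp add: tensor_def vs_scl)

lemma tensor_add_right: "tensor x (y + y') = tensor x y + tensor x y'"
proof (induction x rule: pm_induct)
  case (add u v)
  then show ?case by (simp add: tensor_add_left algebra_simps)
qed (simp_all add: tensor_zero_left tensor_scl_left scl_add,
    simp add: tensor_def vs_scl lin_ext_add[OF vs_scl])

lemma tensor_scl_right: "tensor x (scl c y) = scl c (tensor x y)"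
proof (induction x rule: pm_induct)
  case (add u v)
  then show ?case by (simp add: tensor_add_left scl_add)
qed (simp_all add: tensor_zero_left tensor_scl_left mult.commute,
    simp add: tensor_def vs_scl lin_ext_scl[OF vs_scl])

lemma tensor_zero_right: "tensor x 0 = 0"
  using tensor_scl_right[of x 0 0] by simp

lemma tensor_sum_left: "tensor (\<Sum>i\<in>I. f i) y = (\<Sum>i\<in>I. tensor (f i) y)"
  by (induction I rule: infinite_finite_induct) (simp_all add: tensor_zero_left tensor_add_left)

lemma tensor_sum_right: "tensor x (\<Sum>i\<in>I. f i) = (\<Sum>i\<in>I. tensor x (f i))"
  by (induction I rule: infinite_finite_induct) (simp_all add: tensor_zero_right tensor_add_right)

lemma tensor_minus: "tensor (- x) y = - tensor x y" "tensor x (- y) = - tensor x y"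
  using tensor_scl_left[of "-1" x y] tensor_scl_right[of x "-1" y] by simp_all

lemma tensor_mult: "tensor x y * tensor x' y' = tensor (x * x') (y * y')"
proof -
  have 1: "tensor (mon v) y * tensor (mon v') y' = tensor (mon v * mon v') (y * y')" for v v'
  proof -
    have "tensor (mon v) (mon w) * tensor (mon v') y' = tensor (mon v * mon v') (mon w * y')" for w
      by (induction y' rule: pm_induct)
        (simp_all add: tensor_zero_right tensor_add_right tensor_scl_right distrib_left tensor_mon mon_mult[symmetric])
    then show ?thesis
      by (induction y rule: pm_induct)
        (simp_all add: tensor_zero_right tensor_add_right tensor_scl_right distrib_right)
  qed
  have 2: "tensor (mon v) y * tensor x' y' = tensor (mon v * x') (y * y')" for v
    by (induction x' rule: pm_induct)
      (simp_all add: 1 tensor_zero_left tensor_add_left tensor_scl_left distrib_left)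
  show ?thesis
    by (induction x rule: pm_induct)
      (simp_all add: 2 tensor_zero_left tensor_add_left tensor_scl_left distrib_right)
qed

lemma tensor_one: "tensor 1 1 = 1"
  by (simp add: mon_zero[symmetric] tensor_mon zero_prod_def)

lemma pm2_induct [case_names zero add scl tensor]:
  fixes p :: "'m::monoid_add \<times> 'm \<Rightarrow>\<^sub>0 complex"
  assumes "P 0" "\<And>x y. P x \<Longrightarrow> P y \<Longrightarrow> P (x + y)" "\<And>c x. P x \<Longrightarrow> P (scl c x)" "\<And>x y. P (tensor x y)"
  shows "P p"
  by (induction p rule: pm_induct) (use assms in \<open>auto simp: tensor_mon[symmetric]\<close>)

text \<open>\<open>ev2\<close>, \<open>evr\<close> and \<open>evl\<close> apply g \<otimes> h, id
  \<otimes> h and h \<otimes> id to a tensor; after \<open>cop\<close> they become convolution and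
  the two translations, see \<open>conv_ev2\<close>, \<open>lact_evr\<close>,
  \<open>ract_evl\<close>.\<close>

definition ev2 :: "(('m::monoid_add \<Rightarrow>\<^sub>0 complex) \<Rightarrow> complex) \<Rightarrow> (('m \<Rightarrow>\<^sub>0 complex) \<Rightarrow> complex) \<Rightarrow> ('m \<times> 'm \<Rightarrow>\<^sub>0 complex) \<Rightarrow> complex"
  where "ev2 g h = lin_ext (*) (\<lambda>(v, w). g (mon v) * h (mon w))"

definition evr :: "(('m::monoid_add \<Rightarrow>\<^sub>0 complex) \<Rightarrow> complex) \<Rightarrow> ('m \<times> 'm \<Rightarrow>\<^sub>0 complex) \<Rightarrow> ('m \<Rightarrow>\<^sub>0 complex)"
  where "evr h = lin_ext scl (\<lambda>(v, w). scl (h (mon w)) (mon v))"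

definition evl :: "(('m::monoid_add \<Rightarrow>\<^sub>0 complex) \<Rightarrow> complex) \<Rightarrow> ('m \<times> 'm \<Rightarrow>\<^sub>0 complex) \<Rightarrow> ('m \<Rightarrow>\<^sub>0 complex)"
  where "evl h = lin_ext scl (\<lambda>(v, w). scl (h (mon v)) (mon w))"

lemma lfun_ev2: "lfun (ev2 g h)" unfolding ev2_def by (rule lfun_lin_ext)

lemma evr_lin: "evr h (x + y) = evr h x + evr h y" "evr h (scl c x) = scl c (evr h x)" "evr h 0 = 0"
  by (simp_all add: evr_def lin_ext_add[OF vs_scl] lin_ext_scl[OF vs_scl] vs_scl)

lemma evl_lin: "evl h (x + y) = evl h x + evl h y" "evl h (scl c x) = scl c (evl h x)" "evl h 0 = 0"
  by (simp_all add: evl_def lin_ext_add[OF vs_scl] lin_ext_scl[OF vs_scl] vs_scl)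

lemma additive_sum:
  assumes "\<And>x y. f (x + y) = f x + f y" "f 0 = 0"
  shows "f (\<Sum>i\<in>I. g i) = (\<Sum>i\<in>I. f (g i))"
  by (induction I rule: infinite_finite_induct) (simp_all add: assms)

lemma evr_tensor: assumes "lfun h" shows "evr h (tensor x y) = scl (h y) x"
proof -
  have "evr h (tensor (mon v) y) = scl (h y) (mon v)" for v
    by (induction y rule: pm_induct)
      (simp_all add: tensor_zero_right tensor_add_right tensor_scl_right evr_lin lfun_simps[OF assms] fa.scale_left_distrib,
       simp add: tensor_mon evr_def vs_scl)
  then show ?thesis
    by (induction x rule: pm_induct)
      (simp_all add: tensor_zero_left tensor_add_left tensor_scl_left evr_lin scl_add mult.commute)
qed

lemma evl_tensor: assumes "lfun h" shows "evl h (tensor x y) = scl (h x) y"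
proof -
  have "evl h (tensor (mon v) y) = scl (h (mon v)) y" for v
    by (induction y rule: pm_induct)
      (simp_all add: tensor_zero_right tensor_add_right tensor_scl_right evl_lin scl_add mult.commute,
       simp add: tensor_mon evl_def vs_scl)
  then show ?thesis
    by (induction x rule: pm_induct)
      (simp_all add: tensor_zero_left tensor_add_left tensor_scl_left evl_lin lfun_simps[OF assms] fa.scale_left_distrib)
qed

lemma ev2_tensor: assumes "lfun g" "lfun h" shows "ev2 g h (tensor x y) = g x * h y"
proof -
  have "ev2 g h (tensor (mon v) y) = g (mon v) * h y" for v
    by (induction y rule: pm_induct)
      (simp_all add: tensor_zero_right tensor_add_right tensor_scl_right lfun_simps[OF lfun_ev2] lfun_simps[OF assms(2)] algebra_simps,
       simp add: tensor_mon ev2_def vs_complex)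
  then show ?thesis
    by (induction x rule: pm_induct)
      (simp_all add: tensor_zero_left tensor_add_left tensor_scl_left lfun_simps[OF lfun_ev2] lfun_simps[OF assms(1)] algebra_simps)
qed

section \<open>Products of the entries of \<open>U\<^bsub>1/2\<^esub>\<close>\<close>

definition bl :: "nat \<Rightarrow> bool list set" where "bl n = {K. length K = n}"

lemma finite_bl [simp]: "finite (bl n)"
  using finite_lists_length_eq[of "UNIV :: bool set" n] by (simp add: bl_def)

lemma bl_0 [simp]: "bl 0 = {[]}" by (auto simp: bl_def)

lemma in_bl [simp]: "K \<in> bl n \<longleftrightarrow> length K = n" by (simp add: bl_def)

lemma sum_bl_Suc: "sum f (bl (Suc n)) = (\<Sum>b\<in>UNIV. \<Sum>K\<in>bl n. f (b # K))"
proof -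
  have "bl (Suc n) = (\<lambda>(b, K). b # K) ` (UNIV \<times> bl n)"
    by (auto simp: bl_def length_Suc_conv image_iff)
  then have "sum f (bl (Suc n)) = sum f ((\<lambda>(b, K). b # K) ` (UNIV \<times> bl n))" by simp
  also have "\<dots> = (\<Sum>(b, K)\<in>UNIV \<times> bl n. f (b # K))"
    by (subst sum.reindex) (auto simp: inj_on_def intro!: sum.cong)
  finally show ?thesis by (simp add: sum.cartesian_product)
qed

lemma sum_bl_add: "sum f (bl (m + n)) = (\<Sum>K\<in>bl m. \<Sum>L\<in>bl n. f (K @ L))"
  by (induction m arbitrary: f) (simp_all add: sum_bl_Suc)

text \<open>\<open>star\<close> reverses a word and flips its indices; this bijection absorbs the
  effect in sums over intermediate index words.\<close>

lemma sum_bl_rev: "(\<Sum>K\<in>bl n. f (rev (map Not K))) = sum f (bl n)"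
proof -
  have inv: "rev (map Not (rev (map Not K))) = K" for K by (simp add: rev_map o_def)
  have "bij_betw (\<lambda>K. rev (map Not K)) (bl n) (bl n)"
    by (rule bij_betw_byWitness[of _ "\<lambda>K. rev (map Not K)"]) (auto simp: inv)
  then show ?thesis by (rule sum.reindex_bij_betw)
qed

lemma sum_bool: "(\<Sum>b\<in>UNIV. f b) = f False + f True"
  by (simp add: UNIV_bool)

locale sq =
  fixes q :: real
  assumes q_pos: "0 < q" and q_lt: "q < 1"
begin

lemma q_nz [simp]: "q \<noteq> 0" "qc q \<noteq> 0" using q_pos by auto

text \<open>Index \<open>False\<close> is the first and \<open>True\<close> the second basis vector
  of spin 1/2.\<close>

definition U :: "bool \<Rightarrow> bool \<Rightarrow> falg"
  where "U i j = (if i then if j then als else ga else if j then scl (- qc q) gas else al)"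

text \<open>Matrix coefficients of the tensor powers of U_1/2. They span F because every generator
  is a scalar multiple of an entry, and coproduct, antipode and involution act on them by
  manipulating indices.\<close>

definition uw :: "bool list \<Rightarrow> bool list \<Rightarrow> falg"
  where "uw I J = prod_list (map2 U I J)"

lemma uw_Nil [simp]: "uw [] [] = 1" by (simp add: uw_def)

lemma uw_Cons [simp]: "uw (i # I) (j # J) = U i j * uw I J" by (simp add: uw_def)

lemma uw_append: "length I = length J \<Longrightarrow> uw (I @ I') (J @ J') = uw I J * uw I' J'"
  by (simp add: uw_def)

lemma gelt_U: "\<exists>c i j. gelt g = scl c (U i j)"
proof -
  have "gelt g = scl (if g = Gen_c_st then - 1 / qc q else 1)
      (U (g = Gen_a_st \<or> g = Gen_c) (g = Gen_a_st \<or> g = Gen_c_st))"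
    by (cases g) (simp_all add: U_def)
  then show ?thesis
    by (rule_tac exI, rule_tac exI, rule_tac exI)
qed

lemma mon_Cons: "mon (FWord (g # w)) = gelt g * mon (FWord w)"
  by (simp add: mon_mult[symmetric] plus_fword_def)

lemma mon_Nil: "mon (FWord []) = (1 :: falg)"
  using mon_zero[where 'a = "gen fword"] by (simp add: zero_fword_def)

lemma mon_uw: "\<exists>c I J. length I = length J \<and> mon (FWord w) = scl c (uw I J)"
proof (induction w)
  case Nil
  show ?case
    by (rule exI[of _ 1], rule exI[of _ "[]"], rule exI[of _ "[]"]) (simp add: mon_Nil)
next
  case (Cons g w)
  from Cons.IH obtain c I J where 1: "length I = length J" "mon (FWord w) = scl c (uw I J)"
    by metis
  obtain d i j where 2: "gelt g = scl d (U i j)"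
    using gelt_U by metis
  show ?case
    by (rule exI[of _ "c * d"], rule exI[of _ "i # I"], rule exI[of _ "j # J"])
      (simp add: 1 mon_Cons[of g w, unfolded 1 2])
qed

lemma falg_induct [case_names zero add scl uw]:
  assumes "P 0" "\<And>x y. P x \<Longrightarrow> P y \<Longrightarrow> P (x + y)" "\<And>c x. P x \<Longrightarrow> P (scl c x)"
    "\<And>I J. length I = length J \<Longrightarrow> P (uw I J)"
  shows "P x"
proof (induction x rule: pm_induct)
  case (mon w)
  obtain c I J where "length I = length J" "mon w = scl c (uw I J)"
    using mon_uw[of "letters w"] by auto
  then show ?case using assms by simp
qed (use assms in auto)

text \<open>Diagonal part of the equivalence between U_1/2 and its conjugate: the adjoint of the
  entry (i, j) is \<open>tt i / tt j\<close> times the entry with both indices flipped.\<close>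

definition tt :: "bool \<Rightarrow> complex" where "tt i = (if i then 1 else - qc q)"
definition tw :: "bool list \<Rightarrow> complex" where "tw I = prod_list (map tt I)"

lemma tt_nz [simp]: "tt i \<noteq> 0" by (simp add: tt_def)
lemma tt_cnj [simp]: "cnj (tt i) = tt i" by (simp add: tt_def)
lemma tt_not: "tt (\<not> i) = - qc q / tt i" by (simp add: tt_def)
lemma tw_nz [simp]: "tw I \<noteq> 0" by (induction I) (simp_all add: tw_def)
lemma tw_cnj [simp]: "cnj (tw I) = tw I" by (induction I) (simp_all add: tw_def)
lemma tw_simps [simp]: "tw [] = 1" "tw (i # I) = tt i * tw I" by (simp_all add: tw_def)
lemma tw_append: "tw (I @ J) = tw I * tw J" by (simp add: tw_def)
lemma tw_flip: "tw (rev (map Not I)) = (- qc q) ^ length I / tw I"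
  by (induction I) (simp_all add: tw_append tt_not, simp only: mult.commute)

abbreviation flip :: "bool list \<Rightarrow> bool list" where "flip I \<equiv> rev (map Not I)"

lemma flip_flip [simp]: "rev (map Not (flip I)) = I" by (simp add: rev_map o_def)

section \<open>Involution, antipode and coproduct on index words\<close>

lemma star_lin: "star (x + y) = star x + star y" "star (scl c x) = scl (cnj c) (star x)" "star 0 = 0"
  unfolding star_def by (rule lin_ext_add[OF vs_cscl] lin_ext_scl[OF vs_cscl] lin_ext_zero[OF vs_cscl])+

lemma star_minus: "star (- x) = - star x"
  using star_lin(2)[of "-1" x] by simp

lemma star_mult: "star (x * y) = star y * star x"
  unfolding star_def
proof (rule lin_ext_mult[OF vs_cscl, where f = "\<lambda>x y. y * x"])
  fix v w :: "gen fword"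
  show "mon (FWord (rev (map star_gen (letters (v + w)))))
      = mon (FWord (rev (map star_gen (letters w)))) * mon (FWord (rev (map star_gen (letters v))))"
    by (simp add: mon_mult[symmetric] plus_fword_def)
qed (simp_all add: algebra_simps)

lemma star_gelt: "star (gelt g) = gelt (star_gen g)"
  by (simp add: star_def lin_ext_mon[OF vs_cscl])

lemma star_one: "star 1 = 1"
  using lin_ext_mon[OF vs_cscl, of "\<lambda>w. mon (FWord (rev (map star_gen (letters w))))" 0]
  by (simp add: star_def mon_zero zero_fword_def mon_Nil)

lemma star_U: "star (U i j) = scl (tt i / tt j) (U (\<not> i) (\<not> j))"
  by (simp add: U_def star_gelt star_lin star_minus tt_def)

lemma star_uw: "length I = length J \<Longrightarrow> star (uw I J) = scl (tw I / tw J) (uw (flip I) (flip J))"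
  by (induction I J rule: list_induct2) (simp_all add: star_one star_mult star_U uw_append mult.commute)

lemma star_star [simp]: "star (star x) = x"
proof (induction x rule: falg_induct)
  case (uw I J)
  then show ?case by (simp add: star_uw star_lin tw_flip)
qed (simp_all add: star_lin)

lemma star_diff: "star (x - y) = star x - star y"
  using star_lin(1)[of "x - y" y] by simp

lemma star_sum: "star (\<Sum>i\<in>I. f i) = (\<Sum>i\<in>I. star (f i))"
  by (rule additive_sum) (simp_all add: star_lin)

lemma antipode_lin: "antipode q (x + y) = antipode q x + antipode q y"
  "antipode q (scl c x) = scl c (antipode q x)" "antipode q 0 = 0"
  by (simp_all add: antipode_def lin_ext_add[OF vs_scl] lin_ext_scl[OF vs_scl] lin_ext_zero[OF vs_scl])

lemma antipode_minus: "antipode q (- x) = - antipode q x"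
  using antipode_lin(2)[of "-1" x] by simp

lemma antipode_mult: "antipode q (x * y) = antipode q y * antipode q x"
  unfolding antipode_def
  by (rule lin_ext_mult[OF vs_scl, where f = "\<lambda>x y. y * x"]) (simp_all add: algebra_simps plus_fword_def)

lemma antipode_mon: "antipode q (mon w) = prod_list (rev (map (antipode_gen q) (letters w)))"
  by (simp add: antipode_def lin_ext_mon[OF vs_scl])

lemma antipode_one: "antipode q 1 = 1"
  using antipode_mon[of "FWord []"] by (simp add: mon_Nil)

lemma antipode_U: "antipode q (U i j) = scl (tt j / tt i) (U (\<not> j) (\<not> i))"
  by (simp add: U_def antipode_mon antipode_lin antipode_minus tt_def)

lemma antipode_uw: "length I = length J \<Longrightarrow> antipode q (uw I J) = scl (tw J / tw I) (uw (flip J) (flip I))"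
  by (induction I J rule: list_induct2) (simp_all add: antipode_one antipode_mult antipode_U uw_append mult.commute)

lemma antipode_inv_lin: "antipode_inv q (x + y) = antipode_inv q x + antipode_inv q y"
  "antipode_inv q (scl c x) = scl c (antipode_inv q x)" "antipode_inv q 0 = 0"
  by (simp_all add: antipode_inv_def lin_ext_add[OF vs_scl] lin_ext_scl[OF vs_scl] lin_ext_zero[OF vs_scl])

lemma antipode_inv_minus: "antipode_inv q (- x) = - antipode_inv q x"
  using antipode_inv_lin(2)[of "-1" x] by simp

lemma antipode_inv_mult: "antipode_inv q (x * y) = antipode_inv q y * antipode_inv q x"
  unfolding antipode_inv_def
  by (rule lin_ext_mult[OF vs_scl, where f = "\<lambda>x y. y * x"]) (simp_all add: algebra_simps plus_fword_def)

lemma antipode_inv_mon: "antipode_inv q (mon w) = prod_list (rev (map (antipode_inv_gen q) (letters w)))"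
  by (simp add: antipode_inv_def lin_ext_mon[OF vs_scl])

lemma antipode_inv_one: "antipode_inv q 1 = 1"
  using antipode_inv_mon[of "FWord []"] by (simp add: mon_Nil)

lemma antipode_inv_U: "antipode_inv q (U i j) = scl (tt i / tt j) (U (\<not> j) (\<not> i))"
  by (simp add: U_def antipode_inv_mon antipode_inv_lin antipode_inv_minus tt_def)

lemma antipode_inv_uw:
  "length I = length J \<Longrightarrow> antipode_inv q (uw I J) = scl (tw I / tw J) (uw (flip J) (flip I))"
  by (induction I J rule: list_induct2)
    (simp_all add: antipode_inv_one antipode_inv_mult antipode_inv_U uw_append mult.commute)

text \<open>For a unitary matrix, S followed by the involution transposes; here this holds already
  in the free algebra. Hence \<open>dstar\<close> is the conjugate transpose on these matrices,
  \<open>dstar_uw\<close>.\<close>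

lemma star_antipode_uw: "length I = length J \<Longrightarrow> star (antipode q (uw I J)) = uw J I"
  by (simp add: antipode_uw star_lin star_uw tw_flip)

lemma star_antipode_star_antipode: "star (antipode q (star (antipode q x))) = x"
  by (induction x rule: falg_induct) (simp_all add: antipode_lin star_lin star_antipode_uw)

lemma star_antipode_inv: "star (antipode q (antipode_inv q x)) = star x"
  by (induction x rule: falg_induct)
    (simp_all add: antipode_lin antipode_inv_lin star_lin star_antipode_uw antipode_inv_uw star_uw)

lemma cop_lin: "cop q (x + y) = cop q x + cop q y" "cop q (scl c x) = scl c (cop q x)" "cop q 0 = 0"
  by (simp_all add: cop_def lin_ext_add[OF vs_scl] lin_ext_scl[OF vs_scl] lin_ext_zero[OF vs_scl])

lemma cop_minus: "cop q (- x) = - cop q x"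
  using cop_lin(2)[of "-1" x] by simp

lemma cop_mult: "cop q (x * y) = cop q x * cop q y"
  unfolding cop_def by (rule lin_ext_mult_scl) (simp add: plus_fword_def)

lemma cop_mon: "cop q (mon w) = prod_list (map (cop_gen q) (letters w))"
  by (simp add: cop_def lin_ext_mon[OF vs_scl])

lemma cop_one: "cop q 1 = 1"
  using cop_mon[of "FWord []"] by (simp add: mon_Nil)

lemma cop_U: "cop q (U i j) = (\<Sum>k\<in>UNIV. tensor (U i k) (U k j))"
  by (auto simp add: U_def cop_mon cop_lin cop_minus sum_bool tensor_scl_left tensor_scl_right tensor_minus scl_add scl_diff)

lemma cop_uw: "length I = length J \<Longrightarrow> cop q (uw I J) = (\<Sum>K\<in>bl (length I). tensor (uw I K) (uw K J))"
proof (induction I J rule: list_induct2)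
  case (Cons i I j J)
  then show ?case
    by (simp add: cop_mult cop_U sum_bl_Suc sum_product tensor_mult)
qed (simp add: cop_one tensor_one)

lemma cop_sum: "cop q (\<Sum>i\<in>I. f i) = (\<Sum>i\<in>I. cop q (f i))"
  by (rule additive_sum) (simp_all add: cop_lin)

lemma lfun_eps: "lfun eps" unfolding eps_def by (rule lfun_lin_ext)

lemma eps_mult: "eps (x * y) = eps x * eps y"
  unfolding eps_def by (rule lin_ext_mult_complex) (simp add: plus_fword_def)

lemma eps_mon: "eps (mon w) = prod_list (map eps_gen (letters w))"
  by (simp add: eps_def lin_ext_mon[OF vs_complex])

lemma eps_one [simp]: "eps 1 = 1"
  using eps_mon[of "FWord []"] by (simp add: mon_Nil)

lemma eps_U: "eps (U i j) = (if i = j then 1 else 0)"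
  by (simp add: U_def eps_mon lfun_scl[OF lfun_eps] lfun_minus[OF lfun_eps])

lemma eps_uw: "length I = length J \<Longrightarrow> eps (uw I J) = (if I = J then 1 else 0)"
  by (induction I J rule: list_induct2) (simp_all add: eps_mult eps_U)

lemma eps_star: "eps (star x) = cnj (eps x)"
proof (induction x rule: falg_induct)
  case (uw I J)
  have "flip I = flip J \<longleftrightarrow> I = J" by (metis flip_flip)
  then show ?case using uw by (simp add: star_uw eps_uw lfun_scl[OF lfun_eps])
qed (simp_all add: star_lin lfun_simps[OF lfun_eps])

section \<open>Convolution on the dual, its involutions and its translations\<close>

lemma conv_ev2: "conv q g h x = ev2 g h (cop q x)"
  by (simp add: conv_def ev2_def)

lemma lfun_conv: "lfun (conv q g h)"
  by (rule lfunI) (simp_all add: conv_ev2 cop_lin lfun_simps[OF lfun_ev2])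

lemma conv_uw: "lfun g \<Longrightarrow> lfun h \<Longrightarrow> length I = length J \<Longrightarrow>
    conv q g h (uw I J) = (\<Sum>K\<in>bl (length I). g (uw I K) * h (uw K J))"
  by (simp add: conv_ev2 cop_uw lfun_sum[OF lfun_ev2] ev2_tensor)

lemma lfun_eqI:
  assumes "lfun g" "lfun h" "\<And>I J. length I = length J \<Longrightarrow> g (uw I J) = h (uw I J)"
  shows "g = h"
proof
  fix x show "g x = h x"
    by (induction x rule: falg_induct) (simp_all add: lfun_simps[OF assms(1)] lfun_simps[OF assms(2)] assms(3))
qed

lemma conv_assoc: assumes "lfun f" "lfun g" "lfun h"
  shows "conv q (conv q f g) h = conv q f (conv q g h)"
proof (rule lfun_eqI[OF lfun_conv lfun_conv])
  fix I J :: "bool list" assume l: "length I = length J"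
  have "conv q (conv q f g) h (uw I J)
      = (\<Sum>K\<in>bl (length I). \<Sum>L\<in>bl (length I). f (uw I L) * g (uw L K) * h (uw K J))"
    using l assms by (simp add: conv_uw lfun_conv sum_distrib_right)
  also have "\<dots> = (\<Sum>L\<in>bl (length I). \<Sum>K\<in>bl (length I). f (uw I L) * g (uw L K) * h (uw K J))"
    by (rule sum.swap)
  also have "\<dots> = conv q f (conv q g h) (uw I J)"
    using l assms by (simp add: conv_uw lfun_conv sum_distrib_left mult.assoc)
  finally show "conv q (conv q f g) h (uw I J) = conv q f (conv q g h) (uw I J)" .
qed

lemma conv_eps_right: assumes "lfun h" shows "conv q h eps = h"
  by (rule lfun_eqI[OF lfun_conv assms])
    (simp add: conv_uw assms lfun_eps eps_uw if_distrib sum.delta' cong: if_cong)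

lemma conv_eps_left: assumes "lfun h" shows "conv q eps h = h"
  by (rule lfun_eqI[OF lfun_conv assms])
    (simp add: conv_uw assms lfun_eps eps_uw if_distrib if_distribR sum.delta cong: if_cong)

lemma lact_evr: "lact q h b = evr h (cop q b)" by (simp add: lact_def evr_def)
lemma ract_evl: "ract q b h = evl h (cop q b)" by (simp add: ract_def evl_def)

lemma lact_lin: "lact q h (x + y) = lact q h x + lact q h y" "lact q h (scl c x) = scl c (lact q h x)" "lact q h 0 = 0"
  by (simp_all add: lact_evr cop_lin evr_lin)

lemma ract_lin: "ract q (x + y) h = ract q x h + ract q y h" "ract q (scl c x) h = scl c (ract q x h)" "ract q 0 h = 0"
  by (simp_all add: ract_evl cop_lin evl_lin)

lemma lact_uw: "lfun h \<Longrightarrow> length I = length J \<Longrightarrow>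
    lact q h (uw I J) = (\<Sum>K\<in>bl (length I). scl (h (uw K J)) (uw I K))"
  by (simp add: lact_evr cop_uw evr_tensor additive_sum[of "evr h"] evr_lin)

lemma ract_uw: "lfun h \<Longrightarrow> length I = length J \<Longrightarrow>
    ract q (uw I J) h = (\<Sum>K\<in>bl (length I). scl (h (uw I K)) (uw K J))"
  by (simp add: ract_evl cop_uw evl_tensor additive_sum[of "evl h"] evl_lin)

text \<open>Together with \<open>ract_apply\<close> it turns an equation between translated elements
  into an identity of convolution products.\<close>

lemma lact_apply: assumes "lfun g" "lfun h" shows "g (lact q h x) = conv q g h x"
  by (induction x rule: falg_induct)
    (simp_all add: lact_lin lact_uw conv_uw assms lfun_simps[OF lfun_conv] lfun_simps[OF assms(1)] mult.commute)

lemma ract_apply: assumes "lfun g" "lfun h" shows "g (ract q x h) = conv q h g x"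
  by (induction x rule: falg_induct)
    (simp_all add: ract_lin ract_uw conv_uw assms lfun_simps[OF lfun_conv] lfun_simps[OF assms(1)] mult.commute)

lemma lfun_dstar: assumes "lfun h" shows "lfun (dstar q h)"
  by (rule lfunI) (simp_all add: dstar_def antipode_lin star_lin lfun_simps[OF assms])

lemma dstar_uw: "length I = length J \<Longrightarrow> dstar q h (uw I J) = cnj (h (uw J I))"
  by (simp add: dstar_def star_antipode_uw)

lemma dstar_dstar: "dstar q (dstar q h) = h"
  by (rule ext) (simp add: dstar_def star_antipode_star_antipode)

lemma dstar_conv: assumes "lfun g" "lfun h"
  shows "dstar q (conv q g h) = conv q (dstar q h) (dstar q g)"
  by (rule lfun_eqI[OF lfun_dstar[OF lfun_conv] lfun_conv])
    (simp add: dstar_uw conv_uw lfun_dstar assms mult.commute)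

text \<open>Conjugate linear like \<open>dstar\<close>, but it preserves the order of convolution
  (\<open>dagger_conv\<close>) where \<open>dstar\<close> reverses it; the two together give
  composition with the inverse antipode, \<open>antipode_inv_dagger\<close>.\<close>

definition dagger :: "(falg \<Rightarrow> complex) \<Rightarrow> falg \<Rightarrow> complex"
  where "dagger h x = cnj (h (star x))"

lemma lfun_dagger: assumes "lfun h" shows "lfun (dagger h)"
  by (rule lfunI) (simp_all add: dagger_def star_lin lfun_simps[OF assms])

lemma dagger_uw: "lfun h \<Longrightarrow> length I = length J \<Longrightarrow>
    dagger h (uw I J) = tw I / tw J * cnj (h (uw (flip I) (flip J)))"
  by (simp add: dagger_def star_uw lfun_scl)

lemma dagger_conv: assumes "lfun g" "lfun h"
  shows "dagger (conv q g h) = conv q (dagger g) (dagger h)"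
proof (rule lfun_eqI[OF lfun_dagger[OF lfun_conv] lfun_conv])
  fix I J :: "bool list" assume l: "length I = length J"
  have "conv q (dagger g) (dagger h) (uw I J)
      = (\<Sum>K\<in>bl (length I). tw I / tw J * cnj (g (uw (flip I) (flip K)) * h (uw (flip K) (flip J))))"
    using l by (auto simp: conv_uw lfun_dagger assms dagger_uw intro!: sum.cong)
  also have "\<dots> = (\<Sum>K\<in>bl (length I). tw I / tw J * cnj (g (uw (flip I) K) * h (uw K (flip J))))"
    by (rule sum_bl_rev)
  also have "\<dots> = dagger (conv q g h) (uw I J)"
    using l by (simp add: conv_uw lfun_conv assms dagger_uw sum_distrib_left)
  finally show "dagger (conv q g h) (uw I J) = conv q (dagger g) (dagger h) (uw I J)" by simp
qed

lemma antipode_inv_dagger: "h (antipode_inv q x) = dagger (dstar q h) x"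
  by (simp add: dagger_def dstar_def) (metis star_antipode_inv star_antipode_star_antipode)

lemma lact_star: assumes "lfun h" shows "lact q h (star x) = star (lact q (dagger h) x)"
proof (induction x rule: falg_induct)
  case (uw I J)
  have "lact q h (star (uw I J)) = (\<Sum>K\<in>bl (length I). scl (tw I / tw J * h (uw K (flip J))) (uw (flip I) K))"
    using uw by (simp add: star_uw lact_lin lact_uw assms scl_sum)
  also have "\<dots> = (\<Sum>K\<in>bl (length I). scl (tw I / tw J * h (uw (flip K) (flip J))) (uw (flip I) (flip K)))"
    by (rule sum_bl_rev[symmetric])
  also have "\<dots> = star (lact q (dagger h) (uw I J))"
    using uw by (auto simp add: lact_uw lfun_dagger assms star_sum star_lin dagger_uw star_uw intro!: sum.cong)
  finally show ?case .
qed (simp_all add: star_lin lact_lin)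

end

section \<open>Functionals on the quotient algebra\<close>

context sq
begin

definition ucoef :: "bool \<Rightarrow> bool \<Rightarrow> complex" where "ucoef i j = (if \<not> i \<and> j then - qc q else 1)"
primrec row :: "gen \<Rightarrow> bool" where
  "row Gen_a = False" | "row Gen_a_st = True" | "row Gen_c = True" | "row Gen_c_st = False"
primrec col :: "gen \<Rightarrow> bool" where
  "col Gen_a = False" | "col Gen_a_st = True" | "col Gen_c = False" | "col Gen_c_st = True"
definition gn :: "bool \<Rightarrow> bool \<Rightarrow> gen"
  where "gn i j = (if i then if j then Gen_a_st else Gen_c else if j then Gen_c_st else Gen_a)"

text \<open>The linear functional with prescribed values on the products of the \<open>u\<^sub>i\<^sub>j\<close>.\<close>

definition mk :: "(bool list \<Rightarrow> bool list \<Rightarrow> complex) \<Rightarrow> falg \<Rightarrow> complex"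
  where "mk f = lin_ext (*) (\<lambda>w. f (map row (letters w)) (map col (letters w))
     / prod_list (map (\<lambda>g. ucoef (row g) (col g)) (letters w)))"

lemma U_gn: "U i j = scl (ucoef i j) (gelt (gn i j))"
  by (simp add: U_def ucoef_def gn_def)

lemma uw_mon: "length I = length J \<Longrightarrow>
    uw I J = scl (prod_list (map2 ucoef I J)) (mon (FWord (map2 gn I J)))"
proof (induction I J rule: list_induct2)
  case (Cons i I j J)
  show ?case by (simp add: Cons.IH U_gn mon_Cons[of "gn i j" "map2 gn I J"])
qed (simp add: mon_Nil)

lemma row_gn [simp]: "row (gn i j) = i" "col (gn i j) = j" by (auto simp: gn_def)

lemma lfun_mk: "lfun (mk f)" unfolding mk_def by (rule lfun_lin_ext)

lemma mk_uw: assumes "length I = length J" shows "mk f (uw I J) = f I J"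
proof -
  have 1: "map row (map2 gn I J) = I" "map col (map2 gn I J) = J"
    using assms by (induction I J rule: list_induct2) simp_all
  have 2: "prod_list (map (\<lambda>g. ucoef (row g) (col g)) (map2 gn I J)) = prod_list (map2 ucoef I J)"
    using assms by (induction I J rule: list_induct2) simp_all
  have 3: "prod_list (map2 ucoef I J) \<noteq> 0"
    using assms by (induction I J rule: list_induct2) (simp_all add: ucoef_def)
  have "mk f (mon (FWord (map2 gn I J))) = f I J / prod_list (map2 ucoef I J)"
    unfolding mk_def by (simp only: lin_ext_mon[OF vs_complex] fword.sel 1 2)
  then show ?thesis
    by (simp add: uw_mon[OF assms] lfun_scl[OF lfun_mk] 3)
qed

section \<open>The ideal of relations and its annihilator \<open>Udual\<close>\<close>

definition eqv :: "falg \<Rightarrow> falg \<Rightarrow> bool" (infix \<open>\<simeq>\<close> 50) where "x \<simeq> y \<longleftrightarrow> x - y \<in> RelIdeal q"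

lemma Rel_subspace: "fa.subspace (RelIdeal q)" unfolding RelIdeal_def by (rule fa.subspace_span)

lemma Rel_zero: "0 \<in> RelIdeal q" using Rel_subspace by (simp add: fa.subspace_def)
lemma Rel_add: "x \<in> RelIdeal q \<Longrightarrow> y \<in> RelIdeal q \<Longrightarrow> x + y \<in> RelIdeal q"
  using Rel_subspace by (simp add: fa.subspace_def)
lemma Rel_scl: "x \<in> RelIdeal q \<Longrightarrow> scl c x \<in> RelIdeal q"
  using Rel_subspace by (simp add: fa.subspace_def)
lemma Rel_diff: "x \<in> RelIdeal q \<Longrightarrow> y \<in> RelIdeal q \<Longrightarrow> x - y \<in> RelIdeal q"
  using Rel_subspace by (rule fa.subspace_diff)
lemma Rel_sum: "(\<And>i. i \<in> I \<Longrightarrow> f i \<in> RelIdeal q) \<Longrightarrow> sum f I \<in> RelIdeal q"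
  using Rel_subspace by (rule fa.subspace_sum)

lemma Rel_induct [consumes 1, case_names zero add scl gen]:
  assumes "x \<in> RelIdeal q" "P 0" "\<And>x y. P x \<Longrightarrow> P y \<Longrightarrow> P (x + y)" "\<And>c x. P x \<Longrightarrow> P (scl c x)"
    "\<And>x r y. r \<in> rels q \<union> star ` rels q \<Longrightarrow> P (x * r * y)"
  shows "P x"
  using assms(1) unfolding RelIdeal_def
proof (rule fa.span_induct)
  show "fa.subspace (Collect P)" unfolding fa.subspace_def using assms by auto
qed (use assms in auto)

lemma Rel_gen: "r \<in> rels q \<union> star ` rels q \<Longrightarrow> x * r * y \<in> RelIdeal q"
  unfolding RelIdeal_def by (rule fa.span_base) blast

lemma Rel_mult_left: "x \<in> RelIdeal q \<Longrightarrow> y * x \<in> RelIdeal q"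
proof (induction rule: Rel_induct)
  case (gen x r z)
  then show ?case using Rel_gen[of r "y * x" z] by (simp add: mult.assoc)
qed (simp_all add: Rel_zero Rel_add Rel_scl distrib_left)

lemma Rel_mult_right: "x \<in> RelIdeal q \<Longrightarrow> x * y \<in> RelIdeal q"
proof (induction rule: Rel_induct)
  case (gen x r z)
  then show ?case using Rel_gen[of r x "z * y"] by (simp add: mult.assoc)
qed (simp_all add: Rel_zero Rel_add Rel_scl distrib_right)

lemma Rel_star: "x \<in> RelIdeal q \<Longrightarrow> star x \<in> RelIdeal q"
proof (induction rule: Rel_induct)
  case (gen x r z)
  have "star r \<in> rels q \<union> star ` rels q" using gen by (auto simp: image_iff)
  then show ?case using Rel_gen[of "star r" "star z" "star x"] by (simp add: star_mult mult.assoc)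
qed (simp_all add: Rel_zero Rel_add Rel_scl star_lin)

text \<open>The q-antisymmetric form on the spin 1/2 space. Its invariance under U_1/2 along rows
  and along columns, \<open>Ra\<close> and \<open>Rb\<close>, expresses that the quantum determinant
  is 1; it is equivalent to the five relations with their adjoints, see \<open>R_eqs\<close> and
  \<open>r_eqs\<close>.\<close>

definition eE :: "bool \<Rightarrow> bool \<Rightarrow> complex" where "eE i j = (if i = j then 0 else if i then - qc q else 1)"
definition Ra :: "bool \<Rightarrow> bool \<Rightarrow> falg"
  where "Ra i j = (\<Sum>k\<in>UNIV. \<Sum>l\<in>UNIV. scl (eE k l) (U i k * U j l)) - scl (eE i j) 1"
definition Rb :: "bool \<Rightarrow> bool \<Rightarrow> falg"
  where "Rb i j = (\<Sum>k\<in>UNIV. \<Sum>l\<in>UNIV. scl (eE k l) (U k i * U l j)) - scl (eE i j) 1"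

definition r1 :: falg where "r1 = als * al + gas * ga - 1"
definition r2 :: falg where "r2 = al * als + scl ((qc q)\<^sup>2) (ga * gas) - 1"
definition r3 :: falg where "r3 = gas * ga - ga * gas"
definition r4 :: falg where "r4 = al * ga - scl (qc q) (ga * al)"
definition r5 :: falg where "r5 = al * gas - scl (qc q) (gas * al)"

lemma rels_eq: "rels q = {r1, r2, r3, r4, r5}"
  by (simp only: rels_def r1_def r2_def r3_def r4_def r5_def)

lemma star_r: "star r1 = r1" "star r2 = r2" "star r3 = r3"
  by (simp_all add: r1_def r2_def r3_def star_diff star_lin star_mult star_gelt star_one)

lemma rels_star_eq: "rels q \<union> star ` rels q = {r1, r2, r3, r4, r5, star r4, star r5}"
  by (simp add: rels_eq star_r insert_commute)

lemma R_eqs: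
  "Ra False False = scl (- qc q) r5"
  "Ra False True = r2 + scl ((qc q)\<^sup>2) r3"
  "Ra True False = scl (- qc q) (r1 - r3)"
  "Ra True True = star r5"
  "Rb False False = r4"
  "Rb False True = r2"
  "Rb True False = scl (- qc q) r1"
  "Rb True True = scl (- qc q) (star r4)"
  by (simp_all add: r1_def r2_def r3_def r4_def r5_def Ra_def Rb_def eE_def U_def sum_bool scl_diff scl_add
      star_diff star_lin star_mult star_gelt power2_eq_square algebra_simps)

lemma r_Rel: "r \<in> {r1, r2, r3, r4, r5, star r4, star r5} \<Longrightarrow> r \<in> RelIdeal q"
  using Rel_gen[of r 1 1] unfolding rels_star_eq by simp

lemma Ra_Rel: "Ra i j \<in> RelIdeal q"
  by (cases i; cases j) (simp_all only: R_eqs Rel_scl Rel_add Rel_diff r_Rel insert_iff simp_thms)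

lemma Rb_Rel: "Rb i j \<in> RelIdeal q"
  by (cases i; cases j) (simp_all only: R_eqs Rel_scl Rel_add Rel_diff r_Rel insert_iff simp_thms)

lemma r_eqs: "r1 = scl (- 1 / qc q) (Rb True False)" "r2 = Rb False True"
    "r3 = scl (1 / (qc q)\<^sup>2) (Ra False True + scl (- 1) (Rb False True))"
    "r4 = Rb False False" "r5 = scl (- 1 / qc q) (Ra False False)"
    "star r4 = scl (- 1 / qc q) (Rb True True)" "star r5 = Ra True True"
  by (simp_all add: R_eqs)

text \<open>Both outer factors of a generator of the ideal expand into products of entries, so
  vanishing on the ideal becomes a family of matrix identities, collected in
  \<open>UdualI\<close>.\<close>

lemma Rel_induct_R [consumes 1, case_names zero add scl Ra Rb]:
  assumes "x \<in> RelIdeal q" "P 0" "\<And>x y. P x \<Longrightarrow> P y \<Longrightarrow> P (x + y)" "\<And>c x. P x \<Longrightarrow> P (scl c x)"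
    and a: "\<And>I J I' J' i j. length I = length J \<Longrightarrow> length I' = length J' \<Longrightarrow> P (uw I J * Ra i j * uw I' J')"
    and b: "\<And>I J I' J' i j. length I = length J \<Longrightarrow> length I' = length J' \<Longrightarrow> P (uw I J * Rb i j * uw I' J')"
  shows "P x"
  using assms(1)
proof (induction rule: Rel_induct)
  case (gen x r y)
  have ext: "P (x * z * y)"
    if z: "\<And>I J I' J'. length I = length J \<Longrightarrow> length I' = length J' \<Longrightarrow> P (uw I J * z * uw I' J')" for x y z
  proof -
    have 1: "P (uw I J * z * y)" if "length I = length J" for I J
      by (induction y rule: falg_induct) (simp_all add: assms(2-4) z distrib_left that)
    show ?thesis
      by (induction x rule: falg_induct) (simp_all add: assms(2-4) 1 distrib_right)
  qed
  have A: "P (x * Ra i j * y)" and B: "P (x * Rb i j * y)" for i j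
    using ext a b by blast+
  have s: "P (x * scl c z * y)" if "P (x * z * y)" for c z using assms(4)[OF that] by simp
  have p: "P (x * (z + w) * y)" if "P (x * z * y)" "P (x * w * y)" for z w
    using assms(3)[OF that] by (simp add: distrib_left distrib_right)
  have "P (x * r1 * y)" "P (x * r2 * y)" "P (x * r3 * y)" "P (x * r4 * y)" "P (x * r5 * y)"
    "P (x * star r4 * y)" "P (x * star r5 * y)"
    unfolding r_eqs(6,7) unfolding r_eqs(1-5) by (intro s p A B)+
  then show ?case using gen unfolding rels_star_eq by (elim insertE emptyE) simp_all
qed (use assms in auto)

lemma in_Udual: "h \<in> Udual q \<longleftrightarrow> lfun h \<and> (\<forall>x\<in>RelIdeal q. h x = 0)"
  by (simp add: Udual_def linear_iff_lfun)

lemma Udual_lfun: "h \<in> Udual q \<Longrightarrow> lfun h" by (simp add: in_Udual)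
lemma Udual_zero: "h \<in> Udual q \<Longrightarrow> x \<in> RelIdeal q \<Longrightarrow> h x = 0" by (simp add: in_Udual)
lemma Udual_eqv: "h \<in> Udual q \<Longrightarrow> x \<simeq> y \<Longrightarrow> h x = h y"
  using lfun_diff[OF Udual_lfun, of h x y] by (simp add: eqv_def Udual_zero)

lemma h_Ra: assumes "lfun h" "length I = length J" "length I' = length J'"
  shows "h (uw I J * Ra i j * uw I' J') =
    (\<Sum>k\<in>UNIV. \<Sum>l\<in>UNIV. eE k l * h (uw (I @ i # j # I') (J @ k # l # J'))) - eE i j * h (uw (I @ I') (J @ J'))"
  by (simp add: Ra_def sum_bool uw_append assms(2,3) left_diff_distrib right_diff_distrib distrib_left distrib_right
      lfun_simps[OF assms(1)] mult.assoc)

lemma h_Rb: assumes "lfun h" "length I = length J" "length I' = length J'"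
  shows "h (uw I J * Rb i j * uw I' J') =
    (\<Sum>k\<in>UNIV. \<Sum>l\<in>UNIV. eE k l * h (uw (I @ k # l # I') (J @ i # j # J'))) - eE i j * h (uw (I @ I') (J @ J'))"
  by (simp add: Rb_def sum_bool uw_append assms(2,3) left_diff_distrib right_diff_distrib distrib_left distrib_right
      lfun_simps[OF assms(1)] mult.assoc)

lemma UdualI:
  assumes h: "lfun h"
    and a: "\<And>I J I' J' i j. length I = length J \<Longrightarrow> length I' = length J' \<Longrightarrow>
      (\<Sum>k\<in>UNIV. \<Sum>l\<in>UNIV. eE k l * h (uw (I @ i # j # I') (J @ k # l # J'))) = eE i j * h (uw (I @ I') (J @ J'))"
    and b: "\<And>I J I' J' i j. length I = length J \<Longrightarrow> length I' = length J' \<Longrightarrow>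
      (\<Sum>k\<in>UNIV. \<Sum>l\<in>UNIV. eE k l * h (uw (I @ k # l # I') (J @ i # j # J'))) = eE i j * h (uw (I @ I') (J @ J'))"
  shows "h \<in> Udual q"
proof -
  have "h x = 0" if "x \<in> RelIdeal q" for x
    using that
  proof (induction rule: Rel_induct_R)
    case (Ra I J I' J' i j) then show ?case by (simp only: h_Ra[OF h] a) simp
  next
    case (Rb I J I' J' i j) then show ?case by (simp only: h_Rb[OF h] b) simp
  qed (simp_all add: lfun_simps[OF h])
  then show ?thesis using h by (simp add: in_Udual)
qed

lemma UdualDa: assumes "h \<in> Udual q" "length I = length J" "length I' = length J'"
  shows "(\<Sum>k\<in>UNIV. \<Sum>l\<in>UNIV. eE k l * h (uw (I @ i # j # I') (J @ k # l # J'))) = eE i j * h (uw (I @ I') (J @ J'))"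
  using h_Ra[OF Udual_lfun[OF assms(1)] assms(2,3), of i j]
    Udual_zero[OF assms(1) Rel_mult_right[OF Rel_mult_left[OF Ra_Rel]]] by simp

lemma UdualDb: assumes "h \<in> Udual q" "length I = length J" "length I' = length J'"
  shows "(\<Sum>k\<in>UNIV. \<Sum>l\<in>UNIV. eE k l * h (uw (I @ k # l # I') (J @ i # j # J'))) = eE i j * h (uw (I @ I') (J @ J'))"
  using h_Rb[OF Udual_lfun[OF assms(1)] assms(2,3), of i j]
    Udual_zero[OF assms(1) Rel_mult_right[OF Rel_mult_left[OF Rb_Rel]]] by simp

text \<open>A family of functionals closed under removal of the first letter only has to satisfy the relations at the front.\<close>

lemma Udual_family:
  fixes h :: "'x \<Rightarrow> falg \<Rightarrow> complex"
  assumes h: "\<And>x. lfun (h x)"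
    and rec: "\<And>x i j I J. length I = length J \<Longrightarrow> h x (uw (i # I) (j # J)) = (\<Sum>y\<in>Y x. c x y i j * h y (uw I J))"
    and a: "\<And>x I J i j. length I = length J \<Longrightarrow>
      (\<Sum>k\<in>UNIV. \<Sum>l\<in>UNIV. eE k l * h x (uw (i # j # I) (k # l # J))) = eE i j * h x (uw I J)"
    and b: "\<And>x I J i j. length I = length J \<Longrightarrow>
      (\<Sum>k\<in>UNIV. \<Sum>l\<in>UNIV. eE k l * h x (uw (k # l # I) (i # j # J))) = eE i j * h x (uw I J)"
  shows "h x \<in> Udual q"
proof (rule UdualI[OF h])
  fix I J I' J' :: "bool list" and i j
  assume l: "length I = length J" "length I' = length J'"
  show "(\<Sum>k\<in>UNIV. \<Sum>l\<in>UNIV. eE k l * h x (uw (I @ i # j # I') (J @ k # l # J'))) = eE i j * h x (uw (I @ I') (J @ J'))"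
    using l(1)
  proof (induction I J arbitrary: x rule: list_induct2)
    case (Cons m M n N)
    have "(\<Sum>k\<in>UNIV. \<Sum>l\<in>UNIV. eE k l * h x (uw ((m # M) @ i # j # I') ((n # N) @ k # l # J')))
        = (\<Sum>y\<in>Y x. c x y m n * (\<Sum>k\<in>UNIV. \<Sum>l\<in>UNIV. eE k l * h y (uw (M @ i # j # I') (N @ k # l # J'))))"
      using Cons.hyps l(2) by (simp add: rec sum_bool sum_distrib_left sum.distrib[symmetric] distrib_left mult.left_commute del: uw_Cons)
    also have "\<dots> = eE i j * h x (uw ((m # M) @ I') ((n # N) @ J'))"
      using Cons.hyps l(2) by (simp add: Cons.IH rec sum_distrib_left mult.left_commute del: uw_Cons)
    finally show ?case .
  qed (use a l(2) in simp)
  show "(\<Sum>k\<in>UNIV. \<Sum>l\<in>UNIV. eE k l * h x (uw (I @ k # l # I') (J @ i # j # J'))) = eE i j * h x (uw (I @ I') (J @ J'))"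
    using l(1)
  proof (induction I J arbitrary: x rule: list_induct2)
    case (Cons m M n N)
    have "(\<Sum>k\<in>UNIV. \<Sum>l\<in>UNIV. eE k l * h x (uw ((m # M) @ k # l # I') ((n # N) @ i # j # J')))
        = (\<Sum>y\<in>Y x. c x y m n * (\<Sum>k\<in>UNIV. \<Sum>l\<in>UNIV. eE k l * h y (uw (M @ k # l # I') (N @ i # j # J'))))"
      using Cons.hyps l(2) by (simp add: rec sum_bool sum_distrib_left sum.distrib[symmetric] distrib_left mult.left_commute del: uw_Cons)
    also have "\<dots> = eE i j * h x (uw ((m # M) @ I') ((n # N) @ J'))"
      using Cons.hyps l(2) by (simp add: Cons.IH rec sum_distrib_left mult.left_commute del: uw_Cons)
    finally show ?case .
  qed (use b l(2) in simp)
qed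

lemma sum4_swap: "(\<Sum>k\<in>A. \<Sum>l\<in>B. \<Sum>m\<in>C. f k l m) = (\<Sum>m\<in>C. \<Sum>k\<in>A. \<Sum>l\<in>B. f k l m)"
proof -
  have "(\<Sum>k\<in>A. \<Sum>l\<in>B. \<Sum>m\<in>C. f k l m) = (\<Sum>k\<in>A. \<Sum>m\<in>C. \<Sum>l\<in>B. f k l m)"
    by (rule sum.cong[OF refl], rule sum.swap)
  also have "\<dots> = (\<Sum>m\<in>C. \<Sum>k\<in>A. \<Sum>l\<in>B. f k l m)" by (rule sum.swap)
  finally show ?thesis .
qed

lemma sum_bl_mid: "sum f (bl (Suc (Suc (m + n)))) =
    (\<Sum>K\<in>bl m. \<Sum>K'\<in>bl n. \<Sum>k\<in>UNIV. \<Sum>l\<in>UNIV. f (K @ k # l # K'))"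
proof -
  have "sum g (bl (Suc (Suc n))) = (\<Sum>K'\<in>bl n. \<Sum>k\<in>UNIV. \<Sum>l\<in>UNIV. g (k # l # K'))" for g :: "bool list \<Rightarrow> 'a"
    by (simp only: sum_bl_Suc, rule sum4_swap)
  then show ?thesis using sum_bl_add[of f m "Suc (Suc n)"] by simp
qed

text \<open>In the convolution sum the invariance for one factor moves \<open>eE\<close> from the
  outer pair of indices to the intermediate pair, where the invariance for the other factor takes
  over. So the annihilator is stable under convolution without first passing the coproduct to the
  quotient.\<close>

lemma Udual_conv: assumes g: "g \<in> Udual q" and h: "h \<in> Udual q" shows "conv q g h \<in> Udual q"
proof (rule UdualI[OF lfun_conv])
  note gh = Udual_lfun[OF g] Udual_lfun[OF h]
  fix I J I' J' :: "bool list" and i j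
  assume l: "length I = length J" "length I' = length J'"
  let ?S = "\<lambda>f. \<Sum>K\<in>bl (length I). \<Sum>K'\<in>bl (length I'). f K K'"
  have c1: "conv q g h (uw (I @ I') (J @ J')) = ?S (\<lambda>K K'. g (uw (I @ I') (K @ K')) * h (uw (K @ K') (J @ J')))"
    using l by (simp add: conv_uw gh sum_bl_add)
  have c2: "conv q g h (uw (I @ i1 # i2 # I') (J @ j1 # j2 # J')) = ?S (\<lambda>K K'. \<Sum>m\<in>UNIV. \<Sum>n\<in>UNIV.
      g (uw (I @ i1 # i2 # I') (K @ m # n # K')) * h (uw (K @ m # n # K') (J @ j1 # j2 # J')))" for i1 i2 j1 j2
    using l by (simp add: conv_uw gh sum_bl_mid)
  have "(\<Sum>k\<in>UNIV. \<Sum>l\<in>UNIV. eE k l * conv q g h (uw (I @ i # j # I') (J @ k # l # J')))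
      = ?S (\<lambda>K K'. \<Sum>m\<in>UNIV. \<Sum>n\<in>UNIV. g (uw (I @ i # j # I') (K @ m # n # K')) *
          (\<Sum>k\<in>UNIV. \<Sum>l\<in>UNIV. eE k l * h (uw (K @ m # n # K') (J @ k # l # J'))))"
    by (simp add: c2 sum_bool sum_distrib_left sum.distrib[symmetric] distrib_left algebra_simps)
  also have "\<dots> = ?S (\<lambda>K K'. (\<Sum>m\<in>UNIV. \<Sum>n\<in>UNIV. eE m n * g (uw (I @ i # j # I') (K @ m # n # K'))) * h (uw (K @ K') (J @ J')))"
    using l by (simp add: UdualDa[OF h] sum_distrib_right mult.assoc mult.left_commute)
  also have "\<dots> = eE i j * conv q g h (uw (I @ I') (J @ J'))"
    using l by (simp add: UdualDa[OF g] c1 sum_distrib_left mult.assoc)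
  finally show "(\<Sum>k\<in>UNIV. \<Sum>l\<in>UNIV. eE k l * conv q g h (uw (I @ i # j # I') (J @ k # l # J')))
     = eE i j * conv q g h (uw (I @ I') (J @ J'))" .
  have "(\<Sum>k\<in>UNIV. \<Sum>l\<in>UNIV. eE k l * conv q g h (uw (I @ k # l # I') (J @ i # j # J')))
      = ?S (\<lambda>K K'. \<Sum>m\<in>UNIV. \<Sum>n\<in>UNIV. 
          (\<Sum>k\<in>UNIV. \<Sum>l\<in>UNIV. eE k l * g (uw (I @ k # l # I') (K @ m # n # K'))) * h (uw (K @ m # n # K') (J @ i # j # J')))"
    by (simp add: c2 sum_bool sum_distrib_left sum.distrib[symmetric] distrib_left algebra_simps)
  also have "\<dots> = ?S (\<lambda>K K'. g (uw (I @ I') (K @ K')) * (\<Sum>m\<in>UNIV. \<Sum>n\<in>UNIV. eE m n * h (uw (K @ m # n # K') (J @ i # j # J'))))"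
    using l by (simp add: UdualDb[OF g] sum_distrib_left mult.assoc mult.left_commute)
  also have "\<dots> = eE i j * conv q g h (uw (I @ I') (J @ J'))"
    using l by (simp add: UdualDb[OF h] c1 sum_distrib_left mult.left_commute)
  finally show "(\<Sum>k\<in>UNIV. \<Sum>l\<in>UNIV. eE k l * conv q g h (uw (I @ k # l # I') (J @ i # j # J')))
     = eE i j * conv q g h (uw (I @ I') (J @ J'))" .
qed

lemma eE_cnj [simp]: "cnj (eE i j) = eE i j" by (simp add: eE_def)

text \<open>Transposition exchanges the row relations and the column relations.\<close>

lemma Udual_dstar: assumes h: "h \<in> Udual q" shows "dstar q h \<in> Udual q"
proof (rule UdualI[OF lfun_dstar[OF Udual_lfun[OF h]]])
  fix I J I' J' :: "bool list" and i j
  assume l: "length I = length J" "length I' = length J'"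
  show "(\<Sum>k\<in>UNIV. \<Sum>l\<in>UNIV. eE k l * dstar q h (uw (I @ i # j # I') (J @ k # l # J'))) = eE i j * dstar q h (uw (I @ I') (J @ J'))"
    using arg_cong[OF UdualDb[OF h l(1)[symmetric] l(2)[symmetric], of i j], of cnj] l by (simp add: dstar_uw)
  show "(\<Sum>k\<in>UNIV. \<Sum>l\<in>UNIV. eE k l * dstar q h (uw (I @ k # l # I') (J @ i # j # J'))) = eE i j * dstar q h (uw (I @ I') (J @ J'))"
    using arg_cong[OF UdualDa[OF h l(1)[symmetric] l(2)[symmetric], of i j], of cnj] l by (simp add: dstar_uw)
qed

lemma Udual_dagger: assumes h: "h \<in> Udual q" shows "dagger h \<in> Udual q"
  by (simp add: in_Udual lfun_dagger[OF Udual_lfun[OF h]]) (simp add: dagger_def Rel_star Udual_zero[OF h])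

lemma Udual_lincomb: "(\<And>i. i \<in> S \<Longrightarrow> h i \<in> Udual q) \<Longrightarrow> (\<lambda>x. \<Sum>i\<in>S. c i * h i x) \<in> Udual q"
  by (auto simp add: in_Udual lfun_def sum.distrib sum_distrib_left distrib_left mult.left_commute)

lemma Udual_add: "g \<in> Udual q \<Longrightarrow> h \<in> Udual q \<Longrightarrow> (\<lambda>x. g x + h x) \<in> Udual q"
  by (auto simp add: in_Udual lfun_def distrib_left)

lemma Udual_scl: "h \<in> Udual q \<Longrightarrow> (\<lambda>x. c * h x) \<in> Udual q"
  by (auto simp add: in_Udual lfun_def distrib_left)

lemma Udual_eps: "eps \<in> Udual q"
  by (rule Udual_family[where h = "\<lambda>_::unit. eps" and Y = "\<lambda>_. {()}" and c = "\<lambda>_ _ i j. if i = j then 1 else 0" and x = "()"])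
    (auto simp: lfun_eps eps_uw sum_bool eps_mult eps_U eE_def)

text \<open>Composing a functional with the antipode amounts to \<open>dagger\<close> followed by
  \<open>dstar\<close>, and both preserve the annihilator.\<close>

lemma antipode_Rel: assumes "x \<in> RelIdeal q" shows "\<forall>h\<in>Udual q. h (antipode q x) = 0"
proof
  fix h assume h: "h \<in> Udual q"
  have "h (antipode q x) = dstar q (dagger h) x" by (simp add: dstar_def dagger_def)
  then show "h (antipode q x) = 0" using Udual_zero[OF Udual_dstar[OF Udual_dagger[OF h]] assms] by simp
qed

text \<open>A basis of the ideal stays independent after adding a vector outside the ideal; the
  functional that is 1 on this vector and 0 on the basis annihilates the ideal.\<close>

lemma separation: assumes "\<And>h. h \<in> Udual q \<Longrightarrow> h x = 0" shows "x \<in> RelIdeal q"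
proof (rule ccontr)
  assume x: "x \<notin> RelIdeal q"
  obtain B where B: "B \<subseteq> RelIdeal q" "fa.independent B" "RelIdeal q \<subseteq> fa.span B"
    by (rule fa.basis_exists)
  have "fa.span B \<subseteq> RelIdeal q" using B(1) Rel_subspace by (simp add: fa.span_minimal)
  then have "x \<notin> fa.span B" using x by blast
  then have ind: "fa.independent (insert x B)" using B(2) by (simp add: fa.independent_insert)
  interpret C: vector_space "(*) :: complex \<Rightarrow> complex \<Rightarrow> complex" by (rule vs_complex)
  interpret VP: vector_space_pair "scl :: complex \<Rightarrow> falg \<Rightarrow> falg" "(*) :: complex \<Rightarrow> complex \<Rightarrow> complex" ..
  obtain g where g: "Vector_Spaces.linear scl (*) g" "\<forall>y\<in>insert x B. g y = (if y = x then 1 else 0)"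
    using VP.linear_independent_extend[OF ind, of "\<lambda>y. if y = x then 1 else 0"] by blast
  have lg: "lfun g" using g(1) by (simp add: linear_iff_lfun)
  have "x \<notin> B" using x B(1) by blast
  then have gB: "g y = 0" if "y \<in> B" for y using g(2) that by auto
  have "g y = 0" if "y \<in> fa.span B" for y
    using that
  proof (rule fa.span_induct)
    show "fa.subspace (Collect (\<lambda>y. g y = 0))" by (simp add: fa.subspace_def lfun_simps[OF lg])
  qed (use gB in auto)
  then have "g \<in> Udual q" using lg B(3) by (auto simp: in_Udual)
  from assms[OF this] g(2) show False by simp
qed

lemma eqvI: "(\<And>h. h \<in> Udual q \<Longrightarrow> h x = h y) \<Longrightarrow> x \<simeq> y"
  unfolding eqv_def by (rule separation) (simp add: lfun_diff[OF Udual_lfun])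

lemma eqv_refl [simp]: "x \<simeq> x" by (simp add: eqv_def Rel_zero)
lemma eqv_sym: "x \<simeq> y \<Longrightarrow> y \<simeq> x" using Rel_diff[OF Rel_zero, of "x - y"] by (simp add: eqv_def)
lemma eqv_trans [trans]: "x \<simeq> y \<Longrightarrow> y \<simeq> z \<Longrightarrow> x \<simeq> z" using Rel_add[of "x - y" "y - z"] by (simp add: eqv_def)
lemma eqv_add: "x \<simeq> y \<Longrightarrow> x' \<simeq> y' \<Longrightarrow> x + x' \<simeq> y + y'"
  using Rel_add[of "x - y" "x' - y'"] by (simp add: eqv_def algebra_simps)
lemma eqv_diff: "x \<simeq> y \<Longrightarrow> x' \<simeq> y' \<Longrightarrow> x - x' \<simeq> y - y'"
  using Rel_diff[of "x - y" "x' - y'"] by (simp add: eqv_def algebra_simps)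
lemma eqv_scl: "x \<simeq> y \<Longrightarrow> scl c x \<simeq> scl c y" using Rel_scl[of "x - y" c] by (simp add: eqv_def scl_diff)
lemma eqv_sum: "(\<And>i. i \<in> I \<Longrightarrow> f i \<simeq> g i) \<Longrightarrow> sum f I \<simeq> sum g I"
  using Rel_sum[of I "\<lambda>i. f i - g i"] by (simp add: eqv_def sum_subtractf)
lemma eqv_mult: assumes "x \<simeq> y" "x' \<simeq> y'" shows "x * x' \<simeq> y * y'"
proof -
  have "x * x' - y * y' = (x - y) * x' + y * (x' - y')" by (simp add: algebra_simps)
  then show ?thesis using assms by (simp add: eqv_def Rel_add Rel_mult_left Rel_mult_right)
qed
lemma eqv_star: "x \<simeq> y \<Longrightarrow> star x \<simeq> star y" using Rel_star[of "x - y"] by (simp add: eqv_def star_diff)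
lemma eqv_zero: "x \<simeq> 0 \<longleftrightarrow> x \<in> RelIdeal q" by (simp add: eqv_def)
lemma eqv_lact: assumes "h \<in> Udual q" "x \<simeq> y" shows "lact q h x \<simeq> lact q h y"
  by (rule eqvI) (simp add: lact_apply Udual_lfun assms Udual_eqv[OF Udual_conv assms(2)])
lemma eqv_ract: assumes "h \<in> Udual q" "x \<simeq> y" shows "ract q x h \<simeq> ract q y h"
  by (rule eqvI) (simp add: ract_apply Udual_lfun assms Udual_eqv[OF Udual_conv assms(2)])

end

section \<open>The generators of \<open>U\<^sub>q(su(2))\<close>\<close>

context sq
begin

definition wt :: "bool list \<Rightarrow> int" where "wt I = sum_list (map (\<lambda>i. if i then - 1 else 1) I)"
definition nT :: "bool list \<Rightarrow> nat" where "nT I = length (filter id I)"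

lemma wt_simps [simp]: "wt [] = 0" "wt (i # I) = (if i then - 1 else 1) + wt I" "wt (I @ J) = wt I + wt J"
  by (simp_all add: wt_def)

lemma nT_simps [simp]: "nT [] = 0" "nT (i # I) = (if i then Suc (nT I) else nT I)" "nT (I @ J) = nT I + nT J"
  "nT (replicate n i) = (if i then n else 0)"
  by (simp_all add: nT_def filter_replicate)

lemma wt_nT: "wt I = int (length I) - 2 * int (nT I)"
  by (induction I) simp_all

lemma nT_le: "nT I \<le> length I" by (simp add: nT_def)

lemma nT_zero: "nT I = 0 \<longleftrightarrow> I = replicate (length I) False"
  by (induction I) auto

text \<open>An arbitrary function of the weight w, where k itself is the function q^w. Beyond powers
  of k this includes the projections onto weight spaces, which the separation argument uses.\<close>

definition Kc :: "(int \<Rightarrow> complex) \<Rightarrow> falg \<Rightarrow> complex"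
  where "Kc \<phi> = mk (\<lambda>I J. if I = J then \<phi> (wt I) else 0)"

lemma lfun_Kc [simp]: "lfun (Kc \<phi>)" by (simp add: Kc_def lfun_mk)

lemma Kc_uw: "length I = length J \<Longrightarrow> Kc \<phi> (uw I J) = (if I = J then \<phi> (wt I) else 0)"
  by (simp add: Kc_def mk_uw)

lemma conv_Kc_left: "lfun h \<Longrightarrow> length I = length J \<Longrightarrow> conv q (Kc \<phi>) h (uw I J) = \<phi> (wt I) * h (uw I J)"
  by (simp add: conv_uw Kc_uw if_distrib[of "\<lambda>x. x * _"] sum.delta cong: if_cong)

lemma conv_Kc_right: "lfun h \<Longrightarrow> length I = length J \<Longrightarrow> conv q h (Kc \<phi>) (uw I J) = h (uw I J) * \<phi> (wt J)"
  by (simp add: conv_uw Kc_uw if_distrib sum.delta' cong: if_cong)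

text \<open>\<open>eE\<close> pairs only unequal indices, so removing such a pair leaves the weight
  unchanged.\<close>

lemma Kc_Udual [simp]: "Kc \<phi> \<in> Udual q"
proof (rule UdualI[OF lfun_Kc])
  fix I J I' J' :: "bool list" and i j
  assume l: "length I = length J" "length I' = length J'"
  have w: "I @ i # j # I' = J @ k # l # J' \<longleftrightarrow> I @ I' = J @ J' \<and> i = k \<and> j = l" for k l
    using l by auto
  show "(\<Sum>k\<in>UNIV. \<Sum>l\<in>UNIV. eE k l * Kc \<phi> (uw (I @ i # j # I') (J @ k # l # J'))) = eE i j * Kc \<phi> (uw (I @ I') (J @ J'))"
    using l by (auto simp add: Kc_uw sum_bool eE_def)
  show "(\<Sum>k\<in>UNIV. \<Sum>l\<in>UNIV. eE k l * Kc \<phi> (uw (I @ k # l # I') (J @ i # j # J'))) = eE i j * Kc \<phi> (uw (I @ I') (J @ J'))"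
    using l by (auto simp add: Kc_uw sum_bool eE_def)
qed

lemma conv_Kc_Kc: "conv q (Kc \<phi>) (Kc \<psi>) = Kc (\<lambda>w. \<phi> w * \<psi> w)"
  by (rule lfun_eqI[OF lfun_conv lfun_Kc]) (simp add: conv_Kc_left Kc_uw)

lemma Kc_one: "Kc (\<lambda>_. 1) = eps"
  by (rule lfun_eqI[OF lfun_Kc lfun_eps]) (simp add: Kc_uw eps_uw)

lemma Kc_sum: "Kc (\<lambda>w. \<Sum>i\<in>S. c i * \<phi> i w) x = (\<Sum>i\<in>S. c i * Kc (\<phi> i) x)"
proof (induction x rule: falg_induct)
  case (uw I J) then show ?case by (auto simp: Kc_uw intro!: sum.neutral)
qed (simp_all add: lfun_simps[OF lfun_Kc] sum.distrib distrib_left sum_distrib_left mult.left_commute)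

lemma dstar_Kc: "dstar q (Kc \<phi>) = Kc (\<lambda>w. cnj (\<phi> w))"
  by (rule lfun_eqI[OF lfun_dstar[OF lfun_Kc] lfun_Kc]) (auto simp add: dstar_uw Kc_uw)

text \<open>\<open>kk\<close>, \<open>ki\<close>, \<open>ee\<close>, \<open>ff\<close>,
  \<open>idm\<close> are the spin 1/2 matrices of k, k^-1, e, f, 1; they govern what each element
  does to the first letter of a word.\<close>

definition kk :: "bool \<Rightarrow> bool \<Rightarrow> complex" where "kk i j = (if i = j then if i then 1 / qc q else qc q else 0)"
definition ki :: "bool \<Rightarrow> bool \<Rightarrow> complex" where "ki i j = (if i = j then if i then qc q else 1 / qc q else 0)"
definition ee :: "bool \<Rightarrow> bool \<Rightarrow> complex" where "ee i j = (if \<not> i \<and> j then qc (sqrt q) else 0)"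
definition ff :: "bool \<Rightarrow> bool \<Rightarrow> complex" where "ff i j = (if i \<and> \<not> j then 1 / qc (sqrt q) else 0)"
definition idm :: "bool \<Rightarrow> bool \<Rightarrow> complex" where "idm i j = (if i = j then 1 else 0)"

definition Kf :: "falg \<Rightarrow> complex" where "Kf = Kc (\<lambda>w. qc q powi w)"

lemma lfun_UeUf [simp]: "lfun (U_e q)" "lfun (U_f q)" "lfun (U_kinv q)" "lfun Kf"
  by (simp_all add: U_e_def U_f_def U_kinv_def Kf_def lfun_lin_ext)

lemma sqrt_q: "qc q / qc (sqrt q) = qc (sqrt q)"
  using q_pos by (metis less_eq_real_def of_real_divide real_div_sqrt)

lemma U_kinv_mult: "U_kinv q (x * y) = U_kinv q x * U_kinv q y"
  unfolding U_kinv_def by (rule lin_ext_mult_complex) (simp add: plus_fword_def)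

lemma U_kinv_mon: "U_kinv q (mon w) = prod_list (map (kinv_gen q) (letters w))"
  by (simp add: U_kinv_def lin_ext_mon[OF vs_complex])

lemma U_kinv_one: "U_kinv q 1 = 1" using U_kinv_mon[of "FWord []"] by (simp add: mon_Nil)

lemma U_kinv_rec: "U_kinv q (U i j * x) = ki i j * U_kinv q x"
  by (simp add: U_kinv_mult) (simp add: U_def U_kinv_mon ki_def lfun_simps[OF lfun_UeUf(3)])

lemma U_kinv_uw: "length I = length J \<Longrightarrow> U_kinv q (uw I J) = (if I = J then qc q powi (- wt I) else 0)"
  by (induction I J rule: list_induct2)
    (auto simp: U_kinv_rec U_kinv_one ki_def power_int_add power_int_diff power_int_minus divide_simps)

lemma U_kinv_Kc: "U_kinv q = Kc (\<lambda>w. qc q powi (- w))"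
  by (rule lfun_eqI) (simp_all add: U_kinv_uw Kc_uw)

lemma Kf_uw: "length I = length J \<Longrightarrow> Kf (uw I J) = (if I = J then qc q powi (wt I) else 0)"
  by (simp add: Kf_def Kc_uw)

lemma Kf_one: "Kf 1 = 1" using Kf_uw[of "[]" "[]"] by simp

lemma Kf_uw_rec: "length I = length J \<Longrightarrow> Kf (uw (i # I) (j # J)) = kk i j * Kf (uw I J)"
  unfolding Kf_def by (subst Kc_uw, simp, subst Kc_uw, simp) (auto simp: kk_def power_int_add power_int_diff divide_simps)

lemma rec_ext:
  assumes "lfun g" "lfun h" "\<And>I J. length I = length J \<Longrightarrow> g (x * uw I J) = h (uw I J)"
  shows "g (x * y) = h y"
  by (induction y rule: falg_induct) (simp_all add: assms(3) distrib_left lfun_simps[OF assms(1)] lfun_simps[OF assms(2)])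

lemma Kf_rec: "Kf (U i j * y) = kk i j * Kf y"
  by (rule rec_ext[OF lfun_UeUf(4), where h = "\<lambda>y. kk i j * Kf y"])
    (use Kf_uw_rec in \<open>auto simp: lfun_def distrib_left lfun_simps[OF lfun_UeUf(4)]\<close>)

lemma eps_rec: "eps (U i j * y) = idm i j * eps y" by (simp add: eps_mult eps_U idm_def)

lemma U_e_gelt: "U_e q (gelt g * y) = e_gen q g * eps y + k_gen q g * U_e q y"
proof (induction y rule: pm_induct)
  case (mon w)
  obtain l where w: "w = FWord l" by (cases w)
  show ?case unfolding w mon_Cons[symmetric]
    by (simp add: U_e_def eps_def lin_ext_mon[OF vs_complex])
qed (simp_all add: distrib_left lfun_simps[OF lfun_UeUf(1)] lfun_simps[OF lfun_eps])

lemma U_f_gelt: "U_f q (gelt g * y) = eps_gen g * U_f q y + f_gen q g * U_kinv q y"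
proof (induction y rule: pm_induct)
  case (mon w)
  obtain l where w: "w = FWord l" by (cases w)
  show ?case unfolding w mon_Cons[symmetric]
    by (simp add: U_f_def U_kinv_def lin_ext_mon[OF vs_complex])
qed (simp_all add: distrib_left lfun_simps[OF lfun_UeUf(2)] lfun_simps[OF lfun_UeUf(3)])

lemma U_e_rec: "U_e q (U i j * y) = ee i j * eps y + kk i j * U_e q y"
  by (simp add: U_def U_e_gelt ee_def kk_def lfun_simps[OF lfun_UeUf(1)]) (metis sqrt_q times_divide_eq_left)

lemma U_f_rec: "U_f q (U i j * y) = idm i j * U_f q y + ff i j * U_kinv q y"
  by (simp add: U_def U_f_gelt ff_def idm_def lfun_simps[OF lfun_UeUf(2)])

lemma U_e_one: "U_e q 1 = 0"
proof -
  have "U_e q (mon (FWord [])) = 0" by (simp only: U_e_def lin_ext_mon[OF vs_complex] fword.sel e_word.simps)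
  then show ?thesis by (simp add: mon_Nil)
qed

lemma U_f_one: "U_f q 1 = 0"
proof -
  have "U_f q (mon (FWord [])) = 0" by (simp only: U_f_def lin_ext_mon[OF vs_complex] fword.sel f_word.simps)
  then show ?thesis by (simp add: mon_Nil)
qed

lemma U_kinv_Udual [simp]: "U_kinv q \<in> Udual q" by (simp add: U_kinv_Kc)
lemma Kf_Udual [simp]: "Kf \<in> Udual q" by (simp add: Kf_def)

lemma sqrt_q_nz [simp]: "qc (sqrt q) \<noteq> 0" using q_pos by simp

lemma sqrt_q_sq: "qc (sqrt q) * qc (sqrt q) = qc q" using q_pos by (simp flip: of_real_mult)

text \<open>The coproduct e \<otimes> 1 + k \<otimes> e makes the family {e, 1} closed under removal
  of the first letter, as \<open>Udual_family\<close> requires; for f below the family is {f,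
  k^-1}.\<close>

lemma U_e_Udual [simp]: "U_e q \<in> Udual q"
proof -
  let ?h = "\<lambda>b. if b then U_e q else eps"
  have "?h True \<in> Udual q"
  proof (rule Udual_family[where h = ?h and Y = "\<lambda>_. UNIV" and x = True
        and c = "\<lambda>x y i j. if x then if y then kk i j else ee i j else if y then 0 else idm i j"])
    fix x :: bool and i j and I J :: "bool list"
    show "(\<Sum>k\<in>UNIV. \<Sum>l\<in>UNIV. eE k l * ?h x (uw (i # j # I) (k # l # J))) = eE i j * ?h x (uw I J)"
      by (cases x; cases i; cases j) (simp_all add: sum_bool eE_def U_e_rec eps_rec ee_def kk_def idm_def algebra_simps)
    show "(\<Sum>k\<in>UNIV. \<Sum>l\<in>UNIV. eE k l * ?h x (uw (k # l # I) (i # j # J))) = eE i j * ?h x (uw I J)"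
      by (cases x; cases i; cases j) (simp_all add: sum_bool eE_def U_e_rec eps_rec ee_def kk_def idm_def algebra_simps)
  qed (auto simp: lfun_eps U_e_rec eps_rec sum_bool)
  then show ?thesis by simp
qed

lemma U_f_Udual [simp]: "U_f q \<in> Udual q"
proof -
  let ?h = "\<lambda>b. if b then U_f q else U_kinv q"
  have "?h True \<in> Udual q"
  proof (rule Udual_family[where h = ?h and Y = "\<lambda>_. UNIV" and x = True
        and c = "\<lambda>x y i j. if x then if y then idm i j else ff i j else if y then 0 else ki i j"])
    fix x :: bool and i j and I J :: "bool list"
    show "(\<Sum>k\<in>UNIV. \<Sum>l\<in>UNIV. eE k l * ?h x (uw (i # j # I) (k # l # J))) = eE i j * ?h x (uw I J)"
      by (cases x; cases i; cases j) (simp_all add: sum_bool eE_def U_f_rec U_kinv_rec ff_def ki_def idm_def algebra_simps)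
    show "(\<Sum>k\<in>UNIV. \<Sum>l\<in>UNIV. eE k l * ?h x (uw (k # l # I) (i # j # J))) = eE i j * ?h x (uw I J)"
      by (cases x; cases i; cases j) (simp_all add: sum_bool eE_def U_f_rec U_kinv_rec ff_def ki_def idm_def algebra_simps)
  qed (auto simp: U_f_rec U_kinv_rec sum_bool)
  then show ?thesis by simp
qed

text \<open>First-letter recursion for a convolution product whose factors have two-term coproducts
  \<open>g1\<close> \<otimes> \<open>gA\<close> + \<open>g2\<close> \<otimes> \<open>gB\<close> and
  \<open>h1\<close> \<otimes> \<open>hA\<close> + \<open>h2\<close> \<otimes> \<open>hB\<close>; the
  left legs enter through their spin 1/2 matrices.\<close>

lemma conv_rec2:
  assumes l: "lfun g" "lfun gA" "lfun gB" "lfun h" "lfun hA" "lfun hB"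
    and g: "\<And>i j z. g (U i j * z) = g1 i j * gA z + g2 i j * gB z"
    and h: "\<And>i j z. h (U i j * z) = h1 i j * hA z + h2 i j * hB z"
  shows "conv q g h (U i j * z) =
    (\<Sum>k\<in>UNIV. g1 i k * h1 k j) * conv q gA hA z + (\<Sum>k\<in>UNIV. g1 i k * h2 k j) * conv q gA hB z +
    (\<Sum>k\<in>UNIV. g2 i k * h1 k j) * conv q gB hA z + (\<Sum>k\<in>UNIV. g2 i k * h2 k j) * conv q gB hB z"
proof (induction z rule: falg_induct)
  case (uw I J)
  have "conv q g h (uw (i # I) (j # J)) = (\<Sum>k\<in>UNIV. \<Sum>K\<in>bl (length I). g (uw (i # I) (k # K)) * h (uw (k # K) (j # J)))"
    using uw l by (subst conv_uw) (simp_all add: sum_bl_Suc)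
  then show ?case using uw l
    by (simp add: g h conv_uw sum_bool sum.distrib sum_distrib_left sum_distrib_right algebra_simps)
qed (simp_all add: distrib_left lfun_simps[OF lfun_conv] algebra_simps)

lemma U_e_support: "length I = length J \<Longrightarrow> U_e q (uw I J) \<noteq> 0 \<Longrightarrow> nT J = Suc (nT I)"
  by (induction I J rule: list_induct2)
    (auto simp: U_e_one U_e_rec ee_def kk_def eps_uw split: if_splits)

lemma U_f_support: "length I = length J \<Longrightarrow> U_f q (uw I J) \<noteq> 0 \<Longrightarrow> nT I = Suc (nT J)"
  by (induction I J rule: list_induct2)
    (auto simp: U_f_one U_f_rec ff_def idm_def U_kinv_uw split: if_splits)

text \<open>e raises the weight by 2: the relation ke = q^2 ek, for arbitrary functions of the
  weight.\<close>

lemma Kc_U_e: "conv q (Kc \<phi>) (U_e q) = conv q (U_e q) (Kc (\<lambda>w. \<phi> (w + 2)))"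
proof (rule lfun_eqI[OF lfun_conv lfun_conv])
  fix I J :: "bool list" assume l: "length I = length J"
  show "conv q (Kc \<phi>) (U_e q) (uw I J) = conv q (U_e q) (Kc (\<lambda>w. \<phi> (w + 2))) (uw I J)"
  proof (cases "U_e q (uw I J) = 0")
    case False
    then have "wt J + 2 = wt I" using U_e_support[OF l] l by (simp add: wt_nT)
    then show ?thesis using l by (simp add: conv_Kc_left conv_Kc_right)
  qed (use l in \<open>simp add: conv_Kc_left conv_Kc_right\<close>)
qed

lemma Kc_U_f: "conv q (Kc \<phi>) (U_f q) = conv q (U_f q) (Kc (\<lambda>w. \<phi> (w - 2)))"
proof (rule lfun_eqI[OF lfun_conv lfun_conv])
  fix I J :: "bool list" assume l: "length I = length J"
  show "conv q (Kc \<phi>) (U_f q) (uw I J) = conv q (U_f q) (Kc (\<lambda>w. \<phi> (w - 2))) (uw I J)"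
  proof (cases "U_f q (uw I J) = 0")
    case False
    then have "wt J - 2 = wt I" using U_f_support[OF l] l by (simp add: wt_nT)
    then show ?thesis using l by (simp add: conv_Kc_left conv_Kc_right)
  qed (use l in \<open>simp add: conv_Kc_left conv_Kc_right\<close>)
qed

definition qint :: "int \<Rightarrow> complex" where "qint w = (qc q powi w - qc q powi (- w)) / (qc q - 1 / qc q)"

lemma Kc_qint: "Kc qint x = (Kf x - U_kinv q x) / (qc q - 1 / qc q)"
proof -
  have "Kc (\<lambda>w. \<Sum>i\<in>UNIV. (if i then - 1 / (qc q - 1 / qc q) else 1 / (qc q - 1 / qc q)) * (if i then qc q powi (- w) else qc q powi w)) x
      = (\<Sum>i\<in>UNIV. (if i then - 1 / (qc q - 1 / qc q) else 1 / (qc q - 1 / qc q)) * Kc (\<lambda>w. if i then qc q powi (- w) else qc q powi w) x)"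
    by (rule Kc_sum)
  moreover have "(\<lambda>w. \<Sum>i\<in>UNIV. (if i then - 1 / (qc q - 1 / qc q) else 1 / (qc q - 1 / qc q)) * (if i then qc q powi (- w) else qc q powi w)) = qint"
    by (rule ext) (simp add: sum_bool qint_def diff_divide_distrib)
  ultimately show ?thesis by (simp add: sum_bool Kf_def U_kinv_Kc diff_divide_distrib)
qed

lemma q_diff_nz [simp]: "qc q - 1 / qc q \<noteq> 0"
proof -
  have "q * q < 1" using mult_strict_mono[of q 1 q 1] q_pos q_lt by simp
  then have "q < 1 / q" using q_pos by (simp add: pos_less_divide_eq)
  then have "q - 1 / q \<noteq> 0" by simp
  then show ?thesis by (metis of_real_1 of_real_diff of_real_divide of_real_eq_0_iff)
qed

lemma q_neq_inv [simp]: "qc q \<noteq> 1 / qc q"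
  using q_diff_nz by (metis right_minus_eq)

text \<open>The commutator of e and f is not built into \<open>U_e\<close> and \<open>U_f\<close>;
  it is checked on words by removing the first letter, a recursion that also produces the mixed
  products e k^-1 and k^-1 e.\<close>

lemma E_F_comm: "conv q (U_e q) (U_f q) x = conv q (U_f q) (U_e q) x + Kc qint x"
proof -
  note l = lfun_UeUf lfun_eps
  \<comment> \<open>Reorders the mixed products in \<open>ef\<close> and \<open>fe\<close>; the
    entry below the diagonal is the one that needs it.\<close>
  have 1: "conv q (U_e q) (U_kinv q) y = (qc q)\<^sup>2 * conv q (U_kinv q) (U_e q) y" for y
  proof -
    have "conv q (U_kinv q) (U_e q) = conv q (U_e q) (Kc (\<lambda>w. qc q powi (- (w + 2))))"
      unfolding U_kinv_Kc by (rule Kc_U_e)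
    moreover have "conv q (U_e q) (U_kinv q) y = (qc q)\<^sup>2 * conv q (U_e q) (Kc (\<lambda>w. qc q powi (- (w + 2)))) y"
    proof (induction y rule: falg_induct)
      case (uw I J)
      then show ?case by (simp add: U_kinv_Kc conv_Kc_right power_int_diff power_int_minus power2_eq_square field_simps)
    qed (simp_all add: lfun_simps[OF lfun_conv] algebra_simps)
    ultimately show ?thesis by simp
  qed
  have ef: "conv q (U_e q) (U_f q) (U i j * z) = (\<Sum>k\<in>UNIV. ee i k * idm k j) * U_f q z + (\<Sum>k\<in>UNIV. ee i k * ff k j) * U_kinv q z
    + (\<Sum>k\<in>UNIV. kk i k * idm k j) * conv q (U_e q) (U_f q) z + (\<Sum>k\<in>UNIV. kk i k * ff k j) * conv q (U_e q) (U_kinv q) z" for i j z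
    using conv_rec2[OF l(1,5,1,2,2,3) U_e_rec U_f_rec, of i j z] by (simp add: conv_eps_left)
  have fe: "conv q (U_f q) (U_e q) (U i j * z) = (\<Sum>k\<in>UNIV. idm i k * ee k j) * U_f q z + (\<Sum>k\<in>UNIV. idm i k * kk k j) * conv q (U_f q) (U_e q) z
    + (\<Sum>k\<in>UNIV. ff i k * ee k j) * U_kinv q z + (\<Sum>k\<in>UNIV. ff i k * kk k j) * conv q (U_kinv q) (U_e q) z" for i j z
    using conv_rec2[OF l(2,2,3,1,5,1) U_f_rec U_e_rec, of i j z] by (simp add: conv_eps_right)
  have "conv q (U_e q) (U_f q) (uw I J) = conv q (U_f q) (U_e q) (uw I J) + Kc qint (uw I J)"
    if "length I = length J" for I J
    using that
  proof (induction I J rule: list_induct2)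
    case Nil
    have "conv q (U_e q) (U_f q) (uw [] []) = 0" "conv q (U_f q) (U_e q) (uw [] []) = 0"
      by (subst conv_uw; simp add: U_e_one U_f_one)+
    then show ?case by (simp add: Kc_qint Kf_one U_kinv_one)
  next
    case (Cons i I j J)
    have s: "ee False True * ff True False = 1" "ff True False * ee False True = 1" by (simp_all add: ee_def ff_def)
    \<comment> \<open>Since c (q - 1/q) = 1, the identity \<open>cq\<close> absorbs the stray k^-1
      term of the diagonal entries into c (k - k^-1).\<close>
    define c where "c = 1 / (qc q - 1 / qc q)"
    have cq: "1 - c * qc q + c / qc q = 0"
    proof -
      have "c * (qc q - 1 / qc q) = 1" by (simp add: c_def)
      then have "c * qc q - c / qc q = 1" by (simp add: right_diff_distrib)
      then have "c * qc q = 1 + c / qc q" by (simp only: diff_eq_eq)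
      then show ?thesis by simp
    qed
    have K: "Kc qint x = c * (Kf x - U_kinv q x)" for x by (simp add: Kc_qint c_def)
    have 2: "1 / qc q * (v + c * (k - l)) = 1 / qc q * v + l + c * (1 / qc q * k - qc q * l)" for v k l
    proof -
      have "1 / qc q * v + l + c * (1 / qc q * k - qc q * l)
          = 1 / qc q * (v + c * (k - l)) + l * (1 - c * qc q + c / qc q)" by (simp add: algebra_simps)
      then show ?thesis by (simp add: cq)
    qed
    have 3: "l + qc q * (v + c * (k - l)) = qc q * v + c * (qc q * k - 1 / qc q * l)" for v k l
    proof -
      have "l + qc q * (v + c * (k - l))
          = qc q * v + c * (qc q * k - 1 / qc q * l) + l * (1 - c * qc q + c / qc q)" by (simp add: algebra_simps)
      then show ?thesis by (simp add: cq)
    qed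
    let ?z = "uw I J"
    have TT: "conv q (U_e q) (U_f q) (U True True * ?z) = 1 / qc q * conv q (U_e q) (U_f q) ?z"
      "conv q (U_f q) (U_e q) (U True True * ?z) = 1 / qc q * conv q (U_f q) (U_e q) ?z + U_kinv q ?z"
      unfolding ef fe by (simp_all add: sum_bool ee_def ff_def kk_def idm_def)
    have FF: "conv q (U_e q) (U_f q) (U False False * ?z) = U_kinv q ?z + qc q * conv q (U_e q) (U_f q) ?z"
      "conv q (U_f q) (U_e q) (U False False * ?z) = qc q * conv q (U_f q) (U_e q) ?z"
      unfolding ef fe by (simp_all add: sum_bool ee_def ff_def kk_def idm_def)
    have FT: "conv q (U_e q) (U_f q) (U False True * ?z) = conv q (U_f q) (U_e q) (U False True * ?z)"
      unfolding ef fe by (simp add: sum_bool ee_def ff_def kk_def idm_def)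
    have TF: "conv q (U_e q) (U_f q) (U True False * ?z) = conv q (U_f q) (U_e q) (U True False * ?z)"
      unfolding ef fe by (simp add: 1 sum_bool ee_def ff_def kk_def idm_def power2_eq_square)
    have 4: "conv q (U_e q) (U_f q) (U i j * ?z) = conv q (U_f q) (U_e q) (U i j * ?z) + c * (kk i j * Kf ?z - ki i j * U_kinv q ?z)"
    proof (cases i; cases j)
      assume "i" "j"
      then show ?thesis
        using 2[of "conv q (U_f q) (U_e q) ?z" "Kf ?z" "U_kinv q ?z"]
        by (simp only: TT Cons.IH K kk_def ki_def if_True simp_thms)
    next
      assume "\<not> i" "\<not> j"
      then show ?thesis
        using 3[of "U_kinv q ?z" "conv q (U_f q) (U_e q) ?z" "Kf ?z"]
        by (simp only: FF Cons.IH K kk_def ki_def if_True if_False simp_thms)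
    qed (simp_all add: FT TF kk_def ki_def)
    show ?case
      using 4 by (simp add: K Kf_rec U_kinv_rec)
  qed
  then show ?thesis
    by (induction x rule: falg_induct) (simp_all add: lfun_simps[OF lfun_conv] lfun_simps[OF lfun_Kc] algebra_simps)
qed

text \<open>The relation e^* = f k read entry by entry, since these matrices are real.\<close>

lemma U_e_transpose: "length I = length J \<Longrightarrow> U_e q (uw J I) = U_f q (uw I J) * qc q powi (wt J)"
proof (induction I J rule: list_induct2)
  case (Cons i I j J)
  have a: "qc q powi (1 + wt J) = qc q * qc q powi wt J" "qc q powi (wt J - 1) = qc q powi wt J / qc q"
    by (simp_all add: power_int_add power_int_diff)
  have m: "qc q powi (- wt K) * (qc q * qc q powi wt K) = qc q" "qc q powi (- wt K) * qc q powi wt K = 1" for K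
    by (simp_all add: power_int_minus)
  have "U_e q (uw (j # J) (i # I)) = ee j i * (if J = I then 1 else 0) + kk j i * (U_f q (uw I J) * qc q powi wt J)"
    using Cons by (simp add: U_e_rec eps_uw)
  also have "\<dots> = (idm i j * U_f q (uw I J) + ff i j * (if I = J then qc q powi (- wt J) else 0)) * qc q powi (wt (j # J))"
    using sqrt_q by (cases i; cases j) (auto simp: ee_def ff_def kk_def idm_def a m)
  also have "\<dots> = U_f q (uw (i # I) (j # J)) * qc q powi (wt (j # J))"
    using Cons by (simp add: U_f_rec U_kinv_uw)
  finally show ?case .
qed (simp add: U_e_one U_f_one)

lemma cnj_U_f: "length I = length J \<Longrightarrow> cnj (U_f q (uw I J)) = U_f q (uw I J)"
  by (induction I J rule: list_induct2) (simp_all add: U_f_one U_f_rec ff_def idm_def U_kinv_uw)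

lemma dstar_U_f: "dstar q (U_f q) = conv q (U_kinv q) (U_e q)"
proof (rule lfun_eqI[OF lfun_dstar lfun_conv])
  fix I J :: "bool list" assume l: "length I = length J"
  show "dstar q (U_f q) (uw I J) = conv q (U_kinv q) (U_e q) (uw I J)"
    using l U_e_transpose[of J I] unfolding U_kinv_Kc
    by (simp add: dstar_uw cnj_U_f conv_Kc_left power_int_minus field_simps)
qed simp

lemma lfun_conv_pow [simp]: assumes "lfun h" shows "lfun (conv_pow q h m)"
  by (cases m) (simp_all add: lfun_eps lfun_conv)

lemma conv_pow_Suc_right: assumes "lfun h" shows "conv_pow q h (Suc m) = conv q (conv_pow q h m) h"
proof (induction m)
  case 0 then show ?case by (simp add: conv_eps_left conv_eps_right assms)
next
  case (Suc m)
  have "conv_pow q h (Suc (Suc m)) = conv q h (conv q (conv_pow q h m) h)" using Suc by simp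
  also have "\<dots> = conv q (conv_pow q h (Suc m)) h" by (simp add: conv_assoc assms)
  finally show ?case .
qed

lemma Udual_conv_pow [simp]: assumes "h \<in> Udual q" shows "conv_pow q h m \<in> Udual q"
  by (induction m) (simp_all add: Udual_eps Udual_conv assms)

end

text \<open>Nonnegative reals among the complex numbers. The matrices of e and f on index words have
  such entries, so in their powers no cancellation can occur and one nonzero term suffices.\<close>

definition nnr :: "complex set" where "nnr = {z. 0 \<le> Re z \<and> Im z = 0}"

lemma sum_nnr_pos:
  fixes f :: "'x \<Rightarrow> complex"
  assumes "finite S" "\<And>x. x \<in> S \<Longrightarrow> f x \<in> nnr" "y \<in> S" "f y \<noteq> 0"
  shows "sum f S \<in> nnr \<and> sum f S \<noteq> 0"
proof -
  have *: "0 \<le> Re (f x)" "Im (f x) = 0" if "x \<in> S" for x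
    using assms(2)[OF that] by (auto simp: nnr_def)
  have "Re (f y) \<noteq> 0" using *[OF assms(3)] assms(4) by (simp add: complex_eq_iff)
  then have "0 < Re (f y)" using *(1)[OF assms(3)] by simp
  also have "Re (f y) \<le> (\<Sum>x\<in>S. Re (f x))"
    by (rule member_le_sum) (use assms * in auto)
  finally have 1: "0 < Re (sum f S)" by simp
  moreover have "Im (sum f S) = 0" using * by simp
  moreover have "sum f S \<noteq> 0" using 1 by (metis less_irrefl zero_complex.simps(1))
  moreover have "0 \<le> Re (sum f S)" using 1 by (rule less_imp_le)
  ultimately show ?thesis unfolding nnr_def mem_Collect_eq by blast
qed

section \<open>Separation of points by \<open>U\<^sub>q(su(2))\<close>\<close>

lemma nnr_simps: "0 \<in> nnr" "1 \<in> nnr" "x \<in> nnr \<Longrightarrow> y \<in> nnr \<Longrightarrow> x + y \<in> nnr"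
  "x \<in> nnr \<Longrightarrow> y \<in> nnr \<Longrightarrow> x * y \<in> nnr" "0 \<le> r \<Longrightarrow> complex_of_real r \<in> nnr"
  by (simp_all add: nnr_def)

lemma sum_nzE: "sum f S \<noteq> 0 \<Longrightarrow> \<exists>x\<in>S. f x \<noteq> 0"
  by (meson sum.neutral)

context sq
begin

definition delta :: "int \<Rightarrow> int \<Rightarrow> complex" where "delta w v = (if v = w then 1 else 0)"

text \<open>The operator f^A e^B P_w with P_w the projection onto weight w: test functionals adapted
  to the PBW monomials below.\<close>

definition tf :: "nat \<Rightarrow> nat \<Rightarrow> int \<Rightarrow> falg \<Rightarrow> complex"
  where "tf A B w = conv q (conv_pow q (U_f q) A) (conv q (conv_pow q (U_e q) B) (Kc (delta w)))"

lemma tf_Udual: "tf A B w \<in> Udual q" by (simp add: tf_def Udual_conv)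

lemma kk_nnr: "kk i j \<in> nnr" "ee i j \<in> nnr" "ff i j \<in> nnr" "idm i j \<in> nnr" "ki i j \<in> nnr"
  using q_pos by (auto simp: kk_def ee_def ff_def idm_def ki_def nnr_def)

lemma eps_nnr: "length I = length J \<Longrightarrow> eps (uw I J) \<in> nnr" by (simp add: eps_uw nnr_def)

lemma U_kinv_nnr: "length I = length J \<Longrightarrow> U_kinv q (uw I J) \<in> nnr"
  by (induction I J rule: list_induct2) (simp_all add: U_kinv_one U_kinv_rec nnr_simps kk_nnr)

lemma U_e_nnr: "length I = length J \<Longrightarrow> U_e q (uw I J) \<in> nnr"
  by (induction I J rule: list_induct2) (simp_all add: U_e_one U_e_rec nnr_simps kk_nnr eps_nnr)

lemma U_f_nnr: "length I = length J \<Longrightarrow> U_f q (uw I J) \<in> nnr"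
  by (induction I J rule: list_induct2) (simp_all add: U_f_one U_f_rec nnr_simps kk_nnr U_kinv_nnr)

lemma U_e_witness: "0 < nT J \<Longrightarrow> \<exists>K. length K = length J \<and> Suc (nT K) = nT J \<and> U_e q (uw K J) \<noteq> 0"
proof (induction J)
  case (Cons j J)
  show ?case
  proof (cases j)
    case True
    then show ?thesis
      by (intro exI[of _ "False # J"]) (simp add: U_e_rec ee_def kk_def eps_uw)
  next
    case False
    then obtain K where K: "length K = length J" "Suc (nT K) = nT J" "U_e q (uw K J) \<noteq> 0" using Cons by auto
    then show ?thesis using False by (intro exI[of _ "False # K"]) (simp add: U_e_rec ee_def kk_def)
  qed
qed simp

lemma U_f_witness: "0 < nT I \<Longrightarrow> \<exists>K. length K = length I \<and> Suc (nT K) = nT I \<and> U_f q (uw I K) \<noteq> 0"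
proof (induction I)
  case (Cons i I)
  show ?case
  proof (cases i)
    case True
    then show ?thesis
      by (intro exI[of _ "False # I"]) (simp add: U_f_rec ff_def idm_def U_kinv_uw)
  next
    case False
    then obtain K where K: "length K = length I" "Suc (nT K) = nT I" "U_f q (uw I K) \<noteq> 0" using Cons by auto
    then show ?thesis using False by (intro exI[of _ "False # K"]) (simp add: U_f_rec ff_def idm_def)
  qed
qed simp

lemma U_e_pow_support: "length I = length J \<Longrightarrow> conv_pow q (U_e q) B (uw I J) \<noteq> 0 \<Longrightarrow> nT J = nT I + B"
proof (induction B arbitrary: I)
  case 0 then show ?case by (simp add: eps_uw split: if_splits)
next
  case (Suc B)
  then have "(\<Sum>K\<in>bl (length I). U_e q (uw I K) * conv_pow q (U_e q) B (uw K J)) \<noteq> 0"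
    by (simp add: conv_uw)
  then obtain K where "length K = length I" "U_e q (uw I K) * conv_pow q (U_e q) B (uw K J) \<noteq> 0"
    using sum_nzE by fastforce
  then show ?case using Suc.IH[of K] U_e_support[of I K] Suc.prems(1) by auto
qed

lemma U_f_pow_support: "length I = length J \<Longrightarrow> conv_pow q (U_f q) B (uw I J) \<noteq> 0 \<Longrightarrow> nT I = nT J + B"
proof (induction B arbitrary: I)
  case 0 then show ?case by (simp add: eps_uw split: if_splits)
next
  case (Suc B)
  then have "(\<Sum>K\<in>bl (length I). U_f q (uw I K) * conv_pow q (U_f q) B (uw K J)) \<noteq> 0"
    by (simp add: conv_uw)
  then obtain K where "length K = length I" "U_f q (uw I K) * conv_pow q (U_f q) B (uw K J) \<noteq> 0"
    using sum_nzE by fastforce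
  then show ?case using Suc.IH[of K] U_f_support[of I K] Suc.prems(1) by auto
qed

text \<open>e^B carries an index word with B letters \<open>True\<close> to the
  all-\<open>False\<close> word of highest weight; the expansion has nonnegative terms and
  \<open>U_e_witness\<close> supplies a nonzero one.\<close>

lemma U_e_pow_nz: "nT J = B \<Longrightarrow>
    conv_pow q (U_e q) B (uw (replicate (length J) False) J) \<in> nnr \<and>
    conv_pow q (U_e q) B (uw (replicate (length J) False) J) \<noteq> 0"
proof (induction B arbitrary: J)
  case 0
  then have J: "J = replicate (length J) False" by (simp add: nT_zero)
  then have "eps (uw (replicate (length J) False) J) = 1" by (simp add: eps_uw)
  then show ?case by (simp add: nnr_def)
next
  case (Suc B)
  let ?F = "replicate (length J) False"
  obtain K where K: "length K = length J" "Suc (nT K) = nT J" "U_e q (uw K J) \<noteq> 0"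
    using U_e_witness[of J] Suc.prems by auto
  have *: "conv_pow q (U_e q) B (uw ?F L) * U_e q (uw L J) \<in> nnr" if "L \<in> bl (length J)" for L
  proof (cases "U_e q (uw L J) = 0")
    case False
    then have "nT L = B" using U_e_support[of L J] that Suc.prems by simp
    then show ?thesis using Suc.IH[of L] that U_e_nnr[of L J] by (simp add: nnr_simps)
  qed (simp add: nnr_simps)
  have "nT K = B" using K Suc.prems by simp
  then have nz: "conv_pow q (U_e q) B (uw ?F K) * U_e q (uw K J) \<noteq> 0" using K Suc.IH[of K] by simp
  have "conv_pow q (U_e q) (Suc B) (uw ?F J) = (\<Sum>L\<in>bl (length J). conv_pow q (U_e q) B (uw ?F L) * U_e q (uw L J))"
    by (subst conv_pow_Suc_right) (simp_all add: conv_uw)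
  then show ?case using sum_nnr_pos[OF finite_bl *, where y = K] nz K by simp
qed

lemma U_f_pow_nz: "nT I = B \<Longrightarrow>
    conv_pow q (U_f q) B (uw I (replicate (length I) False)) \<in> nnr \<and>
    conv_pow q (U_f q) B (uw I (replicate (length I) False)) \<noteq> 0"
proof (induction B arbitrary: I)
  case 0
  then have J: "I = replicate (length I) False" by (simp add: nT_zero)
  then have "eps (uw I (replicate (length I) False)) = 1" by (simp add: eps_uw)
  then show ?case by (simp add: nnr_def)
next
  case (Suc B)
  let ?F = "replicate (length I) False"
  obtain K where K: "length K = length I" "Suc (nT K) = nT I" "U_f q (uw I K) \<noteq> 0"
    using U_f_witness[of I] Suc.prems by auto
  have *: "U_f q (uw I L) * conv_pow q (U_f q) B (uw L ?F) \<in> nnr" if "L \<in> bl (length I)" for L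
  proof (cases "U_f q (uw I L) = 0")
    case False
    then have "nT L = B" using U_f_support[of I L] that Suc.prems by simp
    then show ?thesis using Suc.IH[of L] that U_f_nnr[of I L] by (simp add: nnr_simps)
  qed (simp add: nnr_simps)
  have "nT K = B" using K Suc.prems by simp
  then have nz: "U_f q (uw I K) * conv_pow q (U_f q) B (uw K ?F) \<noteq> 0" using K Suc.IH[of K] by simp
  have "conv_pow q (U_f q) (Suc B) (uw I ?F) = (\<Sum>L\<in>bl (length I). U_f q (uw I L) * conv_pow q (U_f q) B (uw L ?F))"
    by (simp add: conv_uw)
  then show ?case using sum_nnr_pos[OF finite_bl *, where y = K] nz K by simp
qed

lemma tf_uw: "length I = length J \<Longrightarrow> tf A B w (uw I J) =
    (\<Sum>K\<in>bl (length I). conv_pow q (U_f q) A (uw I K) * (conv_pow q (U_e q) B (uw K J) * delta w (wt J)))"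
  unfolding tf_def by (subst conv_uw) (simp_all add: lfun_conv conv_Kc_right)

text \<open>Counting letters: e^B removes B letters \<open>True\<close> from the column word and f^A
  restores A of them.\<close>

lemma tf_support:
  assumes "length I = length J" "tf A B w (uw I J) \<noteq> 0"
  shows "wt J = w \<and> B \<le> nT J \<and> nT I + B = nT J + A"
proof -
  obtain K where K: "length K = length I"
    "conv_pow q (U_f q) A (uw I K) * (conv_pow q (U_e q) B (uw K J) * delta w (wt J)) \<noteq> 0"
    using assms sum_nzE by (fastforce simp: tf_uw)
  then show ?thesis
    using U_f_pow_support[of I K A] U_e_pow_support[of K J B] assms(1)
    by (auto simp: delta_def split: if_splits)
qed

text \<open>When A and B are the numbers of \<open>True\<close> in the two index words, the only
  intermediate word is the all-\<open>False\<close> one, so the value is a product of two nonzero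
  entries.\<close>

lemma tf_nz:
  assumes l: "length I = length J"
  shows "tf (nT I) (nT J) (wt J) (uw I J) \<noteq> 0"
proof -
  let ?F = "replicate (length I) False"
  let ?f = "\<lambda>K. conv_pow q (U_f q) (nT I) (uw I K) * (conv_pow q (U_e q) (nT J) (uw K J) * delta (wt J) (wt J))"
  have "?f K = 0" if "K \<in> bl (length I)" "K \<noteq> ?F" for K
  proof (rule ccontr)
    assume "?f K \<noteq> 0"
    then have "nT K = 0" using U_e_pow_support[of K J "nT J"] that(1) l by auto
    then show False using that nT_zero[of K] by simp
  qed
  then have "(\<Sum>K\<in>bl (length I). ?f K) = (\<Sum>K\<in>{?F}. ?f K)"
    by (intro sum.mono_neutral_right) auto
  then show ?thesis using U_f_pow_nz[of I] U_e_pow_nz[of J] l by (simp add: tf_uw delta_def)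
qed

text \<open>A triple (n, a, b) stands for the PBW monomial of length n whose row and column words
  contain a and b letters \<open>True\<close>: powers of \<gamma>, \<gamma>* and \<alpha> if a + b
  \<le> n, powers of \<gamma>, \<gamma>* and \<alpha>* otherwise. This labelling is the one that
  \<open>tf_support\<close> can read off.\<close>

definition pwI :: "nat \<times> nat \<times> nat \<Rightarrow> bool list" where
  "pwI = (\<lambda>(n, a, b). if a + b \<le> n then replicate a True @ replicate b False @ replicate (n - a - b) False
     else replicate (n - b) True @ replicate (n - a) False @ replicate (a + b - n) True)"
definition pwJ :: "nat \<times> nat \<times> nat \<Rightarrow> bool list" where
  "pwJ = (\<lambda>(n, a, b). if a + b \<le> n then replicate a False @ replicate b True @ replicate (n - a - b) False
     else replicate (n - b) False @ replicate (n - a) True @ replicate (a + b - n) True)"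
definition ptr :: "(nat \<times> nat \<times> nat) set" where "ptr = {(n, a, b). a \<le> n \<and> b \<le> n}"
definition pw :: "nat \<times> nat \<times> nat \<Rightarrow> falg" where "pw t = uw (pwI t) (pwJ t)"

lemma pw_length: "t \<in> ptr \<Longrightarrow> length (pwI t) = fst t \<and> length (pwJ t) = fst t"
  by (auto simp: ptr_def pwI_def pwJ_def)

lemma pw_nT: "t \<in> ptr \<Longrightarrow> nT (pwI t) = fst (snd t) \<and> nT (pwJ t) = snd (snd t)"
  by (auto simp: ptr_def pwI_def pwJ_def)

lemma uw_replicate: "uw (replicate n i) (replicate n j) = U i j ^ n"
  by (induction n) simp_all

definition pm :: "nat \<Rightarrow> nat \<Rightarrow> nat \<Rightarrow> bool \<Rightarrow> falg"
  where "pm j k i s = ga ^ j * gas ^ k * (if s then als else al) ^ i"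

lemma gas_pow: "gas ^ k = scl ((- 1 / qc q) ^ k) (U False True ^ k)"
proof (induction k)
  case (Suc k)
  have "gas = scl (- 1 / qc q) (U False True)" by (simp add: U_def)
  then show ?case using Suc by (simp add: mult.commute)
qed simp

lemma pm_pw: "\<exists>c. \<exists>t\<in>ptr. pm j k i s = scl c (pw t)"
proof -
  define t where "t = (j + k + i, if s then (j + i, k + i) else (j, k))"
  have t: "t \<in> ptr" by (auto simp: t_def ptr_def)
  have "pw t = U True False ^ j * U False True ^ k * U s s ^ i"
    by (cases "i = 0") (auto simp: t_def pw_def pwI_def pwJ_def uw_append uw_replicate mult.assoc)
  then have "pm j k i s = scl ((- 1 / qc q) ^ k) (pw t)"
    by (cases s) (simp_all add: pm_def gas_pow, simp_all add: U_def)
  then show ?thesis using t by blast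
qed

section \<open>Spanning of the quotient by PBW monomials\<close>

lemma ga_gas: "gas * ga \<simeq> ga * gas" using r_Rel[of r3] by (simp add: eqv_def r3_def)
lemma al_ga: "al * ga \<simeq> scl (qc q) (ga * al)" using r_Rel[of r4] by (simp add: eqv_def r4_def)
lemma al_gas: "al * gas \<simeq> scl (qc q) (gas * al)" using r_Rel[of r5] by (simp add: eqv_def r5_def)
lemma als_ga: "als * ga \<simeq> scl (1 / qc q) (ga * als)"
proof -
  have "ga * als \<simeq> scl (qc q) (als * ga)"
    using r_Rel[of "star r5"] by (simp add: eqv_def r5_def star_diff star_lin star_mult star_gelt)
  from eqv_scl[OF eqv_sym[OF this], of "1 / qc q"] show ?thesis by simp
qed
lemma als_gas: "als * gas \<simeq> scl (1 / qc q) (gas * als)"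
proof -
  have "gas * als \<simeq> scl (qc q) (als * gas)"
    using r_Rel[of "star r4"] by (simp add: eqv_def r4_def star_diff star_lin star_mult star_gelt)
  from eqv_scl[OF eqv_sym[OF this], of "1 / qc q"] show ?thesis by simp
qed
lemma al_als: "al * als \<simeq> 1 - scl ((qc q)\<^sup>2) (ga * gas)"
  using r_Rel[of r2] by (simp add: eqv_def r2_def algebra_simps)
lemma als_al: "als * al \<simeq> 1 - ga * gas"
proof -
  have "als * al \<simeq> 1 - gas * ga" using r_Rel[of r1] by (simp add: eqv_def r1_def algebra_simps)
  also have "\<dots> \<simeq> 1 - ga * gas" by (rule eqv_diff[OF eqv_refl ga_gas])
  finally show ?thesis .
qed

lemma comm_pow: assumes "x * y \<simeq> scl c (y * x)" shows "x * y ^ n \<simeq> scl (c ^ n) (y ^ n * x)"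
proof (induction n)
  case (Suc n)
  have "x * y ^ Suc n = x * y * y ^ n" by (simp add: mult.assoc)
  also have "\<dots> \<simeq> scl c (y * x) * y ^ n" by (rule eqv_mult[OF assms eqv_refl])
  also have "\<dots> = scl c (y * (x * y ^ n))" by (simp add: mult.assoc)
  also have "\<dots> \<simeq> scl c (y * scl (c ^ n) (y ^ n * x))" by (intro eqv_scl eqv_mult eqv_refl Suc)
  also have "\<dots> = scl (c ^ Suc n) (y ^ Suc n * x)" by (simp add: mult.assoc)
  finally show ?case .
qed simp

definition PS :: "falg set" where "PS = fa.span (RelIdeal q \<union> pw ` ptr)"

lemma PS_add: "x \<in> PS \<Longrightarrow> y \<in> PS \<Longrightarrow> x + y \<in> PS" unfolding PS_def by (rule fa.span_add)
lemma PS_diff: "x \<in> PS \<Longrightarrow> y \<in> PS \<Longrightarrow> x - y \<in> PS" unfolding PS_def by (rule fa.span_diff)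
lemma PS_scl: "x \<in> PS \<Longrightarrow> scl c x \<in> PS" unfolding PS_def by (rule fa.span_scale)
lemma PS_Rel: "x \<in> RelIdeal q \<Longrightarrow> x \<in> PS" unfolding PS_def by (rule fa.span_base) simp
lemma PS_eqv: "x \<simeq> y \<Longrightarrow> y \<in> PS \<Longrightarrow> x \<in> PS" using PS_add[OF PS_Rel, of "x - y" y] by (simp add: eqv_def)
lemma PS_pm: "pm j k i s \<in> PS"
proof -
  obtain c t where "t \<in> ptr" "pm j k i s = scl c (pw t)" using pm_pw by metis
  then show ?thesis using PS_scl[of "pw t" c] fa.span_base[of "pw t" "RelIdeal q \<union> pw ` ptr"] by (simp add: PS_def)
qed

text \<open>Normal ordering: \<gamma> and \<gamma>* commute with every letter up to powers of q, and
  a product of \<alpha> with \<alpha>* in either order is a polynomial in \<gamma>\<gamma>*.\<close>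

lemma PS_mult_pm: "gelt g * pm j k i s \<in> PS"
proof (cases g)
  case Gen_c
  then show ?thesis using PS_pm[of "Suc j" k i s] by (simp add: pm_def mult.assoc)
next
  case Gen_c_st
  have "gas * ga ^ j \<simeq> ga ^ j * gas" using comm_pow[of gas ga 1 j] ga_gas by simp
  then have "gas * pm j k i s \<simeq> pm j (Suc k) i s"
    using eqv_mult[of "gas * ga ^ j" "ga ^ j * gas" "gas ^ k * (if s then als else al) ^ i"]
    by (simp add: pm_def mult.assoc)
  then show ?thesis using Gen_c_st PS_eqv[OF _ PS_pm] by simp
next
  \<comment> \<open>\<open>gm\<close> moves \<alpha> or \<alpha>* to the right of the powers of
    \<gamma> and \<gamma>*; \<open>red\<close> resolves its collision with the opposite
    letter.\<close>
  have gm: "x * pm j k i s \<simeq> scl (c ^ (j + k)) (ga ^ j * gas ^ k * (x * (if s then als else al) ^ i))"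
    if 1: "x * ga \<simeq> scl c (ga * x)" and 2: "x * gas \<simeq> scl c (gas * x)" for x c
  proof -
    have "x * pm j k i s = x * ga ^ j * (gas ^ k * (if s then als else al) ^ i)" by (simp add: pm_def mult.assoc)
    also have "\<dots> \<simeq> scl (c ^ j) (ga ^ j * x) * (gas ^ k * (if s then als else al) ^ i)"
      by (rule eqv_mult[OF comm_pow[OF 1] eqv_refl])
    also have "\<dots> = scl (c ^ j) (ga ^ j * (x * gas ^ k * (if s then als else al) ^ i))" by (simp add: mult.assoc)
    also have "\<dots> \<simeq> scl (c ^ j) (ga ^ j * (scl (c ^ k) (gas ^ k * x) * (if s then als else al) ^ i))"
      by (intro eqv_scl eqv_mult eqv_refl comm_pow[OF 2])
    also have "\<dots> = scl (c ^ (j + k)) (ga ^ j * gas ^ k * (x * (if s then als else al) ^ i))"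
      by (simp add: mult.assoc power_add)
    finally show ?thesis .
  qed
  have red: "ga ^ j * gas ^ k * (y * x) \<in> PS" if "y \<simeq> 1 - scl d (ga * gas)" "x = (if s then als else al) ^ i" for d x y i
  proof -
    have gg: "gas ^ k * ga \<simeq> ga * gas ^ k" using eqv_sym[OF comm_pow[of ga gas 1 k]] eqv_sym[OF ga_gas] by simp
    have "ga ^ j * gas ^ k * (ga * gas * x) = ga ^ j * ((gas ^ k * ga) * (gas * x))" by (simp add: mult.assoc)
    also have "\<dots> \<simeq> ga ^ j * ((ga * gas ^ k) * (gas * x))" by (intro eqv_mult eqv_refl gg)
    also have "\<dots> = pm (Suc j) (Suc k) i s" by (simp add: that(2) pm_def mult.assoc power_Suc2 del: power_Suc)
    finally have 1: "ga ^ j * gas ^ k * (ga * gas * x) \<in> PS" by (rule PS_eqv) (rule PS_pm)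
    have 2: "ga ^ j * gas ^ k * x \<in> PS" using PS_pm[of j k i s] by (simp add: pm_def that(2))
    have "ga ^ j * gas ^ k * (y * x) \<simeq> ga ^ j * gas ^ k * ((1 - scl d (ga * gas)) * x)"
      by (intro eqv_mult eqv_refl that(1))
    also have "\<dots> = ga ^ j * gas ^ k * x - scl d (ga ^ j * gas ^ k * (ga * gas * x))" by (simp add: left_diff_distrib right_diff_distrib)
    finally show ?thesis by (rule PS_eqv) (intro PS_diff PS_scl 1 2)
  qed
  {
    case Gen_a
    have "ga ^ j * gas ^ k * (al * (if s then als else al) ^ i) \<in> PS"
    proof (cases "s \<and> 0 < i")
      case True
      then obtain i' where "i = Suc i'" by (cases i) auto
      then show ?thesis using red[OF al_als, of "als ^ i'" i'] True by (simp add: mult.assoc)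
    next
      case False
      then show ?thesis using PS_pm[of j k "Suc i" False] by (auto simp: pm_def)
    qed
    then show ?thesis using Gen_a PS_eqv[OF gm[OF al_ga al_gas] PS_scl] by simp
  next
    case Gen_a_st
    have e: "als * al \<simeq> 1 - scl 1 (ga * gas)" using als_al by simp
    have "ga ^ j * gas ^ k * (als * (if s then als else al) ^ i) \<in> PS"
    proof (cases "\<not> s \<and> 0 < i")
      case True
      then obtain i' where "i = Suc i'" by (cases i) auto
      then show ?thesis using red[OF e, of "al ^ i'" i'] True by (simp add: mult.assoc)
    next
      case False
      then show ?thesis using PS_pm[of j k "Suc i" True] by (auto simp: pm_def)
    qed
    then show ?thesis using Gen_a_st PS_eqv[OF gm[OF als_ga als_gas] PS_scl] by simp
  }
qed

lemma PS_mult: "x \<in> PS \<Longrightarrow> gelt g * x \<in> PS"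
  unfolding PS_def
proof (induction rule: fa.span_induct)
  case base
  show ?case by (auto simp: fa.subspace_def distrib_left PS_def[symmetric] PS_add PS_scl PS_Rel Rel_zero)
next
  case (step x)
  then show ?case
  proof
    assume "x \<in> RelIdeal q"
    then show "gelt g * x \<in> fa.span (RelIdeal q \<union> pw ` ptr)"
      using PS_Rel[OF Rel_mult_left] by (simp add: PS_def)
  next
    assume "x \<in> pw ` ptr"
    then obtain n a b where t: "a \<le> n" "b \<le> n" "x = pw (n, a, b)" by (auto simp: ptr_def)
    obtain c j k i s where c: "x = scl c (pm j k i s)"
    proof (cases "a + b \<le> n")
      case True
      have "x = scl ((- qc q) ^ b) (pm a b (n - a - b) False)"
        using True by (simp add: t(3) pw_def pwI_def pwJ_def uw_append uw_replicate mult.assoc pm_def gas_pow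
          power_mult_distrib[symmetric]) (simp add: U_def)
      then show ?thesis by (rule that)
    next
      case False
      have "x = scl ((- qc q) ^ (n - a)) (pm (n - b) (n - a) (a + b - n) True)"
        using False t(1,2) by (simp add: t(3) pw_def pwI_def pwJ_def uw_append uw_replicate mult.assoc pm_def gas_pow
          power_mult_distrib[symmetric]) (simp add: U_def)
      then show ?thesis by (rule that)
    qed
    show "gelt g * x \<in> fa.span (RelIdeal q \<union> pw ` ptr)"
      using PS_scl[OF PS_mult_pm[of g j k i s], of c] by (simp add: c PS_def)
  qed
qed

lemma PS_UNIV: "x \<in> PS"
proof (induction x rule: pm_induct)
  case (mon w)
  have "mon (FWord l) \<in> PS" for l
  proof (induction l)
    case Nil then show ?case using PS_pm[of 0 0 0 True] by (simp add: mon_Nil pm_def)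
  next
    case (Cons g l) then show ?case using PS_mult by (subst mon_Cons) simp
  qed
  then show ?case by (cases w) simp
qed (auto intro: PS_add PS_scl PS_Rel Rel_zero)

text \<open>
  The words in \<open>e\<close>, \<open>f\<close> and the spectral projections of \<open>k\<close> separate the points of the quotient:
  \<open>f\<^sup>A e\<^sup>B\<close> is triangular with respect to the PBW basis.
\<close>

theorem density:
  assumes z: "\<And>A B w. tf A B w x = 0"
  shows "x \<in> RelIdeal q"
proof -
  obtain r p where rp: "x = r + p" "r \<in> fa.span (RelIdeal q)" "p \<in> fa.span (pw ` ptr)"
    using PS_UNIV[of x] by (auto simp: PS_def fa.span_Un)
  have r: "r \<in> RelIdeal q" using rp(2) by (metis Rel_subspace fa.span_eq_iff)
  obtain V c where V: "finite V" "V \<subseteq> pw ` ptr" "p = (\<Sum>v\<in>V. scl (c v) v)"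
    using rp(3) by (auto simp: fa.span_explicit)
  obtain T where T: "T \<subseteq> ptr" "inj_on pw T" "V = pw ` T" using V(2) by (auto simp: subset_image_inj)
  have fT: "finite T" using V(1) T(2,3) by (simp add: finite_image_iff)
  have p: "p = (\<Sum>t\<in>T. scl (c (pw t)) (pw t))" using V(3) T by (simp add: sum.reindex)
  define S where "S = {t \<in> T. c (pw t) \<noteq> 0}"
  have "S = {}"
  proof (rule ccontr)
    assume ne: "S \<noteq> {}"
    have fS: "finite S" using fT by (simp add: S_def)
    \<comment> \<open>A term with the most letters \<open>True\<close> in its column word. Its test
      functional sees only terms with at least as many, with the same weight and the same difference
      of counts; by maximality these data leave \<open>t0\<close> alone.\<close>
    obtain t0 where t0: "t0 \<in> S" "\<And>t. t \<in> S \<Longrightarrow> snd (snd t) \<le> snd (snd t0)"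
    proof -
      have "Max ((\<lambda>t. snd (snd t)) ` S) \<in> (\<lambda>t. snd (snd t)) ` S" using ne fS by (intro Max_in) auto
      then obtain t0 where "t0 \<in> S" "Max ((\<lambda>t. snd (snd t)) ` S) = snd (snd t0)" by auto
      then show ?thesis using that[of t0] fS by (metis Max_ge finite_imageI imageI)
    qed
    let ?h = "tf (nT (pwI t0)) (nT (pwJ t0)) (wt (pwJ t0))"
    note lh = Udual_lfun[OF tf_Udual]
    have t0p: "t0 \<in> ptr" using t0(1) T(1) by (auto simp: S_def)
    have zero: "c (pw t) * ?h (pw t) = 0" if "t \<in> T" "t \<noteq> t0" for t
    proof (rule ccontr)
      assume a: "c (pw t) * ?h (pw t) \<noteq> 0"
      then have tS: "t \<in> S" using that by (simp add: S_def)
      have tp: "t \<in> ptr" using that(1) T(1) by auto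
      have "wt (pwJ t) = wt (pwJ t0) \<and> nT (pwJ t0) \<le> nT (pwJ t) \<and> nT (pwI t) + nT (pwJ t0) = nT (pwJ t) + nT (pwI t0)"
        using tf_support[where I = "pwI t" and J = "pwJ t" and A = "nT (pwI t0)" and B = "nT (pwJ t0)" and w = "wt (pwJ t0)"] a pw_length[OF tp] by (simp add: pw_def)
      then have "fst t = fst t0" "fst (snd t) = fst (snd t0)" "snd (snd t) = snd (snd t0)"
        using t0(2)[OF tS] pw_nT[OF tp] pw_nT[OF t0p] pw_length[OF tp] pw_length[OF t0p]
        by (auto simp: wt_nT)
      then show False using that(2) by (simp add: prod_eq_iff)
    qed
    have "?h x = ?h p" using Udual_zero[OF tf_Udual r] by (simp add: rp(1) lfun_add[OF lh])
    also have "\<dots> = (\<Sum>t\<in>T. c (pw t) * ?h (pw t))" by (simp add: p lfun_simps[OF lh])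
    also have "\<dots> = (\<Sum>t\<in>{t0}. c (pw t) * ?h (pw t))"
      by (rule sum.mono_neutral_right) (use fT zero t0(1) in \<open>auto simp: S_def\<close>)
    finally have "c (pw t0) * ?h (pw t0) = 0" using z by simp
    then show False using t0(1) tf_nz[of "pwI t0" "pwJ t0"] pw_length[OF t0p] by (simp add: S_def pw_def)
  qed
  then have "p = 0" using p by (auto simp: S_def intro!: sum.neutral)
  then show ?thesis using rp(1) r by simp
qed

end

section \<open>Unitary corepresentations\<close>

lemma cinner_simps:
  "cinner N x (\<lambda>i. y i + z i) = cinner N x y + cinner N x z"
  "cinner N x (\<lambda>i. c * y i) = c * cinner N x y"
  "cinner N (\<lambda>i. y i + z i) x = cinner N y x + cinner N z x"
  "cinner N (\<lambda>i. c * y i) x = cnj c * cinner N y x"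
  "cinner N x (\<lambda>i. y i - z i) = cinner N x y - cinner N x z"
  "cinner N (\<lambda>i. y i - z i) x = cinner N y x - cinner N z x"
  "cinner N x (\<lambda>i. 0) = 0" "cinner N (\<lambda>i. 0) x = 0"
  by (simp_all add: cinner_def sum.distrib sum_distrib_left algebra_simps sum_subtractf)

lemma cinner_sum_right: "cinner N x (\<lambda>i. \<Sum>a\<in>S. c a * e a i) = (\<Sum>a\<in>S. c a * cinner N x (e a))"
proof -
  have "cinner N x (\<lambda>i. \<Sum>a\<in>S. c a * e a i) = (\<Sum>i<N. \<Sum>a\<in>S. c a * (cnj (x i) * e a i))"
    by (simp add: cinner_def sum_distrib_left mult.left_commute)
  also have "\<dots> = (\<Sum>a\<in>S. \<Sum>i<N. c a * (cnj (x i) * e a i))" by (rule sum.swap)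
  finally show ?thesis by (simp add: cinner_def sum_distrib_left)
qed

lemma cinner_cnj: "cnj (cinner N x y) = cinner N y x"
  by (simp add: cinner_def mult.commute)

lemma cinner_sum_left: "cinner N (\<lambda>i. \<Sum>a\<in>S. c a * e a i) x = (\<Sum>a\<in>S. cnj (c a) * cinner N (e a) x)"
  using arg_cong[OF cinner_sum_right[of N x c e S], of cnj] by (simp add: cinner_cnj)

lemma cinner_self: "cinner N x x = complex_of_real (\<Sum>i<N. (cmod (x i))\<^sup>2)"
  by (simp add: cinner_def mult.commute complex_norm_square[symmetric] del: of_real_power)

lemma cinner_self_nnr: "cinner N x x \<in> nnr" by (simp add: cinner_self nnr_def sum_nonneg)

lemma cinner_self_zero: assumes "x \<in> cvec N" "cinner N x x = 0" shows "x = (\<lambda>_. 0)"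
proof
  fix i
  have "(\<Sum>i<N. (cmod (x i))\<^sup>2) = 0" using assms(2) by (simp only: cinner_self of_real_eq_0_iff)
  then have "\<forall>i\<in>{..<N}. (cmod (x i))\<^sup>2 = 0" by (subst (asm) sum_nonneg_eq_0_iff) auto
  then show "x i = 0" using assms(1) by (cases "i < N") (auto simp: cvec_def)
qed

definition ud :: "nat \<Rightarrow> nat \<Rightarrow> complex" where "ud k = (\<lambda>i. if i = k then 1 else 0)"

lemma ud_apply: "ud k i = (if i = k then 1 else 0)" by (simp add: ud_def)

lemma ud_same: "ud k k = 1" by (simp add: ud_def)

lemma ud_cvec: "k < N \<Longrightarrow> ud k \<in> cvec N" by (auto simp: ud_def cvec_def)

lemma cinner_ud_left: "k < N \<Longrightarrow> cinner N (ud k) x = x k"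
  by (simp add: cinner_def ud_def if_distrib[of cnj] if_distrib[of "\<lambda>c. c * _"] sum.delta cong: if_cong)

lemma cinner_ud_right: "k < N \<Longrightarrow> cinner N x (ud k) = cnj (x k)"
  using cinner_ud_left[of k N x] cinner_cnj[of N "ud k" x] by simp

lemma cinner_expand: "cinner N y x = (\<Sum>k<N. x k * cinner N y (ud k))"
  unfolding cinner_def[of N y x] by (intro sum.cong refl) (simp add: cinner_ud_right mult.commute)

lemma cvec_eqI: assumes "x \<in> cvec N" "y \<in> cvec N" "\<And>z. z \<in> cvec N \<Longrightarrow> cinner N z x = cinner N z y" shows "x = y"
proof
  fix i show "x i = y i"
  proof (cases "i < N")
    case True then show ?thesis using assms(3)[OF ud_cvec[OF True]] by (simp add: cinner_ud_left)
  qed (use assms(1,2) in \<open>auto simp: cvec_def\<close>)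
qed

lemma cvec_subspace: "csubspace N (cvec N)" by (auto simp: csubspace_def cvec_def)

lemma csub_add: "csubspace N V \<Longrightarrow> x \<in> V \<Longrightarrow> y \<in> V \<Longrightarrow> (\<lambda>i. x i + c * y i) \<in> V"
  by (simp add: csubspace_def)

lemma csub_zero: "csubspace N V \<Longrightarrow> (\<lambda>_. 0) \<in> V" by (simp add: csubspace_def)

lemma csub_scale: "csubspace N V \<Longrightarrow> y \<in> V \<Longrightarrow> (\<lambda>i. c * y i) \<in> V"
  using csub_add[of N V "\<lambda>_. 0" y c] csub_zero[of N V] by simp

lemma csub_sum: assumes "csubspace N V" "\<And>a. a \<in> S \<Longrightarrow> e a \<in> V"
  shows "(\<lambda>i. \<Sum>a\<in>S. c a * e a i) \<in> V"
  using assms(2)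
proof (induction S rule: infinite_finite_induct)
  case (insert a S)
  then show ?case using csub_add[OF assms(1), of "\<lambda>i. \<Sum>a\<in>S. c a * e a i" "e a" "c a"]
    by (simp add: add.commute)
qed (simp_all add: csub_zero[OF assms(1)])

lemma csub_diff: assumes "csubspace N V" "x \<in> V" "y \<in> V" shows "(\<lambda>i. x i - y i) \<in> V"
  using csub_add[OF assms, of "-1"] by simp

lemma csub_cvec: "csubspace N V \<Longrightarrow> x \<in> V \<Longrightarrow> x \<in> cvec N" by (auto simp: csubspace_def)

lemmas cvec_lin = csub_add[OF cvec_subspace] csub_zero[OF cvec_subspace] csub_scale[OF cvec_subspace]
  csub_sum[OF cvec_subspace] csub_diff[OF cvec_subspace]

definition onf :: "nat \<Rightarrow> nat \<Rightarrow> (nat \<Rightarrow> nat \<Rightarrow> complex) \<Rightarrow> bool"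
  where "onf N d e \<longleftrightarrow> (\<forall>a<d. e a \<in> cvec N \<and> (\<forall>b<d. cinner N (e a) (e b) = (if a = b then 1 else 0)))"

definition proj :: "nat \<Rightarrow> nat \<Rightarrow> (nat \<Rightarrow> nat \<Rightarrow> complex) \<Rightarrow> (nat \<Rightarrow> complex) \<Rightarrow> nat \<Rightarrow> complex"
  where "proj N d e x = (\<lambda>i. \<Sum>a<d. cinner N (e a) x * e a i)"

lemma onf_inner: "onf N d e \<Longrightarrow> a < d \<Longrightarrow> b < d \<Longrightarrow> cinner N (e a) (e b) = (if a = b then 1 else 0)"
  by (simp add: onf_def)

lemma cinner_proj: assumes "onf N d e" "a < d" shows "cinner N (e a) (proj N d e x) = cinner N (e a) x"
proof -
  have "cinner N (e a) (proj N d e x) = (\<Sum>b<d. cinner N (e b) x * cinner N (e a) (e b))"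
    by (simp add: proj_def cinner_sum_right)
  also have "\<dots> = (\<Sum>b<d. if b = a then cinner N (e b) x else 0)"
    by (intro sum.cong refl) (use onf_inner[OF assms] in auto)
  finally show ?thesis using assms(2) by simp
qed

lemma bessel:
  assumes "onf N d e"
  shows "(\<Sum>a<d. cmod (cinner N (e a) x) ^ 2) \<le> Re (cinner N x x)"
proof -
  let ?p = "proj N d e x"
  have p: "cinner N x ?p = (\<Sum>a<d. cinner N (e a) x * cnj (cinner N (e a) x))"
    by (simp add: proj_def cinner_sum_right cinner_cnj)
  have pp: "cinner N ?p ?p = (\<Sum>a<d. cnj (cinner N (e a) x) * cinner N (e a) x)"
    unfolding proj_def[of N d e x] cinner_sum_left unfolding proj_def[symmetric]
    by (intro sum.cong refl) (simp add: cinner_proj[OF assms])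
  have "cinner N ?p x = cnj (cinner N x ?p)" by (simp add: cinner_cnj)
  also have "\<dots> = cinner N x ?p" unfolding p by (simp add: mult.commute)
  finally have "cinner N (\<lambda>i. x i - ?p i) (\<lambda>i. x i - ?p i) = cinner N x x - cinner N x ?p"
    using p pp by (simp add: cinner_simps mult.commute)
  moreover have "0 \<le> Re (cinner N (\<lambda>i. x i - ?p i) (\<lambda>i. x i - ?p i))"
    using cinner_self_nnr by (simp add: nnr_def)
  moreover have "Re (cinner N x ?p) = (\<Sum>a<d. cmod (cinner N (e a) x) ^ 2)"
    by (simp add: p complex_norm_square[symmetric] del: of_real_power)
  ultimately show ?thesis by simp
qed

lemma onf_trace: assumes "onf N d e" shows "(\<Sum>i<N. \<Sum>a<d. cmod (e a i) ^ 2) = real d"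
proof -
  have "(\<Sum>i<N. cmod (e a i) ^ 2) = 1" if "a < d" for a
  proof -
    have "complex_of_real (\<Sum>i<N. cmod (e a i) ^ 2) = 1"
      using assms that by (simp only: cinner_self[symmetric] onf_def) simp
    then show ?thesis by (simp only: of_real_eq_1_iff)
  qed
  then have "(\<Sum>a<d. \<Sum>i<N. cmod (e a i) ^ 2) = real d" by simp
  then show ?thesis by (subst sum.swap)
qed

text \<open>Bessel at the unit vectors, summed over all coordinates: the squared entries add up to d
  and each coordinate contributes at most 1.\<close>

lemma onf_le: assumes "onf N d e" shows "d \<le> N"
proof -
  have "(\<Sum>a<d. cmod (e a i) ^ 2) \<le> 1" if "i < N" for i
    using bessel[OF assms, of "ud i"] that by (simp add: cinner_ud_right cinner_ud_left ud_same)
  then have "(\<Sum>i<N. \<Sum>a<d. cmod (e a i) ^ 2) \<le> (\<Sum>i<N. 1)" by (intro sum_mono) auto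
  then show ?thesis using onf_trace[OF assms] by simp
qed

lemma proj_cvec: "onf N d e \<Longrightarrow> proj N d e x \<in> cvec N"
  unfolding proj_def by (rule cvec_lin(4)) (simp add: onf_def)

text \<open>For a family of length N the same count forces equality in Bessel at every unit vector,
  so each unit vector equals its projection.\<close>

lemma onf_full: assumes "onf N N e" "x \<in> cvec N" shows "proj N N e x = x"
proof -
  have le: "(\<Sum>a<N. cmod (e a i) ^ 2) \<le> 1" if "i < N" for i
    using bessel[OF assms(1), of "ud i"] that by (simp add: cinner_ud_right cinner_ud_left ud_same)
  have eq: "(\<Sum>a<N. cmod (e a i) ^ 2) = 1" if "i < N" for i
  proof (rule ccontr)
    assume "(\<Sum>a<N. cmod (e a i) ^ 2) \<noteq> 1"
    then have "(\<Sum>i<N. \<Sum>a<N. cmod (e a i) ^ 2) < (\<Sum>i<N. 1)"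
      by (intro sum_strict_mono_ex1) (use le that in \<open>auto intro!: bexI[of _ i] simp: order.not_eq_order_implies_strict\<close>)
    then show False using onf_trace[OF assms(1)] by simp
  qed
  have u: "proj N N e (ud k) = ud k" if k: "k < N" for k
  proof -
    let ?p = "proj N N e (ud k)"
    have a: "?p k = 1"
    proof -
      have "?p k = complex_of_real (\<Sum>a<N. cmod (e a k) ^ 2)"
        unfolding proj_def cinner_ud_right[OF k] of_real_sum complex_norm_square by (intro sum.cong refl mult.commute)
      then show ?thesis by (simp only: eq[OF k] of_real_1)
    qed
    have "cinner N ?p ?p = (\<Sum>a<N. cnj (cinner N (e a) (ud k)) * cinner N (e a) (ud k))"
      unfolding proj_def[of N N e "ud k"] cinner_sum_left unfolding proj_def[symmetric]
      by (intro sum.cong refl) (simp add: cinner_proj[OF assms(1)])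
    also have "\<dots> = ?p k" unfolding proj_def cinner_ud_right[OF k] by (simp add: mult.commute)
    finally have pp: "cinner N ?p ?p = 1" using a by (rule trans)
    have "cinner N (\<lambda>i. ?p i - ud k i) (\<lambda>i. ?p i - ud k i)
        = cinner N ?p ?p - cinner N ?p (ud k) - (cinner N (ud k) ?p - cinner N (ud k) (ud k))"
      by (simp only: cinner_simps algebra_simps)
    also have "\<dots> = 0"
      unfolding cinner_ud_left[OF k] cinner_ud_right[OF k] a pp ud_same by simp
    finally have "cinner N (\<lambda>i. ?p i - ud k i) (\<lambda>i. ?p i - ud k i) = 0" .
    moreover have "(\<lambda>i. ?p i - ud k i) \<in> cvec N"
      by (rule cvec_lin(5)[OF proj_cvec[OF assms(1)] ud_cvec[OF k]])
    ultimately have z: "(\<lambda>i. ?p i - ud k i) = (\<lambda>_. 0)" by (rule cinner_self_zero[rotated])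
    show ?thesis
    proof
      fix i show "?p i = ud k i" using fun_cong[OF z, of i] by simp
    qed
  qed
  show ?thesis
  proof (rule cvec_eqI[OF proj_cvec[OF assms(1)] assms(2)])
    fix z :: "nat \<Rightarrow> complex" assume z: "z \<in> cvec N"
    have x: "x = (\<lambda>i. \<Sum>k<N. x k * ud k i)"
      using assms(2) by (auto simp: fun_eq_iff ud_def cvec_def if_distrib sum.delta cong: if_cong)
    have "proj N N e x = (\<lambda>i. \<Sum>k<N. x k * proj N N e (ud k) i)"
    proof
      fix i
      have "proj N N e x i = (\<Sum>a<N. \<Sum>k<N. x k * cinner N (e a) (ud k) * e a i)"
        unfolding proj_def cinner_expand[of N _ x] by (simp add: sum_distrib_right)
      also have "\<dots> = (\<Sum>k<N. \<Sum>a<N. x k * cinner N (e a) (ud k) * e a i)" by (rule sum.swap)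
      also have "\<dots> = (\<Sum>k<N. x k * proj N N e (ud k) i)" by (simp add: proj_def sum_distrib_left mult.assoc)
      finally show "proj N N e x i = (\<Sum>k<N. x k * proj N N e (ud k) i)" .
    qed
    also have "\<dots> = (\<lambda>i. \<Sum>k<N. x k * ud k i)" by (simp add: u)
    also have "\<dots> = x" by (rule x[symmetric])
    finally show "cinner N z (proj N N e x) = cinner N z x" by simp
  qed
qed

text \<open>A family of maximal length exists by \<open>onf_le\<close>; a nonzero remainder of a
  projection could be normalised and appended.\<close>

lemma onb_exists:
  assumes V: "csubspace N V"
  shows "\<exists>d e. onf N d e \<and> (\<forall>a<d. e a \<in> V) \<and> (\<forall>x\<in>V. proj N d e x = x)"
proof -
  let ?P = "\<lambda>d. \<exists>e. onf N d e \<and> (\<forall>a<d. e a \<in> V)"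
  have "?P 0" by (simp add: onf_def)
  moreover have "\<forall>d. ?P d \<longrightarrow> d \<le> N" using onf_le by blast
  ultimately obtain d where d: "?P d" "\<And>d'. ?P d' \<Longrightarrow> d' \<le> d"
    using ex_has_greatest_nat[of ?P 0 "\<lambda>d. d" "Suc N"] by (metis le_imp_less_Suc)
  then obtain e where e: "onf N d e" "\<forall>a<d. e a \<in> V" by blast
  have "proj N d e x = x" if x: "x \<in> V" for x
  proof (rule ccontr)
    assume ne: "proj N d e x \<noteq> x"
    define y where "y = (\<lambda>i. x i - proj N d e x i)"
    have yV: "y \<in> V" unfolding y_def proj_def by (intro csub_diff[OF V] x csub_sum[OF V]) (use e in auto)
    have y0: "y \<noteq> (\<lambda>_. 0)"
    proof
      assume y: "y = (\<lambda>_. 0)"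
      have "proj N d e x i = x i" for i using fun_cong[OF y, of i] by (simp add: y_def)
      then show False using ne by auto
    qed
    have ey: "cinner N (e a) y = 0" "cinner N y (e a) = 0" if "a < d" for a
    proof -
      show "cinner N (e a) y = 0" using cinner_proj[OF e(1) that] by (simp add: y_def cinner_simps)
      then show "cinner N y (e a) = 0" using cinner_cnj[of N "e a" y] by simp
    qed
    define r where "r = sqrt (Re (cinner N y y))"
    have "cinner N y y \<noteq> 0" using cinner_self_zero csub_cvec[OF V yV] y0 by blast
    then have yy: "cinner N y y = complex_of_real (r\<^sup>2)" "r \<noteq> 0"
      using cinner_self_nnr[of N y] by (auto simp: r_def nnr_def complex_eq_iff)
    define c where "c = complex_of_real (1 / r)"
    define e' where "e' = e(d := (\<lambda>i. c * y i))"
    have "cinner N (e' d) (e' d) = cnj c * (c * cinner N y y)"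
      by (simp add: e'_def cinner_simps)
    also have "\<dots> = 1" using yy by (simp add: c_def power2_eq_square)
    finally have "onf N (Suc d) e'"
      using e(1) ey csub_scale[OF V yV] csub_cvec[OF V] unfolding onf_def less_Suc_eq
      by (auto simp: e'_def cinner_simps)
    moreover have "\<forall>a<Suc d. e' a \<in> V"
      using e(2) csub_scale[OF V yV] by (auto simp: less_Suc_eq e'_def)
    ultimately show False using d(2)[of "Suc d"] by auto
  qed
  then show ?thesis using e by blast
qed

definition orth :: "nat \<Rightarrow> (nat \<Rightarrow> complex) set \<Rightarrow> (nat \<Rightarrow> complex) set"
  where "orth N V = {x \<in> cvec N. \<forall>y\<in>V. cinner N y x = 0}"

lemma orth_subspace: "csubspace N (orth N V)"
  unfolding csubspace_def orth_def by (auto simp: cinner_simps intro: cvec_lin)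

text \<open>Completes a basis of V by one of its orthogonal complement. The count d + d' = N is what
  makes both parts smaller in the induction of \<open>decomposition\<close>.\<close>

lemma onb_split:
  assumes V: "csubspace N V"
  obtains d e d' f where "onf N d e" "onf N d' f" "\<And>a. a < d \<Longrightarrow> e a \<in> V" "\<And>a. a < d' \<Longrightarrow> f a \<in> orth N V"
    "\<And>x. x \<in> V \<Longrightarrow> proj N d e x = x" "\<And>x i. x \<in> cvec N \<Longrightarrow> x i = proj N d e x i + proj N d' f x i"
    "d + d' = N"
proof -
  obtain d e where e: "onf N d e" "\<forall>a<d. e a \<in> V" "\<forall>x\<in>V. proj N d e x = x" using onb_exists[OF V] by blast
  obtain d' f where f: "onf N d' f" "\<forall>a<d'. f a \<in> orth N V" "\<forall>x\<in>orth N V. proj N d' f x = x"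
    using onb_exists[OF orth_subspace] by blast
  have ef: "cinner N (e a) (f b) = 0" "cinner N (f b) (e a) = 0" if "a < d" "b < d'" for a b
  proof -
    show "cinner N (e a) (f b) = 0" using e(2) f(2) that by (auto simp: orth_def)
    then show "cinner N (f b) (e a) = 0" using cinner_cnj[of N "e a" "f b"] by simp
  qed
  have c: "x i = proj N d e x i + proj N d' f x i" if x: "x \<in> cvec N" for x i
  proof -
    let ?y = "\<lambda>i. x i - proj N d e x i"
    have "?y \<in> orth N V"
      unfolding orth_def mem_Collect_eq
    proof (intro conjI ballI)
      show "?y \<in> cvec N" by (intro cvec_lin x proj_cvec e)
      fix y assume "y \<in> V"
      then have y: "y = proj N d e y" using e(3) by simp
      have "cinner N y ?y = (\<Sum>a<d. cnj (cinner N (e a) y) * cinner N (e a) ?y)"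
        by (subst y, subst proj_def, rule cinner_sum_left)
      also have "\<dots> = 0" by (intro sum.neutral) (simp add: cinner_simps cinner_proj[OF e(1)])
      finally show "cinner N y ?y = 0" .
    qed
    then have "proj N d' f ?y = ?y" using f(3) by blast
    moreover have "proj N d' f ?y = proj N d' f x"
    proof -
      have "cinner N (f b) ?y = cinner N (f b) x" if "b < d'" for b
        using that by (simp add: cinner_simps proj_def cinner_sum_right ef)
      then show ?thesis by (simp add: proj_def)
    qed
    ultimately show ?thesis by (metis add_diff_cancel_left' diff_add_cancel add.commute)
  qed
  have "d + d' = N"
  proof -
    have "(\<Sum>a<d. cmod (e a i) ^ 2) + (\<Sum>a<d'. cmod (f a i) ^ 2) = 1" if "i < N" for i
    proof -
      have "complex_of_real (\<Sum>a<d. cmod (e a i) ^ 2) = proj N d e (ud i) i" for d and e :: "nat \<Rightarrow> nat \<Rightarrow> complex"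
        by (simp add: proj_def cinner_ud_right[OF that] mult.commute complex_norm_square[symmetric] del: of_real_power)
      then have "complex_of_real ((\<Sum>a<d. cmod (e a i) ^ 2) + (\<Sum>a<d'. cmod (f a i) ^ 2)) = 1"
        using c[OF ud_cvec[OF that], of i] by (simp only: of_real_add ud_same)
      then show ?thesis by (simp only: of_real_eq_1_iff)
    qed
    then have "(\<Sum>i<N. (\<Sum>a<d. cmod (e a i) ^ 2) + (\<Sum>a<d'. cmod (f a i) ^ 2)) = real N" by simp
    then have "real d + real d' = real N"
      by (simp only: sum.distrib onf_trace[OF e(1)] onf_trace[OF f(1)])
    then show ?thesis by linarith
  qed
  then show ?thesis using that e f c by blast
qed


context sq
begin

lemma rep_cvec: "rep N u h x \<in> cvec N" by (simp add: rep_def cvec_def)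

lemma rep_lin: "rep N u h (\<lambda>i. x i + c * y i) = (\<lambda>i. rep N u h x i + c * rep N u h y i)"
  by (auto simp: rep_def fun_eq_iff sum.distrib sum_distrib_left algebra_simps)

lemma rep_scale: "rep N u h (\<lambda>i. c * y i) = (\<lambda>i. c * rep N u h y i)"
  by (auto simp: rep_def fun_eq_iff sum_distrib_left algebra_simps)

lemma rep_zero: "rep N u h (\<lambda>i. 0) = (\<lambda>i. 0)" by (auto simp: rep_def)

lemma rep_sum: "rep N u h (\<lambda>i. \<Sum>a\<in>S. c a * e a i) = (\<lambda>i. \<Sum>a\<in>S. c a * rep N u h (e a) i)"
proof (induction S rule: infinite_finite_induct)
  case (insert a S)
  then show ?case using rep_lin[of N u h "\<lambda>i. \<Sum>a\<in>S. c a * e a i" "c a" "e a"] by (simp add: add.commute)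
qed (simp_all add: rep_zero)

lemma rep_lincomb: "rep N u (\<lambda>x. \<Sum>s\<in>S. c s * h s x) y = (\<lambda>i. \<Sum>s\<in>S. c s * rep N u (h s) y i)"
proof
  fix i
  have "(\<Sum>j<N. (\<Sum>s\<in>S. c s * h s (u i j)) * y j) = (\<Sum>j<N. \<Sum>s\<in>S. c s * (h s (u i j) * y j))"
    by (simp add: sum_distrib_right mult.assoc)
  also have "\<dots> = (\<Sum>s\<in>S. \<Sum>j<N. c s * (h s (u i j) * y j))" by (rule sum.swap)
  finally show "rep N u (\<lambda>x. \<Sum>s\<in>S. c s * h s x) y i = (\<Sum>s\<in>S. c s * rep N u (h s) y i)"
    by (simp add: rep_def sum_distrib_left)
qed

lemma mcoef_eval: assumes "lfun h" shows "h (mcoef N u x y) = cinner N x (rep N u h y)"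
  by (simp add: mcoef_def lfun_simps[OF assms] cinner_def rep_def sum_distrib_left mult_ac)

lemma mcoef_ud: "i < N \<Longrightarrow> j < N \<Longrightarrow> mcoef N u (ud i) (ud j) = u i j"
  by (simp add: mcoef_def ud_def if_distrib[of cnj] if_distrib[of "\<lambda>c. c * _"] if_distrib[of "\<lambda>c. scl c _"]
     if_distrib[of "\<lambda>c. _ * c"] sum.delta cong: if_cong)

lemma mcoef_scale: "mcoef N u (\<lambda>i. c * x i) (\<lambda>i. d * y i) = scl (cnj c * d) (mcoef N u x y)"
  by (simp add: mcoef_def scl_sum mult.assoc mult.left_commute)

lemma mcoef_sum_right: "mcoef N u x (\<lambda>i. \<Sum>a\<in>S. c a * e a i) = (\<Sum>a\<in>S. scl (c a) (mcoef N u x (e a)))"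
proof (induction S rule: infinite_finite_induct)
  case (insert a S)
  have "mcoef N u x (\<lambda>i. c a * e a i + (\<Sum>a\<in>S. c a * e a i)) = scl (c a) (mcoef N u x (e a)) + mcoef N u x (\<lambda>i. \<Sum>a\<in>S. c a * e a i)"
    by (simp add: mcoef_def scl_sum distrib_left fa.scale_left_distrib sum.distrib mult.left_commute)
  then show ?case using insert by simp
qed (simp_all add: mcoef_def)

lemma mcoef_sum_left: "mcoef N u (\<lambda>i. \<Sum>a\<in>S. c a * e a i) y = (\<Sum>a\<in>S. scl (cnj (c a)) (mcoef N u (e a) y))"
proof (induction S rule: infinite_finite_induct)
  case (insert a S)
  have "mcoef N u (\<lambda>i. c a * e a i + (\<Sum>a\<in>S. c a * e a i)) y = scl (cnj (c a)) (mcoef N u (e a) y) + mcoef N u (\<lambda>i. \<Sum>a\<in>S. c a * e a i) y"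
    by (simp add: mcoef_def scl_sum distrib_right fa.scale_left_distrib sum.distrib mult.assoc)
  then show ?case using insert by simp
qed (simp_all add: mcoef_def)

lemma cvec_expand: "x \<in> cvec N \<Longrightarrow> x = (\<lambda>i. \<Sum>k<N. x k * ud k i)"
  by (auto simp: fun_eq_iff ud_def cvec_def if_distrib sum.delta cong: if_cong)

lemma mcoef_expand_right: assumes "y \<in> cvec N"
  shows "mcoef N u x y = (\<Sum>k<N. scl (y k) (mcoef N u x (ud k)))"
  by (subst cvec_expand[OF assms]) (simp add: mcoef_sum_right)

lemma mcoef_expand_left: assumes "x \<in> cvec N"
  shows "mcoef N u x y = (\<Sum>k<N. scl (cnj (x k)) (mcoef N u (ud k) y))"
  by (subst cvec_expand[OF assms]) (simp add: mcoef_sum_left)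

lemma ev2_Rel2: assumes "g \<in> Udual q" "h \<in> Udual q" "z \<in> RelIdeal2 q" shows "ev2 g h z = 0"
  using assms(3) unfolding RelIdeal2_def
proof (rule fa.span_induct)
  show "fa.subspace (Collect (\<lambda>z. ev2 g h z = 0))" by (simp add: fa.subspace_def lfun_simps[OF lfun_ev2])
next
  fix z assume "z \<in> {tensor x y |x y. x \<in> RelIdeal q} \<union> {tensor x y |x y. y \<in> RelIdeal q}"
  then show "ev2 g h z = 0"
    using Udual_zero[OF assms(1)] Udual_zero[OF assms(2)]
    by (auto simp: ev2_tensor Udual_lfun assms(1,2))
qed

lemma Rel2_subspace: "fa.subspace (RelIdeal2 q)" unfolding RelIdeal2_def by (rule fa.subspace_span)
lemma Rel2_left: "x \<in> RelIdeal q \<Longrightarrow> tensor x y \<in> RelIdeal2 q"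
  unfolding RelIdeal2_def by (rule fa.span_base) blast
lemma Rel2_right: "y \<in> RelIdeal q \<Longrightarrow> tensor x y \<in> RelIdeal2 q"
  unfolding RelIdeal2_def by (rule fa.span_base) blast
lemmas Rel2_simps = fa.subspace_0[OF Rel2_subspace] fa.subspace_add[OF Rel2_subspace]
  fa.subspace_scale[OF Rel2_subspace] fa.subspace_diff[OF Rel2_subspace] fa.subspace_sum[OF Rel2_subspace]

text \<open>The map x \<otimes> y to S(x) y; \<open>ma_cop\<close> is one half of the antipode
  axiom, valid modulo the ideal.\<close>

definition ma :: "falg2 \<Rightarrow> falg"
  where "ma = lin_ext scl (\<lambda>(v, w). antipode q (mon v) * mon w)"

lemma ma_lin: "ma (x + y) = ma x + ma y" "ma (scl c x) = scl c (ma x)" "ma 0 = 0"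
  by (simp_all add: ma_def lin_ext_add[OF vs_scl] lin_ext_scl[OF vs_scl] lin_ext_zero[OF vs_scl])

lemma ma_tensor: "ma (tensor x y) = antipode q x * y"
proof -
  have "ma (tensor (mon v) y) = antipode q (mon v) * y" for v
    by (induction y rule: pm_induct)
      (simp_all add: tensor_zero_right tensor_add_right tensor_scl_right ma_lin distrib_left,
       simp add: tensor_mon ma_def lin_ext_mon[OF vs_scl])
  then show ?thesis
    by (induction x rule: pm_induct)
      (simp_all add: tensor_zero_left tensor_add_left tensor_scl_left ma_lin antipode_lin distrib_right)
qed

lemma ma_Rel2: assumes "z \<in> RelIdeal2 q" shows "ma z \<in> RelIdeal q"
  using assms unfolding RelIdeal2_def
proof (rule fa.span_induct)
  show "fa.subspace (Collect (\<lambda>z. ma z \<in> RelIdeal q))"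
    by (simp add: fa.subspace_def ma_lin Rel_zero Rel_add Rel_scl)
next
  fix z assume "z \<in> {tensor x y |x y. x \<in> RelIdeal q} \<union> {tensor x y |x y. y \<in> RelIdeal q}"
  moreover have "antipode q x \<in> RelIdeal q" if "x \<in> RelIdeal q" for x
    using antipode_Rel[OF that] separation by blast
  ultimately show "ma z \<in> RelIdeal q"
    by (auto simp: ma_tensor Rel_mult_left Rel_mult_right)
qed

lemma antipode_U_sum: "(\<Sum>k\<in>UNIV. antipode q (U i k) * U k j) \<simeq> scl (idm i j) 1"
proof -
  have "(\<Sum>k\<in>UNIV. antipode q (U i k) * U k j) - scl (idm i j) 1 = scl (1 / tt i) (Rb (\<not> i) j)"
    by (cases i; cases j)
      (simp_all add: sum_bool antipode_U tt_def Rb_def eE_def idm_def scl_add scl_diff)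
  then show ?thesis using Rel_scl[OF Rb_Rel] by (simp add: eqv_def)
qed

lemma ma_cop: "ma (cop q x) \<simeq> scl (eps x) 1"
proof (induction x rule: falg_induct)
  case (uw I J)
  then show ?case
  proof (induction I J rule: list_induct2)
    case Nil then show ?case by (simp add: cop_one tensor_one[symmetric] ma_tensor antipode_one)
  next
    case (Cons i I j J)
    have e: "ma (cop q (uw I J)) = (\<Sum>K\<in>bl (length I). antipode q (uw I K) * uw K J)" if "length I = length J" for I J
      using that by (simp add: cop_uw additive_sum[of ma] ma_lin ma_tensor)
    have "ma (cop q (uw (i # I) (j # J)))
        = (\<Sum>K\<in>bl (length I). antipode q (uw I K) * (\<Sum>k\<in>UNIV. antipode q (U i k) * U k j) * uw K J)"
      using Cons.hyps by (subst e) (simp_all add: sum_bl_Suc sum_bool antipode_mult distrib_left distrib_right sum.distrib mult.assoc)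
    also have "\<dots> \<simeq> (\<Sum>K\<in>bl (length I). antipode q (uw I K) * scl (idm i j) 1 * uw K J)"
      by (intro eqv_sum eqv_mult eqv_refl antipode_U_sum)
    also have "\<dots> = scl (idm i j) (ma (cop q (uw I J)))" using Cons.hyps by (simp add: e scl_sum)
    also have "\<dots> \<simeq> scl (idm i j) (scl (eps (uw I J)) 1)" by (rule eqv_scl[OF Cons.IH])
    finally show ?case by (simp add: eps_rec)
  qed
next
  case (add x y) then show ?case using eqv_add[OF add] by (simp add: cop_lin ma_lin lfun_add[OF lfun_eps] fa.scale_left_distrib)
next
  case (scl c x) then show ?case using eqv_scl[OF scl, of c] by (simp add: cop_lin ma_lin lfun_scl[OF lfun_eps])
qed (simp add: cop_lin ma_lin lfun_zero[OF lfun_eps])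

lemma corep_conv:
  assumes u: "unitary_corep q N u" and gh: "g \<in> Udual q" "h \<in> Udual q" and ij: "i < N" "j < N"
  shows "conv q g h (u i j) = (\<Sum>k<N. g (u i k) * h (u k j))"
proof -
  have "ev2 g h (cop q (u i j) - (\<Sum>k<N. tensor (u i k) (u k j))) = 0"
    using u ij by (intro ev2_Rel2 gh) (simp add: unitary_corep_def)
  then show ?thesis using gh by (simp add: conv_ev2 lfun_simps[OF lfun_ev2] ev2_tensor Udual_lfun)
qed

text \<open>The antipode axiom and unitarity together give S(u_ij) = u_ji^* modulo the ideal: the
  row unitarity relation is inserted after S(u_ik), and the antipode axiom contracts the other pair.
  So \<open>dstar\<close> is the conjugate transpose in every unitary corepresentation, not only in
  the tensor powers.\<close>

lemma corep_dstar:
  assumes u: "unitary_corep q N u" and h: "h \<in> Udual q" and ij: "i < N" "j < N"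
  shows "dstar q h (u i j) = cnj (h (u j i))"
proof -
  have u1: "(\<Sum>k<N. antipode q (u i k) * u k l) \<simeq> (if i = l then 1 else 0)" if "l < N" for l
  proof -
    have m1: "ma (cop q (u i l) - (\<Sum>k<N. tensor (u i k) (u k l))) \<in> RelIdeal q"
      using u ij that by (intro ma_Rel2) (simp add: unitary_corep_def)
    have m2: "ma (cop q (u i l)) = ma (cop q (u i l) - (\<Sum>k<N. tensor (u i k) (u k l))) + (\<Sum>k<N. antipode q (u i k) * u k l)"
      using ma_lin(1)[of "cop q (u i l) - (\<Sum>k<N. tensor (u i k) (u k l))" "\<Sum>k<N. tensor (u i k) (u k l)"]
      by (simp add: additive_sum[of ma] ma_lin ma_tensor)
    have "ma (cop q (u i l)) \<simeq> (\<Sum>k<N. antipode q (u i k) * u k l)"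
      unfolding eqv_def m2 using m1 by simp
    moreover have "eps (u i l) = (if i = l then 1 else 0)" using u ij that by (simp add: unitary_corep_def)
    ultimately show ?thesis using eqv_trans[OF eqv_sym ma_cop, of "u i l"] by (auto split: if_splits)
  qed
  have u2: "(\<Sum>l<N. u k l * star (u j l)) \<simeq> (if k = j then 1 else 0)" if "k < N" for k
    using u ij that by (simp add: unitary_corep_def eqv_def)
  have "antipode q (u i j) = (\<Sum>k<N. antipode q (u i k) * (if k = j then 1 else 0))"
    using ij by (simp add: if_distrib sum.delta cong: if_cong)
  also have "\<dots> \<simeq> (\<Sum>k<N. antipode q (u i k) * (\<Sum>l<N. u k l * star (u j l)))"
    by (intro eqv_sum eqv_mult eqv_refl eqv_sym[OF u2]) auto
  also have "\<dots> = (\<Sum>k<N. \<Sum>l<N. antipode q (u i k) * u k l * star (u j l))"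
    by (simp add: sum_distrib_left mult.assoc)
  also have "\<dots> = (\<Sum>l<N. (\<Sum>k<N. antipode q (u i k) * u k l) * star (u j l))"
    by (subst sum.swap) (simp add: sum_distrib_right)
  also have "\<dots> \<simeq> (\<Sum>l<N. (if i = l then 1 else 0) * star (u j l))"
    by (intro eqv_sum eqv_mult eqv_refl u1) auto
  also have "\<dots> = star (u j i)" using ij by (simp add: if_distrib[of "\<lambda>c. c * _"] sum.delta cong: if_cong)
  finally have "star (antipode q (u i j)) \<simeq> u j i" using eqv_star by fastforce
  then show ?thesis using Udual_eqv[OF h] by (simp add: dstar_def)
qed

lemma rep_conv:
  assumes u: "unitary_corep q N u" and gh: "g \<in> Udual q" "h \<in> Udual q"
  shows "rep N u (conv q g h) x = rep N u g (rep N u h x)"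
proof
  fix i
  show "rep N u (conv q g h) x i = rep N u g (rep N u h x) i"
  proof (cases "i < N")
    case True
    have "(\<Sum>j<N. conv q g h (u i j) * x j) = (\<Sum>j<N. \<Sum>k<N. g (u i k) * h (u k j) * x j)"
      using True by (simp add: corep_conv[OF u gh] sum_distrib_right)
    also have "\<dots> = (\<Sum>k<N. \<Sum>j<N. g (u i k) * h (u k j) * x j)" by (rule sum.swap)
    finally show ?thesis using True by (simp add: rep_def sum_distrib_left mult.assoc)
  qed (simp add: rep_def)
qed

lemma rep_eps: assumes u: "unitary_corep q N u" and x: "x \<in> cvec N" shows "rep N u eps x = x"
proof
  fix i
  have "(\<Sum>j<N. eps (u i j) * x j) = x i" if "i < N"
    using u that by (simp add: unitary_corep_def if_distrib[of "\<lambda>c. c * _"] sum.delta cong: if_cong)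
  then show "rep N u eps x i = x i" using x by (auto simp: rep_def cvec_def)
qed

lemma rep_adj:
  assumes u: "unitary_corep q N u" and h: "h \<in> Udual q"
  shows "cinner N (rep N u h x) y = cinner N x (rep N u (dstar q h) y)"
proof -
  have "cinner N x (rep N u (dstar q h) y) = (\<Sum>i<N. \<Sum>j<N. cnj (x i) * (cnj (h (u j i)) * y j))"
    by (simp add: cinner_def rep_def sum_distrib_left corep_dstar[OF u h])
  also have "\<dots> = (\<Sum>j<N. \<Sum>i<N. cnj (x i) * (cnj (h (u j i)) * y j))" by (rule sum.swap)
  also have "\<dots> = cinner N (rep N u h x) y"
    by (simp add: cinner_def rep_def sum_distrib_left sum_distrib_right mult_ac)
  finally show ?thesis by simp
qed

lemma eps_mcoef: assumes "unitary_corep q N u" "y \<in> cvec N" shows "eps (mcoef N u x y) = cinner N x y"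
  by (simp add: mcoef_eval lfun_eps rep_eps assms)

lemma mcoef_eqv_rep: 
  assumes u: "unitary_corep q N u" and h: "h \<in> Udual q"
  shows "lact q h (mcoef N u x y) \<simeq> mcoef N u x (rep N u h y)"
  by (rule eqvI) (simp add: lact_apply Udual_lfun h mcoef_eval lfun_conv rep_conv[OF u _ h])

lemma mcoef_eqv_rep_left: 
  assumes u: "unitary_corep q N u" and h: "h \<in> Udual q"
  shows "ract q (mcoef N u x y) h \<simeq> mcoef N u (rep N u (dstar q h) x) y"
  by (rule eqvI) (simp add: ract_apply Udual_lfun h mcoef_eval lfun_conv rep_conv[OF u h] rep_adj[OF u Udual_dstar[OF h]] dstar_dstar)

text \<open>Resolution of the identity for two complementary families, inserted between the factors
  of products and tensors.\<close>

lemma complete_sum: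
  fixes g :: "nat \<Rightarrow> nat \<Rightarrow> ('m::monoid_add \<Rightarrow>\<^sub>0 complex)"
  assumes c: "\<And>x i. x \<in> cvec N \<Longrightarrow> x i = proj N d e x i + proj N d' f x i"
  shows "(\<Sum>a<d. \<Sum>k<N. \<Sum>l<N. scl (e a k * cnj (e a l)) (g k l)) + (\<Sum>a<d'. \<Sum>k<N. \<Sum>l<N. scl (f a k * cnj (f a l)) (g k l))
    = (\<Sum>k<N. g k k)"
proof -
  have sw: "(\<Sum>a<d. \<Sum>k<N. \<Sum>l<N. scl (e a k * cnj (e a l)) (g k l)) = (\<Sum>k<N. \<Sum>l<N. scl (\<Sum>a<d. e a k * cnj (e a l)) (g k l))"
    for d and e :: "nat \<Rightarrow> nat \<Rightarrow> complex"
  proof -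
    have "(\<Sum>a<d. \<Sum>k<N. \<Sum>l<N. scl (e a k * cnj (e a l)) (g k l)) = (\<Sum>k<N. \<Sum>a<d. \<Sum>l<N. scl (e a k * cnj (e a l)) (g k l))"
      by (rule sum.swap)
    also have "\<dots> = (\<Sum>k<N. \<Sum>l<N. \<Sum>a<d. scl (e a k * cnj (e a l)) (g k l))"
      by (rule sum.cong[OF refl], rule sum.swap)
    finally show ?thesis by (simp add: fa.scale_sum_left)
  qed
  have d: "(\<Sum>a<d. e a k * cnj (e a l)) + (\<Sum>a<d'. f a k * cnj (f a l)) = (if k = l then 1 else 0)" if "l < N" for k l
    using c[OF ud_cvec[OF that], of k] that by (simp add: proj_def cinner_ud_right ud_apply mult.commute)
  have "(\<Sum>l<N. scl ((\<Sum>a<d. e a k * cnj (e a l)) + (\<Sum>a<d'. f a k * cnj (f a l))) (g k l)) = g k k" if "k < N" for k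
  proof -
    have "(\<Sum>l<N. scl ((\<Sum>a<d. e a k * cnj (e a l)) + (\<Sum>a<d'. f a k * cnj (f a l))) (g k l))
        = (\<Sum>l<N. if l = k then g k l else 0)"
      by (intro sum.cong refl) (simp add: d)
    then show ?thesis using that by simp
  qed
  then show ?thesis
    by (simp add: sw sum.distrib[symmetric] fa.scale_left_distrib[symmetric])
qed

text \<open>Inserting the resolution of the identity into the coproduct and unitarity relations
  leaves the wanted sum over \<open>e\<close> and a sum over \<open>f\<close>; the latter dies
  because the off-diagonal blocks lie in the ideal.\<close>

lemma block_corep:
  assumes w: "unitary_corep q N w" and e: "onf N d e" and f: "\<And>a. a < d' \<Longrightarrow> f a \<in> cvec N"
    and c: "\<And>x i. x \<in> cvec N \<Longrightarrow> x i = proj N d e x i + proj N d' f x i"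
    and ef: "\<And>a b. a < d \<Longrightarrow> b < d' \<Longrightarrow> mcoef N w (e a) (f b) \<in> RelIdeal q"
    and fe: "\<And>a b. a < d \<Longrightarrow> b < d' \<Longrightarrow> mcoef N w (f b) (e a) \<in> RelIdeal q"
  shows "unitary_corep q d (\<lambda>a b. mcoef N w (e a) (e b))"
  unfolding unitary_corep_def
proof (intro allI impI conjI)
  fix i j assume ij: "i < d" "j < d"
  have ec: "e a \<in> cvec N" if "a < d" for a using e that by (simp add: onf_def)
  note [simp] = ec[OF ij(1)] ec[OF ij(2)]
  let ?m = "mcoef N w"
  show "eps (?m (e i) (e j)) = (if i = j then 1 else 0)"
    using ij e by (simp add: eps_mcoef[OF w] onf_def)
  have t: "tensor (?m (e i) v) (?m v (e j)) = (\<Sum>k<N. \<Sum>l<N. scl (v k * cnj (v l)) (tensor (?m (e i) (ud k)) (?m (ud l) (e j))))"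
    if "v \<in> cvec N" for v
    unfolding mcoef_expand_right[OF that, of w "e i"] mcoef_expand_left[OF that, of w "e j"]
    by (simp add: tensor_sum_left tensor_sum_right tensor_scl_left tensor_scl_right mult.commute scl_sum, rule sum.swap)
  have cop: "cop q (?m (e i) (e j)) - (\<Sum>k<N. tensor (?m (e i) (ud k)) (?m (ud k) (e j))) \<in> RelIdeal2 q"
  proof -
    have eq: "tensor (?m (e i) (ud k)) (?m (ud k) (e j))
      = (\<Sum>i'<N. \<Sum>j'<N. scl (cnj (e i i') * e j j') (tensor (w i' k) (w k j')))" if "k < N" for k
      unfolding mcoef_expand_right[of "e j" N, simplified] mcoef_expand_left[of "e i" N, simplified]
      using that by (simp add: mcoef_ud tensor_sum_left tensor_sum_right tensor_scl_left tensor_scl_right mult.commute scl_sum,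
          intro sum.swap)
    have "(\<Sum>k<N. tensor (?m (e i) (ud k)) (?m (ud k) (e j)))
        = (\<Sum>k<N. \<Sum>i'<N. \<Sum>j'<N. scl (cnj (e i i') * e j j') (tensor (w i' k) (w k j')))"
      by (intro sum.cong refl eq) auto
    also have "\<dots> = (\<Sum>i'<N. \<Sum>j'<N. scl (cnj (e i i') * e j j') (\<Sum>k<N. tensor (w i' k) (w k j')))"
      unfolding scl_sum by (rule sum4_swap[symmetric])
    finally have A: "(\<Sum>k<N. tensor (?m (e i) (ud k)) (?m (ud k) (e j)))
        = (\<Sum>i'<N. \<Sum>j'<N. scl (cnj (e i i') * e j j') (\<Sum>k<N. tensor (w i' k) (w k j')))" .
    have "cop q (?m (e i) (e j)) - (\<Sum>k<N. tensor (?m (e i) (ud k)) (?m (ud k) (e j)))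
       = (\<Sum>i'<N. \<Sum>j'<N. scl (cnj (e i i') * e j j') (cop q (w i' j') - (\<Sum>k<N. tensor (w i' k) (w k j'))))"
      unfolding A mcoef_def[of N w "e i" "e j"] by (simp only: cop_sum cop_lin sum_subtractf scl_diff)
    moreover have "cop q (w i' j') - (\<Sum>k<N. tensor (w i' k) (w k j')) \<in> RelIdeal2 q" if "i' < N" "j' < N" for i' j'
      using w that by (simp add: unitary_corep_def)
    ultimately show ?thesis
      by (simp only:) (intro fa.subspace_sum[OF Rel2_subspace] fa.subspace_scale[OF Rel2_subspace]; simp)
  qed
  have "(\<Sum>k<N. tensor (?m (e i) (ud k)) (?m (ud k) (e j)))
      = (\<Sum>a<d. tensor (?m (e i) (e a)) (?m (e a) (e j))) + (\<Sum>a<d'. tensor (?m (e i) (f a)) (?m (f a) (e j)))"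
  proof -
    have "(\<Sum>a<d. tensor (?m (e i) (e a)) (?m (e a) (e j))) = (\<Sum>a<d. \<Sum>k<N. \<Sum>l<N. scl (e a k * cnj (e a l)) ((\<lambda>k l. tensor (?m (e i) (ud k)) (?m (ud l) (e j))) k l))"
      by (rule sum.cong[OF refl]) (simp only: t ec lessThan_iff)
    moreover have "(\<Sum>a<d'. tensor (?m (e i) (f a)) (?m (f a) (e j))) = (\<Sum>a<d'. \<Sum>k<N. \<Sum>l<N. scl (f a k * cnj (f a l)) ((\<lambda>k l. tensor (?m (e i) (ud k)) (?m (ud l) (e j))) k l))"
      by (rule sum.cong[OF refl]) (simp only: t f lessThan_iff)
    ultimately show ?thesis using complete_sum[OF c, of "\<lambda>k l. tensor (?m (e i) (ud k)) (?m (ud l) (e j))"] by (simp only:)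
  qed
  moreover have "(\<Sum>a<d'. tensor (?m (e i) (f a)) (?m (f a) (e j))) \<in> RelIdeal2 q"
    by (intro Rel2_simps Rel2_left ef ij) auto
  ultimately show "cop q (?m (e i) (e j)) - (\<Sum>k<d. tensor (?m (e i) (e k)) (?m (e k) (e j))) \<in> RelIdeal2 q"
    using fa.subspace_add[OF Rel2_subspace cop, of "\<Sum>a<d'. tensor (?m (e i) (f a)) (?m (f a) (e j))"]
    by (simp add: algebra_simps)
  have dlt: "cinner N (e i) (e j) = (if i = j then 1 else 0)" using e ij by (simp add: onf_def)
  have s1: "star (?m v (e i)) * ?m v (e j) = (\<Sum>k<N. \<Sum>l<N. scl (v k * cnj (v l)) (star (?m (ud k) (e i)) * ?m (ud l) (e j)))"
    if "v \<in> cvec N" for v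
    unfolding mcoef_expand_left[OF that, of w]
    by (simp add: star_sum star_lin sum_product mult.commute)
  have s2: "?m (e i) v * star (?m (e j) v) = (\<Sum>k<N. \<Sum>l<N. scl (v k * cnj (v l)) (?m (e i) (ud k) * star (?m (e j) (ud l))))"
    if "v \<in> cvec N" for v
    unfolding mcoef_expand_right[OF that, of w]
    by (simp add: star_sum star_lin sum_product mult.commute)
  have m1: "?m (ud k) y = (\<Sum>l<N. scl (y l) (w k l))" if "k < N" "y \<in> cvec N" for k y
    using that by (simp add: mcoef_expand_right[of y N] mcoef_ud)
  have m2: "?m y (ud k) = (\<Sum>l<N. scl (cnj (y l)) (w l k))" if "k < N" "y \<in> cvec N" for k y
    using that by (simp add: mcoef_expand_left[of y N] mcoef_ud)
  have del: "(\<Sum>l<N. \<Sum>l'<N. scl (cnj (e i l) * e j l') (if l = l' then 1 else 0)) = (if i = j then 1 else (0::falg))"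
  proof -
    have "(\<Sum>l<N. \<Sum>l'<N. scl (cnj (e i l) * e j l') (if l = l' then 1 else (0::falg))) = scl (cinner N (e i) (e j)) 1"
      by (simp add: if_distrib[of "scl _"] sum.delta' cinner_def fa.scale_sum_left cong: if_cong)
    then show ?thesis by (simp add: dlt)
  qed
  have "(\<Sum>k<N. star (?m (ud k) (e i)) * ?m (ud k) (e j))
     = (\<Sum>k<N. \<Sum>l<N. \<Sum>l'<N. scl (cnj (e i l) * e j l') (star (w k l) * w k l'))"
    by (intro sum.cong refl) (simp add: m1 star_sum star_lin sum_product mult.commute)
  also have "\<dots> = (\<Sum>l<N. \<Sum>l'<N. scl (cnj (e i l) * e j l') (\<Sum>k<N. star (w k l) * w k l'))"
    unfolding scl_sum by (rule sum4_swap[symmetric])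
  also have "\<dots> \<simeq> (\<Sum>l<N. \<Sum>l'<N. scl (cnj (e i l) * e j l') (if l = l' then 1 else 0))"
    using w by (intro eqv_sum eqv_scl) (simp add: unitary_corep_def eqv_def)
  finally have 1: "(\<Sum>k<N. star (?m (ud k) (e i)) * ?m (ud k) (e j)) \<simeq> (if i = j then 1 else 0)" unfolding del .
  have "(\<Sum>k<N. star (?m (ud k) (e i)) * ?m (ud k) (e j))
      = (\<Sum>a<d. star (?m (e a) (e i)) * ?m (e a) (e j)) + (\<Sum>a<d'. star (?m (f a) (e i)) * ?m (f a) (e j))"
  proof -
    have "(\<Sum>a<d. star (?m (e a) (e i)) * ?m (e a) (e j)) = (\<Sum>a<d. \<Sum>k<N. \<Sum>l<N. scl (e a k * cnj (e a l)) ((\<lambda>k l. star (?m (ud k) (e i)) * ?m (ud l) (e j)) k l))"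
      by (rule sum.cong[OF refl]) (simp only: s1 ec lessThan_iff)
    moreover have "(\<Sum>a<d'. star (?m (f a) (e i)) * ?m (f a) (e j)) = (\<Sum>a<d'. \<Sum>k<N. \<Sum>l<N. scl (f a k * cnj (f a l)) ((\<lambda>k l. star (?m (ud k) (e i)) * ?m (ud l) (e j)) k l))"
      by (rule sum.cong[OF refl]) (simp only: s1 f lessThan_iff)
    ultimately show ?thesis using complete_sum[OF c, of "\<lambda>k l. star (?m (ud k) (e i)) * ?m (ud l) (e j)"] by (simp only:)
  qed
  moreover have "(\<Sum>a<d'. star (?m (f a) (e i)) * ?m (f a) (e j)) \<in> RelIdeal q"
    by (intro Rel_sum Rel_mult_left fe ij) auto
  ultimately show "(\<Sum>k<d. star (?m (e k) (e i)) * ?m (e k) (e j)) - (if i = j then 1 else 0) \<in> RelIdeal q"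
    using Rel_diff[OF 1[unfolded eqv_def], of "\<Sum>a<d'. star (?m (f a) (e i)) * ?m (f a) (e j)"] by (simp add: algebra_simps)
  have "(\<Sum>k<N. ?m (e i) (ud k) * star (?m (e j) (ud k)))
     = (\<Sum>k<N. \<Sum>l<N. \<Sum>l'<N. scl (cnj (e i l) * e j l') (w l k * star (w l' k)))"
    by (intro sum.cong refl) (simp add: m2 star_sum star_lin sum_product mult.commute)
  also have "\<dots> = (\<Sum>l<N. \<Sum>l'<N. scl (cnj (e i l) * e j l') (\<Sum>k<N. w l k * star (w l' k)))"
    unfolding scl_sum by (rule sum4_swap[symmetric])
  also have "\<dots> \<simeq> (\<Sum>l<N. \<Sum>l'<N. scl (cnj (e i l) * e j l') (if l = l' then 1 else 0))"
    using w by (intro eqv_sum eqv_scl) (simp add: unitary_corep_def eqv_def)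
  finally have 2: "(\<Sum>k<N. ?m (e i) (ud k) * star (?m (e j) (ud k))) \<simeq> (if i = j then 1 else 0)" unfolding del .
  have "(\<Sum>k<N. ?m (e i) (ud k) * star (?m (e j) (ud k)))
      = (\<Sum>a<d. ?m (e i) (e a) * star (?m (e j) (e a))) + (\<Sum>a<d'. ?m (e i) (f a) * star (?m (e j) (f a)))"
  proof -
    have "(\<Sum>a<d. ?m (e i) (e a) * star (?m (e j) (e a))) = (\<Sum>a<d. \<Sum>k<N. \<Sum>l<N. scl (e a k * cnj (e a l)) ((\<lambda>k l. ?m (e i) (ud k) * star (?m (e j) (ud l))) k l))"
      by (rule sum.cong[OF refl]) (simp only: s2 ec lessThan_iff)
    moreover have "(\<Sum>a<d'. ?m (e i) (f a) * star (?m (e j) (f a))) = (\<Sum>a<d'. \<Sum>k<N. \<Sum>l<N. scl (f a k * cnj (f a l)) ((\<lambda>k l. ?m (e i) (ud k) * star (?m (e j) (ud l))) k l))"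
      by (rule sum.cong[OF refl]) (simp only: s2 f lessThan_iff)
    ultimately show ?thesis using complete_sum[OF c, of "\<lambda>k l. ?m (e i) (ud k) * star (?m (e j) (ud l))"] by (simp only:)
  qed
  moreover have "(\<Sum>a<d'. ?m (e i) (f a) * star (?m (e j) (f a))) \<in> RelIdeal q"
    by (intro Rel_sum Rel_mult_right ef ij) auto
  ultimately show "(\<Sum>k<d. ?m (e i) (e k) * star (?m (e j) (e k))) - (if i = j then 1 else 0) \<in> RelIdeal q"
    using Rel_diff[OF 2[unfolded eqv_def], of "\<Sum>a<d'. ?m (e i) (f a) * star (?m (e j) (f a))"] by (simp add: algebra_simps)
qed

end

section \<open>Decomposition into irreducible corepresentations\<close>

lemma sum_div_mod: "(\<Sum>I<N * M. F (I div M) (I mod M)) = (\<Sum>i<N. \<Sum>j<M. F i j)" for F :: "nat \<Rightarrow> nat \<Rightarrow> 'a::comm_monoid_add"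
proof -
  have "(\<Sum>I<N * M. F (I div M) (I mod M)) = (\<Sum>i<N. \<Sum>I\<in>{i * M..<i * M + M}. F (I div M) (I mod M))"
    by (rule sum.nat_group[symmetric])
  also have "\<dots> = (\<Sum>i<N. \<Sum>j<M. F i j)"
  proof (rule sum.cong[OF refl])
    fix i
    have "(\<Sum>I\<in>{0 + i * M..<M + i * M}. F (I div M) (I mod M)) = (\<Sum>j\<in>{0..<M}. F ((j + i * M) div M) ((j + i * M) mod M))"
      by (rule sum.shift_bounds_nat_ivl)
    also have "\<dots> = (\<Sum>j\<in>{0..<M}. F i j)" by (intro sum.cong refl) simp
    finally show "(\<Sum>I\<in>{i * M..<i * M + M}. F (I div M) (I mod M)) = (\<Sum>j<M. F i j)"
      by (simp add: add.commute lessThan_atLeast0)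
  qed
  finally show ?thesis .
qed

context sq
begin

type_synonym comp = "nat \<times> (nat \<Rightarrow> nat \<Rightarrow> falg) \<times> ((nat \<Rightarrow> complex) \<Rightarrow> nat \<Rightarrow> complex)"

text \<open>Commuting with every functional encodes a morphism of comodules; surjectivity lets
  highest weight vectors of the target be lifted, see \<open>intw_weight\<close>.\<close>

definition intw :: "nat \<Rightarrow> (nat \<Rightarrow> nat \<Rightarrow> falg) \<Rightarrow> nat \<Rightarrow> (nat \<Rightarrow> nat \<Rightarrow> falg) \<Rightarrow> ((nat \<Rightarrow> complex) \<Rightarrow> nat \<Rightarrow> complex) \<Rightarrow> bool"
  where "intw N w M v T \<longleftrightarrow> (\<forall>x\<in>cvec N. T x \<in> cvec M) \<and> (\<forall>y\<in>cvec M. \<exists>x\<in>cvec N. T x = y) \<and>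
    (\<forall>h\<in>Udual q. \<forall>x\<in>cvec N. T (rep N w h x) = rep M v h (T x))"

definition Tc :: "nat \<Rightarrow> nat \<Rightarrow> (nat \<Rightarrow> nat \<Rightarrow> complex) \<Rightarrow> (nat \<Rightarrow> complex) \<Rightarrow> nat \<Rightarrow> complex"
  where "Tc N d e x = (\<lambda>a. if a < d then cinner N (e a) x else 0)"

lemma rep_add: "rep N u h (\<lambda>i. x i + y i) = (\<lambda>i. rep N u h x i + rep N u h y i)"
  using rep_lin[of N u h x 1 y] by simp

lemma proj_inner: 
  assumes c: "\<And>x i. x \<in> cvec N \<Longrightarrow> x i = proj N d e x i + proj N d' f x i" and x: "x \<in> cvec N"
  shows "cinner N y x = (\<Sum>a<d. cinner N (e a) x * cinner N y (e a)) + (\<Sum>a<d'. cinner N (f a) x * cinner N y (f a))"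
proof -
  have "x = (\<lambda>i. proj N d e x i + proj N d' f x i)" using c[OF x] by (rule ext)
  then have "cinner N y x = cinner N y (\<lambda>i. proj N d e x i + proj N d' f x i)" by (rule arg_cong)
  then show ?thesis by (simp add: cinner_simps proj_def cinner_sum_right)
qed

lemma Tc_intw:
  assumes e: "onf N d e" and f: "\<And>a. a < d' \<Longrightarrow> f a \<in> cvec N"
    and c: "\<And>x i. x \<in> cvec N \<Longrightarrow> x i = proj N d e x i + proj N d' f x i"
    and ef: "\<And>a b. a < d \<Longrightarrow> b < d' \<Longrightarrow> mcoef N w (e a) (f b) \<in> RelIdeal q"
  shows "intw N w d (\<lambda>a b. mcoef N w (e a) (e b)) (Tc N d e)"
  unfolding intw_def
proof (intro conjI ballI)
  show "Tc N d e x \<in> cvec d" for x by (simp add: Tc_def cvec_def)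
next
  fix y assume y: "y \<in> cvec d"
  have "(\<lambda>i. \<Sum>a<d. y a * e a i) \<in> cvec N" using e by (intro cvec_lin(4)) (simp add: onf_def)
  moreover have "Tc N d e (\<lambda>i. \<Sum>a<d. y a * e a i) = y"
  proof
    fix b
    have "(\<Sum>a<d. y a * cinner N (e b) (e a)) = (\<Sum>a<d. if a = b then y a else 0)" if "b < d"
      by (intro sum.cong refl) (use onf_inner[OF e that] in auto)
    then show "Tc N d e (\<lambda>i. \<Sum>a<d. y a * e a i) b = y b" using y
      by (auto simp: Tc_def cinner_sum_right cvec_def)
  qed
  ultimately show "\<exists>x\<in>cvec N. Tc N d e x = y" by blast
next
  fix h x assume h: "h \<in> Udual q" and x: "x \<in> cvec N"
  show "Tc N d e (rep N w h x) = rep d (\<lambda>a b. mcoef N w (e a) (e b)) h (Tc N d e x)"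
  proof
    fix a
    show "Tc N d e (rep N w h x) a = rep d (\<lambda>a b. mcoef N w (e a) (e b)) h (Tc N d e x) a"
    proof (cases "a < d")
      case True
      have "x = (\<lambda>i. proj N d e x i + proj N d' f x i)" using c[OF x] by auto
      then have "rep N w h x = rep N w h (\<lambda>i. proj N d e x i + proj N d' f x i)" by (rule arg_cong)
      then have "cinner N (e a) (rep N w h x) = cinner N (e a) (rep N w h (proj N d e x)) + cinner N (e a) (rep N w h (proj N d' f x))"
        by (simp only: rep_add cinner_simps)
      moreover have "cinner N (e a) (rep N w h (proj N d' f x)) = 0"
        unfolding proj_def rep_sum cinner_sum_right
        by (intro sum.neutral ballI) (use Udual_zero[OF h ef[OF True]] in \<open>simp add: mcoef_eval Udual_lfun[OF h]\<close>)
      ultimately show ?thesis using True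
        by (simp add: Tc_def rep_def[of d] mcoef_eval Udual_lfun[OF h]) (simp add: proj_def rep_sum cinner_sum_right, simp add: mult.commute)
    qed (simp add: Tc_def rep_def)
  qed
qed

lemma Tc_total:
  assumes e: "onf N d e" and f: "onf N d' f"
    and c: "\<And>x i. x \<in> cvec N \<Longrightarrow> x i = proj N d e x i + proj N d' f x i"
    and ef: "\<And>a b. a < d \<Longrightarrow> b < d' \<Longrightarrow> mcoef N w (e a) (f b) \<in> RelIdeal q"
    and fe: "\<And>a b. a < d \<Longrightarrow> b < d' \<Longrightarrow> mcoef N w (f b) (e a) \<in> RelIdeal q"
    and xy: "x \<in> cvec N" "y \<in> cvec N"
  shows "mcoef N w x y \<simeq> mcoef d (\<lambda>a b. mcoef N w (e a) (e b)) (Tc N d e x) (Tc N d e y) +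
    mcoef d' (\<lambda>a b. mcoef N w (f a) (f b)) (Tc N d' f x) (Tc N d' f y)"
proof (rule eqvI)
  fix h assume h: "h \<in> Udual q"
  have c': "x i = proj N d' f x i + proj N d e x i" if "x \<in> cvec N" for x i using c[OF that] by (simp add: add.commute)
  have 1: "Tc N d e (rep N w h y) = rep d (\<lambda>a b. mcoef N w (e a) (e b)) h (Tc N d e y)"
    using Tc_intw[OF e _ c ef] f h xy(2) by (simp add: intw_def onf_def)
  have 2: "Tc N d' f (rep N w h y) = rep d' (\<lambda>a b. mcoef N w (f a) (f b)) h (Tc N d' f y)"
    using Tc_intw[OF f _ c' fe] e h xy(2) by (simp add: intw_def onf_def)
  have 3: "cinner d (Tc N d e x) (Tc N d e z) = (\<Sum>a<d. cinner N (e a) z * cinner N x (e a))" for d and e z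
    by (auto simp: cinner_def[of d] Tc_def cinner_cnj mult.commute intro!: sum.cong)
  have "cinner N x (rep N w h y) = cinner d (Tc N d e x) (Tc N d e (rep N w h y)) + cinner d' (Tc N d' f x) (Tc N d' f (rep N w h y))"
    unfolding 3 by (rule proj_inner[OF c rep_cvec])
  then show "h (mcoef N w x y) = h (mcoef d (\<lambda>a b. mcoef N w (e a) (e b)) (Tc N d e x) (Tc N d e y) +
    mcoef d' (\<lambda>a b. mcoef N w (f a) (f b)) (Tc N d' f x) (Tc N d' f y))"
    by (simp add: lfun_add[OF Udual_lfun[OF h]] mcoef_eval Udual_lfun[OF h] 1 2)
qed

lemma intw_comp: "intw N w M v T \<Longrightarrow> intw M v K u S \<Longrightarrow> intw N w K u (\<lambda>x. S (T x))"
  unfolding intw_def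
proof (elim conjE, intro conjI ballI)
  fix y assume a: "\<forall>y\<in>cvec M. \<exists>x\<in>cvec N. T x = y" "\<forall>y\<in>cvec K. \<exists>x\<in>cvec M. S x = y" "y \<in> cvec K"
  then obtain z where z: "z \<in> cvec M" "S z = y" by blast
  then obtain x where "x \<in> cvec N" "T x = z" using a(1) by blast
  then show "\<exists>x\<in>cvec N. S (T x) = y" using z by blast
qed auto

text \<open>Induction on the dimension. An invariant subspace has an invariant orthogonal complement
  because \<open>Udual\<close> is stable under \<open>dstar\<close>, so both off-diagonal blocks of
  the coefficient matrix lie in the ideal.\<close>

lemma decomposition:
  assumes "unitary_corep q N w"
  shows "\<exists>L :: comp list. (\<forall>(M, v, T)\<in>set L. irred_unitary_corep q M v \<and> intw N w M v T) \<and>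
    (\<forall>x\<in>cvec N. \<forall>y\<in>cvec N. mcoef N w x y \<simeq> (\<Sum>(M, v, T)\<leftarrow>L. mcoef M v (T x) (T y)))"
  using assms
proof (induction N arbitrary: w rule: less_induct)
  case (less N w)
  note w = less.prems
  show ?case
  proof (cases "N = 0 \<or> irred_unitary_corep q N w")
    case True
    then show ?thesis
    proof
      assume "N = 0"
      then show ?thesis by (intro exI[of _ "[]"]) (simp add: mcoef_def)
    next
      assume i: "irred_unitary_corep q N w"
      have "intw N w N w (\<lambda>x. x)" by (auto simp: intw_def)
      then show ?thesis using i by (intro exI[of _ "[(N, w, \<lambda>x. x)]"]) simp
    qed
  next
    case False
    then obtain V where V: "csubspace N V" "\<And>h. h \<in> Udual q \<Longrightarrow> rep N w h ` V \<subseteq> V" "V \<noteq> {\<lambda>_. 0}" "V \<noteq> cvec N"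
      using w unfolding irred_unitary_corep_def by auto
    obtain d e d' f where ef: "onf N d e" "onf N d' f" "\<And>a. a < d \<Longrightarrow> e a \<in> V" "\<And>a. a < d' \<Longrightarrow> f a \<in> orth N V"
      "\<And>x. x \<in> V \<Longrightarrow> proj N d e x = x" "\<And>x i. x \<in> cvec N \<Longrightarrow> x i = proj N d e x i + proj N d' f x i" "d + d' = N"
      using onb_split[OF V(1)] by metis
    have d0: "d \<noteq> 0"
    proof
      assume "d = 0"
      then have "x = (\<lambda>_. 0)" if "x \<in> V" for x using ef(5)[OF that] by (simp add: proj_def)
      then show False using V(3) csub_zero[OF V(1)] by blast
    qed
    have d0': "d' \<noteq> 0"
    proof
      assume d': "d' = 0"
      have "x \<in> V" if x: "x \<in> cvec N" for x
      proof -
        have "x = proj N d e x" using ef(6)[OF x] d' by (auto simp: proj_def[of N 0])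
        moreover have "proj N d e x \<in> V" unfolding proj_def by (rule csub_sum[OF V(1)]) (use ef(3) in simp)
        ultimately show ?thesis by simp
      qed
      then show False using V(4) csub_cvec[OF V(1)] by blast
    qed
    have fc: "f a \<in> cvec N" if "a < d'" for a using ef(2) that by (simp add: onf_def)
    have ec: "e a \<in> cvec N" if "a < d" for a using ef(1) that by (simp add: onf_def)
    have c': "x i = proj N d' f x i + proj N d e x i" if "x \<in> cvec N" for x i using ef(6)[OF that] by (simp add: add.commute)
    have fe0: "mcoef N w (f b) (e a) \<in> RelIdeal q" if "a < d" "b < d'" for a b
    proof (rule separation)
      fix h assume h: "h \<in> Udual q"
      have "rep N w h (e a) \<in> V" using V(2)[OF h] ef(3)[OF that(1)] by blast
      then have "cinner N (rep N w h (e a)) (f b) = 0" using ef(4)[OF that(2)] by (simp add: orth_def)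
      then have "cinner N (f b) (rep N w h (e a)) = 0" using cinner_cnj[of N "rep N w h (e a)" "f b"] by simp
      then show "h (mcoef N w (f b) (e a)) = 0" by (simp add: mcoef_eval Udual_lfun h)
    qed
    have ef0: "mcoef N w (e a) (f b) \<in> RelIdeal q" if "a < d" "b < d'" for a b
    proof (rule separation)
      fix h assume h: "h \<in> Udual q"
      have "rep N w (dstar q h) (e a) \<in> V" using V(2)[OF Udual_dstar[OF h]] ef(3)[OF that(1)] by blast
      then have "cinner N (rep N w (dstar q h) (e a)) (f b) = 0" using ef(4)[OF that(2)] by (simp add: orth_def)
      then show "h (mcoef N w (e a) (f b)) = 0"
        using rep_adj[OF w Udual_dstar[OF h], of "e a" "f b"] by (simp add: mcoef_eval Udual_lfun h dstar_dstar)
    qed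
    let ?w1 = "\<lambda>a b. mcoef N w (e a) (e b)" and ?w2 = "\<lambda>a b. mcoef N w (f a) (f b)"
    have u1: "unitary_corep q d ?w1" by (rule block_corep[OF w ef(1) fc ef(6) ef0 fe0])
    have u2: "unitary_corep q d' ?w2" by (rule block_corep[OF w ef(2) ec c' fe0 ef0])
    have i1: "intw N w d ?w1 (Tc N d e)" by (rule Tc_intw[OF ef(1) fc ef(6) ef0])
    have i2: "intw N w d' ?w2 (Tc N d' f)" by (rule Tc_intw[OF ef(2) ec c' fe0])
    obtain L1 :: "comp list" where L1: "\<forall>(M, v, T)\<in>set L1. irred_unitary_corep q M v \<and> intw d ?w1 M v T"
      "\<forall>x\<in>cvec d. \<forall>y\<in>cvec d. mcoef d ?w1 x y \<simeq> (\<Sum>(M, v, T)\<leftarrow>L1. mcoef M v (T x) (T y))"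
      using less.IH[OF _ u1] d0' ef(7) by auto
    obtain L2 :: "comp list" where L2: "\<forall>(M, v, T)\<in>set L2. irred_unitary_corep q M v \<and> intw d' ?w2 M v T"
      "\<forall>x\<in>cvec d'. \<forall>y\<in>cvec d'. mcoef d' ?w2 x y \<simeq> (\<Sum>(M, v, T)\<leftarrow>L2. mcoef M v (T x) (T y))"
      using less.IH[OF _ u2] d0 ef(7) by auto
    let ?f1 = "\<lambda>(M, v, T). (M, v, \<lambda>x. T (Tc N d e x)) :: comp" and ?f2 = "\<lambda>(M, v, T). (M, v, \<lambda>x. T (Tc N d' f x)) :: comp"
    let ?L = "map ?f1 L1 @ map ?f2 L2"
    have "irred_unitary_corep q M v \<and> intw N w M v T" if mem: "(M, v, T) \<in> set ?L" for M v T
    proof -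
      consider T' where "(M, v, T') \<in> set L1" "T = (\<lambda>x. T' (Tc N d e x))"
        | T' where "(M, v, T') \<in> set L2" "T = (\<lambda>x. T' (Tc N d' f x))"
        using mem by auto
      then show ?thesis
        by cases (use L1(1) L2(1) intw_comp[OF i1] intw_comp[OF i2] in fastforce)+
    qed
    moreover have "mcoef N w x y \<simeq> (\<Sum>(M, v, T)\<leftarrow>?L. mcoef M v (T x) (T y))" if "x \<in> cvec N" "y \<in> cvec N" for x y
    proof -
      have "mcoef N w x y \<simeq> mcoef d ?w1 (Tc N d e x) (Tc N d e y) + mcoef d' ?w2 (Tc N d' f x) (Tc N d' f y)"
        by (rule Tc_total[OF ef(1,2,6) ef0 fe0 that])
      also have "\<dots> \<simeq> (\<Sum>(M, v, T)\<leftarrow>L1. mcoef M v (T (Tc N d e x)) (T (Tc N d e y)))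
          + (\<Sum>(M, v, T)\<leftarrow>L2. mcoef M v (T (Tc N d' f x)) (T (Tc N d' f y)))"
        by (intro eqv_add L1(2)[rule_format] L2(2)[rule_format]) (use i1 i2 that in \<open>simp_all add: intw_def\<close>)
      also have "\<dots> = (\<Sum>(M, v, T)\<leftarrow>?L. mcoef M v (T x) (T y))"
        by (simp add: o_def case_prod_unfold)
      finally show ?thesis .
    qed
    ultimately show ?thesis by (intro exI[of _ ?L]) blast
  qed
qed

section \<open>Tensor products of corepresentations and spanning by irreducible coefficients\<close>

lemma Rel2_mult: assumes "z \<in> RelIdeal2 q" shows "z * y \<in> RelIdeal2 q \<and> y * z \<in> RelIdeal2 q"
  using assms unfolding RelIdeal2_def
proof (rule fa.span_induct)
  show "fa.subspace (Collect (\<lambda>z. z * y \<in> fa.span ({tensor x y |x y. x \<in> RelIdeal q} \<union> {tensor x y |x y. y \<in> RelIdeal q}) \<and>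
      y * z \<in> fa.span ({tensor x y |x y. x \<in> RelIdeal q} \<union> {tensor x y |x y. y \<in> RelIdeal q})))"
    unfolding RelIdeal2_def[symmetric] by (simp add: fa.subspace_def distrib_left distrib_right Rel2_simps)
next
  fix z assume z: "z \<in> {tensor x y |x y. x \<in> RelIdeal q} \<union> {tensor x y |x y. y \<in> RelIdeal q}"
  have "z * y \<in> RelIdeal2 q \<and> y * z \<in> RelIdeal2 q"
  proof (induction y rule: pm2_induct)
    case (tensor a b)
    have "tensor x y * tensor a b \<in> RelIdeal2 q \<and> tensor a b * tensor x y \<in> RelIdeal2 q" if "x \<in> RelIdeal q" for x y
      by (simp add: tensor_mult Rel2_left Rel_mult_left Rel_mult_right that)
    moreover have "tensor x y * tensor a b \<in> RelIdeal2 q \<and> tensor a b * tensor x y \<in> RelIdeal2 q" if "y \<in> RelIdeal q" for x y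
      by (simp add: tensor_mult Rel2_right Rel_mult_left Rel_mult_right that)
    ultimately show ?case using z by blast
  qed (simp_all add: distrib_left distrib_right Rel2_simps)
  then show "z * y \<in> fa.span ({tensor x y |x y. x \<in> RelIdeal q} \<union> {tensor x y |x y. y \<in> RelIdeal q}) \<and>
      y * z \<in> fa.span ({tensor x y |x y. x \<in> RelIdeal q} \<union> {tensor x y |x y. y \<in> RelIdeal q})"
    by (simp add: RelIdeal2_def)
qed

text \<open>A pair (i, j) with j < M is coded as the single index i M + j.\<close>

definition tcorep :: "nat \<Rightarrow> (nat \<Rightarrow> nat \<Rightarrow> falg) \<Rightarrow> (nat \<Rightarrow> nat \<Rightarrow> falg) \<Rightarrow> nat \<Rightarrow> nat \<Rightarrow> falg"
  where "tcorep M u v = (\<lambda>I J. u (I div M) (J div M) * v (I mod M) (J mod M))"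

definition tvec :: "nat \<Rightarrow> (nat \<Rightarrow> complex) \<Rightarrow> (nat \<Rightarrow> complex) \<Rightarrow> nat \<Rightarrow> complex"
  where "tvec M x y = (\<lambda>I. x (I div M) * y (I mod M))"

lemma tvec_cvec: "0 < M \<Longrightarrow> x \<in> cvec N \<Longrightarrow> tvec M x y \<in> cvec (N * M)"
  by (auto simp: tvec_def cvec_def less_eq_div_iff_mult_less_eq)

lemma tcorep_mcoef: "mcoef (N * M) (tcorep M u v) (tvec M x x') (tvec M y y') = mcoef N u x y * mcoef M v x' y'"
proof -
  have "mcoef (N * M) (tcorep M u v) (tvec M x x') (tvec M y y')
     = (\<Sum>i<N. \<Sum>i'<M. \<Sum>j<N. \<Sum>j'<M. scl (cnj (x i * x' i') * (y j * y' j')) (u i j * v i' j'))"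
    unfolding mcoef_def tcorep_def tvec_def
    by (subst sum_div_mod[of "\<lambda>i i'. \<Sum>J<N * M. scl (cnj (x i * x' i') * (y (J div M) * y' (J mod M))) (u i (J div M) * v i' (J mod M))"],
        subst sum_div_mod[of "\<lambda>j j'. scl (cnj (x _ * x' _) * (y j * y' j')) (u _ j * v _ j')"]) (rule refl)
  also have "\<dots> = (\<Sum>i<N. \<Sum>j<N. \<Sum>i'<M. \<Sum>j'<M. scl (cnj (x i) * y j) (u i j) * scl (cnj (x' i') * y' j') (v i' j'))"
    by (rule sum.cong[OF refl], subst sum.swap) (simp add: mult_ac)
  also have "\<dots> = mcoef N u x y * mcoef M v x' y'"
    unfolding mcoef_def sum_distrib_right unfolding sum_distrib_left by (rule refl)
  finally show ?thesis .
qed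

lemma div_mod_eq_iff: "(i::nat) = j \<longleftrightarrow> i div M = j div M \<and> i mod M = j mod M"
  by (metis div_mult_mod_eq)

lemma tcorep_unitary:
  assumes u: "unitary_corep q N u" and v: "unitary_corep q M v" and M: "0 < M"
  shows "unitary_corep q (N * M) (tcorep M u v)"
  unfolding unitary_corep_def
proof (intro allI impI conjI)
  fix i j assume ij: "i < N * M" "j < N * M"
  define i1 i2 j1 j2 where d: "i1 = i div M" "i2 = i mod M" "j1 = j div M" "j2 = j mod M"
  have lt: "i1 < N" "j1 < N" "i2 < M" "j2 < M"
    using ij M by (simp_all add: d less_mult_imp_div_less)
  have t: "tcorep M u v i j = u i1 j1 * v i2 j2" by (simp add: tcorep_def d)
  have eqij: "i = j \<longleftrightarrow> i1 = j1 \<and> i2 = j2" unfolding d by (rule div_mod_eq_iff)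
  let ?A = "\<Sum>k<N. tensor (u i1 k) (u k j1)" and ?B = "\<Sum>k<M. tensor (v i2 k) (v k j2)"
  have "(\<Sum>k<N * M. tensor (tcorep M u v i k) (tcorep M u v k j)) = (\<Sum>k<N. \<Sum>l<M. tensor (u i1 k * v i2 l) (u k j1 * v l j2))"
    unfolding tcorep_def d by (rule sum_div_mod)
  also have "\<dots> = ?A * ?B" by (simp add: sum_product tensor_mult)
  finally have s: "(\<Sum>k<N * M. tensor (tcorep M u v i k) (tcorep M u v k j)) = ?A * ?B" .
  have "cop q (u i1 j1) * cop q (v i2 j2) - ?A * ?B = (cop q (u i1 j1) - ?A) * cop q (v i2 j2) + ?A * (cop q (v i2 j2) - ?B)"
    by (simp add: algebra_simps)
  moreover have "\<dots> \<in> RelIdeal2 q"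
    by (rule Rel2_simps(2)) (use u v lt Rel2_mult in \<open>auto simp: unitary_corep_def\<close>)
  ultimately show "cop q (tcorep M u v i j) - (\<Sum>k<N * M. tensor (tcorep M u v i k) (tcorep M u v k j)) \<in> RelIdeal2 q"
    unfolding s unfolding t cop_mult by simp
  show "eps (tcorep M u v i j) = (if i = j then 1 else 0)"
    using u v lt by (simp add: t eps_mult unitary_corep_def eqij)
  have s1: "(\<Sum>k<N * M. star (tcorep M u v k i) * tcorep M u v k j) = (\<Sum>k<N. \<Sum>l<M. star (u k i1 * v l i2) * (u k j1 * v l j2))"
    unfolding tcorep_def d by (rule sum_div_mod)
  also have "\<dots> = (\<Sum>l<M. star (v l i2) * ((\<Sum>k<N. star (u k i1) * u k j1) * v l j2))"
    by (subst sum.swap) (simp add: star_mult sum_distrib_left sum_distrib_right mult.assoc)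
  also have "\<dots> \<simeq> (\<Sum>l<M. star (v l i2) * ((if i1 = j1 then 1 else 0) * v l j2))"
    using u lt by (intro eqv_sum eqv_mult eqv_refl) (simp add: unitary_corep_def eqv_def)
  also have "\<dots> = (if i1 = j1 then 1 else 0) * (\<Sum>l<M. star (v l i2) * v l j2)" by simp
  also have "\<dots> \<simeq> (if i1 = j1 then 1 else 0) * (if i2 = j2 then 1 else 0)"
    using v lt by (intro eqv_mult eqv_refl) (simp add: unitary_corep_def eqv_def)
  also have "\<dots> = (if i = j then 1 else 0)" by (simp add: eqij)
  finally show "(\<Sum>k<N * M. star (tcorep M u v k i) * tcorep M u v k j) - (if i = j then 1 else 0) \<in> RelIdeal q"
    by (simp add: eqv_def)
  have "(\<Sum>k<N * M. tcorep M u v i k * star (tcorep M u v j k)) = (\<Sum>k<N. \<Sum>l<M. (u i1 k * v i2 l) * star (u j1 k * v j2 l))"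
    unfolding tcorep_def d by (rule sum_div_mod)
  also have "\<dots> = (\<Sum>k<N. u i1 k * ((\<Sum>l<M. v i2 l * star (v j2 l)) * star (u j1 k)))"
    by (simp add: star_mult sum_distrib_left sum_distrib_right mult.assoc)
  also have "\<dots> \<simeq> (\<Sum>k<N. u i1 k * ((if i2 = j2 then 1 else 0) * star (u j1 k)))"
    using v lt by (intro eqv_sum eqv_mult eqv_refl) (simp add: unitary_corep_def eqv_def)
  also have "\<dots> = (if i2 = j2 then 1 else 0) * (\<Sum>k<N. u i1 k * star (u j1 k))" by simp
  also have "\<dots> \<simeq> (if i2 = j2 then 1 else 0) * (if i1 = j1 then 1 else 0)"
    using u lt by (intro eqv_mult eqv_refl) (simp add: unitary_corep_def eqv_def)
  also have "\<dots> = (if i = j then 1 else 0)" by (simp add: eqij)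
  finally show "(\<Sum>k<N * M. tcorep M u v i k * star (tcorep M u v j k)) - (if i = j then 1 else 0) \<in> RelIdeal q"
    by (simp add: eqv_def)
qed

definition fund :: "nat \<Rightarrow> nat \<Rightarrow> falg" where "fund i j = U (i = 1) (j = 1)"

lemma fund_unitary: "unitary_corep q 2 fund"
proof -
  have A: "star (U False i) * U False j + star (U True i) * U True j - (if i = j then 1 else 0) \<in> RelIdeal q" for i j
  proof -
    have "star (U False i) * U False j + star (U True i) * U True j - (if i = j then 1 else 0) =
      (if i then if j then r2 else r4 else if j then star r4 else r1)"
      by (cases i; cases j) (simp_all add: U_def star_lin star_minus star_gelt star_diff star_mult r1_def r2_def r4_def
          power2_eq_square algebra_simps)
    then show ?thesis by (simp add: r_Rel)
  qed
  have B: "U i False * star (U j False) + U i True * star (U j True) - (if i = j then 1 else 0) \<in> RelIdeal q" for i j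
  proof -
    have "U i False * star (U j False) + U i True * star (U j True) - (if i = j then 1 else 0) =
      (if i then if j then r1 - r3 else star r5 else if j then r5 else r2 + scl ((qc q)\<^sup>2) r3)"
      by (cases i; cases j) (simp_all add: U_def star_lin star_minus star_gelt star_diff star_mult r1_def r2_def r3_def r5_def
          power2_eq_square algebra_simps scl_diff)
    then show ?thesis by (simp add: r_Rel Rel_diff Rel_add Rel_scl)
  qed
  have s: "(\<Sum>k<(2::nat). f (k = 1)) = f False + f True" for f :: "bool \<Rightarrow> 'a::comm_monoid_add"
    by (simp add: numeral_2_eq_2 add.commute)
  have eq: "(i = (1::nat)) = (j = 1) \<longleftrightarrow> i = j" if "i < 2" "j < 2" for i j using that by auto
  show ?thesis
    unfolding unitary_corep_def fund_def
  proof (intro allI impI conjI)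
    fix i j :: nat assume "i < 2" "j < 2"
    note e = eq[OF this]
    show "cop q (U (i = 1) (j = 1)) - (\<Sum>k<(2::nat). tensor (U (i = 1) (k = 1)) (U (k = 1) (j = 1))) \<in> RelIdeal2 q"
      unfolding s[of "\<lambda>k. tensor (U (i = 1) k) (U k (j = 1))"] cop_U sum_bool by (simp add: Rel2_simps(1))
    show "eps (U (i = 1) (j = 1)) = (if i = j then 1 else 0)" by (simp only: eps_U e)
    show "(\<Sum>k<(2::nat). star (U (k = 1) (i = 1)) * U (k = 1) (j = 1)) - (if i = j then 1 else 0) \<in> RelIdeal q"
      unfolding s[of "\<lambda>k. star (U k (i = 1)) * U k (j = 1)"] using A[of "i = 1" "j = 1"] by (simp only: e)
    show "(\<Sum>k<(2::nat). U (i = 1) (k = 1) * star (U (j = 1) (k = 1))) - (if i = j then 1 else 0) \<in> RelIdeal q"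
      unfolding s[of "\<lambda>k. U (i = 1) k * star (U (j = 1) k)"] using B[of "i = 1" "j = 1"] by (simp only: e)
  qed
qed

lemma triv_unitary: "unitary_corep q 1 (\<lambda>_ _. 1)"
  by (simp add: unitary_corep_def cop_one tensor_one Rel2_simps star_one Rel_zero)

lemma triv_irred: "irred_unitary_corep q 1 (\<lambda>_ _. 1)"
  unfolding irred_unitary_corep_def
proof (intro conjI allI impI triv_unitary)
  fix V assume "csubspace 1 V \<and> (\<forall>h\<in>Udual q. rep 1 (\<lambda>_ _. 1) h ` V \<subseteq> V)"
  then have V: "csubspace 1 V" by simp
  show "V = {\<lambda>_. 0} \<or> V = cvec 1"
  proof (cases "V \<subseteq> {\<lambda>_. 0}")
    case True then show ?thesis using csub_zero[OF V] by auto
  next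
    case False
    then obtain x where x: "x \<in> V" "x \<noteq> (\<lambda>_. 0)" by auto
    have xc: "x i = 0" if "i \<noteq> 0" for i using csub_cvec[OF V x(1)] that by (simp add: cvec_def)
    have x0: "x 0 \<noteq> 0"
    proof
      assume "x 0 = 0"
      then have "x = (\<lambda>_. 0)" using xc by (intro ext) (metis)
      then show False using x(2) by simp
    qed
    have "y \<in> V" if y: "y \<in> cvec 1" for y
    proof -
      have "y = (\<lambda>i. (y 0 / x 0) * x i)"
      proof
        fix i show "y i = (y 0 / x 0) * x i"
          using x0 xc[of i] y by (cases "i = 0") (auto simp: cvec_def)
      qed
      then show ?thesis using csub_scale[OF V x(1), of "y 0 / x 0"] by simp
    qed
    then show ?thesis using csub_cvec[OF V] by blast
  qed
qed auto

definition IMC :: "falg set"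
  where "IMC = {mcoef N u x y |N u x y. irred_unitary_corep q N u \<and> x \<in> cvec N \<and> y \<in> cvec N}"

lemma IMC_I: "irred_unitary_corep q N u \<Longrightarrow> x \<in> cvec N \<Longrightarrow> y \<in> cvec N \<Longrightarrow> mcoef N u x y \<in> IMC"
  unfolding IMC_def by blast

lemma irr_span_corep:
  assumes "unitary_corep q N w" "x \<in> cvec N" "y \<in> cvec N"
  shows "mcoef N w x y \<in> fa.span (RelIdeal q \<union> IMC)"
proof -
  obtain L :: "comp list" where L: "\<forall>(M, v, T)\<in>set L. irred_unitary_corep q M v \<and> intw N w M v T"
    "\<forall>x\<in>cvec N. \<forall>y\<in>cvec N. mcoef N w x y \<simeq> (\<Sum>(M, v, T)\<leftarrow>L. mcoef M v (T x) (T y))"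
    using decomposition[OF assms(1)] by blast
  have 1: "(\<Sum>(M, v, T)\<leftarrow>L. mcoef M v (T x) (T y)) \<in> fa.span (RelIdeal q \<union> IMC)"
    using L(1)
  proof (induction L)
    case Nil then show ?case by (simp add: fa.span_zero)
  next
    case (Cons p L)
    obtain M v T where p: "p = (M, v, T)" by (cases p)
    have "mcoef M v (T x) (T y) \<in> IMC"
      using Cons.prems assms(2,3) unfolding p by (intro IMC_I) (auto simp: intw_def)
    then have "mcoef M v (T x) (T y) \<in> fa.span (RelIdeal q \<union> IMC)" by (intro fa.span_base) simp
    then show ?case using Cons by (auto simp: p intro!: fa.span_add)
  qed
  have "mcoef N w x y - (\<Sum>(M, v, T)\<leftarrow>L. mcoef M v (T x) (T y)) \<in> fa.span (RelIdeal q \<union> IMC)"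
    using L(2) assms(2,3) by (intro fa.span_base) (simp add: eqv_def)
  from fa.span_add[OF this 1] show ?thesis by simp
qed

definition MC :: "falg set"
  where "MC = {mcoef N u x y |N u x y. 0 < N \<and> unitary_corep q N u \<and> x \<in> cvec N \<and> y \<in> cvec N}"

lemma MC_mult: "a \<in> MC \<Longrightarrow> b \<in> MC \<Longrightarrow> a * b \<in> MC"
proof -
  assume "a \<in> MC" "b \<in> MC"
  then obtain N u x y M v x' y' where "a = mcoef N u x y" "0 < N" "unitary_corep q N u" "x \<in> cvec N" "y \<in> cvec N"
    "b = mcoef M v x' y'" "0 < M" "unitary_corep q M v" "x' \<in> cvec M" "y' \<in> cvec M"
    by (auto simp: MC_def)
  then have "a * b = mcoef (N * M) (tcorep M u v) (tvec M x x') (tvec M y y') \<and> 0 < N * M \<and>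
     unitary_corep q (N * M) (tcorep M u v) \<and> tvec M x x' \<in> cvec (N * M) \<and> tvec M y y' \<in> cvec (N * M)"
    by (simp add: tcorep_mcoef tcorep_unitary tvec_cvec)
  then show ?thesis unfolding MC_def by blast
qed

lemma MC_U: "U i j \<in> MC"
proof -
  have "U i j = mcoef 2 fund (ud (if i then 1 else 0)) (ud (if j then 1 else 0))"
    by (simp add: mcoef_ud fund_def)
  moreover have "ud (if i then 1 else 0) \<in> cvec 2" for i by (rule ud_cvec) simp
  ultimately show ?thesis unfolding MC_def using fund_unitary zero_less_numeral by blast
qed

lemma MC_uw: "length I = length J \<Longrightarrow> uw I J \<in> MC"
proof (induction I J rule: list_induct2)
  case Nil
  have "1 = mcoef 1 (\<lambda>_ _. 1) (ud 0) (ud 0)" by (simp add: mcoef_ud)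
  then show ?case unfolding MC_def uw_Nil using triv_unitary ud_cvec[of 0 1] zero_less_one by blast
qed (simp add: MC_mult MC_U)

text \<open>Entries of U_1/2 are coefficients of a unitary corepresentation, tensor products close
  such coefficients under multiplication, and every corepresentation decomposes.\<close>

lemma irr_span: "x \<in> fa.span (RelIdeal q \<union> IMC)"
proof (induction x rule: falg_induct)
  case (uw I J)
  from MC_uw[OF this] show ?case using irr_span_corep by (auto simp: MC_def)
qed (simp_all add: fa.span_zero fa.span_add fa.span_scale)

lemma irr_induct [case_names Rel add scl irr]:
  assumes "\<And>x. x \<in> RelIdeal q \<Longrightarrow> P x" "\<And>x y. P x \<Longrightarrow> P y \<Longrightarrow> P (x + y)" "\<And>c x. P x \<Longrightarrow> P (scl c x)"
    "\<And>N u x y. irred_unitary_corep q N u \<Longrightarrow> x \<in> cvec N \<Longrightarrow> y \<in> cvec N \<Longrightarrow> P (mcoef N u x y)"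
  shows "P x"
  using irr_span[of x]
proof (rule fa.span_induct)
  show "fa.subspace (Collect P)" using assms(1)[OF Rel_zero] assms(2,3) by (simp add: fa.subspace_def)
next
  fix x assume "x \<in> RelIdeal q \<union> IMC" then show "P x" using assms(1,4) by (auto simp: IMC_def)
qed

text \<open>Provides the uniqueness half of the definite description in \<open>Phi\<close>.\<close>

lemma Udual_unique:
  assumes g: "g \<in> Udual q" and h: "h \<in> Udual q"
    and e: "\<And>N u x. irred_unitary_corep q N u \<Longrightarrow> x \<in> cvec N \<Longrightarrow> rep N u g x = rep N u h x"
  shows "g = h"
proof
  fix x show "g x = h x"
  proof (induction x rule: irr_induct)
    case (irr N u x y)
    then show ?case by (simp add: mcoef_eval Udual_lfun g h e)
  qed (simp_all add: Udual_zero g h lfun_simps[OF Udual_lfun[OF g]] lfun_simps[OF Udual_lfun[OF h]])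
qed

end

section \<open>Classification of the irreducible corepresentations\<close>

context sq
begin

text \<open>Filtration by word length. On a fixed level only finitely many weights and eigenvalue
  labels occur, so spectral decompositions become finite sums.\<close>

definition FL :: "nat \<Rightarrow> falg set" where "FL W = fa.span {uw I J |I J. length I = length J \<and> length I \<le> W}"

lemma FL_mono: "W \<le> W' \<Longrightarrow> FL W \<subseteq> FL W'"
  unfolding FL_def by (rule fa.span_mono) (blast intro: le_trans)

lemma FL_ex: "\<exists>W. x \<in> FL W"
proof (induction x rule: falg_induct)
  case (add x y)
  then obtain W W' where "x \<in> FL W" "y \<in> FL W'" by auto
  then have "x \<in> FL (max W W')" "y \<in> FL (max W W')" using FL_mono by (meson max.cobounded1 max.cobounded2 subsetD)+
  then show ?case unfolding FL_def by (blast intro: fa.span_add)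
next
  case (uw I J)
  then have "uw I J \<in> FL (length I)" unfolding FL_def
    by (intro fa.span_base CollectI exI[of _ I] exI[of _ J]) simp
  then show ?case by blast
qed (auto simp: FL_def intro: fa.span_zero fa.span_scale)

lemma FL_finite: "finite S \<Longrightarrow> \<exists>W. S \<subseteq> FL W"
proof (induction S rule: finite_induct)
  case (insert x S)
  then obtain W W' where "S \<subseteq> FL W" "x \<in> FL W'" using FL_ex by blast
  then have "S \<subseteq> FL (max W W')" "x \<in> FL (max W W')" using FL_mono by (meson max.cobounded1 max.cobounded2 subset_trans subsetD)+
  then show ?case by blast
qed simp

lemma FL_eq:
  assumes x: "x \<in> FL W" and g: "lfun g" and h: "lfun h"
    and e: "\<And>I J. length I = length J \<Longrightarrow> length I \<le> W \<Longrightarrow> g (uw I J) = h (uw I J)"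
  shows "g x = h x"
  using x unfolding FL_def
proof (rule fa.span_induct)
  show "fa.subspace (Collect (\<lambda>x. g x = h x))" by (simp add: fa.subspace_def lfun_simps[OF g] lfun_simps[OF h])
qed (use e in auto)

lemma rep_FL:
  fixes N :: nat
  obtains W where "\<And>i j. i < N \<Longrightarrow> j < N \<Longrightarrow> u i j \<in> FL W"
proof -
  have "finite ((\<lambda>(i, j). u i j) ` ({..<N} \<times> {..<N}))" by (intro finite_imageI finite_cartesian_product) auto
  then obtain W where "(\<lambda>(i, j). u i j) ` ({..<N} \<times> {..<N}) \<subseteq> FL W" using FL_finite by blast
  then show ?thesis by (intro that[of W]) auto
qed

lemma rep_cong: "(\<And>i j. i < N \<Longrightarrow> j < N \<Longrightarrow> g (u i j) = h (u i j)) \<Longrightarrow> rep N u g x = rep N u h x"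
  by (auto simp: rep_def intro!: sum.cong)

section \<open>q-integers and highest weight vectors\<close>

definition qi :: "int \<Rightarrow> real" where "qi n = (q powi n - q powi (- n)) / (q - 1 / q)"

lemma qint_qi: "qint n = complex_of_real (qi n)"
  by (simp add: qint_def qi_def of_real_power_int)

lemma q_sub: "q - 1 / q < 0"
proof -
  have "q * q < 1" using mult_strict_mono[of q 1 q 1] q_pos q_lt by simp
  then show ?thesis using q_pos by (simp add: pos_less_divide_eq)
qed

lemma qi_minus: "qi (- n) = - qi n"
  by (simp add: qi_def minus_divide_left)

lemma qi_pos: assumes "0 < n" shows "0 < qi n"
proof -
  have "q powi n < 1" using assms q_pos q_lt by (simp add: power_int_def power_less_one_iff)
  moreover have "1 < q powi (- n)"
    using calculation q_pos by (simp add: power_int_minus one_less_inverse_iff)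
  ultimately show ?thesis unfolding qi_def using q_sub by (intro divide_neg_neg) auto
qed

lemma qi_zero: "qi 0 = 0" by (simp add: qi_def)

text \<open>The coefficient in e f^j v = \<open>cc w j\<close> f^(j-1) v for a highest weight vector
  v of weight w: moving e past each f leaves the q-integer of the weight at that stage.\<close>

definition cc :: "int \<Rightarrow> nat \<Rightarrow> real" where "cc w j = (\<Sum>i<j. qi (w - 2 * int i))"

lemma qi_rec: "qi j * qi (w - j + 1) + qi (w - 2 * j) = qi (j + 1) * qi (w - j)"
proof -
  define A B where "A = q powi j" and "B = q powi w"
  have AB: "A \<noteq> 0" "B \<noteq> 0" by (simp_all add: A_def B_def)
  have e: "q powi (- j) = 1 / A" "q powi (w - j + 1) = q * B / A" "q powi (- (w - j + 1)) = A / (q * B)"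
    "q powi (w - 2 * j) = B / (A * A)" "q powi (- (w - 2 * j)) = A * A / B" "q powi (j + 1) = q * A" "q powi (- (j + 1)) = 1 / (q * A)"
    "q powi (w - j) = B / A" "q powi (- (w - j)) = A / B"
  proof -
    have pa: "q powi (x + y) = q powi x * q powi y" "q powi (x - y) = q powi x / q powi y" "q powi (- x) = 1 / q powi x" for x y
      by (simp_all add: power_int_add power_int_diff power_int_minus inverse_eq_divide)
    have 2: "q powi (2 * j) = A * A" using pa(1)[of j j] by (simp only: A_def mult_2)
    show "q powi (- j) = 1 / A" "q powi (w - j + 1) = q * B / A" "q powi (- (w - j + 1)) = A / (q * B)"
      "q powi (w - 2 * j) = B / (A * A)" "q powi (- (w - 2 * j)) = A * A / B" "q powi (j + 1) = q * A" "q powi (- (j + 1)) = 1 / (q * A)"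
      "q powi (w - j) = B / A" "q powi (- (w - j)) = A / B"
      by (simp_all only: pa 2 A_def[symmetric] B_def[symmetric] power_int_1_right) (simp_all add: mult.commute)
  qed
  have "(A - 1 / A) * (q * B / A - A / (q * B)) + (q - 1 / q) * (B / (A * A) - A * A / B) = (q * A - 1 / (q * A)) * (B / A - A / B)"
    using AB by (simp add: field_simps)
  moreover have "x1 / D * (x2 / D) + y / D = z1 / D * (z2 / D)" if "D \<noteq> 0" "x1 * x2 + D * y = z1 * z2" for D x1 x2 y z1 z2 :: real
  proof -
    have "x1 / D * (x2 / D) + y / D = (x1 * x2 + D * y) / (D * D)" using that(1) by (simp add: field_simps)
    then show ?thesis by (simp add: that(2))
  qed
  ultimately show ?thesis unfolding qi_def e A_def[symmetric] using q_sub by simp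
qed

text \<open>Exhibits positivity for 1 \<le> j \<le> w and the zero at j = w + 1, where the string of
  weight vectors ends; \<open>qi_rec\<close> is the induction step.\<close>

lemma cc_closed: "cc w j = qi (int j) * qi (w - int j + 1)"
proof (induction j)
  case (Suc j)
  have "cc w (Suc j) = qi (int j) * qi (w - int j + 1) + qi (w - 2 * int j)" using Suc by (simp add: cc_def)
  also have "\<dots> = qi (int (Suc j)) * qi (w - int (Suc j) + 1)"
    using qi_rec[of "int j" w] by (simp add: add.commute)
  finally show ?case .
qed (simp add: cc_def qi_zero)

text \<open>\<open>nn w j\<close> is the squared norm of f^j v for a unit highest weight vector v,
  by f^* = k^-1 e; \<open>ce w j B\<close> is the coefficient of f^(j-B) v in e^B f^j v.\<close>

primrec nn :: "int \<Rightarrow> nat \<Rightarrow> real" where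
  "nn w 0 = 1"
| "nn w (Suc j) = cc w (Suc j) * q powi (- (w - 2 * int j)) * nn w j"

primrec ce :: "int \<Rightarrow> nat \<Rightarrow> nat \<Rightarrow> real" where
  "ce w j 0 = 1"
| "ce w j (Suc B) = ce w j B * cc w (j - B)"

lemma nn_pos: "int j \<le> w \<Longrightarrow> 0 < nn w j"
proof (induction j)
  case (Suc j)
  have "0 < cc w (Suc j)" unfolding cc_closed using Suc.prems by (intro mult_pos_pos qi_pos) auto
  then show ?case using Suc q_pos by simp
qed simp

definition wv :: "nat \<Rightarrow> (nat \<Rightarrow> nat \<Rightarrow> falg) \<Rightarrow> int \<Rightarrow> (nat \<Rightarrow> complex) \<Rightarrow> bool"
  where "wv N u w v \<longleftrightarrow> v \<in> cvec N \<and> (\<forall>\<phi>. rep N u (Kc \<phi>) v = (\<lambda>i. \<phi> w * v i))"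

lemma wv_Kc: assumes u: "unitary_corep q N u" shows "wv N u w (rep N u (Kc (delta w)) y)"
  unfolding wv_def
proof (intro conjI allI rep_cvec)
  fix \<phi>
  have "conv q (Kc \<phi>) (Kc (delta w)) = (\<lambda>x. \<Sum>s\<in>{()}. \<phi> w * Kc (delta w) x)"
  proof -
    have "Kc (\<lambda>v. \<phi> v * delta w v) x = (\<Sum>s\<in>{()}. \<phi> w * Kc (delta w) x)" for x
      using Kc_sum[of "\<lambda>_. \<phi> w" "\<lambda>_. delta w" "{()}" x] by (simp add: delta_def if_distrib cong: if_cong)
    then show ?thesis by (auto simp: conv_Kc_Kc)
  qed
  then have "rep N u (Kc \<phi>) (rep N u (Kc (delta w)) y) = rep N u (\<lambda>x. \<Sum>s\<in>{()}. \<phi> w * Kc (delta w) x) y"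
    by (simp add: rep_conv[OF u, symmetric])
  also have "\<dots> = (\<lambda>i. \<phi> w * rep N u (Kc (delta w)) y i)" unfolding rep_lincomb by simp
  finally show "rep N u (Kc \<phi>) (rep N u (Kc (delta w)) y) = (\<lambda>i. \<phi> w * rep N u (Kc (delta w)) y i)" .
qed

lemma wv_E: assumes u: "unitary_corep q N u" and v: "wv N u w v" shows "wv N u (w + 2) (rep N u (U_e q) v)"
  using v unfolding wv_def by (auto simp: rep_cvec rep_conv[OF u, symmetric] Kc_U_e) (simp add: rep_conv[OF u] rep_scale)

lemma wv_F: assumes u: "unitary_corep q N u" and v: "wv N u w v" shows "wv N u (w - 2) (rep N u (U_f q) v)"
  using v unfolding wv_def by (auto simp: rep_cvec rep_conv[OF u, symmetric] Kc_U_f) (simp add: rep_conv[OF u] rep_scale)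

lemma wv_orth: assumes u: "unitary_corep q N u" and "wv N u w v" "wv N u w' v'" "w \<noteq> w'" shows "cinner N v v' = 0"
proof -
  have d: "(\<lambda>v. cnj (delta w v)) = delta w" by (auto simp: delta_def)
  have "cinner N (rep N u (Kc (delta w)) v) v' = cinner N v (rep N u (Kc (delta w)) v')"
    using rep_adj[OF u Kc_Udual, of "delta w" v v'] by (simp only: dstar_Kc d)
  then show ?thesis using assms(2-4) by (simp add: wv_def delta_def cinner_simps)
qed

text \<open>Word length bounds the weights that occur, so there is a largest one, and e would raise
  it by 2.\<close>

lemma highest_weight:
  assumes u: "unitary_corep q N u" and N: "0 < N"
  obtains w v where "wv N u w v" "cinner N v v = 1" "rep N u (U_e q) v = (\<lambda>_. 0)"
proof -
  obtain W where W: "\<And>i j. i < N \<Longrightarrow> j < N \<Longrightarrow> u i j \<in> FL W" by (rule rep_FL[of N u]) blast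
  define S where "S = {w. \<exists>y. rep N u (Kc (delta w)) y \<noteq> (\<lambda>_. 0)}"
  have wt_le: "\<bar>wt I\<bar> \<le> int W" if "length I \<le> W" for I using that nT_le[of I] by (simp add: wt_nT abs_le_iff)
  have "S \<subseteq> {- int W..int W}"
  proof
    fix w assume "w \<in> S"
    then obtain y where y: "rep N u (Kc (delta w)) y \<noteq> (\<lambda>_. 0)" by (auto simp: S_def)
    show "w \<in> {- int W..int W}"
    proof (rule ccontr)
      assume n: "w \<notin> {- int W..int W}"
      have "Kc (delta w) (u i j) = 0" if "i < N" "j < N" for i j
      proof (rule FL_eq[OF W[OF that] lfun_Kc, where h = "\<lambda>_. 0"])
        fix I J :: "bool list" assume l: "length I = length J" "length I \<le> W"
        then show "Kc (delta w) (uw I J) = 0" using wt_le[OF l(2)] n by (auto simp: Kc_uw delta_def)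
      qed (simp add: lfun_def)
      then have "rep N u (Kc (delta w)) y = (\<lambda>_. 0)" by (auto simp: rep_def)
      then show False using y by simp
    qed
  qed
  then have fS: "finite S" by (rule finite_subset) simp
  \<comment> \<open>On words of length at most W the counit is the sum of the weight projections, so
    they cannot all vanish.\<close>
  have "S \<noteq> {}"
  proof
    assume e: "S = {}"
    have "eps (u i j) = (\<Sum>s\<in>{- int W..int W}. 1 * Kc (delta s) (u i j))" if "i < N" "j < N" for i j
    proof (rule FL_eq[OF W[OF that] lfun_eps])
      show "lfun (\<lambda>x. \<Sum>s\<in>{- int W..int W}. 1 * Kc (delta s) x)"
        by (rule Udual_lfun, rule Udual_lincomb) simp
      fix I J :: "bool list" assume l: "length I = length J" "length I \<le> W"
      have "(\<Sum>s\<in>{- int W..int W}. delta s (wt I)) = 1"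
        using wt_le[OF l(2)] by (simp add: delta_def sum.delta' abs_le_iff)
      then show "eps (uw I J) = (\<Sum>s\<in>{- int W..int W}. 1 * Kc (delta s) (uw I J))"
        using l by (auto simp: eps_uw Kc_uw)
    qed
    then have "rep N u eps (ud 0) = rep N u (\<lambda>x. \<Sum>s\<in>{- int W..int W}. 1 * Kc (delta s) x) (ud 0)"
      by (rule rep_cong)
    also have "\<dots> = (\<lambda>i. \<Sum>s\<in>{- int W..int W}. 1 * rep N u (Kc (delta s)) (ud 0) i)" by (rule rep_lincomb)
    also have "\<dots> = (\<lambda>_. 0)"
    proof -
      have "rep N u (Kc (delta s)) (ud 0) = (\<lambda>_. 0)" for s using e by (auto simp: S_def)
      then show ?thesis by simp
    qed
    finally have "ud 0 0 = 0" unfolding rep_eps[OF u ud_cvec[OF N]] by (rule fun_cong)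
    then show False by (simp add: ud_same)
  qed
  define w where "w = Max S"
  have "w \<in> S" using fS \<open>S \<noteq> {}\<close> by (simp add: w_def)
  then obtain y where y: "rep N u (Kc (delta w)) y \<noteq> (\<lambda>_. 0)" by (auto simp: S_def)
  define v where "v = rep N u (Kc (delta w)) y"
  have v: "wv N u w v" unfolding v_def by (rule wv_Kc[OF u])
  have vc: "v \<in> cvec N" using v by (simp add: wv_def)
  have Ev: "rep N u (U_e q) v = (\<lambda>_. 0)"
  proof (rule ccontr)
    assume a: "rep N u (U_e q) v \<noteq> (\<lambda>_. 0)"
    have "rep N u (Kc (delta (w + 2))) (rep N u (U_e q) v) = rep N u (U_e q) v"
      using wv_E[OF u v] by (simp add: wv_def delta_def)
    then have "w + 2 \<in> S" using a unfolding S_def by (metis (mono_tags, lifting) mem_Collect_eq)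
    then have "w + 2 \<le> w" using Max_ge[OF fS, of "w + 2"] unfolding w_def by simp
    then show False by simp
  qed
  define r where "r = Re (cinner N v v)"
  have r: "cinner N v v = complex_of_real r" "0 \<le> r" using cinner_self_nnr[of N v] by (auto simp: r_def nnr_def complex_eq_iff)
  have "cinner N v v \<noteq> 0" using cinner_self_zero[OF vc] y by (auto simp: v_def)
  then have r0: "0 < r" using r by auto
  define c where "c = complex_of_real (1 / sqrt r)"
  have cc: "cnj c * (c * complex_of_real r) = 1"
  proof -
    have "(1 / sqrt r) * ((1 / sqrt r) * r) = 1" using r0 by (simp add: field_simps)
    then show ?thesis unfolding c_def complex_cnj_complex_of_real of_real_mult[symmetric] by (simp only: of_real_1)
  qed
  show ?thesis
  proof (rule that[of w "\<lambda>i. c * v i"])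
    show "wv N u w (\<lambda>i. c * v i)"
      using v cvec_lin(3)[of v N c] by (simp add: wv_def rep_scale mult.left_commute)
    show "cinner N (\<lambda>i. c * v i) (\<lambda>i. c * v i) = 1" using cc by (simp add: cinner_simps r mult.left_commute)
    show "rep N u (U_e q) (\<lambda>i. c * v i) = (\<lambda>_. 0)" by (simp add: rep_scale Ev)
  qed
qed

text \<open>Values of the test functionals in the basis f^i v. The corepresentation enters only
  through w = N - 1, so by \<open>density\<close> the dimension determines these coefficients modulo
  the ideal.\<close>

definition tau :: "int \<Rightarrow> nat \<Rightarrow> nat \<Rightarrow> int \<Rightarrow> nat \<Rightarrow> nat \<Rightarrow> complex"
  where "tau w A B w' i j = (if i = j - B + A then delta w' (w - 2 * int j) * complex_of_real (ce w j B) * complex_of_real (nn w i) else 0)"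

definition std_basis :: "nat \<Rightarrow> (nat \<Rightarrow> nat \<Rightarrow> falg) \<Rightarrow> (nat \<Rightarrow> nat \<Rightarrow> complex) \<Rightarrow> bool"
  where "std_basis N u v \<longleftrightarrow> (\<forall>i<N. wv N u (int N - 1 - 2 * int i) (v i)) \<and>
    (\<forall>i<N. \<forall>j<N. cinner N (v i) (v j) = (if i = j then complex_of_real (nn (int N - 1) i) else 0)) \<and>
    (\<forall>A B w i j. i < N \<longrightarrow> j < N \<longrightarrow> tf A B w (mcoef N u (v i) (v j)) = tau (int N - 1) A B w i j)"

lemma cinner_proj_right: "cinner N y (proj N d e x) = (\<Sum>a<d. cinner N (e a) x * cinner N y (e a))"
  by (simp add: proj_def cinner_sum_right)

text \<open>The vectors f^j v0 span a subspace invariant under all of \<open>Udual\<close>, hence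
  everything by irreducibility; positivity of the norms and the zero of \<open>cc\<close> then force
  the highest weight to be N - 1.\<close>

lemma std_basis_exists:
  assumes irr: "irred_unitary_corep q N u"
  shows "\<exists>v. std_basis N u v"
proof -
  have u: "unitary_corep q N u" and N: "0 < N" using irr by (simp_all add: irred_unitary_corep_def)
  obtain w v0 where v0: "wv N u w v0" "cinner N v0 v0 = 1" "rep N u (U_e q) v0 = (\<lambda>_. 0)"
    by (rule highest_weight[OF u N])
  define v where "v j = rep N u (conv_pow q (U_f q) j) v0" for j
  have v00: "v 0 = v0" using v0(1) by (simp add: v_def rep_eps[OF u] wv_def)
  have vS: "v (Suc j) = rep N u (U_f q) (v j)" for j by (simp add: v_def rep_conv[OF u])
  have vw: "wv N u (w - 2 * int j) (v j)" for j
  proof (induction j)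
    case (Suc j) show ?case using wv_F[OF u Suc] by (simp add: vS algebra_simps)
  qed (simp add: v00 v0)
  have vc: "v j \<in> cvec N" for j using vw[of j] by (simp add: wv_def)
  have Ev: "rep N u (U_e q) (v j) = (\<lambda>i. complex_of_real (cc w j) * v (j - 1) i)" for j
  proof (induction j)
    case (Suc j)
    have EF: "conv q (U_e q) (U_f q) = (\<lambda>x. \<Sum>s\<in>UNIV. 1 * (if s then Kc qint else conv q (U_f q) (U_e q)) x)"
      by (rule ext) (simp add: sum_bool E_F_comm)
    have "rep N u (U_e q) (v (Suc j)) = rep N u (conv q (U_e q) (U_f q)) (v j)" by (simp add: vS rep_conv[OF u])
    also have "\<dots> = (\<lambda>i. rep N u (U_f q) (rep N u (U_e q) (v j)) i + rep N u (Kc qint) (v j) i)"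
      unfolding EF rep_lincomb by (simp add: sum_bool rep_conv[OF u])
    also have "\<dots> = (\<lambda>i. complex_of_real (cc w j) * rep N u (U_f q) (v (j - 1)) i + qint (w - 2 * int j) * v j i)"
      using vw[of j] by (simp add: Suc rep_scale wv_def)
    also have "\<dots> = (\<lambda>i. complex_of_real (cc w (Suc j)) * v (Suc j - 1) i)"
      by (cases j) (simp_all add: cc_def vS[symmetric] qint_qi algebra_simps)
    finally show ?case .
  qed (simp add: v00 v0 cc_def)
  have nS: "cinner N (v (Suc j)) (v (Suc j)) = complex_of_real (cc w (Suc j) * q powi (- (w - 2 * int j))) * cinner N (v j) (v j)" for j
  proof -
    have "cinner N (v (Suc j)) (v (Suc j)) = cinner N (v j) (rep N u (conv q (U_kinv q) (U_e q)) (v (Suc j)))"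
      by (subst vS) (simp add: rep_adj[OF u] dstar_U_f)
    also have "rep N u (conv q (U_kinv q) (U_e q)) (v (Suc j)) = (\<lambda>i. complex_of_real (cc w (Suc j) * q powi (- (w - 2 * int j))) * v j i)"
      using vw[of j] by (simp add: rep_conv[OF u] Ev rep_scale U_kinv_Kc wv_def of_real_power_int mult.assoc)
    finally show ?thesis by (simp add: cinner_simps)
  qed
  have n: "cinner N (v j) (v j) = complex_of_real (nn w j)" for j
    by (induction j) (simp_all add: v00 v0 nS)
  \<comment> \<open>For negative w the vector f v0 would have a negative squared norm.\<close>
  have w0: "0 \<le> w"
  proof (rule ccontr)
    assume "\<not> 0 \<le> w"
    then have "qi w < 0" using qi_pos[of "- w"] qi_minus[of w] by simp
    then have "nn w 1 < 0" using q_pos by (simp add: cc_def mult_less_0_iff)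
    moreover have "0 \<le> nn w 1"
      using cinner_self_nnr[of N "v 1"] by (simp only: n nnr_def mem_Collect_eq Re_complex_of_real)
    ultimately show False by simp
  qed
  define m where "m = nat w"
  have wm: "w = int m" using w0 by (simp add: m_def)
  \<comment> \<open>\<open>cc w (Suc m)\<close> vanishes, so f^(m+1) v0 has norm zero, and all later
    vectors vanish with it.\<close>
  have vz: "v (Suc m + j) = (\<lambda>_. 0)" for j
  proof (induction j)
    case 0
    have "cc w (Suc m) = 0" by (simp add: cc_closed wm qi_zero)
    then show ?case using n[of "Suc m"] by (intro cinner_self_zero[OF vc]) simp
  next
    case (Suc j) then show ?case using vS[of "Suc m + j"] by (simp add: rep_zero)
  qed
  have orth: "cinner N (v i) (v j) = (if i = j then complex_of_real (nn w i) else 0)" for i j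
    using n wv_orth[OF u vw[of i] vw[of j]] by auto
  have Epow: "rep N u (conv_pow q (U_e q) B) (v j) = (\<lambda>i. complex_of_real (ce w j B) * v (j - B) i)" for B j
    by (induction B) (simp_all add: rep_eps[OF u vc] rep_conv[OF u] rep_scale Ev mult.assoc)
  have Fpow: "rep N u (conv_pow q (U_f q) A) (v j) = v (j + A)" for A j
    by (induction A) (simp_all add: rep_eps[OF u vc] rep_conv[OF u] vS)
  have tfv: "rep N u (tf A B w') (v j) = (\<lambda>i. (delta w' (w - 2 * int j) * complex_of_real (ce w j B)) * v (j - B + A) i)" for A B w' j
    using vw[of j] by (simp add: tf_def rep_conv[OF u] Udual_conv rep_scale Epow Fpow wv_def mult.assoc)
  have tft: "tf A B w' (mcoef N u (v i) (v j)) = tau w A B w' i j" for A B w' i j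
    by (simp add: mcoef_eval Udual_lfun[OF tf_Udual] tfv cinner_simps orth tau_def)
  have npos: "0 < nn w j" if "j < Suc m" for j using that by (intro nn_pos) (simp add: wm)
  define e where "e j = (\<lambda>i. complex_of_real (1 / sqrt (nn w j)) * v j i)" for j
  have eonf: "onf N (Suc m) e"
    unfolding onf_def
  proof (intro allI impI conjI)
    fix a b assume ab: "a < Suc m" "b < Suc m"
    show "e a \<in> cvec N" unfolding e_def by (rule cvec_lin(3)[OF vc])
    have "(1 / sqrt (nn w a)) * ((1 / sqrt (nn w a)) * nn w a) = 1" using npos[OF ab(1)] by (simp add: field_simps)
    then have "complex_of_real (1 / sqrt (nn w a)) * (complex_of_real (1 / sqrt (nn w a)) * complex_of_real (nn w a)) = 1"
      unfolding of_real_mult[symmetric] by (simp only: of_real_1)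
    then show "cinner N (e a) (e b) = (if a = b then 1 else 0)"
      unfolding e_def cinner_simps orth by (auto simp del: of_real_divide)
  qed
  define V where "V = {x \<in> cvec N. proj N (Suc m) e x = x}"
  have projV: "proj N (Suc m) e x \<in> V" for x
  proof -
    define p where "p = proj N (Suc m) e x"
    have "(\<Sum>a<Suc m. cinner N (e a) p * e a i) = (\<Sum>a<Suc m. cinner N (e a) x * e a i)" for i
      by (intro sum.cong refl) (simp add: p_def cinner_proj[OF eonf])
    then have "proj N (Suc m) e p = p" by (simp only: proj_def p_def)
    then have "proj N (Suc m) e (proj N (Suc m) e x) = proj N (Suc m) e x" by (simp only: p_def)
    then show ?thesis using proj_cvec[OF eonf] by (simp add: V_def)
  qed
  have subV: "csubspace N V"
    unfolding csubspace_def V_def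
  proof (intro conjI ballI allI subsetI)
    show "(\<lambda>_. 0) \<in> {x \<in> cvec N. proj N (Suc m) e x = x}" using cvec_lin(2) by (simp add: proj_def cinner_simps)
    fix x y c assume xy: "x \<in> {x \<in> cvec N. proj N (Suc m) e x = x}" "y \<in> {x \<in> cvec N. proj N (Suc m) e x = x}"
    have "proj N (Suc m) e (\<lambda>i. x i + c * y i) = (\<lambda>i. proj N (Suc m) e x i + c * proj N (Suc m) e y i)"
      unfolding proj_def by (intro ext) (simp only: cinner_simps sum_distrib_left sum.distrib[symmetric] algebra_simps)
    then show "(\<lambda>i. x i + c * y i) \<in> {x \<in> cvec N. proj N (Suc m) e x = x}" using xy cvec_lin(1) by auto
  qed auto
  have invV: "rep N u h ` V \<subseteq> V" if h: "h \<in> Udual q" for h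
  proof -
    \<comment> \<open>A vector orthogonal to all f^i v0 gives coefficients killed by every test
      functional; \<open>density\<close> puts them into the ideal, so every member of
      \<open>Udual\<close> kills them.\<close>
    have key: "cinner N \<xi> (rep N u h (v j)) = 0" if x: "\<And>i. cinner N \<xi> (v i) = 0" for \<xi> j
    proof -
      have "mcoef N u \<xi> (v j) \<in> RelIdeal q"
        by (rule density) (simp add: mcoef_eval Udual_lfun[OF tf_Udual] tfv cinner_simps x)
      then show ?thesis using Udual_zero[OF h, of "mcoef N u \<xi> (v j)"] by (simp add: mcoef_eval Udual_lfun[OF h])
    qed
    have hv: "rep N u h (v j) \<in> V" for j
    proof -
      let ?z = "rep N u h (v j)"
      let ?d = "\<lambda>i. ?z i - proj N (Suc m) e ?z i"
      have de: "cinner N (e i) ?d = 0" if "i < Suc m" for i by (simp add: cinner_simps cinner_proj[OF eonf that])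
      have dv: "cinner N ?d (v i) = 0" for i
      proof (cases "i < Suc m")
        case True
        have "v i = (\<lambda>k. complex_of_real (sqrt (nn w i)) * e i k)"
          using npos[OF True] by (simp add: e_def)
        moreover have "cinner N ?d (e i) = 0" using de[OF True] cinner_cnj[of N "e i" ?d] by simp
        ultimately show ?thesis by (simp only: cinner_simps) simp
      next
        case False
        then have "v i = (\<lambda>_. 0)" using vz[of "i - Suc m"] by simp
        then show ?thesis by (simp add: cinner_simps)
      qed
      have "cinner N ?d ?d = cinner N ?d ?z - cinner N ?d (proj N (Suc m) e ?z)" by (rule cinner_simps(5))
      also have "cinner N ?d ?z = 0" by (rule key[OF dv])
      also have "cinner N ?d (proj N (Suc m) e ?z) = 0"
        unfolding cinner_proj_right
      proof (intro sum.neutral ballI)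
        fix a assume "a \<in> {..<Suc m}"
        then have "cinner N (e a) ?d = 0" by (intro de) simp
        then have "cinner N ?d (e a) = 0" using cinner_cnj[of N "e a" ?d] by simp
        then show "cinner N (e a) ?z * cinner N ?d (e a) = 0" by simp
      qed
      finally have d0: "cinner N ?d ?d = 0" by simp
      have z: "?d = (\<lambda>_. 0)"
        by (rule cinner_self_zero[OF cvec_lin(5)[OF rep_cvec proj_cvec[OF eonf]] d0])
      then have "proj N (Suc m) e ?z i = ?z i" for i using fun_cong[OF z, of i] by simp
      then show ?thesis by (auto simp: V_def rep_cvec)
    qed
    show ?thesis
    proof
      fix z assume "z \<in> rep N u h ` V"
      then obtain x where x: "x \<in> V" "z = rep N u h x" by auto
      have "x = proj N (Suc m) e x" using x(1) by (simp add: V_def)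
      then have "rep N u h x = rep N u h (proj N (Suc m) e x)" by (simp only:)
      then have "z = rep N u h (\<lambda>i. \<Sum>a<Suc m. cinner N (e a) x * e a i)" unfolding x(2) proj_def .
      then have z: "z = (\<lambda>i. \<Sum>a<Suc m. cinner N (e a) x * rep N u h (e a) i)" by (simp only: rep_sum)
      have "rep N u h (e a) \<in> V" for a unfolding e_def rep_scale by (rule csub_scale[OF subV hv])
      then show "z \<in> V" unfolding z by (intro csub_sum[OF subV])
    qed
  qed
  have "V \<noteq> {\<lambda>_. 0}"
  proof
    assume e: "V = {\<lambda>_. 0}"
    have "e 0 \<in> V"
    proof -
      have "proj N (Suc m) e (e 0) = e 0"
      proof
        fix i
        have "(\<Sum>a<Suc m. cinner N (e a) (e 0) * e a i) = (\<Sum>a<Suc m. if a = 0 then e 0 i else 0)"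
          by (intro sum.cong refl) (use onf_inner[OF eonf] in auto)
        then show "proj N (Suc m) e (e 0) i = e 0 i" by (simp add: proj_def del: sum.lessThan_Suc)
      qed
      then show ?thesis using eonf by (simp add: V_def onf_def)
    qed
    then have "cinner N (e 0) (e 0) = 0" using e by (simp add: cinner_simps)
    then show False using onf_inner[OF eonf, of 0 0] by simp
  qed
  then have Vall: "V = cvec N" using irr subV invV unfolding irred_unitary_corep_def by blast
  \<comment> \<open>The projection reproduces every unit vector, so the count in
    \<open>onf_trace\<close> yields the dimension.\<close>
  have Nm: "N = Suc m"
  proof -
    have "(\<Sum>a<Suc m. cmod (e a i) ^ 2) = 1" if "i < N" for i
    proof -
      have "complex_of_real (\<Sum>a<Suc m. cmod (e a i) ^ 2) = proj N (Suc m) e (ud i) i"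
        unfolding proj_def cinner_ud_right[OF that] of_real_sum complex_norm_square by (intro sum.cong refl mult.commute)
      also have "proj N (Suc m) e (ud i) = ud i" using Vall ud_cvec[OF that] unfolding V_def by blast
      also have "ud i i = 1" by (rule ud_same)
      finally show ?thesis by (simp only: of_real_eq_1_iff)
    qed
    then have "(\<Sum>i<N. \<Sum>a<Suc m. cmod (e a i) ^ 2) = real N" by simp
    then show ?thesis using onf_trace[OF eonf] by simp
  qed
  have wN: "w = int N - 1" using Nm wm by simp
  show ?thesis
    unfolding std_basis_def
    by (intro exI[of _ v]) (use vw orth tft in \<open>auto simp: wN[symmetric]\<close>)
qed

lemma nnN_pos: "i < N \<Longrightarrow> 0 < nn (int N - 1) i" by (rule nn_pos) simp

lemma std_expand:
  assumes "std_basis N u v" "x \<in> cvec N"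
  shows "x = (\<lambda>k. \<Sum>i<N. (cinner N (v i) x / complex_of_real (nn (int N - 1) i)) * v i k)"
proof -
  define e where "e j = (\<lambda>i. complex_of_real (1 / sqrt (nn (int N - 1) j)) * v j i)" for j
  have sq1: "complex_of_real (1 / sqrt (nn (int N - 1) a)) * (complex_of_real (1 / sqrt (nn (int N - 1) a)) * complex_of_real (nn (int N - 1) a)) = 1"
    if "a < N" for a
  proof -
    have "(1 / sqrt (nn (int N - 1) a)) * ((1 / sqrt (nn (int N - 1) a)) * nn (int N - 1) a) = 1" using nnN_pos[OF that] by (simp add: field_simps)
    then show ?thesis unfolding of_real_mult[symmetric] by (simp only: of_real_1)
  qed
  have "onf N N e"
    unfolding onf_def
  proof (intro allI impI conjI)
    fix a b assume ab: "a < N" "b < N"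
    show "e a \<in> cvec N" unfolding e_def using assms(1) ab by (intro cvec_lin(3)) (simp add: std_basis_def wv_def)
    show "cinner N (e a) (e b) = (if a = b then 1 else 0)"
      using assms(1) ab sq1[OF ab(1)] unfolding e_def cinner_simps std_basis_def by (auto simp del: of_real_divide)
  qed
  from onf_full[OF this assms(2)] have "x = proj N N e x" by simp
  also have "\<dots> = (\<lambda>k. \<Sum>i<N. (cinner N (v i) x / complex_of_real (nn (int N - 1) i)) * v i k)"
    unfolding proj_def
  proof (intro ext sum.cong refl)
    fix k i assume "i \<in> {..<N}"
    then have i: "i < N" by simp
    define c where "c = complex_of_real (1 / sqrt (nn (int N - 1) i))"
    have c: "c * (c * complex_of_real (nn (int N - 1) i)) = 1" using sq1[OF i] by (simp only: c_def)
    then have "c * c = 1 / complex_of_real (nn (int N - 1) i)" using nnN_pos[OF i] by (simp add: field_simps)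
    then have c2: "c * c = 1 / complex_of_real (nn (int N - 1) i)" .
    have c3: "cnj c = c" by (simp add: c_def)
    have "cinner N (e i) x * e i k = (c * c) * (cinner N (v i) x * v i k)"
      unfolding e_def c_def[symmetric] cinner_simps c3 by (simp only: mult_ac)
    then show "cinner N (e i) x * e i k = (cinner N (v i) x / complex_of_real (nn (int N - 1) i)) * v i k"
      unfolding c2 by simp
  qed
  finally show ?thesis .
qed

text \<open>The standard bases of both corepresentations have the same values \<open>tau\<close>, so
  by \<open>density\<close> their coefficients agree modulo the ideal; T matches one basis with the
  other.\<close>

lemma irr_equiv:
  assumes i1: "irred_unitary_corep q N u" and i2: "irred_unitary_corep q N u'"
  shows "\<exists>T. intw N u N u' T \<and> (\<forall>x\<in>cvec N. \<forall>y\<in>cvec N. mcoef N u x y \<simeq> mcoef N u' (T x) (T y))"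
proof -
  have uu: "unitary_corep q N u" "unitary_corep q N u'" using i1 i2 by (simp_all add: irred_unitary_corep_def)
  obtain v v' where v: "std_basis N u v" and v': "std_basis N u' v'" using std_basis_exists i1 i2 by metis
  define c where "c x i = cinner N (v i) x / complex_of_real (nn (int N - 1) i)" for x i
  define T where "T x = (\<lambda>k. \<Sum>i<N. c x i * v' i k)" for x
  have vm: "mcoef N u (v i) (v j) \<simeq> mcoef N u' (v' i) (v' j)" if "i < N" "j < N" for i j
    unfolding eqv_def
    by (rule density) (use v v' that in \<open>simp add: lfun_diff[OF Udual_lfun[OF tf_Udual]] std_basis_def\<close>)
  have Tc: "T x \<in> cvec N" for x
    unfolding T_def by (rule cvec_lin(4)) (use v' in \<open>auto simp: std_basis_def wv_def\<close>)
  have Tm: "mcoef N u x y \<simeq> mcoef N u' (T x) (T y)" if "x \<in> cvec N" "y \<in> cvec N" for x y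
  proof -
    have x: "x = (\<lambda>k. \<Sum>i<N. c x i * v i k)" unfolding c_def by (rule std_expand[OF v that(1)])
    have y: "y = (\<lambda>k. \<Sum>i<N. c y i * v i k)" unfolding c_def by (rule std_expand[OF v that(2)])
    let ?S = "\<lambda>u v. \<Sum>i<N. scl (cnj (c x i)) (\<Sum>j<N. scl (c y j) (mcoef N u (v i) (v j)))"
    have "mcoef N u x y = mcoef N u (\<lambda>k. \<Sum>i<N. c x i * v i k) (\<lambda>k. \<Sum>i<N. c y i * v i k)"
      by (rule arg_cong2[OF x y, of "mcoef N u"])
    then have 1: "mcoef N u x y = ?S u v" by (simp only: mcoef_sum_left mcoef_sum_right)
    have 2: "?S u v \<simeq> ?S u' v'" by (intro eqv_sum eqv_scl vm) auto
    have 3: "mcoef N u' (T x) (T y) = ?S u' v'" by (simp only: T_def mcoef_sum_left mcoef_sum_right)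
    show ?thesis unfolding 1 3 by (rule 2)
  qed
  have Tin: "cinner N (T x) (T y) = cinner N x y" if "x \<in> cvec N" "y \<in> cvec N" for x y
    using Udual_eqv[OF Udual_eps Tm[OF that]] by (simp add: eps_mcoef uu that Tc)
  have surj: "\<exists>x\<in>cvec N. T x = y" if y: "y \<in> cvec N" for y
  proof -
    define b where "b i = cinner N (v' i) y / complex_of_real (nn (int N - 1) i)" for i
    define x where "x = (\<lambda>k. \<Sum>i<N. b i * v i k)"
    have xc: "x \<in> cvec N" unfolding x_def by (rule cvec_lin(4)) (use v in \<open>auto simp: std_basis_def wv_def\<close>)
    have "c x i = b i" if i: "i < N" for i
    proof -
      have "cinner N (v i) x = (\<Sum>j<N. b j * cinner N (v i) (v j))" by (simp add: x_def cinner_sum_right)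
      also have "\<dots> = (\<Sum>j<N. if j = i then b i * complex_of_real (nn (int N - 1) i) else 0)"
        by (intro sum.cong refl) (use v i in \<open>auto simp: std_basis_def\<close>)
      finally show ?thesis using i nnN_pos[OF i] by (simp add: c_def)
    qed
    then have "T x = (\<lambda>k. \<Sum>i<N. b i * v' i k)" by (simp add: T_def)
    also have "\<dots> = y" unfolding b_def by (rule std_expand[OF v' y, symmetric])
    finally show ?thesis using xc by blast
  qed
  have "T (rep N u h x) = rep N u' h (T x)" if h: "h \<in> Udual q" and x: "x \<in> cvec N" for h x
  proof (rule cvec_eqI[OF Tc rep_cvec])
    fix z :: "nat \<Rightarrow> complex" assume "z \<in> cvec N"
    then obtain y where y: "y \<in> cvec N" "z = T y" using surj by blast
    have "cinner N z (T (rep N u h x)) = h (mcoef N u y x)"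
      by (simp add: y Tin rep_cvec mcoef_eval Udual_lfun[OF h])
    also have "\<dots> = h (mcoef N u' (T y) (T x))" by (rule Udual_eqv[OF h Tm[OF y(1) x]])
    finally show "cinner N z (T (rep N u h x)) = cinner N z (rep N u' h (T x))"
      by (simp add: y mcoef_eval Udual_lfun[OF h])
  qed
  then have "intw N u N u' T" using Tc surj by (auto simp: intw_def)
  then show ?thesis using Tm by blast
qed

text \<open>The weights N - 1 - 2i are all odd when N is even.\<close>

lemma even_dim_sign:
  assumes "irred_unitary_corep q N u" "even N" "x \<in> cvec N"
  shows "rep N u (Kc (\<lambda>w. if even w then 1 else - 1)) x = (\<lambda>i. - x i)"
proof -
  obtain v where v: "std_basis N u v" using std_basis_exists assms(1) by blast
  let ?c = "\<lambda>i. cinner N (v i) x / complex_of_real (nn (int N - 1) i)"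
  have x: "x = (\<lambda>k. \<Sum>i<N. ?c i * v i k)" by (rule std_expand[OF v assms(3)])
  have "rep N u (Kc (\<lambda>w. if even w then 1 else - 1)) x = rep N u (Kc (\<lambda>w. if even w then 1 else - 1)) (\<lambda>k. \<Sum>i<N. ?c i * v i k)"
    by (rule arg_cong[OF x, of "rep N u (Kc (\<lambda>w. if even w then 1 else - 1))"])
  also have "\<dots> = (\<lambda>k. \<Sum>i<N. ?c i * rep N u (Kc (\<lambda>w. if even w then 1 else - 1)) (v i) k)" by (rule rep_sum)
  also have "\<dots> = (\<lambda>k. \<Sum>i<N. ?c i * (- v i k))"
    using v assms(2) by (intro ext sum.cong refl) (auto simp: std_basis_def wv_def)
  also have "\<dots> = (\<lambda>k. - (\<Sum>i<N. ?c i * v i k))" by (simp add: sum_negf)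
  also have "\<dots> = (\<lambda>k. - x k)" by (rule arg_cong[OF x[symmetric], of "\<lambda>f k. - f k"])
  finally show ?thesis .
qed

end

section \<open>Functional calculus of \<open>iB\<^sub>t\<close>\<close>

context sq
begin

definition pA :: "real \<Rightarrow> complex" where "pA c = qc (q powr c)"

lemma pA_simps [simp]: "pA c \<noteq> 0" "pA (c + 1) = qc q * pA c" "pA (c - 1) = pA c / qc q" "cnj (pA c) = pA c"
  using q_pos by (simp_all add: pA_def powr_add powr_diff)

lemma pA_simps' [simp]: "pA (1 + c) = qc q * pA c"
  using pA_simps(2)[of c] by (simp add: add.commute)

definition pB :: "real \<Rightarrow> complex" where "pB c = pA c + 1 / pA c"

lemma pB_nz [simp]: "pB c \<noteq> 0"
proof -
  have "pB c = complex_of_real (q powr c + 1 / q powr c)" by (simp add: pB_def pA_def)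
  moreover have "0 < q powr c + 1 / q powr c" using q_pos by (simp add: add_pos_pos)
  ultimately show ?thesis by (metis less_irrefl of_real_eq_0_iff)
qed

definition sg :: "bool \<Rightarrow> real" where "sg s = (if s then 1 else - 1)"

text \<open>The spectral projections of the matrix of \<open>iB\<^sub>t\<close> in \<open>H\<^bsub>1/2\<^esub>\<close>, with \<open>t = q\<^sup>c - q\<^bsup>-c\<^esup>\<close>, for the eigenvalues \<open>[c \<plusminus> 1]\<close>.\<close>

definition pr :: "real \<Rightarrow> bool \<Rightarrow> bool \<Rightarrow> bool \<Rightarrow> complex"
  where "pr c s i j = (if i = j then if s = i then pA c else 1 / pA c else if s = i then \<i> else - \<i>) / pB c"

lemma sg_simps [simp]: "sg True = 1" "sg False = - 1" by (simp_all add: sg_def)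

lemma pr_sum: "pr c True i j + pr c False i j = idm i j"
  by (auto simp: pr_def idm_def pB_def[symmetric] add_divide_distrib[symmetric] add.commute)

lemma pr_mult: "pr c s i False * pr c s' False j + pr c s i True * pr c s' True j = (if s = s' then pr c s i j else 0)"
proof -
  let ?n = "\<lambda>s i j. if i = j then if s = i then pA c else 1 / pA c else if s = i then \<i> else - \<i>"
  have "?n s i False * ?n s' False j + ?n s i True * ?n s' True j = (if s = s' then ?n s i j * pB c else 0)"
    by (cases s; cases s'; cases i; cases j) (simp_all add: pB_def field_simps)
  moreover have "x1 / B * (x2 / B) + y1 / B * (y2 / B) = (x1 * x2 + y1 * y2) / (B * B)" for x1 x2 y1 y2 B :: complex
    by (simp add: add_divide_distrib)
  ultimately show ?thesis unfolding pr_def by simp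
qed

lemma pr_cnj: "cnj (pr c s i j) = pr c s j i"
proof -
  have "cnj (pB c) = pB c" by (simp add: pB_def)
  then show ?thesis by (cases s; cases i; cases j) (simp_all add: pr_def)
qed

text \<open>Contraction of \<open>eE\<close> with two consecutive letters, each moving the label by
  1 up or down; \<open>fe\<close> and \<open>fet\<close> belong to the row and the column relations.
  Equal directions give 0 and opposite directions add up to \<open>eE\<close>, which is exactly what
  \<open>Fc_Udual\<close> needs.\<close>

definition fe :: "bool \<Rightarrow> bool \<Rightarrow> bool \<Rightarrow> bool \<Rightarrow> real \<Rightarrow> complex"
  where "fe s s' i j c = (\<Sum>k\<in>UNIV. \<Sum>l\<in>UNIV. eE k l * (pr c s i k * pr (c + sg s) s' j l))"
definition fet :: "bool \<Rightarrow> bool \<Rightarrow> bool \<Rightarrow> bool \<Rightarrow> real \<Rightarrow> complex"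
  where "fet s s' i j c = (\<Sum>k\<in>UNIV. \<Sum>l\<in>UNIV. eE k l * (pr c s k i * pr (c + sg s) s' l j))"

lemma fe_same: "fe s s i j c = 0" "fet s s i j c = 0"
proof -
  define n where "n = (\<lambda>(a::complex) (s::bool) (i::bool) j. if i = j then if s = i then a else 1 / a else if s = i then \<i> else - \<i> :: complex)"
  have T: "n a True i False * n (qc q * a) True j True = qc q * (n a True i True * n (qc q * a) True j False)"
    "n a True False i * n (qc q * a) True True j = qc q * (n a True True i * n (qc q * a) True False j)" if "a \<noteq> 0" for a
    using that by (cases i; cases j; simp add: n_def)+
  have F: "n a False i False * n (a / qc q) False j True = qc q * (n a False i True * n (a / qc q) False j False)"
    "n a False False i * n (a / qc q) False True j = qc q * (n a False True i * n (a / qc q) False False j)" if "a \<noteq> 0" for a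
    using that by (cases i; cases j; simp add: n_def)+
  have pa: "pA (c + sg s) = (if s then qc q * pA c else pA c / qc q)" by (cases s) simp_all
  have *: "n (pA c) s i False * n (pA (c + sg s)) s j True = qc q * (n (pA c) s i True * n (pA (c + sg s)) s j False)"
    "n (pA c) s False i * n (pA (c + sg s)) s True j = qc q * (n (pA c) s True i * n (pA (c + sg s)) s False j)"
    unfolding pa using T[of "pA c"] F[of "pA c"] by (cases s; simp)+
  have d: "x1 / B * (y1 / C) = w * (x2 / B * (y2 / C))" if "x1 * y1 = w * (x2 * y2)" for x1 x2 y1 y2 w B C :: complex
  proof -
    have "x1 / B * (y1 / C) = (x1 * y1) / (B * C)" by simp
    also have "\<dots> = w * (x2 / B * (y2 / C))" by (simp add: that)
    finally show ?thesis .
  qed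
  have p: "pr c s i j = n (pA c) s i j / pB c" for c s i j by (simp add: pr_def n_def)
  show "fe s s i j c = 0" using d[OF *(1), of "pB c" "pB (c + sg s)"]
    unfolding fe_def p by (simp add: sum_bool eE_def)
  show "fet s s i j c = 0" using d[OF *(2), of "pB c" "pB (c + sg s)"]
    unfolding fet_def p by (simp add: sum_bool eE_def)
qed

lemma pr_sum': "pr c False i j = idm i j - pr c True i j" using pr_sum[of c i j] by (simp add: algebra_simps)

text \<open>As the equal directions contribute nothing, the second projection may be replaced by the
  sum of both, which is the identity.\<close>

lemma fe_diff: "fe True False i j c + fe False True i j c = eE i j" "fet True False i j c + fet False True i j c = eE i j"
proof -
  have a: "fe True False i j c = (\<Sum>k\<in>UNIV. eE k j * pr c True i k)"
  proof -
    have "fe True True i j c + fe True False i j c = (\<Sum>k\<in>UNIV. \<Sum>l\<in>UNIV. eE k l * (pr c True i k * idm j l))"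
      by (simp only: fe_def sum_bool pr_sum[of "c + sg True", symmetric] distrib_left add_ac)
    then show ?thesis by (cases j) (simp_all add: fe_same sum_bool idm_def)
  qed
  have b: "fe False True i j c = (\<Sum>k\<in>UNIV. eE k j * pr c False i k)"
  proof -
    have "fe False True i j c + fe False False i j c = (\<Sum>k\<in>UNIV. \<Sum>l\<in>UNIV. eE k l * (pr c False i k * idm j l))"
      by (simp only: fe_def sum_bool pr_sum[of "c + sg False", symmetric] distrib_left add_ac)
    then show ?thesis by (cases j) (simp_all add: fe_same sum_bool idm_def)
  qed
  show "fe True False i j c + fe False True i j c = eE i j"
    unfolding a b by (cases i; cases j) (simp_all add: sum_bool pr_sum' idm_def algebra_simps eE_def)
  have a: "fet True False i j c = (\<Sum>k\<in>UNIV. eE k j * pr c True k i)"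
  proof -
    have "fet True True i j c + fet True False i j c = (\<Sum>k\<in>UNIV. \<Sum>l\<in>UNIV. eE k l * (pr c True k i * idm l j))"
      by (simp only: fet_def sum_bool pr_sum[of "c + sg True", symmetric] distrib_left add_ac)
    then show ?thesis by (cases j) (simp_all add: fe_same sum_bool idm_def)
  qed
  have b: "fet False True i j c = (\<Sum>k\<in>UNIV. eE k j * pr c False k i)"
  proof -
    have "fet False True i j c + fet False False i j c = (\<Sum>k\<in>UNIV. \<Sum>l\<in>UNIV. eE k l * (pr c False k i * idm l j))"
      by (simp only: fet_def sum_bool pr_sum[of "c + sg False", symmetric] distrib_left add_ac)
    then show ?thesis by (cases j) (simp_all add: fe_same sum_bool idm_def)
  qed
  show "fet True False i j c + fet False True i j c = eE i j"
    unfolding a b by (cases i; cases j) (simp_all add: sum_bool pr_sum' idm_def algebra_simps eE_def)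
qed

primrec fcm :: "(real \<Rightarrow> complex) \<Rightarrow> bool list \<Rightarrow> real \<Rightarrow> bool list \<Rightarrow> complex" where
  "fcm \<phi> [] c J = \<phi> c"
| "fcm \<phi> (i # I) c J = pr c True i (hd J) * fcm \<phi> I (c + 1) (tl J) + pr c False i (hd J) * fcm \<phi> I (c - 1) (tl J)"

text \<open>
  \<open>Fc c \<phi>\<close> is \<open>\<phi>\<close> applied to \<open>iB\<^sub>t\<close>, \<open>t = q\<^sup>c - q\<^bsup>-c\<^esup>\<close>, where the eigenvalue \<open>[d]\<close> is labelled by \<open>d\<close>.
  By the coideal property \<open>\<Delta>(B\<^sub>t) = B\<^sub>t \<otimes> k\<^sup>-\<^sup>1 + 1 \<otimes> B\<^sub>0\<close> a letter moves \<open>c\<close> to \<open>c \<plusminus> 1\<close>.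
\<close>

definition Fc :: "real \<Rightarrow> (real \<Rightarrow> complex) \<Rightarrow> falg \<Rightarrow> complex"
  where "Fc c \<phi> = mk (\<lambda>I J. fcm \<phi> I c J)"

lemma lfun_Fc [simp]: "lfun (Fc c \<phi>)" by (simp add: Fc_def lfun_mk)

lemma Fc_one: "Fc c \<phi> 1 = \<phi> c"
  using mk_uw[of "[]" "[]" "\<lambda>I J. fcm \<phi> I c J"] by (simp add: Fc_def)

lemma Fc_uw: "length I = length J \<Longrightarrow> Fc c \<phi> (uw I J) = fcm \<phi> I c J" by (simp add: Fc_def mk_uw)

lemma Fc_rec: "Fc c \<phi> (U i j * y) = pr c True i j * Fc (c + 1) \<phi> y + pr c False i j * Fc (c - 1) \<phi> y"
proof (induction y rule: falg_induct)
  case (uw I J)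
  have "Fc c \<phi> (uw (i # I) (j # J)) = pr c True i j * Fc (c + 1) \<phi> (uw I J) + pr c False i j * Fc (c - 1) \<phi> (uw I J)"
    using uw by (subst Fc_uw, simp, subst Fc_uw, simp, subst Fc_uw, simp, simp)
  then show ?case by simp
qed (simp_all add: distrib_left lfun_simps[OF lfun_Fc] algebra_simps)

lemma Fc_rec2: "Fc c \<phi> (U i j * (U k l * y)) =
    pr c True i j * pr (c + sg True) True k l * Fc (c + 2) \<phi> y +
    pr c True i j * pr (c + sg True) False k l * Fc c \<phi> y +
    pr c False i j * pr (c + sg False) True k l * Fc c \<phi> y +
    pr c False i j * pr (c + sg False) False k l * Fc (c - 2) \<phi> y"
  by (simp add: Fc_rec algebra_simps)

lemma Fc_Udual [simp]: "Fc c \<phi> \<in> Udual q"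
proof (rule Udual_family[where h = "\<lambda>c. Fc c \<phi>" and Y = "\<lambda>c. {c + 1, c - 1}" and c = "\<lambda>c d i j. pr c (d = c + 1) i j"])
  fix c i j and I J :: "bool list"
  have "(\<Sum>k\<in>UNIV. \<Sum>l\<in>UNIV. eE k l * Fc c \<phi> (uw (i # j # I) (k # l # J)))
     = fe True True i j c * Fc (c + 2) \<phi> (uw I J) + (fe True False i j c + fe False True i j c) * Fc c \<phi> (uw I J)
       + fe False False i j c * Fc (c - 2) \<phi> (uw I J)"
    by (simp add: uw_Cons Fc_rec2 fe_def sum_bool algebra_simps)
  then show "(\<Sum>k\<in>UNIV. \<Sum>l\<in>UNIV. eE k l * Fc c \<phi> (uw (i # j # I) (k # l # J))) = eE i j * Fc c \<phi> (uw I J)"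
    by (simp add: fe_same fe_diff)
  have "(\<Sum>k\<in>UNIV. \<Sum>l\<in>UNIV. eE k l * Fc c \<phi> (uw (k # l # I) (i # j # J)))
     = fet True True i j c * Fc (c + 2) \<phi> (uw I J) + (fet True False i j c + fet False True i j c) * Fc c \<phi> (uw I J)
       + fet False False i j c * Fc (c - 2) \<phi> (uw I J)"
    by (simp add: uw_Cons Fc_rec2 fet_def sum_bool algebra_simps)
  then show "(\<Sum>k\<in>UNIV. \<Sum>l\<in>UNIV. eE k l * Fc c \<phi> (uw (k # l # I) (i # j # J))) = eE i j * Fc c \<phi> (uw I J)"
    by (simp add: fe_same fe_diff)
qed (simp_all add: Fc_rec)

text \<open>At a fixed label the two spin 1/2 projections are orthogonal idempotents, so mixed terms
  vanish and both factors follow the same sequence of labels.\<close>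

lemma Fc_mult: "conv q (Fc c \<phi>) (Fc c \<psi>) = Fc c (\<lambda>t. \<phi> t * \<psi> t)"
proof (rule lfun_eqI[OF lfun_conv lfun_Fc])
  fix I J :: "bool list" assume "length I = length J"
  then show "conv q (Fc c \<phi>) (Fc c \<psi>) (uw I J) = Fc c (\<lambda>t. \<phi> t * \<psi> t) (uw I J)"
  proof (induction I J arbitrary: c rule: list_induct2)
    case Nil
    show ?case by (subst conv_uw) (simp_all add: Fc_one)
  next
    case (Cons i I j J)
    show ?case
      unfolding uw_Cons
      by (subst conv_rec2[where gA = "Fc (c + 1) \<phi>" and gB = "Fc (c - 1) \<phi>" and hA = "Fc (c + 1) \<psi>" and hB = "Fc (c - 1) \<psi>"
            and ?g1.0 = "pr c True" and ?g2.0 = "pr c False" and ?h1.0 = "pr c True" and ?h2.0 = "pr c False"])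
         (simp_all add: Fc_rec sum_bool pr_mult Cons.IH)
  qed
qed

lemma Fc_lin: "Fc c (\<lambda>t. x * \<phi> t + y * \<psi> t) z = x * Fc c \<phi> z + y * Fc c \<psi> z"
proof (induction z rule: falg_induct)
  case (uw I J)
  then show ?case
    by (induction I J arbitrary: c rule: list_induct2) (simp_all add: Fc_one Fc_rec algebra_simps)
qed (simp_all add: lfun_simps[OF lfun_Fc] algebra_simps)

lemma Fc_const: "Fc c (\<lambda>_. 1) = eps"
proof (rule lfun_eqI[OF lfun_Fc lfun_eps])
  fix I J :: "bool list" assume "length I = length J"
  then show "Fc c (\<lambda>_. 1) (uw I J) = eps (uw I J)"
    by (induction I J arbitrary: c rule: list_induct2)
      (simp_all add: Fc_one Fc_rec eps_rec distrib_right[symmetric] pr_sum)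
qed

lemma dstar_Fc: "dstar q (Fc c \<phi>) = Fc c (\<lambda>t. cnj (\<phi> t))"
proof (rule lfun_eqI[OF lfun_dstar[OF lfun_Fc] lfun_Fc])
  fix I J :: "bool list" assume l: "length I = length J"
  then have "cnj (Fc c \<phi> (uw J I)) = Fc c (\<lambda>t. cnj (\<phi> t)) (uw I J)"
    by (induction I J arbitrary: c rule: list_induct2) (simp_all add: Fc_one Fc_rec pr_cnj)
  then show "dstar q (Fc c \<phi>) (uw I J) = Fc c (\<lambda>t. cnj (\<phi> t)) (uw I J)" using l by (simp add: dstar_uw)
qed

lemma Fc_cong:
  assumes "length I = length J" "\<And>j::int. \<bar>j\<bar> \<le> int (length I) \<Longrightarrow> \<phi> (c + of_int j) = \<psi> (c + of_int j)"
  shows "Fc c \<phi> (uw I J) = Fc c \<psi> (uw I J)"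
  using assms
proof (induction I J arbitrary: c rule: list_induct2)
  case Nil then show ?case using Nil[of 0] by (simp add: Fc_one)
next
  case (Cons i I j J)
  have "Fc (c + 1) \<phi> (uw I J) = Fc (c + 1) \<psi> (uw I J)"
  proof (rule Cons.IH)
    fix k :: int assume "\<bar>k\<bar> \<le> int (length I)"
    then show "\<phi> (c + 1 + of_int k) = \<psi> (c + 1 + of_int k)" using Cons.prems[of "k + 1"] by (simp add: algebra_simps)
  qed
  moreover have "Fc (c - 1) \<phi> (uw I J) = Fc (c - 1) \<psi> (uw I J)"
  proof (rule Cons.IH)
    fix k :: int assume "\<bar>k\<bar> \<le> int (length I)"
    then show "\<phi> (c - 1 + of_int k) = \<psi> (c - 1 + of_int k)" using Cons.prems[of "k - 1"] by (simp add: algebra_simps)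
  qed
  ultimately show ?case by (simp add: Fc_rec)
qed

section \<open>Identification of the calculus with iB_t\<close>

definition X0 :: "falg \<Rightarrow> complex"
  where "X0 x = \<i> * (- qc (sqrt q) * conv q (U_kinv q) (U_e q) x + qc (sqrt q) * U_f q x)"
text \<open>The spin 1/2 matrix of \<open>X0\<close>. Here \<open>X0\<close> is the part of iB_t
  that does not depend on t; iB_t itself is \<open>X0\<close> plus [a] times k^-1.\<close>

definition x0 :: "bool \<Rightarrow> bool \<Rightarrow> complex" where "x0 i j = (if i = j then 0 else if i then \<i> else - \<i>)"
definition qn :: "real \<Rightarrow> complex" where "qn c = complex_of_real (qnum q c)"

lemma X0_lfun [simp]: "lfun X0"
  by (rule lfunI) (simp_all add: X0_def lfun_simps[OF lfun_conv] lfun_simps[OF lfun_UeUf(2)] algebra_simps)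

lemma X0_rec: "X0 (U i j * y) = x0 i j * U_kinv q y + idm i j * X0 y"
proof -
  have "conv q (U_kinv q) (U_e q) (U i j * y) = (\<Sum>k\<in>UNIV. ki i k * ee k j) * U_kinv q y + (\<Sum>k\<in>UNIV. ki i k * kk k j) * conv q (U_kinv q) (U_e q) y"
    by (subst conv_rec2[where gA = "U_kinv q" and gB = "U_kinv q" and hA = eps and hB = "U_e q"
          and ?g1.0 = ki and ?g2.0 = "\<lambda>_ _. 0" and ?h1.0 = ee and ?h2.0 = kk])
      (simp_all add: U_kinv_rec U_e_rec lfun_eps conv_eps_right)
  then show ?thesis
    by (cases i; cases j) (simp_all add: X0_def U_f_rec sum_bool ki_def kk_def ee_def ff_def idm_def x0_def algebra_simps sqrt_q_sq)
qed

lemma X0_one: "X0 1 = 0"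
proof -
  have "conv q (U_kinv q) (U_e q) (uw [] []) = 0" by (subst conv_uw) (simp_all add: U_e_one)
  then show ?thesis by (simp add: X0_def U_f_one)
qed

text \<open>Spectral decomposition of iB_t, t = q^c - q^-c, in spin 1/2: the projections
  \<open>pr\<close> carry the eigenvalues [c + 1] and [c - 1].\<close>

lemma qn_pm: "pr c True i j * qn (c + 1) + pr c False i j * qn (c - 1) = x0 i j + qn c * ki i j"
proof -
  define D where "D = qc q - 1 / qc q"
  have D: "D \<noteq> 0" by (simp add: D_def)
  have q2: "qn x = (pA x - 1 / pA x) / D" for x
    by (simp add: qn_def qnum_def pA_def D_def powr_minus divide_inverse)
  have A: "(\<alpha> / B) * (u / D) + (\<beta> / B) * (v / D) = w / D \<longleftrightarrow> \<alpha> * u + \<beta> * v = w * B" if "B \<noteq> 0" for \<alpha> \<beta> u v w B :: complex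
  proof -
    have "(\<alpha> / B) * (u / D) + (\<beta> / B) * (v / D) = (\<alpha> * u + \<beta> * v) / (B * D)" by (simp add: add_divide_distrib)
    moreover have "w / D = (w * B) / (B * D)" using that by simp
    moreover have "B * D \<noteq> 0" using that D by simp
    ultimately show ?thesis by (simp only: divide_cancel_right simp_thms)
  qed
  have B: "x0 i j + qn c * ki i j = (x0 i j * D + (pA c - 1 / pA c) * ki i j) / D"
    using D by (simp add: q2 add_divide_distrib)
  show ?thesis
    unfolding B unfolding q2 pr_def A[OF pB_nz]
    by (cases i; cases j) (simp_all add: x0_def ki_def pB_def D_def field_simps)
qed

text \<open>The right side is affine in [c], so after removal of a letter the labels c + 1 and c - 1
  recombine by \<open>pr_sum\<close> and \<open>qn_pm\<close>.\<close>

lemma Fc_qn: "Fc c qn x = X0 x + qn c * U_kinv q x"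
proof (induction x rule: falg_induct)
  case (uw I J)
  then show ?case
  proof (induction I J arbitrary: c rule: list_induct2)
    case Nil then show ?case by (simp add: Fc_one X0_one U_kinv_one)
  next
    case (Cons i I j J)
    have "Fc c qn (uw (i # I) (j # J)) = (pr c True i j + pr c False i j) * X0 (uw I J)
        + (pr c True i j * qn (c + 1) + pr c False i j * qn (c - 1)) * U_kinv q (uw I J)"
      by (simp add: Fc_rec Cons.IH algebra_simps)
    also have "\<dots> = idm i j * X0 (uw I J) + (x0 i j + qn c * ki i j) * U_kinv q (uw I J)" by (simp only: pr_sum qn_pm)
    also have "\<dots> = X0 (uw (i # I) (j # J)) + qn c * U_kinv q (uw (i # I) (j # J))"
      by (simp add: X0_rec U_kinv_rec algebra_simps)
    finally show ?case .
  qed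
qed (simp_all add: lfun_simps[OF lfun_Fc] lfun_simps[OF X0_lfun] lfun_simps[OF lfun_UeUf(3)] algebra_simps)

lemma iBt_Fc: "iBt q a = Fc a qn"
proof
  fix x
  have "qn a = qc (1 / (q - 1 / q)) * qc (tpar q a)"
    by (simp add: qn_def qnum_def tpar_def)
  then show "iBt q a x = Fc a qn x"
    unfolding Fc_qn iBt_def Bt_def X0_def by (simp add: algebra_simps)
qed

text \<open>Common interface of the calculus of iB_t, \<open>Fc\<close>, and of its transport by the
  inverse antipode, \<open>Gc\<close>.\<close>

definition calc :: "((real \<Rightarrow> complex) \<Rightarrow> falg \<Rightarrow> complex) \<Rightarrow> bool"
  where "calc C \<longleftrightarrow> (\<forall>\<phi>. C \<phi> \<in> Udual q) \<and> (\<forall>\<phi> \<psi>. conv q (C \<phi>) (C \<psi>) = C (\<lambda>t. \<phi> t * \<psi> t)) \<and> C (\<lambda>_. 1) = eps \<and>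
    (\<forall>\<phi> \<psi> x y z. C (\<lambda>t. x * \<phi> t + y * \<psi> t) z = x * C \<phi> z + y * C \<psi> z)"

lemma calc_Fc: "calc (Fc c)" by (simp add: calc_def Fc_mult Fc_const Fc_lin)

lemma qnum_inj: assumes "qn c = qn d" shows "c = d"
proof -
  have lt: "qnum q x < qnum q y" if "x < y" for x y
  proof -
    have "q powr y < q powr x" "q powr (- x) < q powr (- y)" using that q_pos q_lt by (simp_all add: powr_less_mono')
    then have "q powr y - q powr (- y) < q powr x - q powr (- x)" by simp
    then show ?thesis unfolding qnum_def by (rule divide_strict_right_mono_neg[OF _ q_sub])
  qed
  have "qnum q c = qnum q d" using assms by (simp add: qn_def)
  then show ?thesis using lt[of c d] lt[of d c] by (cases c d rule: linorder_cases) auto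
qed

definition dq :: "(real \<Rightarrow> complex) \<Rightarrow> real \<Rightarrow> real \<Rightarrow> complex"
  where "dq \<phi> d t = (if t = d then 0 else (\<phi> t - \<phi> d) / (qn t - qn d))"

lemma dq: "\<phi> t = \<phi> d + dq \<phi> d t * (qn t - qn d)"
  using qnum_inj[of t d] by (auto simp: dq_def)

text \<open>The divided difference \<open>dq\<close> turns the functional calculus on an eigenvector into a computation with \<open>iB\<^sub>t\<close>.\<close>

lemma calc_dq: assumes "calc C"
  shows "C \<phi> x = \<phi> d * eps x + (conv q (C (dq \<phi> d)) (C qn) x - qn d * C (dq \<phi> d) x)"
    and "C \<phi> x = \<phi> d * eps x + (conv q (C qn) (C (dq \<phi> d)) x - qn d * C (dq \<phi> d) x)"
proof -
  have lin: "C (\<lambda>t. x * \<phi> t + y * \<psi> t) z = x * C \<phi> z + y * C \<psi> z" for x y z \<phi> \<psi> using assms by (simp add: calc_def)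
  have "\<phi> = (\<lambda>t. \<phi> d * 1 + 1 * (1 * (dq \<phi> d t * qn t) + (- qn d) * dq \<phi> d t))"
    using dq[of \<phi> _ d] by (auto simp: algebra_simps)
  then have "C \<phi> x = C (\<lambda>t. \<phi> d * 1 + 1 * (1 * (dq \<phi> d t * qn t) + (- qn d) * dq \<phi> d t)) x" by (rule arg_cong)
  also have "\<dots> = \<phi> d * eps x + (C (\<lambda>t. dq \<phi> d t * qn t) x - qn d * C (dq \<phi> d) x)"
    unfolding lin using assms by (simp add: calc_def)
  finally have *: "C \<phi> x = \<phi> d * eps x + (C (\<lambda>t. dq \<phi> d t * qn t) x - qn d * C (dq \<phi> d) x)" .
  then show "C \<phi> x = \<phi> d * eps x + (conv q (C (dq \<phi> d)) (C qn) x - qn d * C (dq \<phi> d) x)"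
    using assms by (simp add: calc_def)
  show "C \<phi> x = \<phi> d * eps x + (conv q (C qn) (C (dq \<phi> d)) x - qn d * C (dq \<phi> d) x)"
    using * assms by (simp add: calc_def mult.commute)
qed

lemma calc_Udual: "calc C \<Longrightarrow> C \<phi> \<in> Udual q" by (simp add: calc_def)

lemma lact_conv: assumes "g \<in> Udual q" "h \<in> Udual q" shows "lact q (conv q g h) b \<simeq> lact q g (lact q h b)"
  by (rule eqvI) (simp add: lact_apply Udual_lfun assms lfun_conv conv_assoc)

lemma ract_conv: assumes "g \<in> Udual q" "h \<in> Udual q" shows "ract q b (conv q g h) \<simeq> ract q (ract q b g) h"
  by (rule eqvI) (simp add: ract_apply Udual_lfun assms lfun_conv conv_assoc)

lemma conv_fun_lin:
  assumes "lfun g" "lfun h1" "lfun h2"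
  shows "conv q g (\<lambda>x. c * h1 x + d * h2 x) b = c * conv q g h1 b + d * conv q g h2 b"
    "conv q (\<lambda>x. c * h1 x + d * h2 x) g b = c * conv q h1 g b + d * conv q h2 g b"
proof -
  have l: "lfun (\<lambda>x. c * h1 x + d * h2 x)" 
    if "lfun h1" "lfun h2" for h1 h2 :: "falg \<Rightarrow> complex"
    by (rule lfunI) (simp_all add: lfun_simps[OF that(1)] lfun_simps[OF that(2)] algebra_simps)
  note l' = l[OF assms(2,3)]
  have "conv q g (\<lambda>x. c * h1 x + d * h2 x) = (\<lambda>b. c * conv q g h1 b + d * conv q g h2 b)"
    by (rule lfun_eqI[OF lfun_conv l[OF lfun_conv lfun_conv]])
      (simp add: conv_uw assms l' sum.distrib sum_distrib_left algebra_simps)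
  then show "conv q g (\<lambda>x. c * h1 x + d * h2 x) b = c * conv q g h1 b + d * conv q g h2 b" by (rule fun_cong)
  have "conv q (\<lambda>x. c * h1 x + d * h2 x) g = (\<lambda>b. c * conv q h1 g b + d * conv q h2 g b)"
    by (rule lfun_eqI[OF lfun_conv l[OF lfun_conv lfun_conv]])
      (simp add: conv_uw assms l' sum.distrib sum_distrib_left algebra_simps)
  then show "conv q (\<lambda>x. c * h1 x + d * h2 x) g b = c * conv q h1 g b + d * conv q h2 g b" by (rule fun_cong)
qed

lemma lfun_lin2: "lfun g \<Longrightarrow> lfun h \<Longrightarrow> lfun (\<lambda>x. c * g x + d * h x)"
  by (simp add: lfun_def algebra_simps)

text \<open>By \<open>calc_dq\<close> the element \<phi>(iB_t) - \<phi>(d) is a multiple of iB_t -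
  [d], so an eigenvector of iB_t is one of all its functions.\<close>

lemma calc_lact:
  assumes C: "calc C" and b: "lact q (C qn) b \<simeq> scl (qn d) b"
  shows "lact q (C \<phi>) b \<simeq> scl (\<phi> d) b"
proof (rule eqvI)
  fix g assume g: "g \<in> Udual q"
  note l = Udual_lfun[OF g] Udual_lfun[OF calc_Udual[OF C]]
  have e: "conv q h (C qn) b = qn d * h b" if "h \<in> Udual q" for h
    using Udual_eqv[OF that b] by (simp add: lact_apply Udual_lfun[OF that] l lfun_scl)
  have "conv q g (C \<phi>) b = \<phi> d * conv q g eps b + (conv q g (conv q (C (dq \<phi> d)) (C qn)) b - qn d * conv q g (C (dq \<phi> d)) b)"
  proof -
    have "C \<phi> = (\<lambda>x. \<phi> d * eps x + 1 * (\<lambda>x. 1 * conv q (C (dq \<phi> d)) (C qn) x + (- qn d) * C (dq \<phi> d) x) x)"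
      by (rule ext) (use calc_dq(1)[OF C] in simp)
    then have "conv q g (C \<phi>) b = conv q g (\<lambda>x. \<phi> d * eps x + 1 * (\<lambda>x. 1 * conv q (C (dq \<phi> d)) (C qn) x + (- qn d) * C (dq \<phi> d) x) x) b" by (simp only:)
    also have "\<dots> = \<phi> d * conv q g eps b + 1 * conv q g (\<lambda>x. 1 * conv q (C (dq \<phi> d)) (C qn) x + (- qn d) * C (dq \<phi> d) x) b"
      by (rule conv_fun_lin(1)) (intro l lfun_eps lfun_lin2 lfun_conv)+
    also have "conv q g (\<lambda>x. 1 * conv q (C (dq \<phi> d)) (C qn) x + (- qn d) * C (dq \<phi> d) x) b = 1 * conv q g (conv q (C (dq \<phi> d)) (C qn)) b + (- qn d) * conv q g (C (dq \<phi> d)) b"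
      by (rule conv_fun_lin(1)) (intro l lfun_conv)+
    finally show ?thesis by simp
  qed
  also have "conv q g (conv q (C (dq \<phi> d)) (C qn)) b = qn d * conv q g (C (dq \<phi> d)) b"
    using e[OF Udual_conv[OF g calc_Udual[OF C]]] by (simp add: conv_assoc l)
  finally show "g (lact q (C \<phi>) b) = g (scl (\<phi> d) b)"
    by (simp add: lact_apply l lfun_scl conv_eps_right)
qed

lemma calc_ract:
  assumes C: "calc C" and b: "ract q b (C qn) \<simeq> scl (qn d) b"
  shows "ract q b (C \<phi>) \<simeq> scl (\<phi> d) b"
proof (rule eqvI)
  fix g assume g: "g \<in> Udual q"
  note l = Udual_lfun[OF g] Udual_lfun[OF calc_Udual[OF C]]
  have e: "conv q (C qn) h b = qn d * h b" if "h \<in> Udual q" for h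
    using Udual_eqv[OF that b] by (simp add: ract_apply Udual_lfun[OF that] l lfun_scl)
  have "conv q (C \<phi>) g b = \<phi> d * conv q eps g b + (conv q (conv q (C qn) (C (dq \<phi> d))) g b - qn d * conv q (C (dq \<phi> d)) g b)"
  proof -
    have "C \<phi> = (\<lambda>x. \<phi> d * eps x + 1 * (\<lambda>x. 1 * conv q (C qn) (C (dq \<phi> d)) x + (- qn d) * C (dq \<phi> d) x) x)"
      by (rule ext) (use calc_dq(2)[OF C] in simp)
    then have "conv q (C \<phi>) g b = conv q (\<lambda>x. \<phi> d * eps x + 1 * (\<lambda>x. 1 * conv q (C qn) (C (dq \<phi> d)) x + (- qn d) * C (dq \<phi> d) x) x) g b" by (simp only:)
    also have "\<dots> = \<phi> d * conv q eps g b + 1 * conv q (\<lambda>x. 1 * conv q (C qn) (C (dq \<phi> d)) x + (- qn d) * C (dq \<phi> d) x) g b"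
      by (rule conv_fun_lin(2)) (intro l lfun_eps lfun_lin2 lfun_conv)+
    also have "conv q (\<lambda>x. 1 * conv q (C qn) (C (dq \<phi> d)) x + (- qn d) * C (dq \<phi> d) x) g b = 1 * conv q (conv q (C qn) (C (dq \<phi> d))) g b + (- qn d) * conv q (C (dq \<phi> d)) g b"
      by (rule conv_fun_lin(2)) (intro l lfun_conv)+
    finally show ?thesis by simp
  qed
  also have "conv q (conv q (C qn) (C (dq \<phi> d))) g b = qn d * conv q (C (dq \<phi> d)) g b"
    using e[OF Udual_conv[OF calc_Udual[OF C] g]] by (simp add: conv_assoc l)
  finally show "g (ract q b (C \<phi>)) = g (scl (\<phi> d) b)"
    by (simp add: ract_apply l lfun_scl conv_eps_left)
qed

lemma calc_rep:
  assumes C: "calc C" and u: "unitary_corep q N u" and x: "x \<in> cvec N"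
    and b: "rep N u (C qn) x = (\<lambda>i. qn d * x i)"
  shows "rep N u (C \<phi>) x = (\<lambda>i. \<phi> d * x i)"
proof (rule cvec_eqI[OF rep_cvec cvec_lin(3)[OF x]])
  fix z
  note l = Udual_lfun[OF calc_Udual[OF C]]
  have "lact q (C qn) (mcoef N u z x) \<simeq> scl (qn d) (mcoef N u z x)"
    using mcoef_eqv_rep[OF u calc_Udual[OF C], of qn z x] mcoef_scale[of N u 1 z "qn d" x] by (simp add: b)
  from Udual_eqv[OF Udual_eps calc_lact[OF C this, of \<phi>]]
  show "cinner N z (rep N u (C \<phi>) x) = cinner N z (\<lambda>i. \<phi> d * x i)"
    by (simp add: lact_apply lfun_eps l conv_eps_left mcoef_eval lfun_scl[OF lfun_eps] rep_eps[OF u x] cinner_simps)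
qed

text \<open>A two-term coproduct \<open>f1\<close> \<otimes> \<open>g1\<close> + \<open>f2\<close>
  \<otimes> \<open>g2\<close> of \<open>h\<close>, turned into a Leibniz-type rule for translating
  products.\<close>

lemma lact_mult2:
  assumes l: "lfun h" "lfun f1" "lfun f2" "lfun g1" "lfun g2"
    and h: "\<And>x y. h (x * y) = f1 x * g1 y + f2 x * g2 y"
  shows "lact q h (x * y) = lact q f1 x * lact q g1 y + lact q f2 x * lact q g2 y"
proof -
  have "lact q h (uw I J * uw I' J') = lact q f1 (uw I J) * lact q g1 (uw I' J') + lact q f2 (uw I J) * lact q g2 (uw I' J')"
    if "length I = length J" "length I' = length J'" for I J I' J'
  proof -
    have "lact q h (uw (I @ I') (J @ J')) = (\<Sum>K\<in>bl (length I). \<Sum>K'\<in>bl (length I'). scl (h (uw (K @ K') (J @ J'))) (uw (I @ I') (K @ K')))"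
      using that l by (simp add: lact_uw sum_bl_add)
    also have "\<dots> = (\<Sum>K\<in>bl (length I). \<Sum>K'\<in>bl (length I'). scl (f1 (uw K J)) (uw I K) * scl (g1 (uw K' J')) (uw I' K')
        + scl (f2 (uw K J)) (uw I K) * scl (g2 (uw K' J')) (uw I' K'))"
      using that by (intro sum.cong refl) (simp add: uw_append h fa.scale_left_distrib mult.commute)
    also have "\<dots> = lact q f1 (uw I J) * lact q g1 (uw I' J') + lact q f2 (uw I J) * lact q g2 (uw I' J')"
      using that l by (simp only: lact_uw sum.distrib sum_product)
    finally show ?thesis using that by (simp add: uw_append)
  qed
  then have 1: "lact q h (uw I J * y) = lact q f1 (uw I J) * lact q g1 y + lact q f2 (uw I J) * lact q g2 y" if "length I = length J" for I J
    using that by (induction y rule: falg_induct) (simp_all add: lact_lin distrib_left scl_add)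
  show ?thesis
    by (induction x rule: falg_induct) (simp_all add: lact_lin 1 distrib_right scl_add)
qed

lemma ract_mult2:
  assumes l: "lfun h" "lfun f1" "lfun f2" "lfun g1" "lfun g2"
    and h: "\<And>x y. h (x * y) = f1 x * g1 y + f2 x * g2 y"
  shows "ract q (x * y) h = ract q x f1 * ract q y g1 + ract q x f2 * ract q y g2"
proof -
  have "ract q (uw I J * uw I' J') h = ract q (uw I J) f1 * ract q (uw I' J') g1 + ract q (uw I J) f2 * ract q (uw I' J') g2"
    if "length I = length J" "length I' = length J'" for I J I' J'
  proof -
    have "ract q (uw (I @ I') (J @ J')) h = (\<Sum>K\<in>bl (length I). \<Sum>K'\<in>bl (length I'). scl (h (uw (I @ I') (K @ K'))) (uw (K @ K') (J @ J')))"
      using that l by (simp add: ract_uw sum_bl_add)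
    also have "\<dots> = (\<Sum>K\<in>bl (length I). \<Sum>K'\<in>bl (length I'). scl (f1 (uw I K)) (uw K J) * scl (g1 (uw I' K')) (uw K' J')
        + scl (f2 (uw I K)) (uw K J) * scl (g2 (uw I' K')) (uw K' J'))"
      using that by (intro sum.cong refl) (simp add: uw_append h fa.scale_left_distrib mult.commute)
    also have "\<dots> = ract q (uw I J) f1 * ract q (uw I' J') g1 + ract q (uw I J) f2 * ract q (uw I' J') g2"
      using that l by (simp only: ract_uw sum.distrib sum_product)
    finally show ?thesis using that by (simp add: uw_append)
  qed
  then have 1: "ract q (uw I J * y) h = ract q (uw I J) f1 * ract q y g1 + ract q (uw I J) f2 * ract q y g2" if "length I = length J" for I J
    using that by (induction y rule: falg_induct) (simp_all add: ract_lin distrib_left scl_add)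
  show ?thesis
    by (induction x rule: falg_induct) (simp_all add: ract_lin 1 distrib_right scl_add)
qed

section \<open>The coideal property and the transport by the inverse antipode\<close>

lemma X0_mult: "X0 (x * y) = X0 x * U_kinv q y + eps x * X0 y"
proof (induction x rule: falg_induct)
  case (uw I J)
  then show ?case
    by (induction I J rule: list_induct2) (simp_all add: X0_one X0_rec mult.assoc eps_rec U_kinv_mult algebra_simps)
qed (simp_all add: distrib_right lfun_simps[OF X0_lfun] lfun_simps[OF lfun_eps] algebra_simps)

lemma Fc_qn_mult: "Fc c qn (x * y) = Fc c qn x * U_kinv q y + eps x * X0 y"
  by (simp add: Fc_qn X0_mult U_kinv_mult algebra_simps)

lemma lact_eps: "lact q eps x \<simeq> x"
  by (rule eqvI) (simp add: lact_apply Udual_lfun lfun_eps conv_eps_right)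

lemma ract_eps: "ract q x eps \<simeq> x"
  by (rule eqvI) (simp add: ract_apply Udual_lfun lfun_eps conv_eps_left)

lemma Udual_lin2: "g \<in> Udual q \<Longrightarrow> h \<in> Udual q \<Longrightarrow> (\<lambda>x. c * g x + d * h x) \<in> Udual q"
  by (intro Udual_add Udual_scl)

lemma X0_Udual [simp]: "X0 \<in> Udual q"
proof -
  have "X0 = (\<lambda>x. 1 * Fc 0 qn x + (- qn 0) * U_kinv q x)" by (rule ext) (simp add: Fc_qn)
  then show ?thesis using Udual_lin2[OF Fc_Udual[of 0 qn] U_kinv_Udual, of 1 "- qn 0"] by simp
qed

lemma lact_fun_lin: assumes "lfun g" "lfun h"
  shows "lact q (\<lambda>x. c * g x + d * h x) b = scl c (lact q g b) + scl d (lact q h b)"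
proof (induction b rule: falg_induct)
  case (uw I J)
  have l: "lfun (\<lambda>x. c * g x + d * h x)"
    by (rule lfunI) (simp_all add: lfun_simps[OF assms(1)] lfun_simps[OF assms(2)] algebra_simps)
  show ?case using uw by (simp add: lact_uw l assms fa.scale_left_distrib sum.distrib scl_sum)
qed (simp_all add: lact_lin scl_add mult.commute add_ac)

lemma ract_fun_lin: assumes "lfun g" "lfun h"
  shows "ract q b (\<lambda>x. c * g x + d * h x) = scl c (ract q b g) + scl d (ract q b h)"
proof (induction b rule: falg_induct)
  case (uw I J)
  have l: "lfun (\<lambda>x. c * g x + d * h x)"
    by (rule lfunI) (simp_all add: lfun_simps[OF assms(1)] lfun_simps[OF assms(2)] algebra_simps)
  show ?case using uw by (simp add: ract_uw l assms fa.scale_left_distrib sum.distrib scl_sum)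
qed (simp_all add: ract_lin scl_add mult.commute add_ac)

lemma dagger_kinv: "dagger (U_kinv q) = Kf"
proof (rule lfun_eqI[OF lfun_dagger])
  fix I J :: "bool list" assume l: "length I = length J"
  have "flip I = flip J \<longleftrightarrow> I = J" by (metis flip_flip)
  moreover have "wt (flip J) = - wt J" by (induction J) simp_all
  ultimately show "dagger (U_kinv q) (uw I J) = Kf (uw I J)"
    using l by (simp add: dagger_uw U_kinv_uw Kf_uw)
qed simp_all

lemma dagger_eps: "dagger eps = eps"
  by (rule ext) (simp add: dagger_def eps_star)

lemma Kf_kinv: "conv q Kf (U_kinv q) = eps"
  by (simp add: Kf_def U_kinv_Kc conv_Kc_Kc power_int_minus Kc_one)

text \<open>The coproduct of \<open>X0\<close> forces S^-1(X0) = - k X0, and since \<open>X0\<close>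
  is self-adjoint \<open>dagger\<close> coincides with S^-1 on it. The code checks this letter by
  letter.\<close>

lemma dagger_X0: "dagger X0 x = - conv q Kf X0 x"
proof (induction x rule: falg_induct)
  case (uw I J)
  then show ?case
  proof (induction I J rule: list_induct2)
    case Nil
    have "conv q Kf X0 (uw [] []) = 0" by (subst conv_uw) (simp_all add: X0_one)
    then show ?case by (simp add: dagger_def star_one X0_one)
  next
    case (Cons i I j J)
    have c: "conv q Kf X0 (U i j * y) = (\<Sum>k\<in>UNIV. kk i k * x0 k j) * eps y + (\<Sum>k\<in>UNIV. kk i k * idm k j) * conv q Kf X0 y" for y
      by (subst conv_rec2[where gA = Kf and gB = Kf and hA = "U_kinv q" and hB = X0
          and ?g1.0 = kk and ?g2.0 = "\<lambda>_ _. 0" and ?h1.0 = x0 and ?h2.0 = idm])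
        (simp_all add: Kf_rec X0_rec Kf_kinv)
    have X0U: "X0 (U i j) = x0 i j" for i j using X0_rec[of i j 1] by (simp add: U_kinv_one X0_one)
    have KU: "U_kinv q (U i j) = ki i j" for i j using U_kinv_rec[of i j 1] by (simp add: U_kinv_one)
    have "dagger X0 (U i j * uw I J) = dagger X0 (uw I J) * cnj (U_kinv q (star (U i j))) + cnj (eps (star (uw I J))) * dagger X0 (U i j)"
      by (simp add: dagger_def star_mult X0_mult)
    also have "\<dots> = - conv q Kf X0 (U i j * uw I J)"
      unfolding c Cons.IH unfolding dagger_def star_U eps_star lfun_scl[OF X0_lfun] lfun_scl[OF lfun_UeUf(3)] X0U KU
      by (cases i; cases j) (simp_all add: sum_bool kk_def ki_def x0_def idm_def tt_def)
    finally show ?case by simp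
  qed
qed (simp_all add: lfun_simps[OF lfun_dagger[OF X0_lfun]] lfun_simps[OF lfun_conv] algebra_simps)

text \<open>The action of I_c on \<B> is right translation by S^-1 of a function of iB_t. It is
  handled through \<open>dagger\<close>, which preserves the order of convolution, so the laws of
  \<open>Fc\<close> carry over.\<close>

definition Gc :: "real \<Rightarrow> (real \<Rightarrow> complex) \<Rightarrow> falg \<Rightarrow> complex"
  where "Gc c \<phi> = (\<lambda>x. Fc c \<phi> (antipode_inv q x))"

lemma Gc_dagger: "Gc c \<phi> = dagger (Fc c (\<lambda>t. cnj (\<phi> t)))"
  unfolding Gc_def antipode_inv_dagger dstar_Fc ..

lemma Gc_Udual [simp]: "Gc c \<phi> \<in> Udual q" unfolding Gc_dagger by (rule Udual_dagger) simp

lemma calc_Gc: "calc (Gc c)"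
proof -
  have "Gc c (\<lambda>_. 1) = eps" by (simp add: Gc_dagger Fc_const dagger_eps)
  then show ?thesis
    by (simp add: calc_def) (simp add: Gc_dagger dagger_conv[symmetric] Fc_mult dagger_def Fc_lin)
qed

lemma Gc_qn: "Gc c qn x = qn c * Kf x - conv q Kf X0 x"
proof -
  have q: "(\<lambda>t. cnj (qn t)) = qn" by (rule ext) (simp add: qn_def)
  have "Gc c qn x = dagger X0 x + qn c * dagger (U_kinv q) x"
    unfolding Gc_dagger q by (simp add: dagger_def Fc_qn) (simp add: qn_def)
  then show ?thesis by (simp add: dagger_X0 dagger_kinv)
qed

lemma Gc_qn_mult: "Gc c qn (x * y) = Kf x * Gc c qn y + (\<lambda>x. - conv q Kf X0 x) x * eps y"
proof -
  have q: "(\<lambda>t. cnj (qn t)) = qn" by (rule ext) (simp add: qn_def)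
  have "Gc c qn (x * y) = Gc c qn y * dagger (U_kinv q) x + eps y * dagger X0 x"
    unfolding Gc_dagger q by (simp add: dagger_def star_mult Fc_qn_mult eps_star)
  then show ?thesis by (simp add: dagger_X0 dagger_kinv mult.commute)
qed

lemma star_lact_Fc: "lact q (Fc c qn) (star b) = star (lact q (Gc c qn) b)"
proof -
  have q: "(\<lambda>t. cnj (qn t)) = qn" by (rule ext) (simp add: qn_def)
  show ?thesis by (simp add: lact_star Gc_dagger q)
qed

end

section \<open>The Podles sphere and its stabilizer\<close>

locale sqa = sq q for q :: real + fixes a :: real
begin

definition ind :: "real \<Rightarrow> real \<Rightarrow> complex" where "ind d t = (if t = d then 1 else 0)"

lemma ind_same [simp]: "ind d d = 1" by (simp add: ind_def)

lemma calc_ind: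
  assumes "calc C"
  shows "conv q (C qn) (C (ind d)) = (\<lambda>x. qn d * C (ind d) x)" "conv q (C (ind d)) (C qn) = (\<lambda>x. qn d * C (ind d) x)"
proof -
  have e: "(\<lambda>t. qn t * ind d t) = (\<lambda>t. qn d * ind d t + 0 * ind d t)" "(\<lambda>t. ind d t * qn t) = (\<lambda>t. qn d * ind d t + 0 * ind d t)"
    by (auto simp: ind_def)
  have lin: "C (\<lambda>t. x * \<phi> t + y * \<psi> t) z = x * C \<phi> z + y * C \<psi> z" for x y z \<phi> \<psi> using assms by (simp add: calc_def)
  have m: "conv q (C \<phi>) (C \<psi>) = C (\<lambda>t. \<phi> t * \<psi> t)" for \<phi> \<psi> using assms by (simp add: calc_def)
  show "conv q (C qn) (C (ind d)) = (\<lambda>x. qn d * C (ind d) x)" unfolding m e by (rule ext) (simp only: lin, simp)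
  show "conv q (C (ind d)) (C qn) = (\<lambda>x. qn d * C (ind d) x)" unfolding m e by (rule ext) (simp only: lin, simp)
qed

lemma rep_scl_fun: "rep N u (\<lambda>x. c * h x) y = (\<lambda>i. c * rep N u h y i)"
  using rep_lincomb[of N u "\<lambda>_. c" "\<lambda>_. h" "{()}" y] by simp

text \<open>Self-adjoint by \<open>dstar_Fc\<close>, with values in the eigenspace by
  \<open>calc_ind\<close> and equal to the identity there by \<open>calc_rep\<close>.\<close>

lemma Fc_orth_proj:
  assumes "unitary_corep q N u"
  shows "orth_proj N (eigenspace q a N u (qnum q d)) (rep N u (Fc a (ind d)))"
  unfolding orth_proj_def
proof (intro ballI conjI)
  fix x assume "x \<in> cvec N"
  let ?P = "rep N u (Fc a (ind d))"
  have "rep N u (Fc a qn) (?P x) = (\<lambda>i. qn d * ?P x i)"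
    by (simp add: rep_conv[OF assms, symmetric] calc_ind[OF calc_Fc] rep_scl_fun)
  then show "?P x \<in> eigenspace q a N u (qnum q d)"
    by (simp add: eigenspace_def rep_cvec iBt_Fc qn_def)
  fix y assume "y \<in> eigenspace q a N u (qnum q d)"
  then have y: "y \<in> cvec N" "rep N u (Fc a qn) y = (\<lambda>i. qn d * y i)"
    by (auto simp: eigenspace_def iBt_Fc qn_def)
  have "dstar q (Fc a (ind d)) = Fc a (ind d)"
    unfolding dstar_Fc by (rule arg_cong[of _ _ "Fc a"]) (auto simp: ind_def)
  then have "cinner N (?P y) x = cinner N y (?P x)" using rep_adj[OF assms, of "Fc a (ind d)" y x] by simp
  moreover have "?P y = y" using calc_rep[OF calc_Fc assms y, of "ind d"] by simp
  ultimately show "cinner N y (\<lambda>i. x i - ?P x i) = 0" by (simp add: cinner_simps)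
qed

lemma orth_proj_unique:
  assumes P: "orth_proj N V P" and Q: "orth_proj N V Q" and V: "V \<subseteq> cvec N" "\<And>x y. x \<in> V \<Longrightarrow> y \<in> V \<Longrightarrow> (\<lambda>i. x i - y i) \<in> V"
    and x: "x \<in> cvec N"
  shows "P x = Q x"
proof -
  let ?d = "\<lambda>i. P x i - Q x i"
  have PQ: "P x \<in> V" "Q x \<in> V" using P Q x by (auto simp: orth_proj_def)
  then have d: "?d \<in> V" by (rule V(2))
  have "cinner N ?d (\<lambda>i. x i - P x i) = 0" "cinner N ?d (\<lambda>i. x i - Q x i) = 0"
    using P Q x d by (auto simp: orth_proj_def)
  then have "cinner N ?d (P x) = cinner N ?d (Q x)" by (simp add: cinner_simps(5))
  then have "cinner N ?d ?d = 0" by (simp only: cinner_simps(5)) simp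
  then have z: "?d = (\<lambda>_. 0)" using V(1) d by (intro cinner_self_zero) auto
  show ?thesis
  proof
    fix i show "P x i = Q x i" using fun_cong[OF z, of i] by simp
  qed
qed

text \<open>The calculus exhibits the functional; \<open>Udual_unique\<close> and the uniqueness of
  orthogonal projections resolve the definite description.\<close>

lemma Phi_Fc: "Phi q a n = Fc a (ind (a + 2 * of_int n))"
  unfolding Phi_def
proof (rule the_equality)
  show "Fc a (ind (a + 2 * of_int n)) \<in> Udual q \<and> (\<forall>N u. irred_unitary_corep q N u \<longrightarrow>
     orth_proj N (eigenspace q a N u (qnum q (a + 2 * of_int n))) (rep N u (Fc a (ind (a + 2 * of_int n)))))"
    using Fc_orth_proj by (simp add: irred_unitary_corep_def)
  fix h assume h: "h \<in> Udual q \<and> (\<forall>N u. irred_unitary_corep q N u \<longrightarrow>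
     orth_proj N (eigenspace q a N u (qnum q (a + 2 * of_int n))) (rep N u h))"
  show "h = Fc a (ind (a + 2 * of_int n))"
  proof (rule Udual_unique)
    fix N u x assume u: "irred_unitary_corep q N u" and x: "x \<in> cvec N"
    let ?V = "eigenspace q a N u (qnum q (a + 2 * of_int n))"
    have 1: "orth_proj N ?V (rep N u h)" using h u by blast
    have 2: "orth_proj N ?V (rep N u (Fc a (ind (a + 2 * of_int n))))"
      using Fc_orth_proj u by (simp add: irred_unitary_corep_def)
    have 3: "(\<lambda>i. y i - z i) \<in> ?V" if "y \<in> ?V" "z \<in> ?V" for y z
      using that rep_lin[of N u "iBt q a" y "-1" z] cvec_lin(5)[of y N z] by (simp add: eigenspace_def right_diff_distrib)
    have 4: "?V \<subseteq> cvec N" by (auto simp: eigenspace_def)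
    show "rep N u h x = rep N u (Fc a (ind (a + 2 * of_int n))) x"
      by (rule orth_proj_unique[OF 1 2 4 3 x])
  qed (use h in auto)
qed

lemma Ic_Fc: assumes "h \<in> Ic q a" shows "\<exists>\<phi>. h = Fc a \<phi>"
proof -
  obtain T c where h: "finite T" "h = (\<lambda>x. \<Sum>n\<in>T. c n * Phi q a n x)" using assms by (auto simp: Ic_def)
  have "\<exists>\<phi>. (\<lambda>x. \<Sum>n\<in>T. c n * Phi q a n x) = Fc a \<phi>" using h(1)
  proof (induction T rule: finite_induct)
    case empty
    have "(\<lambda>x. 0) = Fc a (\<lambda>t. 0 * 0 + 0 * 0)" by (rule ext) (simp only: Fc_lin, simp)
    then show ?case by auto
  next
    case (insert n T)
    then obtain \<phi> where "(\<lambda>x. \<Sum>n\<in>T. c n * Phi q a n x) = Fc a \<phi>" by blast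
    then have "(\<Sum>n\<in>T. c n * Phi q a n x) = Fc a \<phi> x" for x by (rule fun_cong)
    then have "(\<lambda>x. \<Sum>n\<in>insert n T. c n * Phi q a n x) = Fc a (\<lambda>t. c n * ind (a + 2 * of_int n) t + 1 * \<phi> t)"
      using insert(1,2) by (intro ext) (simp only: Fc_lin, simp add: Phi_Fc)
    then show ?case by blast
  qed
  then show ?thesis using h(2) by simp
qed

lemma Phi_Ic: "Phi q a n \<in> Ic q a"
  unfolding Ic_def by (intro CollectI exI[of _ "{n}"] exI[of _ "\<lambda>_. 1"]) simp

lemma Fc_Ic: "Fc a (ind (a + 2 * of_int n)) \<in> Ic q a" using Phi_Ic by (simp add: Phi_Fc)

lemma Ic_act_Gc: "Ic_act q (Fc a \<phi>) b = ract q b (Gc a \<phi>)"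
  by (simp add: Ic_act_def Gc_def)

lemma Bt_iBt: "Bt q a x = - \<i> * Fc a qn x"
proof -
  have "\<i> * Bt q a x = Fc a qn x" using fun_cong[OF iBt_Fc, of a x] by (simp add: iBt_def)
  then have "- \<i> * (\<i> * Bt q a x) = - \<i> * Fc a qn x" by simp
  then show ?thesis by (simp only: mult.assoc[symmetric]) simp
qed

text \<open>Membership in \<open>\<B>\<close>, tested on the single element \<open>iB\<^sub>t\<close>.\<close>

definition inB :: "falg \<Rightarrow> bool" where "inB b \<longleftrightarrow> lact q (Fc a qn) b \<simeq> scl (qn a) b"

lemma podles_inB: "b \<in> podles q a \<longleftrightarrow> inB b"
proof -
  have Bt: "Bt q a = (\<lambda>x. (- \<i>) * Fc a qn x + 0 * eps x)" by (rule ext) (simp add: Bt_iBt)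
  have BtU: "Bt q a \<in> Udual q" unfolding Bt by (rule Udual_lin2) (simp_all add: Udual_eps)
  have lB: "lact q (Bt q a) b = scl (- \<i>) (lact q (Fc a qn) b)" for b
    unfolding Bt by (simp only: lact_fun_lin lfun_Fc lfun_eps) simp
  have B1: "Bt q a 1 = - \<i> * qn a" by (simp add: Bt_iBt Fc_one)
  show ?thesis
  proof
    assume b: "b \<in> podles q a"
    have "Bt q a \<in> alg_Bt q a"
      unfolding alg_Bt_def
      by (intro CollectI exI[of _ 1] exI[of _ "\<lambda>m. if m = 1 then 1 else 0"] ext)
         (simp add: conv_eps_right[OF Udual_lfun[OF BtU]])
    then have "lact q (Bt q a) b \<simeq> scl (Bt q a 1) b" using b by (simp add: podles_def eqv_def)
    from eqv_scl[OF this, of \<i>] show "inB b" by (simp add: inB_def lB B1 mult.assoc[symmetric])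
  next
    assume b: "inB b"
    have lb: "lact q (Bt q a) b \<simeq> scl (Bt q a 1) b"
      using eqv_scl[OF b[unfolded inB_def], of "- \<i>"] by (simp add: lB B1)
    have p: "lact q (conv_pow q (Bt q a) m) b \<simeq> scl (conv_pow q (Bt q a) m 1) b" for m
    proof (induction m)
      case 0 then show ?case by (simp add: lact_eps)
    next
      case (Suc m)
      note U = BtU Udual_conv_pow[OF BtU, of m]
      have "lact q (conv q (Bt q a) (conv_pow q (Bt q a) m)) b \<simeq> lact q (Bt q a) (lact q (conv_pow q (Bt q a) m) b)"
        by (rule lact_conv[OF U])
      also have "\<dots> \<simeq> lact q (Bt q a) (scl (conv_pow q (Bt q a) m 1) b)" by (rule eqv_lact[OF U(1) Suc])
      also have "\<dots> = scl (conv_pow q (Bt q a) m 1) (lact q (Bt q a) b)" by (simp add: lact_lin)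
      also have "\<dots> \<simeq> scl (conv_pow q (Bt q a) m 1) (scl (Bt q a 1) b)" by (rule eqv_scl[OF lb])
      finally have 1: "lact q (conv_pow q (Bt q a) (Suc m)) b \<simeq> scl (Bt q a 1 * conv_pow q (Bt q a) m 1) b" by (simp add: mult.commute)
      have "conv q (Bt q a) (conv_pow q (Bt q a) m) (uw [] []) = Bt q a 1 * conv_pow q (Bt q a) m 1"
        using U by (subst conv_uw) (simp_all add: Udual_lfun)
      then show ?case using 1 by simp
    qed
    show "b \<in> podles q a"
      unfolding podles_def mem_Collect_eq
    proof
      fix h assume "h \<in> alg_Bt q a"
      then obtain d c where h: "h = (\<lambda>x. \<Sum>m\<le>d::nat. c m * conv_pow q (Bt q a) m x)" by (auto simp: alg_Bt_def)
      have "lact q h b \<simeq> scl (h 1) b"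
      proof (rule eqvI)
        fix g assume g: "g \<in> Udual q"
        have U: "conv_pow q (Bt q a) m \<in> Udual q" for m by (rule Udual_conv_pow[OF BtU])
        have hU: "h \<in> Udual q" unfolding h by (rule Udual_lincomb[OF U])
        have s: "conv q g (\<lambda>x. \<Sum>m\<in>S. c m * conv_pow q (Bt q a) m x) b = (\<Sum>m\<in>S. c m * conv q g (conv_pow q (Bt q a) m) b)"
          if "finite S" for S using that
        proof (induction S rule: finite_induct)
          case empty
          have "conv q g (\<lambda>x. 0 * eps x + 0 * eps x) b = 0 * conv q g eps b + 0 * conv q g eps b"
            by (rule conv_fun_lin(1)) (simp_all add: Udual_lfun[OF g] lfun_eps)
          then show ?case by simp
        next
          case (insert m S)
          have "conv q g (\<lambda>x. c m * conv_pow q (Bt q a) m x + 1 * (\<Sum>m\<in>S. c m * conv_pow q (Bt q a) m x)) b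
             = c m * conv q g (conv_pow q (Bt q a) m) b + 1 * conv q g (\<lambda>x. \<Sum>m\<in>S. c m * conv_pow q (Bt q a) m x) b"
            by (rule conv_fun_lin(1)) (simp_all add: Udual_lfun[OF g] Udual_lfun[OF U] Udual_lfun[OF Udual_lincomb[OF U]])
          then show ?case using insert by simp
        qed
        have "conv q g (conv_pow q (Bt q a) m) b = conv_pow q (Bt q a) m 1 * g b" for m
          using Udual_eqv[OF g p[of m]] by (simp add: lact_apply Udual_lfun[OF g] Udual_lfun[OF U] lfun_scl[OF Udual_lfun[OF g]])
        then have "conv q g h b = h 1 * g b" unfolding h by (simp add: s sum_distrib_right mult.assoc)
        then show "g (lact q h b) = g (scl (h 1) b)"
          by (simp add: lact_apply Udual_lfun g hU lfun_scl)
      qed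
      then show "lact q h b - scl (h 1) b \<in> RelIdeal q" by (simp add: eqv_def)
    qed
  qed
qed

lemma inB_eqv: "b \<simeq> c \<Longrightarrow> inB b \<Longrightarrow> inB c"
  unfolding inB_def by (metis Fc_Udual eqv_lact eqv_scl eqv_sym eqv_trans)

lemma inB_add: "inB b \<Longrightarrow> inB c \<Longrightarrow> inB (b + c)"
  unfolding inB_def lact_lin scl_add by (rule eqv_add)

lemma inB_scl: "inB b \<Longrightarrow> inB (scl x b)"
  unfolding inB_def lact_lin using eqv_scl[of "lact q (Fc a qn) b" "scl (qn a) b" x] by (simp add: mult.commute)

lemma inB_diff: "inB b \<Longrightarrow> inB c \<Longrightarrow> inB (b - c)"
  using inB_add[of b "scl (-1) c"] inB_scl[of c "-1"] by simp

lemma inB_one: "inB 1"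
  using lact_uw[of "Fc a qn" "[]" "[]"] by (simp add: inB_def Fc_one)

lemma inB_cst: "inB (cst c)" using inB_scl[OF inB_one] by (simp add: cst_eq)

lemma inB_zero: "inB 0" using inB_scl[OF inB_one, of 0] by simp

lemma inB_sum: "(\<And>i. i \<in> I \<Longrightarrow> inB (f i)) \<Longrightarrow> inB (sum f I)"
  by (induction I rule: infinite_finite_induct) (simp_all add: inB_zero inB_add)

lemma inB_Rel: "x \<in> RelIdeal q \<Longrightarrow> inB x"
  using inB_eqv[OF eqv_sym inB_zero] by (simp add: eqv_zero)

text \<open>The coproduct of iB_t is iB_t \<otimes> k^-1 + 1 \<otimes> X0. Once the left factor has
  produced [a], the right factor sees [a] k^-1 + X0, which is iB_t again.\<close>

lemma inB_mult: assumes "inB x" "inB y" shows "inB (x * y)"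
proof -
  have "lact q (Fc a qn) (x * y) = lact q (Fc a qn) x * lact q (U_kinv q) y + lact q eps x * lact q X0 y"
    by (rule lact_mult2) (simp_all add: lfun_eps Fc_qn_mult)
  also have "\<dots> \<simeq> scl (qn a) x * lact q (U_kinv q) y + x * lact q X0 y"
    by (intro eqv_add eqv_mult eqv_refl lact_eps assms(1)[unfolded inB_def])
  also have "\<dots> = x * (scl (1) (lact q X0 y) + scl (qn a) (lact q (U_kinv q) y))" by (simp add: algebra_simps)
  also have "\<dots> = x * lact q (\<lambda>x. 1 * X0 x + qn a * U_kinv q x) y" by (simp only: lact_fun_lin X0_lfun lfun_UeUf)
  also have "(\<lambda>x. 1 * X0 x + qn a * U_kinv q x) = Fc a qn" by (rule ext) (simp add: Fc_qn)
  also have "x * lact q (Fc a qn) y \<simeq> x * scl (qn a) y" by (intro eqv_mult eqv_refl assms(2)[unfolded inB_def])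
  finally show ?thesis by (simp add: inB_def)
qed

text \<open>S^-1(iB_t) = [a] k - k X0 = [a] k + [a] - k iB_t, and on \<B> the last term cancels the
  first. Stability of \<B> under the involution follows.\<close>

lemma Gc_inB: assumes "inB b" shows "lact q (Gc a qn) b \<simeq> scl (qn a) b"
proof -
  have "Gc a qn = (\<lambda>x. 1 * (qn a * Kf x + qn a * eps x) + (- 1) * conv q Kf (Fc a qn) x)"
  proof
    fix x
    have "X0 = (\<lambda>x. 1 * Fc a qn x + (- qn a) * U_kinv q x)" by (rule ext) (simp add: Fc_qn)
    then have "conv q Kf X0 x = 1 * conv q Kf (Fc a qn) x + (- qn a) * conv q Kf (U_kinv q) x"
      using conv_fun_lin(1)[of Kf "Fc a qn" "U_kinv q" 1 "- qn a" x] by simp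
    then show "Gc a qn x = 1 * (qn a * Kf x + qn a * eps x) + (- 1) * conv q Kf (Fc a qn) x"
      by (simp add: Gc_qn Kf_kinv)
  qed
  then have "lact q (Gc a qn) b = scl 1 (scl (qn a) (lact q Kf b) + scl (qn a) (lact q eps b)) + scl (- 1) (lact q (conv q Kf (Fc a qn)) b)"
    by (simp only: lact_fun_lin lfun_lin2 lfun_UeUf lfun_eps lfun_conv)
  also have "\<dots> \<simeq> scl 1 (scl (qn a) (lact q Kf b) + scl (qn a) b) + scl (- 1) (scl (qn a) (lact q Kf b))"
  proof (intro eqv_add eqv_scl eqv_refl lact_eps)
    have "lact q (conv q Kf (Fc a qn)) b \<simeq> lact q Kf (lact q (Fc a qn) b)" by (rule lact_conv) simp_all
    also have "\<dots> \<simeq> lact q Kf (scl (qn a) b)" by (rule eqv_lact[OF Kf_Udual assms[unfolded inB_def]])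
    finally show "lact q (conv q Kf (Fc a qn)) b \<simeq> scl (qn a) (lact q Kf b)" by (simp add: lact_lin)
  qed
  finally show ?thesis by simp
qed

lemma inB_star: assumes "inB b" shows "inB (star b)"
proof -
  have "lact q (Fc a qn) (star b) \<simeq> star (scl (qn a) b)"
    unfolding star_lact_Fc by (rule eqv_star[OF Gc_inB[OF assms]])
  then show ?thesis by (simp add: inB_def star_lin) (simp add: qn_def)
qed

text \<open>A functional evaluates b as the counit of its left translate, and on \<B> this translate
  is a scalar multiple of b. Hence the action of Phi_n with n \<noteq> 0 lands in the kernel of the
  counit, see \<open>Ea_eps\<close>.\<close>

lemma Gc_eps: assumes "inB b" shows "Gc a \<phi> b = \<phi> a * eps b"
proof -
  have "eps (lact q (Gc a \<phi>) b) = eps (scl (\<phi> a) b)"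
    by (rule Udual_eqv[OF Udual_eps calc_lact[OF calc_Gc Gc_inB[OF assms]]])
  then show ?thesis by (simp add: lact_apply lfun_eps Udual_lfun[OF Gc_Udual] conv_eps_left lfun_scl)
qed

lemma inB_ract: assumes "inB b" "h \<in> Udual q" shows "inB (ract q b h)"
  unfolding inB_def
proof (rule eqvI)
  fix g assume g: "g \<in> Udual q"
  note l = Udual_lfun[OF g] Udual_lfun[OF assms(2)]
  have "g (lact q (Fc a qn) (ract q b h)) = conv q (conv q h g) (Fc a qn) b"
    by (simp add: lact_apply ract_apply l lfun_conv conv_assoc)
  also have "\<dots> = conv q h g (lact q (Fc a qn) b)" by (simp add: lact_apply lfun_conv)
  also have "\<dots> = conv q h g (scl (qn a) b)"
    by (rule Udual_eqv[OF Udual_conv[OF assms(2) g] assms(1)[unfolded inB_def]])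
  finally show "g (lact q (Fc a qn) (ract q b h)) = g (scl (qn a) (ract q b h))"
    by (simp add: ract_apply l lfun_scl lfun_conv)
qed

section \<open>The module action of I_c on \<B> and its invariants\<close>

definition Ea :: "(real \<Rightarrow> complex) \<Rightarrow> falg \<Rightarrow> falg" where "Ea \<phi> b = ract q b (Gc a \<phi>)"

lemma Ea_lin: "Ea \<phi> (x + y) = Ea \<phi> x + Ea \<phi> y" "Ea \<phi> (scl c x) = scl c (Ea \<phi> x)" "Ea \<phi> 0 = 0"
  by (simp_all add: Ea_def ract_lin)

lemma Ea_eqv: "x \<simeq> y \<Longrightarrow> Ea \<phi> x \<simeq> Ea \<phi> y" unfolding Ea_def by (rule eqv_ract) simp_all

lemma Ea_inB: "inB b \<Longrightarrow> inB (Ea \<phi> b)" unfolding Ea_def by (rule inB_ract) simp_all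

lemma Ea_eps: "inB b \<Longrightarrow> eps (Ea \<phi> b) = \<phi> a * eps b"
  by (simp add: Ea_def ract_apply lfun_eps Udual_lfun[OF Gc_Udual] conv_eps_right Gc_eps)

definition inB0 :: "falg \<Rightarrow> bool" where "inB0 b \<longleftrightarrow> inB b \<and> ract q b (Gc a qn) \<simeq> scl (qn a) b"

lemma inB0_Ea: "inB0 b \<Longrightarrow> Ea \<phi> b \<simeq> scl (\<phi> a) b"
  unfolding Ea_def inB0_def using calc_ract[OF calc_Gc] by blast

lemma Ea_ind: "ract q (Ea (ind d) b) (Gc a qn) \<simeq> scl (qn d) (Ea (ind d) b)"
proof -
  have "ract q (Ea (ind d) b) (Gc a qn) \<simeq> ract q b (conv q (Gc a (ind d)) (Gc a qn))"
    unfolding Ea_def by (rule eqv_sym[OF ract_conv]) simp_all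
  also have "ract q b (conv q (Gc a (ind d)) (Gc a qn)) = scl (qn d) (Ea (ind d) b)"
  proof -
    have e: "conv q (Gc a (ind d)) (Gc a qn) = (\<lambda>x. qn d * Gc a (ind d) x + 0 * eps x)"
      using calc_ind(2)[OF calc_Gc] by simp
    show ?thesis unfolding e by (simp only: ract_fun_lin Udual_lfun[OF Gc_Udual] lfun_eps) (simp add: Ea_def)
  qed
  finally show ?thesis .
qed

text \<open>\<open>Ea (ind a)\<close> is the action of Phi_0, the projection of \<B> onto the
  invariants.\<close>

lemma Ea_inB0: "inB b \<Longrightarrow> inB0 (Ea (ind a) b)"
  using Ea_ind[of a b] Ea_inB[of b "ind a"] by (simp add: inB0_def)

lemma podles0_inB0: "b \<in> podles0 q a \<longleftrightarrow> inB0 b"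
proof
  assume b: "b \<in> podles0 q a"
  then have B: "inB b" by (simp add: podles0_def podles_inB)
  have "Ic_act q (Fc a (ind a)) b \<simeq> scl (Fc a (ind a) 1) b"
    using b Fc_Ic[of 0] by (simp add: podles0_def eqv_def)
  then have e: "Ea (ind a) b \<simeq> b" by (simp add: Ic_act_Gc Ea_def Fc_one)
  have "ract q b (Gc a qn) \<simeq> ract q (Ea (ind a) b) (Gc a qn)" by (rule eqv_ract[OF _ eqv_sym[OF e]]) simp
  also have "\<dots> \<simeq> scl (qn a) (Ea (ind a) b)" by (rule Ea_ind)
  also have "\<dots> \<simeq> scl (qn a) b" by (rule eqv_scl[OF e])
  finally show "inB0 b" using B by (simp add: inB0_def)
next
  assume b: "inB0 b"
  have "Ic_act q h b - scl (h 1) b \<in> RelIdeal q" if h: "h \<in> Ic q a" for h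
  proof -
    obtain \<phi> where h: "h = Fc a \<phi>" using Ic_Fc[OF h] by blast
    show ?thesis using inB0_Ea[OF b, of \<phi>] by (simp add: h Ic_act_Gc Ea_def Fc_one eqv_def)
  qed
  then show "b \<in> podles0 q a" using b by (simp add: podles0_def podles_inB inB0_def)
qed

lemma inB0_eqv: "b \<simeq> c \<Longrightarrow> inB0 b \<Longrightarrow> inB0 c"
  unfolding inB0_def using inB_eqv by (metis Gc_Udual eqv_ract eqv_scl eqv_sym eqv_trans)

lemma inB0_add: "inB0 b \<Longrightarrow> inB0 c \<Longrightarrow> inB0 (b + c)"
  unfolding inB0_def ract_lin scl_add by (auto intro: eqv_add inB_add)

lemma inB0_scl: "inB0 b \<Longrightarrow> inB0 (scl x b)"
  unfolding inB0_def ract_lin using eqv_scl[of "ract q b (Gc a qn)" "scl (qn a) b" x] inB_scl by (auto simp: mult.commute)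

lemma inB0_one: "inB0 1"
proof -
  have "Gc a qn 1 = qn a" using Gc_eps[OF inB_one, of qn] by simp
  then show ?thesis using ract_uw[of "Gc a qn" "[]" "[]"] inB_one by (simp add: inB0_def Udual_lfun[OF Gc_Udual])
qed

text \<open>The coproduct of S^-1(iB_t) is k \<otimes> S^-1(iB_t) - k X0 \<otimes> 1; an invariant
  right factor turns the first leg into [a] k - k X0, that is S^-1(iB_t) acting on b alone.\<close>

lemma Ea_qn_mult: assumes "inB0 y" shows "ract q (b * y) (Gc a qn) \<simeq> ract q b (Gc a qn) * y"
proof -
  have G: "Gc a qn = (\<lambda>x. qn a * Kf x + 1 * (\<lambda>x. - conv q Kf X0 x) x)" by (rule ext) (simp add: Gc_qn)
  have l: "lfun (\<lambda>x. - conv q Kf X0 x)" by (simp add: lfun_def lfun_simps[OF lfun_conv])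
  have "ract q (b * y) (Gc a qn) = ract q b Kf * ract q y (Gc a qn) + ract q b (\<lambda>x. - conv q Kf X0 x) * ract q y eps"
    by (rule ract_mult2) (simp_all only: Gc_qn_mult lfun_eps l lfun_UeUf Udual_lfun[OF Gc_Udual])
  also have "\<dots> \<simeq> ract q b Kf * scl (qn a) y + ract q b (\<lambda>x. - conv q Kf X0 x) * y"
    using assms by (intro eqv_add eqv_mult eqv_refl ract_eps) (simp add: inB0_def)
  also have "\<dots> = (scl (qn a) (ract q b Kf) + scl 1 (ract q b (\<lambda>x. - conv q Kf X0 x))) * y" by (simp add: distrib_right)
  also have "\<dots> = ract q b (\<lambda>x. qn a * Kf x + 1 * (\<lambda>x. - conv q Kf X0 x) x) * y"
    by (simp only: ract_fun_lin l lfun_UeUf)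
  also have "\<dots> = ract q b (Gc a qn) * y" using G by simp
  finally show ?thesis .
qed

lemma Gc_split:
  assumes "antipode_inv q x \<in> FL W"
  shows "Gc a \<phi> x = (\<Sum>j\<in>{- int W..int W}. \<phi> (a + of_int j) * Gc a (ind (a + of_int j)) x)"
proof -
  let ?S = "{- int W..int W}"
  define f where "f = (\<lambda>S t. \<Sum>j\<in>S. \<phi> (a + of_int j) * ind (a + of_int j) t)"
  have e: "Fc a (f S) y = (\<Sum>j\<in>S. \<phi> (a + of_int j) * Fc a (ind (a + of_int j)) y)" if "finite S" for S y
    using that
  proof (induction S rule: finite_induct)
    case empty
    have "Fc a (\<lambda>t. 0 * 0 + 0 * 0) y = 0" by (simp only: Fc_lin, simp)
    then show ?case by (simp add: f_def)
  next
    case (insert j S)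
    have "f (insert j S) = (\<lambda>t. \<phi> (a + of_int j) * ind (a + of_int j) t + 1 * f S t)"
      using insert by (auto simp: f_def)
    then show ?case using insert by (simp only: Fc_lin, simp)
  qed
  have "Fc a \<phi> (antipode_inv q x) = Fc a (f ?S) (antipode_inv q x)"
  proof (rule FL_eq[OF assms lfun_Fc lfun_Fc])
    fix I J :: "bool list" assume l: "length I = length J" "length I \<le> W"
    show "Fc a \<phi> (uw I J) = Fc a (f ?S) (uw I J)"
    proof (rule Fc_cong[OF l(1)])
      fix j :: int assume "\<bar>j\<bar> \<le> int (length I)"
      then have "j \<in> ?S" using l(2) by auto
      moreover have "f ?S (a + of_int j) = (\<Sum>k\<in>?S. if k = j then \<phi> (a + of_int k) else 0)"
        unfolding f_def by (intro sum.cong refl) (auto simp: ind_def)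
      ultimately show "\<phi> (a + of_int j) = f ?S (a + of_int j)" by (simp add: sum.delta)
    qed
  qed
  then show ?thesis by (simp add: Gc_def e)
qed

lemma FL_uw: "length I = length J \<Longrightarrow> length I \<le> W \<Longrightarrow> uw I J \<in> FL W"
  unfolding FL_def by (intro fa.span_base CollectI exI[of _ I] exI[of _ J]) simp

lemma FL_antipode:
  assumes "x \<in> FL W" shows "antipode_inv q x \<in> FL W"
  using assms unfolding FL_def[of W]
proof (rule fa.span_induct)
  let ?S = "{uw I J |I J. length I = length J \<and> length I \<le> W}"
  show "fa.subspace {x. antipode_inv q x \<in> fa.span ?S}"
    by (simp add: fa.subspace_def antipode_inv_lin fa.span_zero fa.span_add fa.span_scale)
  fix x assume "x \<in> ?S"
  then obtain I J where x: "x = uw I J" "length I = length J" "length I \<le> W" by blast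
  have "uw (flip J) (flip I) \<in> fa.span ?S" if "length (flip J) = length (flip I)" "length (flip J) \<le> W"
    using FL_uw[OF that] by (simp only: FL_def)
  then show "antipode_inv q x \<in> fa.span ?S"
    unfolding x(1) using x(2,3) by (simp add: antipode_inv_uw fa.span_scale)
qed

text \<open>Word length is bounded on \<open>b\<close>, so finitely many labels a + j occur,
  uniformly in \<phi>.\<close>

lemma Ea_split: "\<exists>W. \<forall>\<phi>. Ea \<phi> b = (\<Sum>j\<in>{- int W..int W}. scl (\<phi> (a + of_int j)) (Ea (ind (a + of_int j)) b))"
proof -
  obtain W where W: "b \<in> FL W" using FL_ex by blast
  have "Ea \<phi> b = (\<Sum>j\<in>{- int W..int W}. scl (\<phi> (a + of_int j)) (Ea (ind (a + of_int j)) b))" for \<phi>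
    using W unfolding FL_def
  proof (rule fa.span_induct)
    show "fa.subspace {b. Ea \<phi> b = (\<Sum>j\<in>{- int W..int W}. scl (\<phi> (a + of_int j)) (Ea (ind (a + of_int j)) b))}"
      by (simp add: fa.subspace_def Ea_lin scl_add sum.distrib scl_sum mult.commute)
    fix x assume "x \<in> {uw I J |I J. length I = length J \<and> length I \<le> W}"
    then obtain I J where x: "x = uw I J" "length I = length J" "length I \<le> W" by blast
    have "Ea \<phi> x = (\<Sum>K\<in>bl (length I). scl (Gc a \<phi> (uw I K)) (uw K J))"
      using x by (simp add: Ea_def ract_uw Udual_lfun[OF Gc_Udual])
    also have "\<dots> = (\<Sum>K\<in>bl (length I). \<Sum>j\<in>{- int W..int W}. scl (\<phi> (a + of_int j)) (scl (Gc a (ind (a + of_int j)) (uw I K)) (uw K J)))"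
    proof (intro sum.cong refl)
      fix K assume "K \<in> bl (length I)"
      then have "antipode_inv q (uw I K) \<in> FL W" using x by (intro FL_antipode FL_uw) auto
      from Gc_split[OF this, of \<phi>] show "scl (Gc a \<phi> (uw I K)) (uw K J)
          = (\<Sum>j\<in>{- int W..int W}. scl (\<phi> (a + of_int j)) (scl (Gc a (ind (a + of_int j)) (uw I K)) (uw K J)))"
        by (simp add: fa.scale_sum_left)
    qed
    also have "\<dots> = (\<Sum>j\<in>{- int W..int W}. \<Sum>K\<in>bl (length I). scl (\<phi> (a + of_int j)) (scl (Gc a (ind (a + of_int j)) (uw I K)) (uw K J)))"
      by (rule sum.swap)
    also have "\<dots> = (\<Sum>j\<in>{- int W..int W}. scl (\<phi> (a + of_int j)) (Ea (ind (a + of_int j)) x))"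
      using x by (simp add: Ea_def ract_uw Udual_lfun[OF Gc_Udual] scl_sum)
    finally show "Ea \<phi> x = (\<Sum>j\<in>{- int W..int W}. scl (\<phi> (a + of_int j)) (Ea (ind (a + of_int j)) x))" .
  qed
  then show ?thesis by blast
qed

text \<open>For iB_t itself this is \<open>Ea_qn_mult\<close>; splitting \<open>b\<close> into
  eigencomponents carries it to every function. It lets the action of I_c descend to the quotient by
  the left ideal of A_a - \<lambda>, see \<open>LI_Ea\<close>.\<close>

lemma Ea_mult: assumes y: "inB0 y" shows "Ea \<phi> (b * y) \<simeq> Ea \<phi> b * y"
proof -
  obtain W where W: "\<And>\<phi>. Ea \<phi> b = (\<Sum>j\<in>{- int W..int W}. scl (\<phi> (a + of_int j)) (Ea (ind (a + of_int j)) b))"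
    using Ea_split[of b] by blast
  let ?b = "\<lambda>j. Ea (ind (a + of_int j)) b"
  have "Ea (\<lambda>_. 1) b \<simeq> b"
  proof -
    have "Gc a (\<lambda>_. 1) = eps" using calc_Gc by (simp add: calc_def)
    then show ?thesis by (simp add: Ea_def ract_eps)
  qed
  then have b: "(\<Sum>j\<in>{- int W..int W}. ?b j) \<simeq> b" using W[of "\<lambda>_. 1"] by simp
  have e: "Ea \<phi> (?b j * y) \<simeq> scl (\<phi> (a + of_int j)) (?b j * y)" for j
  proof -
    have "ract q (?b j * y) (Gc a qn) \<simeq> ract q (?b j) (Gc a qn) * y" by (rule Ea_qn_mult[OF y])
    also have "\<dots> \<simeq> scl (qn (a + of_int j)) (?b j) * y" by (intro eqv_mult eqv_refl Ea_ind)
    finally have "ract q (?b j * y) (Gc a qn) \<simeq> scl (qn (a + of_int j)) (?b j * y)" by simp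
    from calc_ract[OF calc_Gc this, of \<phi>] show ?thesis by (simp add: Ea_def)
  qed
  have "Ea \<phi> (b * y) \<simeq> Ea \<phi> ((\<Sum>j\<in>{- int W..int W}. ?b j) * y)"
    by (intro Ea_eqv eqv_mult eqv_refl eqv_sym[OF b])
  also have "\<dots> = (\<Sum>j\<in>{- int W..int W}. Ea \<phi> (?b j * y))"
    unfolding sum_distrib_right by (rule additive_sum) (simp_all add: Ea_lin)
  also have "\<dots> \<simeq> (\<Sum>j\<in>{- int W..int W}. scl (\<phi> (a + of_int j)) (?b j * y))" by (intro eqv_sum e)
  also have "\<dots> = Ea \<phi> b * y" unfolding W[of \<phi>] by (simp add: sum_distrib_right)
  finally show ?thesis .
qed

text \<open>In half-integral spin \<open>[a]\<close> is not an eigenvalue of \<open>iB\<^sub>t\<close>.\<close>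

lemma Fc_parity:
  assumes "length I = length J" "\<And>j::int. even (j + int (length I)) \<Longrightarrow> \<phi> (c + of_int j) = 0"
  shows "Fc c \<phi> (uw I J) = 0"
  using assms
proof (induction I J arbitrary: c rule: list_induct2)
  case Nil then show ?case using Nil[of 0] by (simp add: Fc_one)
next
  case (Cons i I j J)
  have "Fc (c + 1) \<phi> (uw I J) = 0"
  proof (rule Cons.IH)
    fix k :: int assume "even (k + int (length I))"
    then show "\<phi> (c + 1 + of_int k) = 0" using Cons.prems[of "k + 1"] by (simp add: algebra_simps)
  qed
  moreover have "Fc (c - 1) \<phi> (uw I J) = 0"
  proof (rule Cons.IH)
    fix k :: int assume "even (k + int (length I))"
    then show "\<phi> (c - 1 + of_int k) = 0" using Cons.prems[of "k - 1"] by (simp add: algebra_simps)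
  qed
  ultimately show ?case by (simp add: Fc_rec)
qed

lemma Fc_ind_sign: "conv q (Fc a (ind a)) (Kc (\<lambda>w. if even w then 1 else - 1)) = Fc a (ind a)"
proof (rule lfun_eqI[OF lfun_conv lfun_Fc])
  fix I J :: "bool list" assume l: "length I = length J"
  show "conv q (Fc a (ind a)) (Kc (\<lambda>w. if even w then 1 else - 1)) (uw I J) = Fc a (ind a) (uw I J)"
  proof (cases "even (length I)")
    case True
    then have "even (wt J)" using l by (simp add: wt_nT)
    then show ?thesis using l by (simp add: conv_Kc_right)
  next
    case False
    have "Fc a (ind a) (uw I J) = 0"
    proof (rule Fc_parity[OF l])
      fix j :: int assume "even (j + int (length I))"
      then have "j \<noteq> 0" using False by auto
      then show "ind a (a + of_int j) = 0" by (simp add: ind_def)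
    qed
    then show ?thesis using l by (simp add: conv_Kc_right)
  qed
qed

text \<open>Phi_0 absorbs the parity of the weight, which acts by -1 in even dimension.\<close>

lemma even_dim_zero:
  assumes "irred_unitary_corep q N u" "even N" "x \<in> cvec N"
  shows "rep N u (Fc a (ind a)) x = (\<lambda>_. 0)"
proof -
  have u: "unitary_corep q N u" using assms(1) by (simp add: irred_unitary_corep_def)
  have "rep N u (Fc a (ind a)) x = rep N u (Fc a (ind a)) (rep N u (Kc (\<lambda>w. if even w then 1 else - 1)) x)"
    by (simp add: rep_conv[OF u, symmetric] Fc_ind_sign)
  also have "\<dots> = (\<lambda>i. - 1 * rep N u (Fc a (ind a)) x i)"
    unfolding even_dim_sign[OF assms] using rep_scale[of N u "Fc a (ind a)" "-1" x] by simp
  finally have "rep N u (Fc a (ind a)) x i = - rep N u (Fc a (ind a)) x i" for i by (metis mult_minus1)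
  then show ?thesis by (auto simp: eq_neg_iff_add_eq_0)
qed

end

section \<open>Spherical functions\<close>

locale sqd = sqa q a for q a :: real +
  fixes u :: "nat \<Rightarrow> nat \<Rightarrow> nat \<Rightarrow> falg" and \<eta> :: "nat \<Rightarrow> int \<Rightarrow> nat \<Rightarrow> complex"
  assumes irr: "\<And>n. irred_unitary_corep q (2 * n + 1) (u n)"
    and eig: "\<And>n. eigenvectors q a n (u n) (\<eta> n)"
begin

definition dd :: "nat \<Rightarrow> nat" where "dd n = 2 * n + 1"
definition et :: "nat \<Rightarrow> nat \<Rightarrow> complex" where "et n = \<eta> n 0"

lemma u_irr: "irred_unitary_corep q (dd n) (u n)" using irr by (simp add: dd_def)
lemma u_corep [simp]: "unitary_corep q (dd n) (u n)" using u_irr by (simp add: irred_unitary_corep_def)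

lemma eta_cvec: "\<bar>j\<bar> \<le> int n \<Longrightarrow> \<eta> n j \<in> cvec (dd n)"
  and eta_eig: "\<bar>j\<bar> \<le> int n \<Longrightarrow> rep (dd n) (u n) (Fc a qn) (\<eta> n j) = (\<lambda>i. qn (a + 2 * of_int j) * \<eta> n j i)"
  and eta_inner: "\<bar>j\<bar> \<le> int n \<Longrightarrow> \<bar>k\<bar> \<le> int n \<Longrightarrow> cinner (dd n) (\<eta> n j) (\<eta> n k) = (if j = k then 1 else 0)"
proof -
  have m: "j \<in> {- int n..int n} \<longleftrightarrow> \<bar>j\<bar> \<le> int n" for j by auto
  note e = eig[of n, unfolded eigenvectors_def eigenspace_def iBt_Fc]
  show "\<bar>j\<bar> \<le> int n \<Longrightarrow> \<eta> n j \<in> cvec (dd n)"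
    "\<bar>j\<bar> \<le> int n \<Longrightarrow> rep (dd n) (u n) (Fc a qn) (\<eta> n j) = (\<lambda>i. qn (a + 2 * of_int j) * \<eta> n j i)"
    "\<bar>j\<bar> \<le> int n \<Longrightarrow> \<bar>k\<bar> \<le> int n \<Longrightarrow> cinner (dd n) (\<eta> n j) (\<eta> n k) = (if j = k then 1 else 0)"
    using e m[of j] m[of k] unfolding dd_def qn_def by blast+
qed

lemma et_cvec [simp]: "et n \<in> cvec (dd n)" and et_eig: "rep (dd n) (u n) (Fc a qn) (et n) = (\<lambda>i. qn a * et n i)"
  and et_norm: "cinner (dd n) (et n) (et n) = 1"
  using eta_cvec[of 0 n] eta_eig[of 0 n] eta_inner[of 0 n 0] by (simp_all add: et_def)

text \<open>The eigenbasis indexed from 0; the eigenvalue [a] sits at index n.\<close>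

definition eb :: "nat \<Rightarrow> nat \<Rightarrow> nat \<Rightarrow> complex" where "eb n k = \<eta> n (int k - int n)"

lemma eb_onf: "onf (dd n) (dd n) (eb n)"
proof -
  have j: "\<bar>int k - int n\<bar> \<le> int n" if "k < dd n" for k using that by (auto simp: dd_def)
  show ?thesis unfolding onf_def eb_def by (auto simp: eta_inner eta_cvec j)
qed

lemma eb_expand: "x \<in> cvec (dd n) \<Longrightarrow> x = (\<lambda>i. \<Sum>k<dd n. cinner (dd n) (eb n k) x * eb n k i)"
  using onf_full[OF eb_onf] by (simp add: proj_def)

text \<open>iB_t is self-adjoint with distinct eigenvalues on the given basis, so an [a]-eigenvector
  is orthogonal to every member except \<open>et n\<close>.\<close>

lemma mult_one:
  assumes x: "x \<in> cvec (dd n)" and e: "rep (dd n) (u n) (Fc a qn) x = (\<lambda>i. qn a * x i)"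
  shows "x = (\<lambda>i. cinner (dd n) (et n) x * et n i)"
proof -
  have z: "cinner (dd n) (eb n k) x = 0" if k: "k < dd n" "k \<noteq> n" for k
  proof -
    let ?j = "int k - int n"
    have j: "\<bar>?j\<bar> \<le> int n" using k by (auto simp: dd_def)
    have "cinner (dd n) (rep (dd n) (u n) (Fc a qn) (\<eta> n ?j)) x = cinner (dd n) (\<eta> n ?j) (rep (dd n) (u n) (dstar q (Fc a qn)) x)"
      by (rule rep_adj) simp_all
    moreover have "dstar q (Fc a qn) = Fc a qn" by (simp add: dstar_Fc qn_def[abs_def])
    ultimately have "cnj (qn (a + 2 * of_int ?j)) * cinner (dd n) (\<eta> n ?j) x = qn a * cinner (dd n) (\<eta> n ?j) x"
      unfolding eta_eig[OF j] by (simp only: e cinner_simps)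
    then have "(qn (a + 2 * of_int ?j) - qn a) * cinner (dd n) (\<eta> n ?j) x = 0" by (simp add: qn_def algebra_simps)
    moreover have "qn (a + 2 * of_int ?j) \<noteq> qn a" using qnum_inj[of "a + 2 * of_int ?j" a] k by auto
    ultimately show ?thesis by (simp add: eb_def)
  qed
  have n: "n < dd n" by (simp add: dd_def)
  have "x i = cinner (dd n) (et n) x * et n i" for i
  proof -
    have "x i = (\<Sum>k<dd n. cinner (dd n) (eb n k) x * eb n k i)" using fun_cong[OF eb_expand[OF x]] .
    also have "\<dots> = (\<Sum>k<dd n. if k = n then cinner (dd n) (eb n n) x * eb n n i else 0)"
      by (rule sum.cong) (auto simp: z)
    also have "\<dots> = cinner (dd n) (eb n n) x * eb n n i" using n by (simp add: sum.delta)
    finally show ?thesis by (simp add: eb_def et_def)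
  qed
  then show ?thesis by (rule ext)
qed

section \<open>The spherical functions psi_n\<close>

definition nu :: "nat \<Rightarrow> complex" where "nu n = cinner (dd n) (et n) (rep (dd n) (u n) (U_kinv q) (et n))"

lemma kinv_root: "U_kinv q = conv q (Kc (\<lambda>w. qc (sqrt q) powi (- w))) (Kc (\<lambda>w. qc (sqrt q) powi (- w)))"
proof -
  have "qc (sqrt q) powi (- w) * qc (sqrt q) powi (- w) = qc q powi (- w)" for w
  proof -
    have "qc (sqrt q) * qc (sqrt q) = qc q" using q_pos by (simp only: of_real_mult[symmetric]) simp
    then show ?thesis by (simp only: power_int_mult_distrib[symmetric])
  qed
  then show ?thesis by (simp add: conv_Kc_Kc U_kinv_Kc)
qed

text \<open>k^-1 is the square of a self-adjoint invertible element, the function q^(-w/2) of the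
  weight.\<close>

lemma kinv_pos:
  assumes w: "unitary_corep q N w" and x: "x \<in> cvec N"
  shows "cinner N x (rep N w (U_kinv q) x) \<in> nnr" "cinner N x (rep N w (U_kinv q) x) = 0 \<Longrightarrow> x = (\<lambda>_. 0)"
proof -
  let ?R = "Kc (\<lambda>w. qc (sqrt q) powi (- w))" and ?R' = "Kc (\<lambda>w. qc (sqrt q) powi w)"
  have d: "dstar q ?R = ?R" by (simp add: dstar_Kc)
  have e: "cinner N x (rep N w (U_kinv q) x) = cinner N (rep N w ?R x) (rep N w ?R x)"
    using rep_adj[OF w, of ?R x "rep N w ?R x"] by (simp add: d kinv_root rep_conv[OF w])
  show "cinner N x (rep N w (U_kinv q) x) \<in> nnr" unfolding e by (rule cinner_self_nnr)
  assume "cinner N x (rep N w (U_kinv q) x) = 0"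
  then have z: "rep N w ?R x = (\<lambda>_. 0)" unfolding e by (rule cinner_self_zero[OF rep_cvec])
  have "conv q ?R' ?R = eps" unfolding conv_Kc_Kc by (simp add: Kc_one[symmetric] power_int_minus)
  then have "x = rep N w ?R' (rep N w ?R x)" by (simp add: rep_conv[OF w, symmetric] rep_eps[OF w x])
  then show "x = (\<lambda>_. 0)" unfolding z rep_zero .
qed

lemma dstar_kinv: "dstar q (U_kinv q) = U_kinv q" by (simp add: U_kinv_Kc dstar_Kc)

lemma nu_nnr: "nu n \<in> nnr" unfolding nu_def by (rule kinv_pos) simp_all
lemma nu_nz [simp]: "nu n \<noteq> 0"
proof
  assume "nu n = 0"
  then have "et n = (\<lambda>_. 0)" unfolding nu_def by (rule kinv_pos(2)[rotated 2]) simp_all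
  then show False using et_norm[of n] by (simp add: cinner_simps)
qed

text \<open>The right vector \<eta> gives membership in \<B>; the left vector is k^-1 \<eta> rather
  than \<eta> because S^-1 enters the action whose invariants are sought. Division by
  \<open>nu n\<close> normalises the counit to 1.\<close>

definition psi :: "nat \<Rightarrow> falg" where
  "psi n = scl (1 / nu n) (mcoef (dd n) (u n) (rep (dd n) (u n) (U_kinv q) (et n)) (et n))"

lemma nu_left: "cinner (dd n) (rep (dd n) (u n) (U_kinv q) (et n)) (et n) = nu n"
  using rep_adj[OF u_corep, of "U_kinv q" n "et n" "et n"] by (simp add: nu_def dstar_kinv)

lemma eps_psi: "eps (psi n) = 1"
  by (simp add: psi_def lfun_scl[OF lfun_eps] eps_mcoef[OF u_corep] nu_left)

lemma mcoef_inB: "inB (mcoef (dd n) (u n) x (et n))"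
  using mcoef_eqv_rep[OF u_corep Fc_Udual, of a qn n x "et n"]
    mcoef_scale[of "dd n" "u n" 1 x "qn a" "et n"] by (simp add: inB_def et_eig)

lemma dstar_X0: "dstar q X0 = X0"
proof -
  have "X0 = Fc 0 qn" by (rule ext) (simp add: Fc_qn qn_def qnum_def)
  then show ?thesis by (simp add: dstar_Fc qn_def[abs_def])
qed

lemma dstar_Gc_qn: "dstar q (Gc a qn) x = qn a * Kf x - conv q X0 Kf x"
proof -
  have K: "dstar q Kf = Kf" by (simp add: Kf_def dstar_Kc)
  have "conv q X0 Kf = dstar q (conv q Kf X0)" by (simp add: dstar_conv dstar_X0 K)
  then have "dstar q (conv q Kf X0) x = conv q X0 Kf x" by simp
  moreover have "dstar q Kf x = Kf x" by (simp add: K)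
  ultimately show ?thesis by (simp add: dstar_def Gc_qn) (simp add: qn_def)
qed

text \<open>
  The adjoint of \<open>S\<^sup>-\<^sup>1(\<Phi>\<^sub>0)\<close> maps into \<open>k\<^sup>-\<^sup>1 \<eta>\<close>, since applying \<open>k\<close> to its values gives
  \<open>[a]\<close>-eigenvectors of \<open>iB\<^sub>t\<close>.
\<close>

lemma Ea_mcoef_aux:
  assumes x: "x \<in> cvec (dd n)"
  shows "\<exists>c. rep (dd n) (u n) (dstar q (Gc a (ind a))) x = (\<lambda>i. c * rep (dd n) (u n) (U_kinv q) (et n) i)"
proof -
  let ?r = "rep (dd n) (u n)"
  let ?y = "?r (dstar q (Gc a (ind a))) x"
  let ?z = "?r Kf ?y"
  have y: "?y \<in> cvec (dd n)" and z: "?z \<in> cvec (dd n)" by (rule rep_cvec)+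
  have "conv q (dstar q (Gc a qn)) (dstar q (Gc a (ind a))) = dstar q (conv q (Gc a (ind a)) (Gc a qn))"
    by (simp add: dstar_conv Udual_lfun[OF Gc_Udual])
  also have "\<dots> = (\<lambda>x. qn a * dstar q (Gc a (ind a)) x)"
    unfolding calc_ind[OF calc_Gc] by (rule ext) (simp add: dstar_def qn_def)
  finally have "?r (dstar q (Gc a qn)) ?y = ?r (\<lambda>x. qn a * dstar q (Gc a (ind a)) x) x"
    by (simp add: rep_conv[symmetric] Udual_dstar)
  then have 1: "?r (dstar q (Gc a qn)) ?y = (\<lambda>i. qn a * ?y i)" by (simp add: rep_scl_fun)
  have "dstar q (Gc a qn) = (\<lambda>x. \<Sum>s\<in>UNIV. (if s then qn a else - 1) * (if s then Kf else conv q X0 Kf) x)"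
    by (rule ext) (simp add: dstar_Gc_qn UNIV_bool)
  then have 2: "?r (dstar q (Gc a qn)) ?y = (\<lambda>i. \<Sum>s\<in>UNIV. (if s then qn a else - 1) * ?r (if s then Kf else conv q X0 Kf) ?y i)"
    by (simp only: rep_lincomb)
  have kz: "?r (U_kinv q) ?z = ?y"
  proof -
    have "conv q (U_kinv q) Kf = eps" by (simp add: Kf_def U_kinv_Kc conv_Kc_Kc Kc_one[symmetric] power_int_minus)
    then show ?thesis by (simp add: rep_conv[symmetric] rep_eps[OF u_corep y] del: rep_def)
  qed
  have "?r X0 ?z = (\<lambda>i. qn a * ?z i - qn a * ?y i)"
  proof
    fix i
    have "qn a * ?y i = qn a * ?z i - ?r X0 ?z i"
      using fun_cong[OF 1, of i] unfolding 2 by (simp add: UNIV_bool rep_conv[OF u_corep])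
    then show "?r X0 ?z i = qn a * ?z i - qn a * ?y i" by (simp add: algebra_simps)
  qed
  moreover have "?r (Fc a qn) ?z = (\<lambda>i. ?r X0 ?z i + qn a * ?r (U_kinv q) ?z i)"
  proof -
    have "Fc a qn = (\<lambda>x. \<Sum>s\<in>UNIV. (if s then qn a else 1) * (if s then U_kinv q else X0) x)"
      by (rule ext) (simp add: Fc_qn UNIV_bool)
    then have "?r (Fc a qn) ?z = (\<lambda>i. \<Sum>s\<in>UNIV. (if s then qn a else 1) * ?r (if s then U_kinv q else X0) ?z i)"
      by (simp only: rep_lincomb)
    then show ?thesis by (simp add: UNIV_bool add.commute)
  qed
  ultimately have "?r (Fc a qn) ?z = (\<lambda>i. qn a * ?z i)" by (simp add: kz)
  from mult_one[OF z this] have zz: "?z = (\<lambda>i. cinner (dd n) (et n) ?z * et n i)" .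
  have "?y = ?r (U_kinv q) (\<lambda>i. cinner (dd n) (et n) ?z * et n i)" using kz zz by metis
  then show ?thesis unfolding rep_scale by blast
qed

text \<open>Phi_0 maps coefficients of spin n into the line of \<open>psi n\<close>; since it
  preserves the counit, the factor can be read off there.\<close>

lemma Ea_mcoef:
  assumes x: "x \<in> cvec (dd n)"
  shows "Ea (ind a) (mcoef (dd n) (u n) x (et n)) \<simeq> scl (eps (mcoef (dd n) (u n) x (et n))) (psi n)"
proof -
  obtain c where c: "rep (dd n) (u n) (dstar q (Gc a (ind a))) x = (\<lambda>i. c * rep (dd n) (u n) (U_kinv q) (et n) i)"
    using Ea_mcoef_aux[OF x] by blast
  have "Ea (ind a) (mcoef (dd n) (u n) x (et n)) \<simeq> mcoef (dd n) (u n) (\<lambda>i. c * rep (dd n) (u n) (U_kinv q) (et n) i) (et n)"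
    using mcoef_eqv_rep_left[OF u_corep[of n] Gc_Udual[of a "ind a"], of x "et n"] by (simp only: Ea_def c)
  also have "\<dots> = scl (cnj c * nu n) (psi n)"
    using mcoef_scale[of "dd n" "u n" c _ 1 "et n"] by (simp add: psi_def)
  finally have 1: "Ea (ind a) (mcoef (dd n) (u n) x (et n)) \<simeq> scl (cnj c * nu n) (psi n)" .
  have "eps (mcoef (dd n) (u n) x (et n)) = cnj c * nu n"
    using Udual_eqv[OF Udual_eps 1] by (simp add: Ea_eps[OF mcoef_inB] lfun_scl[OF lfun_eps] eps_psi)
  then show ?thesis using 1 by simp
qed

lemma psi_inB0: "inB0 (psi n)"
proof -
  have "Ea (ind a) (mcoef (dd n) (u n) (et n) (et n)) \<simeq> psi n"
    using Ea_mcoef[OF et_cvec] by (simp add: eps_mcoef[OF u_corep] et_norm)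
  then show ?thesis using Ea_inB0[OF mcoef_inB] inB0_eqv by blast
qed

lemma intw_rep: "intw N w M v T \<Longrightarrow> h \<in> Udual q \<Longrightarrow> x \<in> cvec N \<Longrightarrow> T (rep N w h x) = rep M v h (T x)"
  and intw_cvec: "intw N w M v T \<Longrightarrow> x \<in> cvec N \<Longrightarrow> T x \<in> cvec M"
  by (auto simp: intw_def)

text \<open>Transports an arbitrary model of spin n to the given \<open>u n\<close>, where the
  [a]-eigenspace is the line of \<open>et n\<close>; the scalar that arises is moved to the left
  vector.\<close>

lemma mcoef_et:
  assumes v: "irred_unitary_corep q (dd n) v" and x: "x \<in> cvec (dd n)" and y: "y \<in> cvec (dd n)"
    and e: "rep (dd n) v (Fc a qn) y = (\<lambda>i. qn a * y i)"
  shows "\<exists>x'\<in>cvec (dd n). mcoef (dd n) v x y \<simeq> mcoef (dd n) (u n) x' (et n)"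
proof -
  obtain T where T: "intw (dd n) v (dd n) (u n) T"
    "\<And>x y. x \<in> cvec (dd n) \<Longrightarrow> y \<in> cvec (dd n) \<Longrightarrow> mcoef (dd n) v x y \<simeq> mcoef (dd n) (u n) (T x) (T y)"
    using irr_equiv[OF v u_irr] by blast
  have vc: "unitary_corep q (dd n) v" using v by (simp add: irred_unitary_corep_def)
  have Ty: "rep (dd n) (u n) (Fc a (ind a)) (T y) = T y"
    unfolding intw_rep[OF T(1) Fc_Udual y, symmetric] using calc_rep[OF calc_Fc vc y e, of "ind a"] by simp
  have "rep (dd n) (u n) (Fc a qn) (T y) = (\<lambda>i. qn a * T y i)"
  proof -
    have "rep (dd n) (u n) (Fc a qn) (rep (dd n) (u n) (Fc a (ind a)) (T y)) = (\<lambda>i. qn a * rep (dd n) (u n) (Fc a (ind a)) (T y) i)"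
      by (simp add: rep_conv[symmetric] calc_ind[OF calc_Fc] rep_scl_fun)
    then show ?thesis unfolding Ty .
  qed
  from mult_one[OF intw_cvec[OF T(1) y] this] obtain c where c: "T y = (\<lambda>i. c * et n i)" by blast
  have "mcoef (dd n) v x y \<simeq> mcoef (dd n) (u n) (\<lambda>i. cnj c * T x i) (et n)"
    using T(2)[OF x y] mcoef_scale[of "dd n" "u n" "cnj c" "T x" 1 "et n"] mcoef_scale[of "dd n" "u n" 1 "T x" c "et n"]
    by (simp add: c)
  then show ?thesis using cvec_lin(3)[OF intw_cvec[OF T(1) x]] by blast
qed

section \<open>Spanning of \<B> by coefficients with right vector \<eta>, and of its invariants by
  the psi_n\<close>

definition BS :: "falg set" where
  "BS = fa.span (RelIdeal q \<union> {mcoef (dd n) (u n) x (et n) |n x. x \<in> cvec (dd n)})"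

lemma BS_Rel: "x \<in> RelIdeal q \<Longrightarrow> x \<in> BS" unfolding BS_def by (rule fa.span_base) simp
lemma BS_mcoef: "x \<in> cvec (dd n) \<Longrightarrow> mcoef (dd n) (u n) x (et n) \<in> BS"
  unfolding BS_def by (rule fa.span_base) blast
lemma BS_add: "x \<in> BS \<Longrightarrow> y \<in> BS \<Longrightarrow> x + y \<in> BS" unfolding BS_def by (rule fa.span_add)
lemma BS_scl: "x \<in> BS \<Longrightarrow> scl c x \<in> BS" unfolding BS_def by (rule fa.span_scale)
lemma BS_eqv: "x \<in> BS \<Longrightarrow> y \<simeq> x \<Longrightarrow> y \<in> BS" using BS_add[of x "y - x"] BS_Rel by (simp add: eqv_def)

lemma rep_ind_eig: assumes "unitary_corep q N v"
  shows "rep N v (Fc a qn) (rep N v (Fc a (ind a)) x) = (\<lambda>i. qn a * rep N v (Fc a (ind a)) x i)"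
  by (simp add: rep_conv[OF assms, symmetric] calc_ind[OF calc_Fc] rep_scl_fun)

text \<open>Checked on irreducible coefficients: in even dimension Phi_0 vanishes, in odd dimension
  \<open>mcoef_et\<close> identifies the result. As left translation by Phi_0 fixes \<B>,
  \<open>inB_BS\<close> follows.\<close>

lemma lact_BS: "lact q (Fc a (ind a)) b \<in> BS"
proof (induction b rule: irr_induct)
  case (Rel x)
  then show ?case using eqv_lact[OF Fc_Udual, of x 0 a "ind a"] by (intro BS_Rel) (simp add: eqv_zero lact_lin)
next
  case (irr N v x y)
  then have v: "unitary_corep q N v" by (simp add: irred_unitary_corep_def)
  have e: "lact q (Fc a (ind a)) (mcoef N v x y) \<simeq> mcoef N v x (rep N v (Fc a (ind a)) y)" by (rule mcoef_eqv_rep[OF v Fc_Udual])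
  have "mcoef N v x (rep N v (Fc a (ind a)) y) \<in> BS"
  proof (cases "even N")
    case True
    then show ?thesis using even_dim_zero[OF irr(1) True irr(3)] by (simp add: mcoef_def BS_Rel Rel_zero)
  next
    case False
    then obtain n where N: "N = dd n" unfolding dd_def by (elim oddE)
    obtain x' where x': "x' \<in> cvec (dd n)" "mcoef (dd n) v x (rep (dd n) v (Fc a (ind a)) y) \<simeq> mcoef (dd n) (u n) x' (et n)"
      using mcoef_et[OF irr(1,2)[unfolded N] rep_cvec rep_ind_eig[OF v[unfolded N]]] by blast
    show ?thesis unfolding N by (rule BS_eqv[OF BS_mcoef[OF x'(1)] x'(2)])
  qed
  then show ?case by (rule BS_eqv[OF _ e])
qed (simp_all add: lact_lin BS_add BS_scl)

lemma inB_BS: assumes "inB b" shows "b \<in> BS"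
proof -
  have "lact q (Fc a (ind a)) b \<simeq> b" using calc_lact[OF calc_Fc assms[unfolded inB_def], of "ind a"] by simp
  then show ?thesis using BS_eqv[OF lact_BS eqv_sym] by blast
qed

definition PSp :: "falg set" where "PSp = fa.span (RelIdeal q \<union> range psi)"

lemma PSp_Rel: "x \<in> RelIdeal q \<Longrightarrow> x \<in> PSp" unfolding PSp_def by (rule fa.span_base) simp
lemma PSp_psi: "psi n \<in> PSp" unfolding PSp_def by (rule fa.span_base) blast
lemma PSp_add: "x \<in> PSp \<Longrightarrow> y \<in> PSp \<Longrightarrow> x + y \<in> PSp" unfolding PSp_def by (rule fa.span_add)
lemma PSp_scl: "x \<in> PSp \<Longrightarrow> scl c x \<in> PSp" unfolding PSp_def by (rule fa.span_scale)
lemma PSp_eqv: "x \<in> PSp \<Longrightarrow> y \<simeq> x \<Longrightarrow> y \<in> PSp" using PSp_add[of x "y - x"] PSp_Rel by (simp add: eqv_def)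

lemma Ea_PSp: assumes "inB b" shows "Ea (ind a) b \<in> PSp"
proof -
  have "b \<in> BS" by (rule inB_BS[OF assms])
  then show ?thesis unfolding BS_def
  proof (rule fa.span_induct)
    show "fa.subspace {b. Ea (ind a) b \<in> PSp}"
      by (auto simp: fa.subspace_def Ea_lin PSp_add PSp_scl PSp_Rel Rel_zero)
    fix x assume "x \<in> RelIdeal q \<union> {mcoef (dd n) (u n) x (et n) |n x. x \<in> cvec (dd n)}"
    then show "Ea (ind a) x \<in> PSp"
    proof
      assume "x \<in> RelIdeal q"
      then show ?thesis using Ea_eqv[of x 0 "ind a"] by (intro PSp_Rel) (simp add: eqv_zero Ea_lin)
    next
      assume "x \<in> {mcoef (dd n) (u n) x (et n) |n x. x \<in> cvec (dd n)}"
      then obtain n y where "x = mcoef (dd n) (u n) y (et n)" "y \<in> cvec (dd n)" by blast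
      then show ?thesis using Ea_mcoef PSp_eqv PSp_scl PSp_psi by metis
    qed
  qed
qed

text \<open>Left translation by Phi_0 fixes y and brings its right vector to the line of
  \<open>et n\<close>, after which \<open>Ea_mcoef\<close> applies. This identifies the chosen
  \<open>Y_elt\<close> with \<open>psi 1\<close> and the unit with \<open>psi 0\<close>.\<close>

lemma psi_unique:
  assumes y: "inB0 y" and e: "eps y = 1" and v: "irred_unitary_corep q (dd n) v" and xz: "x \<in> cvec (dd n)" "z \<in> cvec (dd n)"
    and m: "y \<simeq> mcoef (dd n) v x z"
  shows "y \<simeq> psi n"
proof -
  have vc: "unitary_corep q (dd n) v" using v by (simp add: irred_unitary_corep_def)
  have "y \<simeq> lact q (Fc a (ind a)) y"
    using eqv_sym[OF calc_lact[OF calc_Fc, of a y a "ind a"]] y by (simp add: inB0_def inB_def)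
  also have "\<dots> \<simeq> lact q (Fc a (ind a)) (mcoef (dd n) v x z)" by (rule eqv_lact[OF Fc_Udual m])
  also have "\<dots> \<simeq> mcoef (dd n) v x (rep (dd n) v (Fc a (ind a)) z)" by (rule mcoef_eqv_rep[OF vc Fc_Udual])
  finally have 1: "y \<simeq> mcoef (dd n) v x (rep (dd n) v (Fc a (ind a)) z)" .
  obtain x' where x': "x' \<in> cvec (dd n)" "mcoef (dd n) v x (rep (dd n) v (Fc a (ind a)) z) \<simeq> mcoef (dd n) (u n) x' (et n)"
    using mcoef_et[OF v xz(1) rep_cvec rep_ind_eig[OF vc]] by blast
  from eqv_trans[OF 1 x'(2)] have 2: "y \<simeq> mcoef (dd n) (u n) x' (et n)" .
  have "y \<simeq> Ea (ind a) y" using inB0_Ea[OF y, of "ind a"] by (simp add: eqv_sym)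
  also have "\<dots> \<simeq> Ea (ind a) (mcoef (dd n) (u n) x' (et n))" by (rule Ea_eqv[OF 2])
  also have "\<dots> \<simeq> scl (eps (mcoef (dd n) (u n) x' (et n))) (psi n)" by (rule Ea_mcoef[OF x'(1)])
  finally show ?thesis using Udual_eqv[OF Udual_eps 2] e by simp
qed

lemma Y_psi: "Y_elt q a \<simeq> psi 1"
proof -
  have d: "dd 1 = 3" by (simp add: dd_def)
  let ?P = "\<lambda>y. y \<in> podles0 q a \<and> eps y = 1 \<and>
    (\<exists>u. irred_unitary_corep q 3 u \<and> (\<exists>x\<in>cvec 3. \<exists>z\<in>cvec 3. y - mcoef 3 u x z \<in> RelIdeal q))"
  have psi: "psi 1 = mcoef 3 (u 1) (\<lambda>i. cnj (1 / nu 1) * rep (dd 1) (u 1) (U_kinv q) (et 1) i) (et 1)"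
    using mcoef_scale[of 3 "u 1" "cnj (1 / nu 1)" "rep 3 (u 1) (U_kinv q) (et 1)" 1 "et 1"]
    by (simp only: psi_def d) simp
  have "?P (psi 1)"
  proof (intro conjI exI[of _ "u 1"] bexI)
    show "psi 1 - mcoef 3 (u 1) (\<lambda>i. cnj (1 / nu 1) * rep (dd 1) (u 1) (U_kinv q) (et 1) i) (et 1) \<in> RelIdeal q"
      by (simp only: psi[symmetric]) (simp add: Rel_zero)
    show "(\<lambda>i. cnj (1 / nu 1) * rep (dd 1) (u 1) (U_kinv q) (et 1) i) \<in> cvec 3"
      using cvec_lin(3)[OF rep_cvec, of _ "dd 1"] by (simp only: d)
      show "et 1 \<in> cvec 3" using et_cvec[of 1] by (simp only: d)
    show "irred_unitary_corep q 3 (u 1)" using u_irr[of 1] by (simp only: d)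
  qed (simp_all add: podles0_inB0 psi_inB0 eps_psi)
  then have "?P (Y_elt q a)" unfolding Y_elt_def by (rule someI[of ?P "psi 1"])
  then obtain v x z where "inB0 (Y_elt q a)" "eps (Y_elt q a) = 1" "irred_unitary_corep q 3 v" "x \<in> cvec 3" "z \<in> cvec 3"
    "Y_elt q a \<simeq> mcoef 3 v x z"
    unfolding podles0_inB0 eqv_def by blast
  then show ?thesis using psi_unique[of "Y_elt q a" 1 v x z] by (simp only: d)
qed

text \<open>Coefficients in A_a = \<open>kap\<close> psi_1 - \<open>kt\<close>; they differ by q +
  1/q, the counit of A_a.\<close>

definition kap :: real where "kap = Q2 q + (1 / Q2 q) * (tpar q a)\<^sup>2"
definition kt :: real where "kt = (1 / Q2 q) * (tpar q a)\<^sup>2"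

lemma A_psi: "A_elt q a \<simeq> scl (of_real kap) (psi 1) - cst (of_real kt)"
  unfolding A_elt_def kap_def kt_def by (intro eqv_diff eqv_scl Y_psi eqv_refl)

lemma A_eps: "eps (A_elt q a) = of_real (Q2 q)"
proof -
  have "eps (A_elt q a) = eps (scl (of_real kap) (psi 1) - cst (of_real kt))" by (rule Udual_eqv[OF Udual_eps A_psi])
  also have "\<dots> = of_real kap - of_real kt"
    by (simp add: lfun_diff[OF lfun_eps] lfun_scl[OF lfun_eps] cst_eq eps_psi eps_one)
  also have "\<dots> = of_real (Q2 q)" by (simp only: kap_def kt_def of_real_diff[symmetric]) simp
  finally show ?thesis .
qed

lemma A_inB0: "inB0 (A_elt q a)"
proof (rule inB0_eqv[OF eqv_sym[OF A_psi]])
  have "inB0 (scl (of_real kap) (psi 1) + scl (- of_real kt) 1)" by (intro inB0_add inB0_scl psi_inB0 inB0_one)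
  then show "inB0 (scl (of_real kap) (psi 1) - cst (of_real kt))" by (simp add: cst_eq)
qed

lemma Q2_pos: "0 < Q2 q" using q_pos by (simp add: add_pos_pos)
lemma kap_pos: "0 < kap"
proof -
  have "0 \<le> (1 / Q2 q) * (tpar q a)\<^sup>2" using Q2_pos by (intro mult_nonneg_nonneg) (simp_all only: zero_le_power2 zero_le_divide_1_iff less_imp_le)
  then show ?thesis unfolding kap_def using Q2_pos by linarith
qed

end

section \<open>Fusion with the spherical function of spin 1\<close>

context sq
begin

lemma rep_zero_fun: "rep N u (\<lambda>_. 0) x = (\<lambda>_. 0)"
  by (rule ext) (auto simp: rep_def)

lemma rep_tcorep:
  assumes h: "\<And>x y. h (x * y) = f1 x * g1 y + f2 x * g2 y" and M: "0 < M"
  shows "rep (N * M) (tcorep M u v) h (tvec M x y) =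
    (\<lambda>I. tvec M (rep N u f1 x) (rep M v g1 y) I + tvec M (rep N u f2 x) (rep M v g2 y) I)"
proof
  fix I
  show "rep (N * M) (tcorep M u v) h (tvec M x y) I = tvec M (rep N u f1 x) (rep M v g1 y) I + tvec M (rep N u f2 x) (rep M v g2 y) I"
  proof (cases "I < N * M")
    case True
    then have b: "I div M < N" "I mod M < M" using M by (simp_all add: less_mult_imp_div_less)
    have "rep (N * M) (tcorep M u v) h (tvec M x y) I
        = (\<Sum>i<N. \<Sum>j<M. h (u (I div M) i * v (I mod M) j) * (x i * y j))"
      unfolding rep_def tcorep_def tvec_def using True sum_div_mod[where F = "\<lambda>i j. h (u (I div M) i * v (I mod M) j) * (x i * y j)" and N = N and M = M] by simp
    also have "\<dots> = (\<Sum>i<N. f1 (u (I div M) i) * x i) * (\<Sum>j<M. g1 (v (I mod M) j) * y j) +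
        (\<Sum>i<N. f2 (u (I div M) i) * x i) * (\<Sum>j<M. g2 (v (I mod M) j) * y j)"
      unfolding sum_product sum.distrib[symmetric] h by (intro sum.cong refl) (simp add: algebra_simps)
    finally show ?thesis using b by (simp add: tvec_def rep_def)
  next
    case False
    then have "N \<le> I div M" using M div_le_mono[of "N * M" I M] by (simp add: not_less)
    then show ?thesis using False by (simp add: tvec_def rep_def)
  qed
qed

text \<open>Weights add under multiplication; bounded word length makes the sum over the weight of
  the second factor finite.\<close>

lemma Kc_mult_FL:
  assumes y: "y \<in> FL W"
  shows "Kc \<phi> (x * y) = (\<Sum>w'\<in>{- int W..int W}. Kc (\<lambda>w. \<phi> (w + w')) x * Kc (delta w') y)"
  using y unfolding FL_def
proof (rule fa.span_induct)
  show "fa.subspace {y. Kc \<phi> (x * y) = (\<Sum>w'\<in>{- int W..int W}. Kc (\<lambda>w. \<phi> (w + w')) x * Kc (delta w') y)}"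
    by (simp add: fa.subspace_def lfun_simps[OF lfun_Kc] distrib_left sum.distrib sum_distrib_left mult.left_commute)
  fix y assume "y \<in> {uw I J |I J. length I = length J \<and> length I \<le> W}"
  then obtain I J where y: "y = uw I J" "length I = length J" "length I \<le> W" by blast
  show "Kc \<phi> (x * y) = (\<Sum>w'\<in>{- int W..int W}. Kc (\<lambda>w. \<phi> (w + w')) x * Kc (delta w') y)"
  proof (induction x rule: falg_induct)
    case (uw I' J')
    show ?case
    proof (cases "I = J")
      case False
      then show ?thesis using uw y by (simp add: uw_append[symmetric] Kc_uw)
    next
      case True
      have b: "wt J \<in> {- int W..int W}" using y nT_le[of J] by (auto simp: wt_nT)
      have "Kc (delta w') y = (if w' = wt J then 1 else 0)" for w' using y True by (auto simp: Kc_uw delta_def)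
      then have "(\<Sum>w'\<in>{- int W..int W}. Kc (\<lambda>w. \<phi> (w + w')) (local.uw I' J') * Kc (delta w') y)
          = (\<Sum>w'\<in>{- int W..int W}. if w' = wt J then Kc (\<lambda>w. \<phi> (w + wt J)) (local.uw I' J') else 0)"
        by (intro sum.cong refl) simp
      then show ?thesis using b uw y True by (simp add: sum.delta uw_append[symmetric] Kc_uw)
    qed
  qed (simp_all add: lfun_simps[OF lfun_Kc] distrib_right sum.distrib sum_distrib_left mult.assoc)
qed

text \<open>In dimension N the weights are N - 1, N - 3, ..., and \<phi> vanishes on all of
  them.\<close>

lemma Kc_irr_zero:
  assumes u: "irred_unitary_corep q N u" and \<phi>: "\<And>w. w \<le> int N - 1 \<Longrightarrow> \<phi> w = 0" and ij: "i < N" "j < N"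
  shows "Kc \<phi> (u i j) = 0"
proof -
  obtain v where v: "std_basis N u v" using std_basis_exists[OF u] by blast
  have z: "rep N u (Kc \<phi>) (v k) = (\<lambda>_. 0)" if "k < N" for k
    using v that \<phi> by (simp add: std_basis_def wv_def)
  have "rep N u (Kc \<phi>) (\<lambda>k. \<Sum>l<N. (cinner N (v l) (ud j) / complex_of_real (nn (int N - 1) l)) * v l k) = (\<lambda>_. 0)"
    unfolding rep_sum using z by simp
  then have "rep N u (Kc \<phi>) (ud j) = (\<lambda>_. 0)" using std_expand[OF v ud_cvec[OF ij(2)]] by simp
  then show ?thesis using mcoef_eval[OF lfun_Kc, of \<phi> N u "ud i" "ud j"] ij by (simp add: mcoef_ud cinner_simps)
qed

text \<open>The highest weights N - 1 and M - 1 add up on the tensor product, while a component of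
  dimension K contains the weight K - 1.\<close>

lemma intw_weight:
  assumes u: "irred_unitary_corep q N u" and v: "irred_unitary_corep q M v" and w: "irred_unitary_corep q K w"
    and T: "intw (N * M) (tcorep M u v) K w T"
  shows "K + 1 \<le> N + M"
proof (rule ccontr)
  assume K: "\<not> K + 1 \<le> N + M"
  \<comment> \<open>Indicator of the weights above N + M - 2: zero on the tensor product, but 1 on
    the highest weight of a component that is too large.\<close>
  define \<phi> where "\<phi> = (\<lambda>w::int. if w \<le> int N + int M - 2 then 0 else 1 :: complex)"
  have M: "0 < M" using v by (simp add: irred_unitary_corep_def)
  obtain W where W: "\<And>i j. i < M \<Longrightarrow> j < M \<Longrightarrow> v i j \<in> FL W" using rep_FL[of M v] by blast
  have z: "Kc \<phi> (u i j * v k l) = 0" if "i < N" "j < N" "k < M" "l < M" for i j k l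
  proof -
    have "Kc (\<lambda>w. \<phi> (w + w')) (u i j) * Kc (delta w') (v k l) = 0" for w'
    proof (cases "w' \<le> int M - 1")
      case True
      have "Kc (\<lambda>w. \<phi> (w + w')) (u i j) = 0"
        by (rule Kc_irr_zero[OF u]) (use True that in \<open>auto simp: \<phi>_def\<close>)
      then show ?thesis by simp
    next
      case False
      have "Kc (delta w') (v k l) = 0"
        by (rule Kc_irr_zero[OF v]) (use False that in \<open>auto simp: delta_def\<close>)
      then show ?thesis by simp
    qed
    then show ?thesis unfolding Kc_mult_FL[OF W[OF that(3,4)]] by (intro sum.neutral) blast
  qed
  have r: "rep (N * M) (tcorep M u v) (Kc \<phi>) x = (\<lambda>_. 0)" for x
  proof
    fix I
    have "Kc \<phi> (tcorep M u v I J) = 0" if "I < N * M" "J < N * M" for J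
      unfolding tcorep_def using that M by (intro z) (simp_all add: less_mult_imp_div_less)
    then show "rep (N * M) (tcorep M u v) (Kc \<phi>) x I = 0" by (simp add: rep_def)
  qed
  obtain b where b: "std_basis K w b" using std_basis_exists[OF w] by blast
  have K0: "0 < K" using w by (simp add: irred_unitary_corep_def)
  have b0: "b 0 \<in> cvec K" "rep K w (Kc \<phi>) (b 0) = (\<lambda>i. \<phi> (int K - 1) * b 0 i)" "cinner K (b 0) (b 0) = 1"
    using b K0 by (auto simp: std_basis_def wv_def)
  obtain x where x: "x \<in> cvec (N * M)" "T x = b 0" using T b0(1) by (auto simp: intw_def)
  \<comment> \<open>\<open>intw\<close> does not state linearity; commuting with the zero functional
    yields T 0 = 0.\<close>
  have "(\<lambda>_. 0) \<in> Udual q" using Udual_lin2[OF Udual_eps Udual_eps, of 0 0] by simp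
  then have "T (\<lambda>_. 0) = rep K w (\<lambda>_. 0) (T x)"
    using T x(1) rep_zero_fun[of "N * M" "tcorep M u v" x] unfolding intw_def by metis
  then have "T (\<lambda>_. 0) = (\<lambda>_. 0)" by (simp add: rep_zero_fun)
  moreover have "T (rep (N * M) (tcorep M u v) (Kc \<phi>) x) = rep K w (Kc \<phi>) (b 0)"
    using T x by (simp add: intw_def)
  ultimately have "(\<lambda>i. \<phi> (int K - 1) * b 0 i) = (\<lambda>_. 0)" using r b0(2) by simp
  moreover have "\<phi> (int K - 1) = 1" using K by (simp add: \<phi>_def)
  ultimately have "b 0 = (\<lambda>_. 0)" by simp
  then show False using b0(3) by (simp add: cinner_simps)
qed

end

context sqd
begin

text \<open>An intertwiner to \<open>u m\<close> sends z to some c times \<open>et m\<close> and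
  commutes with k^-1, so both slots scale by c and the factor is |c|^2 \<open>nu m\<close>. In even
  dimension z is zero.\<close>

lemma wt_vec_mcoef:
  assumes v: "irred_unitary_corep q M v" and z: "z \<in> cvec M" and e: "rep M v (Fc a qn) z = (\<lambda>i. qn a * z i)"
  shows "\<exists>m r. M = dd m \<and> 0 \<le> r \<and> mcoef M v (rep M v (U_kinv q) z) z \<simeq> scl (of_real r) (psi m) \<or>
    mcoef M v (rep M v (U_kinv q) z) z = 0"
proof (cases "even M")
  case True
  have vc: "unitary_corep q M v" using v by (simp add: irred_unitary_corep_def)
  have "z = (\<lambda>_. 0)" using even_dim_zero[OF v True z] calc_rep[OF calc_Fc vc z e, of "ind a"] by simp
  then show ?thesis by (simp add: mcoef_def)
next
  case False
  then obtain m where M: "M = dd m" unfolding dd_def by (elim oddE)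
  obtain T where T: "intw M v (dd m) (u m) T"
    "\<And>x y. x \<in> cvec M \<Longrightarrow> y \<in> cvec M \<Longrightarrow> mcoef M v x y \<simeq> mcoef (dd m) (u m) (T x) (T y)"
    using irr_equiv[OF v[unfolded M] u_irr] unfolding M by blast
  have vc: "unitary_corep q M v" using v by (simp add: irred_unitary_corep_def)
  have Tz: "rep (dd m) (u m) (Fc a (ind a)) (T z) = T z"
    unfolding intw_rep[OF T(1) Fc_Udual z, symmetric] using calc_rep[OF calc_Fc vc z e, of "ind a"] by simp
  have "rep (dd m) (u m) (Fc a qn) (T z) = (\<lambda>i. qn a * T z i)"
    using rep_ind_eig[OF u_corep, of m "T z"] unfolding Tz .
  from mult_one[OF intw_cvec[OF T(1) z] this] obtain c where c: "T z = (\<lambda>i. c * et m i)" by blast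
  have "mcoef M v (rep M v (U_kinv q) z) z \<simeq> mcoef (dd m) (u m) (T (rep M v (U_kinv q) z)) (T z)"
    by (rule T(2)[OF rep_cvec z])
  also have "\<dots> = mcoef (dd m) (u m) (\<lambda>i. c * rep (dd m) (u m) (U_kinv q) (et m) i) (\<lambda>i. c * et m i)"
    unfolding intw_rep[OF T(1) U_kinv_Udual z] c rep_scale ..
  also have "\<dots> = scl (cnj c * c * nu m) (psi m)" unfolding mcoef_scale by (simp add: psi_def)
  also have "cnj c * c * nu m = of_real ((cmod c)\<^sup>2 * Re (nu m))"
    using nu_nnr[of m] complex_norm_square[of c] by (simp add: nnr_def complex_eq_iff mult.commute)
  finally show ?thesis using M nu_nnr[of m] unfolding nnr_def
    by (intro exI[of _ m] exI[of _ "(cmod c)\<^sup>2 * Re (nu m)"]) simp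
qed

lemma sum_list_psi:
  assumes "\<And>t. t \<in> set ts \<Longrightarrow> \<exists>m r. m \<le> K \<and> 0 \<le> r \<and> t \<simeq> scl (of_real r) (psi m)"
  shows "\<exists>c. (\<forall>m. 0 \<le> c m) \<and> sum_list ts \<simeq> (\<Sum>m\<le>K. scl (of_real (c m)) (psi m))"
  using assms
proof (induction ts)
  case Nil
  show ?case by (rule exI[of _ "\<lambda>_. 0"]) simp
next
  case (Cons t ts)
  obtain m r where t: "m \<le> K" "0 \<le> r" "t \<simeq> scl (of_real r) (psi m)" using Cons.prems[of t] by auto
  have "\<exists>c. (\<forall>m. 0 \<le> c m) \<and> sum_list ts \<simeq> (\<Sum>m\<le>K. scl (of_real (c m)) (psi m))"
    by (rule Cons.IH) (use Cons.prems in auto)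
  then obtain c where c: "\<And>m. 0 \<le> c m" "sum_list ts \<simeq> (\<Sum>m\<le>K. scl (of_real (c m)) (psi m))" by blast
  let ?c = "\<lambda>k. c k + (if k = m then r else 0)"
  have "(\<Sum>k\<le>K. scl (of_real (?c k)) (psi k)) = (\<Sum>k\<le>K. scl (of_real (c k)) (psi k)) + (\<Sum>k\<le>K. if k = m then scl (of_real r) (psi m) else 0)"
    unfolding sum.distrib[symmetric] by (intro sum.cong refl) (simp add: fa.scale_left_distrib)
  also have "(\<Sum>k\<le>K. if k = m then scl (of_real r) (psi m) else 0) = scl (of_real r) (psi m)" using t(1) by (simp add: sum.delta)
  finally have "(\<Sum>k\<le>K. scl (of_real (?c k)) (psi k)) = scl (of_real r) (psi m) + (\<Sum>k\<le>K. scl (of_real (c k)) (psi k))"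
    by (simp add: add.commute)
  then have "sum_list (t # ts) \<simeq> (\<Sum>k\<le>K. scl (of_real (?c k)) (psi k))"
    using eqv_add[OF t(3) c(2)] by simp
  moreover have "\<forall>k. 0 \<le> ?c k" using c(1) t(2) by simp
  ultimately show ?case by (intro exI[of _ ?c] conjI)
qed

text \<open>As k^-1 is group-like, psi_n psi_1 is a positive multiple of the coefficient with left
  vector k^-1 w and right vector w, for w = \<eta>^n \<otimes> \<eta>^1. In each irreducible
  component \<open>wt_vec_mcoef\<close> gives zero or a nonnegative multiple of some psi_m,
  \<open>intw_weight\<close> bounds m, and the counit fixes the sum of the coefficients.\<close>

theorem fusion:
  "\<exists>c. (\<forall>m. 0 \<le> c m) \<and> (\<Sum>m\<le>Suc n. c m) = 1 \<and> psi n * psi 1 \<simeq> (\<Sum>m\<le>Suc n. scl (of_real (c m)) (psi m))"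
proof -
  let ?M = "dd 1" and ?W = "tcorep (dd 1) (u n) (u 1)"
  let ?N = "dd n * dd 1"
  let ?w = "tvec ?M (et n) (et 1)"
  have M: "0 < ?M" by (simp add: dd_def)
  have Wc: "unitary_corep q ?N ?W" by (rule tcorep_unitary[OF u_corep u_corep M])
  have w: "?w \<in> cvec ?N" by (rule tvec_cvec[OF M et_cvec])
  have kw: "rep ?N ?W (U_kinv q) ?w = tvec ?M (rep (dd n) (u n) (U_kinv q) (et n)) (rep ?M (u 1) (U_kinv q) (et 1))"
  proof -
    \<comment> \<open>The coproduct of k^-1 has one term; zero functionals fill the second slot of
      \<open>rep_tcorep\<close>.\<close>
    have "U_kinv q (x * y) = U_kinv q x * U_kinv q y + (\<lambda>_. 0) x * (\<lambda>_. 0) y" for x y by (simp add: U_kinv_mult)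
    then have "rep ?N ?W (U_kinv q) ?w = (\<lambda>I. tvec ?M (rep (dd n) (u n) (U_kinv q) (et n)) (rep ?M (u 1) (U_kinv q) (et 1)) I
        + tvec ?M (rep (dd n) (u n) (\<lambda>_. 0) (et n)) (rep ?M (u 1) (\<lambda>_. 0) (et 1)) I)"
      by (rule rep_tcorep[where h = "U_kinv q" and ?f1.0 = "U_kinv q" and ?g1.0 = "U_kinv q" and ?f2.0 = "\<lambda>_. 0" and ?g2.0 = "\<lambda>_. 0", OF _ M])
    then show ?thesis by (simp add: tvec_def rep_zero_fun)
  qed
  have ew: "rep ?N ?W (Fc a qn) ?w = (\<lambda>i. qn a * ?w i)"
  proof
    fix I
    have e1: "qn a * rep ?M (u 1) (U_kinv q) (et 1) k + rep ?M (u 1) X0 (et 1) k = qn a * et 1 k" for k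
    proof -
      have "Fc a qn = (\<lambda>x. \<Sum>s\<in>UNIV. (if s then qn a else 1) * (if s then U_kinv q else X0) x)"
        by (rule ext) (simp add: Fc_qn UNIV_bool)
      then have "rep ?M (u 1) (Fc a qn) (et 1) = (\<lambda>i. \<Sum>s\<in>UNIV. (if s then qn a else 1) * rep ?M (u 1) (if s then U_kinv q else X0) (et 1) i)"
        by (simp only: rep_lincomb)
      from fun_cong[OF this, of k] show ?thesis unfolding et_eig by (simp add: UNIV_bool add.commute)
    qed
    have "rep ?N ?W (Fc a qn) ?w I = tvec ?M (rep (dd n) (u n) (Fc a qn) (et n)) (rep ?M (u 1) (U_kinv q) (et 1)) I
        + tvec ?M (rep (dd n) (u n) eps (et n)) (rep ?M (u 1) X0 (et 1)) I"
      by (rule fun_cong[OF rep_tcorep[where h = "Fc a qn" and ?f1.0 = "Fc a qn" and ?g1.0 = "U_kinv q" and ?f2.0 = eps and ?g2.0 = X0, OF Fc_qn_mult M]])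
    also have "\<dots> = et n (I div ?M) * (qn a * rep ?M (u 1) (U_kinv q) (et 1) (I mod ?M) + rep ?M (u 1) X0 (et 1) (I mod ?M))"
      unfolding et_eig rep_eps[OF u_corep et_cvec] by (simp add: tvec_def algebra_simps)
    finally show "rep ?N ?W (Fc a qn) ?w I = qn a * ?w I" unfolding e1 by (simp add: tvec_def)
  qed
  obtain L :: "comp list" where L: "\<And>M v T. (M, v, T) \<in> set L \<Longrightarrow> irred_unitary_corep q M v \<and> intw ?N ?W M v T"
    "\<And>x y. x \<in> cvec ?N \<Longrightarrow> y \<in> cvec ?N \<Longrightarrow> mcoef ?N ?W x y \<simeq> (\<Sum>(M, v, T)\<leftarrow>L. mcoef M v (T x) (T y))"
    using decomposition[OF Wc] by blast
  let ?x = "rep ?N ?W (U_kinv q) ?w"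
  have t: "\<exists>m r. m \<le> Suc n \<and> 0 \<le> r \<and> t \<simeq> scl (of_real r) (psi m)"
    if mem: "t \<in> set (map (\<lambda>(M, v, T). mcoef M v (T ?x) (T ?w)) L)" for t
  proof -
    obtain M v T where i: "(M, v, T) \<in> set L" and t: "t = mcoef M v (T ?x) (T ?w)" using mem by auto
    have v: "irred_unitary_corep q M v" and T: "intw ?N ?W M v T" using L(1)[OF i] by auto
    have vc: "unitary_corep q M v" using v by (simp add: irred_unitary_corep_def)
    have z: "T ?w \<in> cvec M" by (rule intw_cvec[OF T w])
    have Tz: "rep M v (Fc a (ind a)) (T ?w) = T ?w"
      unfolding intw_rep[OF T Fc_Udual w, symmetric] using calc_rep[OF calc_Fc Wc w ew, of "ind a"] by simp
    have "rep M v (Fc a qn) (T ?w) = (\<lambda>i. qn a * T ?w i)"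
      using rep_ind_eig[OF vc, of "T ?w"] unfolding Tz .
    from wt_vec_mcoef[OF v z this]
    consider m r where "M = dd m" "0 \<le> r" "t \<simeq> scl (of_real r) (psi m)" | "t = 0"
      unfolding t intw_rep[OF T U_kinv_Udual w] by blast
    then show ?thesis
    proof cases
      case 1
      have "M + 1 \<le> dd n + dd 1" by (rule intw_weight[OF u_irr u_irr v T])
      then show ?thesis using 1 by (intro exI[of _ m] exI[of _ r]) (simp add: dd_def)
    next
      case 2
      then show ?thesis by (intro exI[of _ 0] exI[of _ 0]) simp
    qed
  qed
  obtain c where c: "\<And>m. 0 \<le> c m" "(\<Sum>(M, v, T)\<leftarrow>L. mcoef M v (T ?x) (T ?w)) \<simeq> (\<Sum>m\<le>Suc n. scl (of_real (c m)) (psi m))"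
    using sum_list_psi[OF t] by blast
  let ?s = "1 / (Re (nu n) * Re (nu 1))"
  have s: "of_real ?s = 1 / nu n * (1 / nu 1)" "0 \<le> ?s"
    using nu_nnr[of n] nu_nnr[of 1] by (simp_all add: nnr_def complex_is_Real_iff)
  have "psi n * psi 1 = scl (of_real ?s) (mcoef ?N ?W ?x ?w)"
    unfolding psi_def kw s(1) tcorep_mcoef by (simp add: mult.commute)
  also have "\<dots> \<simeq> scl (of_real ?s) (\<Sum>m\<le>Suc n. scl (of_real (c m)) (psi m))"
    by (rule eqv_scl[OF eqv_trans[OF L(2)[OF rep_cvec w] c(2)]])
  also have "\<dots> = (\<Sum>m\<le>Suc n. scl (of_real (?s * c m)) (psi m))"
    unfolding scl_sum by (simp only: fa.scale_scale of_real_mult)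
  finally have f: "psi n * psi 1 \<simeq> (\<Sum>m\<le>Suc n. scl (of_real (?s * c m)) (psi m))" .
  have "eps (psi n * psi 1) = 1" by (simp add: eps_mult eps_psi)
  then have "of_real (\<Sum>m\<le>Suc n. ?s * c m) = (1::complex)"
    using Udual_eqv[OF Udual_eps f] by (simp only: lfun_sum[OF lfun_eps] lfun_scl[OF lfun_eps] eps_psi mult_1_right of_real_sum)
  then have "(\<Sum>m\<le>Suc n. ?s * c m) = 1" by (simp only: of_real_eq_1_iff)
  moreover have "\<forall>m. 0 \<le> ?s * c m" using s(2) c(1) by (intro allI mult_nonneg_nonneg)
  ultimately show ?thesis using f by (intro exI[of _ "\<lambda>m. ?s * c m"] conjI)
qed

end

section \<open>The modules \<open>\<M>\<^bsub>\<lambda>,a\<^esub>\<close>\<close>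

locale sqm = sqd q a u \<eta> for q a u \<eta> +
  fixes ip :: "real \<Rightarrow> falg set \<Rightarrow> falg set \<Rightarrow> complex"
  assumes inv: "\<And>l. 0 < l \<Longrightarrow> l < Q2 q \<Longrightarrow> invariant_inner q a l (ip l)"
begin

definition cl :: "real \<Rightarrow> falg \<Rightarrow> falg set" where "cl l b = b +o LeftIdeal q a l"
abbreviation "Al l \<equiv> A_elt q a - cst (of_real l)"

lemma LI_iff: "z \<in> LeftIdeal q a l \<longleftrightarrow> (\<exists>b. inB b \<and> z \<simeq> b * Al l)"
proof
  assume "z \<in> LeftIdeal q a l"
  then obtain b x where "inB b" "x \<in> RelIdeal q" "z = b * Al l + x" unfolding LeftIdeal_def podles_inB by blast
  then show "\<exists>b. inB b \<and> z \<simeq> b * Al l" by (intro exI[of _ b]) (simp add: eqv_def)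
next
  assume "\<exists>b. inB b \<and> z \<simeq> b * Al l"
  then obtain b where b: "inB b" "z - b * Al l \<in> RelIdeal q" unfolding eqv_def by blast
  have "z = b * Al l + (z - b * Al l)" by simp
  then show "z \<in> LeftIdeal q a l" unfolding LeftIdeal_def podles_inB using b by blast
qed

lemma LI_eqv: "x \<in> LeftIdeal q a l \<Longrightarrow> y \<simeq> x \<Longrightarrow> y \<in> LeftIdeal q a l"
  unfolding LI_iff using eqv_trans by blast

lemma LI_I: "inB b \<Longrightarrow> b * Al l \<in> LeftIdeal q a l" unfolding LI_iff using eqv_refl by blast

lemma LI_zero [simp]: "0 \<in> LeftIdeal q a l" using LI_I[OF inB_zero, of l] by simp

lemma LI_add: assumes "x \<in> LeftIdeal q a l" "y \<in> LeftIdeal q a l" shows "x + y \<in> LeftIdeal q a l"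
proof -
  obtain b c where "inB b" "inB c" "x \<simeq> b * Al l" "y \<simeq> c * Al l" using assms unfolding LI_iff by blast
  then show ?thesis using LI_eqv[OF LI_I[OF inB_add[of b c]] , of "x + y"] eqv_add[of x "b * Al l" y "c * Al l"]
    by (simp only: distrib_right)
qed

lemma LI_mult: assumes "inB c" "x \<in> LeftIdeal q a l" shows "c * x \<in> LeftIdeal q a l"
proof -
  obtain b where b: "inB b" "x \<simeq> b * Al l" using assms(2) unfolding LI_iff by blast
  show ?thesis
    using LI_eqv[OF LI_I[OF inB_mult[OF assms(1) b(1)]] eqv_mult[OF eqv_refl[of c] b(2), unfolded mult.assoc[symmetric]]] .
qed

lemma LI_scl: "x \<in> LeftIdeal q a l \<Longrightarrow> scl c x \<in> LeftIdeal q a l"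
  using LI_mult[OF inB_cst, of x l c] by (simp add: scl_def)

lemma LI_diff: "x \<in> LeftIdeal q a l \<Longrightarrow> y \<in> LeftIdeal q a l \<Longrightarrow> x - y \<in> LeftIdeal q a l"
  using LI_add[of x l "scl (-1) y"] LI_scl[of y l "-1"] by simp

lemma Al_inB0: "inB0 (Al l)"
  using inB0_add[OF A_inB0 inB0_scl[OF inB0_one, of "- of_real l"]] by (simp add: cst_eq)

lemma LI_inB: assumes "x \<in> LeftIdeal q a l" shows "inB x"
proof -
  obtain b where b: "inB b" "x \<simeq> b * Al l" using assms unfolding LI_iff by blast
  then show ?thesis using inB_eqv[OF eqv_sym[OF b(2)] inB_mult] Al_inB0[of l] by (simp add: inB0_def)
qed

lemma LI_Ea: assumes "x \<in> LeftIdeal q a l" shows "Ea \<phi> x \<in> LeftIdeal q a l"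
proof -
  obtain b where b: "inB b" "x \<simeq> b * Al l" using assms unfolding LI_iff by blast
  have "Ea \<phi> x \<simeq> Ea \<phi> (b * Al l)" by (rule Ea_eqv[OF b(2)])
  also have "\<dots> \<simeq> Ea \<phi> b * Al l" by (rule Ea_mult[OF Al_inB0])
  finally show ?thesis by (rule LI_eqv[OF LI_I[OF Ea_inB[OF b(1)]]])
qed

lemma mem_cl: "x \<in> cl l b \<longleftrightarrow> x - b \<in> LeftIdeal q a l"
proof
  assume "x - b \<in> LeftIdeal q a l"
  moreover have "x = b + (x - b)" by simp
  ultimately show "x \<in> cl l b" unfolding cl_def elt_set_plus_def by blast
qed (auto simp: cl_def elt_set_plus_def)

lemma cl_eq: "cl l b = cl l c \<longleftrightarrow> b - c \<in> LeftIdeal q a l"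
proof
  assume "cl l b = cl l c"
  then have "b \<in> cl l c" using mem_cl[of b l b] by simp
  then show "b - c \<in> LeftIdeal q a l" by (simp add: mem_cl)
next
  assume d: "b - c \<in> LeftIdeal q a l"
  show "cl l b = cl l c"
  proof (rule set_eqI)
    fix x
    show "x \<in> cl l b \<longleftrightarrow> x \<in> cl l c"
      using LI_add[OF _ d, of "x - b"] LI_diff[OF _ d, of "x - c"] by (auto simp: mem_cl algebra_simps)
  qed
qed

text \<open>The module operations are unions over representatives; they collapse to a single coset
  once the underlying map respects the ideal.\<close>

lemma UN_cl:
  assumes "\<And>x. x - c \<in> LeftIdeal q a l \<Longrightarrow> F x - F c \<in> LeftIdeal q a l"
  shows "(\<Union>x\<in>cl l c. F x +o LeftIdeal q a l) = cl l (F c)"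
proof -
  have "F x +o LeftIdeal q a l = cl l (F c)" if "x \<in> cl l c" for x
    using assms[OF that[unfolded mem_cl]] unfolding cl_eq[symmetric] by (simp only: cl_def)
  moreover have "c \<in> cl l c" by (simp add: mem_cl)
  ultimately show ?thesis by blast
qed

lemma B_mact_cl: "inB b \<Longrightarrow> B_mact q a l b (cl l c) = cl l (b * c)"
  unfolding B_mact_def by (rule UN_cl) (simp add: right_diff_distrib[symmetric] LI_mult)

lemma M_scl_cl: "M_scl q a l r (cl l c) = cl l (scl r c)"
  unfolding M_scl_def by (rule UN_cl) (simp add: scl_diff[symmetric] LI_scl)

lemma Ic_mact_cl: "Ic_mact q a l (Fc a \<phi>) (cl l c) = cl l (Ea \<phi> c)"
  unfolding Ic_mact_def Ic_act_Gc Ea_def[symmetric]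
proof (rule UN_cl)
  fix x assume "x - c \<in> LeftIdeal q a l"
  moreover have "Ea \<phi> x - Ea \<phi> c = Ea \<phi> (x - c)"
    using Ea_lin(1)[of \<phi> c "x - c"] by simp
  ultimately show "Ea \<phi> x - Ea \<phi> c \<in> LeftIdeal q a l" using LI_Ea by simp
qed

lemma cl_add: "cl l b + cl l c = cl l (b + c)"
proof (rule set_eqI, rule iffI)
  fix x assume "x \<in> cl l b + cl l c"
  then obtain y z where "y \<in> cl l b" "z \<in> cl l c" "x = y + z" by (auto simp: set_plus_def)
  then show "x \<in> cl l (b + c)" using LI_add[of "y - b" l "z - c"] by (simp add: mem_cl algebra_simps)
next
  fix x assume "x \<in> cl l (b + c)"
  then have "x - c \<in> cl l b" by (simp add: mem_cl algebra_simps)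
  moreover have "c \<in> cl l c" by (simp add: mem_cl)
  moreover have "x = (x - c) + c" by simp
  ultimately show "x \<in> cl l b + cl l c" unfolding set_plus_def by blast
qed

lemma Mmod_cl: "Mmod q a l = cl l ` Collect inB"
  by (auto simp: Mmod_def cl_def podles_inB)

lemma e_vec_cl: "e_vec q a l = cl l 1" by (simp add: e_vec_def cl_def)

lemma LI_cl: "LeftIdeal q a l = cl l 0" by (auto simp: mem_cl)

lemma cobdry_cl: "inB b \<Longrightarrow> cobdry q a (cl (Q2 q) c) b = cl (Q2 q) ((b - cst (eps b)) * c)"
  unfolding cobdry_def by (simp add: B_mact_cl M_scl_cl cl_add algebra_simps) (simp add: scl_def)

lemma cocycle_cl: "inB b \<Longrightarrow> cocycle q a b = cl (Q2 q) (b - cst (eps b))"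
  unfolding cocycle_def e_vec_cl by (simp add: cobdry_cl)

lemma shifted_cl: "inB b \<Longrightarrow> shifted_vec q a l b = cl l (b - cst (eps b))"
  unfolding shifted_vec_def e_vec_cl by (simp add: B_mact_cl inB_diff inB_cst)

text \<open>Phi_n with n \<noteq> 0 sends \<B> into the kernel of the counit; this is the
  information about D_2^+ and D_2^- that the coboundary argument takes in.\<close>

lemma weight_sum_cl:
  assumes "X \<in> weight_sum q a T" "0 \<notin> T"
  shows "\<exists>b. inB b \<and> eps b = 0 \<and> X = cl (Q2 q) b"
proof -
  let ?l = "Q2 q"
  obtain T' m where X: "X = LeftIdeal q a ?l + (\<Sum>n\<in>T'. Ic_mact q a ?l (Phi q a n) (m n))"
    and T': "finite T'" "T' \<subseteq> T" "\<And>n. n \<in> T' \<Longrightarrow> m n \<in> Mmod q a ?l"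
    using assms(1) unfolding weight_sum_def by blast
  have "\<exists>b. inB b \<and> eps b = 0 \<and> LeftIdeal q a ?l + (\<Sum>n\<in>T'. Ic_mact q a ?l (Phi q a n) (m n)) = cl ?l b"
    using T'
  proof (induction T' rule: finite_induct)
    case empty
    show ?case by (intro exI[of _ 0]) (simp add: LI_cl inB_zero lfun_zero[OF lfun_eps] cl_add del: set_plus_def)
  next
    case (insert n T')
    obtain b where b: "inB b" "eps b = 0" "LeftIdeal q a ?l + (\<Sum>n\<in>T'. Ic_mact q a ?l (Phi q a n) (m n)) = cl ?l b"
      using insert.IH insert.prems by auto
    obtain c where c: "inB c" "m n = cl ?l c" using insert.prems(2)[of n] by (auto simp: Mmod_cl)
    have n: "n \<noteq> 0" using insert.prems(1) assms(2) by auto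
    have e: "eps (Ea (ind (a + 2 * of_int n)) c) = 0" using n by (simp add: Ea_eps[OF c(1)] ind_def)
    have "LeftIdeal q a ?l + (\<Sum>n\<in>insert n T'. Ic_mact q a ?l (Phi q a n) (m n)) = cl ?l (Ea (ind (a + 2 * of_int n)) c) + cl ?l b"
      unfolding sum.insert[OF insert.hyps] b(3)[symmetric] c(2) Phi_Fc Ic_mact_cl by (rule add.left_commute)
    then show ?case unfolding cl_add using b c e
      by (intro exI[of _ "Ea (ind (a + 2 * of_int n)) c + b"]) (simp add: inB_add Ea_inB lfun_add[OF lfun_eps])
  qed
  then show ?thesis unfolding X .
qed

lemma D2_cl:
  assumes "X \<in> D2 q a" shows "\<exists>b. inB b \<and> eps b = 0 \<and> X = cl (Q2 q) b"
proof -
  obtain Y Z where Y: "Y \<in> D2p q a" and Z: "Z \<in> D2m q a" and X: "X = Y + Z"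
    using assms unfolding D2_def set_plus_def by blast
  obtain b where "inB b" "eps b = 0" "Y = cl (Q2 q) b" using weight_sum_cl[OF Y[unfolded D2p_def]] by auto
  moreover obtain c where "inB c" "eps c = 0" "Z = cl (Q2 q) c" using weight_sum_cl[OF Z[unfolded D2m_def]] by auto
  ultimately show ?thesis unfolding X
    by (intro exI[of _ "b + c"]) (simp add: cl_add inB_add lfun_add[OF lfun_eps])
qed

section \<open>The vector state of e_a at parameter l\<close>

definition ph :: "real \<Rightarrow> falg \<Rightarrow> complex" where "ph l x = ip l (cl l 1) (cl l x)"

lemma psi_zero: "1 \<simeq> psi 0"
proof -
  have d: "dd 0 = 1" by (simp add: dd_def)
  have "(1::falg) = mcoef 1 (\<lambda>_ _. 1) (ud 0) (ud 0)" by (simp add: mcoef_ud)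
  then show ?thesis
    using psi_unique[of 1 0 "\<lambda>_ _. 1" "ud 0" "ud 0"] triv_irred ud_cvec[of 0 1] by (simp only: d) (simp add: inB0_one eps_one)
qed

context
  fixes l :: real
  assumes l: "0 < l" "l < Q2 q"
begin

lemma MmodI: "inB x \<Longrightarrow> cl l x \<in> Mmod q a l" by (simp add: Mmod_cl)

lemma inner: "inner_on q a l (ip l)" using inv[OF l] by (simp add: invariant_inner_def)

lemmas ip_add = inner[unfolded inner_on_def, THEN conjunct1, rule_format, OF MmodI MmodI MmodI, unfolded cl_add]
  and ip_scl = inner[unfolded inner_on_def, THEN conjunct2, THEN conjunct1, rule_format, OF MmodI MmodI, unfolded M_scl_cl]
  and ip_cnj = inner[unfolded inner_on_def, THEN conjunct2, THEN conjunct2, THEN conjunct1, rule_format, OF MmodI MmodI]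
  and ip_pos = inner[unfolded inner_on_def, THEN conjunct2, THEN conjunct2, THEN conjunct2, rule_format, OF MmodI]
  and ip_inv = inv[OF l, unfolded invariant_inner_def, THEN conjunct2, THEN conjunct1, rule_format, OF _ _ MmodI MmodI]

lemma ph_add: "inB x \<Longrightarrow> inB y \<Longrightarrow> ph l (x + y) = ph l x + ph l y"
  unfolding ph_def by (rule ip_add[OF inB_one])
lemma ph_scl: "inB x \<Longrightarrow> ph l (scl c x) = c * ph l x"
  unfolding ph_def by (rule ip_scl[OF inB_one])
lemma ph_zero: "ph l 0 = 0" using ph_scl[OF inB_zero, of 0] by simp
lemma ph_diff: "inB x \<Longrightarrow> inB y \<Longrightarrow> ph l (x - y) = ph l x - ph l y"
  using ph_add[of x "scl (-1) y"] ph_scl[of y "-1"] inB_scl[of y "-1"] by simp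
lemma ph_sum: "(\<And>i. i \<in> I \<Longrightarrow> inB (f i)) \<Longrightarrow> ph l (sum f I) = (\<Sum>i\<in>I. ph l (f i))"
  by (induction I rule: infinite_finite_induct) (simp_all add: ph_zero ph_add inB_sum)
lemma ph_LI: "x - y \<in> LeftIdeal q a l \<Longrightarrow> ph l x = ph l y"
  unfolding ph_def using cl_eq[of l x y] by simp
lemma ph_eqv: "x \<simeq> y \<Longrightarrow> ph l x = ph l y"
  by (rule ph_LI) (simp add: LI_eqv[OF LI_zero] eqv_def)
lemma ph_one: "ph l 1 = 1"
  using inv[OF l] by (simp add: invariant_inner_def ph_def e_vec_cl)

text \<open>Invariance is given for products b \<omega>. With \<omega> = Phi_0, which fixes e_a, it
  moves x to the other side at the cost of a Phi_0 there; the case x = 1, \<open>ph_Ea\<close>, then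
  removes that projection.\<close>

lemma ph_inv:
  assumes x: "inB x" and y: "inB y"
  shows "ip l (cl l x) (cl l y) = ph l (Ea (ind a) (star x * y))"
proof -
  have P: "Fc a (ind a) \<in> Ic q a" using Fc_Ic[of 0] by simp
  have d: "dstar q (Fc a (ind a)) = Fc a (ind a)"
    unfolding dstar_Fc by (rule arg_cong[of _ _ "Fc a"]) (auto simp: ind_def)
  have "ip l (B_mact q a l x (Ic_mact q a l (Fc a (ind a)) (cl l 1))) (cl l y)
      = ip l (cl l 1) (Ic_mact q a l (dstar q (Fc a (ind a))) (B_mact q a l (star x) (cl l y)))"
    by (rule ip_inv[OF _ P inB_one y]) (simp add: podles_inB x)
  then have "ip l (cl l (x * Ea (ind a) 1)) (cl l y) = ip l (cl l 1) (cl l (Ea (ind a) (star x * y)))"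
    unfolding d B_mact_cl[OF inB_star[OF x]] Ic_mact_cl B_mact_cl[OF x] .
  moreover have "cl l (x * Ea (ind a) 1) = cl l x"
  proof -
    have "Ea (ind a) 1 \<simeq> 1" using inB0_Ea[OF inB0_one, of "ind a"] by simp
    then have "x * Ea (ind a) 1 \<simeq> x * 1" by (rule eqv_mult[OF eqv_refl])
    then show ?thesis unfolding cl_eq using LI_eqv[OF LI_zero] by (simp add: eqv_def)
  qed
  ultimately show ?thesis by (simp add: ph_def)
qed

lemma ph_Ea: "inB y \<Longrightarrow> ph l (Ea (ind a) y) = ph l y"
  using ph_inv[OF inB_one, of y] by (simp add: star_one ph_def)

lemma ip_ph: "inB x \<Longrightarrow> inB y \<Longrightarrow> ip l (cl l x) (cl l y) = ph l (star x * y)"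
  by (simp add: ph_inv ph_Ea inB_mult inB_star)

lemma ph_cnj: "inB x \<Longrightarrow> inB y \<Longrightarrow> ph l (star y * x) = cnj (ph l (star x * y))"
  using ip_cnj[of x y] by (simp add: ip_ph)

lemma ph_star: "inB x \<Longrightarrow> ph l (star x) = cnj (ph l x)"
  using ph_cnj[OF inB_one, of x] by (simp add: star_one)

lemma ph_pos: assumes x: "inB x" shows "0 \<le> Re (ph l (star x * x))"
proof (cases "cl l x = LeftIdeal q a l")
  case True
  then have "x \<in> LeftIdeal q a l" using cl_eq[of l x 0] by (simp add: LI_cl)
  then have "ph l (star x * x) = ph l 0" using LI_mult[OF inB_star[OF x]] by (intro ph_LI) simp
  then show ?thesis by (simp add: ph_zero)
next
  case False
  then have "0 < Re (ip l (cl l x) (cl l x))"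
    by (rule ip_pos[OF x])
  then show ?thesis by (simp add: ip_ph x)
qed

lemma ph_Al: "inB x \<Longrightarrow> ph l (x * Al l) = 0"
  using ph_LI[of "x * Al l" 0] LI_I[of x l] by (simp add: ph_zero)

lemma ph_psi1:
  assumes x: "inB x"
  shows "of_real kap * ph l (x * psi 1) = of_real (l + kt) * ph l x"
proof -
  have p: "inB (psi 1)" using psi_inB0 by (simp add: inB0_def)
  have "x * Al l \<simeq> x * (scl (of_real kap) (psi 1) - cst (of_real kt) - cst (of_real l))"
    by (intro eqv_mult eqv_diff A_psi eqv_refl)
  also have "\<dots> = scl (of_real kap) (x * psi 1) - scl (of_real (l + kt)) x"
    by (simp add: algebra_simps cst_eq fa.scale_left_distrib)
  finally have "ph l (scl (of_real kap) (x * psi 1) - scl (of_real (l + kt)) x) = 0"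
    using ph_eqv ph_Al[OF x] by metis
  then show ?thesis using x p by (simp add: ph_diff ph_scl inB_scl inB_mult)
qed

end

end

section \<open>The limit \<open>\<lambda> \<rightarrow> q + q\<^sup>-\<^sup>1\<close>\<close>

context sqm
begin

abbreviation "F \<equiv> at_left (Q2 q)"

lemma ev_l: "(\<And>l. 0 < l \<Longrightarrow> l < Q2 q \<Longrightarrow> P l) \<Longrightarrow> eventually P F"
  using eventually_at_left_real[OF Q2_pos] by (rule eventually_mono) auto

lemma lim_cong: "(\<And>l. 0 < l \<Longrightarrow> l < Q2 q \<Longrightarrow> f l = g l) \<Longrightarrow> (f \<longlongrightarrow> c) F \<longleftrightarrow> (g \<longlongrightarrow> c) F"
  by (rule tendsto_cong[OF ev_l])

lemma lim_congI: "(g \<longlongrightarrow> c) F \<Longrightarrow> (\<And>l. 0 < l \<Longrightarrow> l < Q2 q \<Longrightarrow> f l = g l) \<Longrightarrow> (f \<longlongrightarrow> c) F"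
  using lim_cong[of f g c] by blast

definition gp :: "real \<Rightarrow> complex" where "gp l = of_real (Q2 q - l)"

lemma gp_nz: "l < Q2 q \<Longrightarrow> gp l \<noteq> 0"
  unfolding gp_def of_real_eq_0_iff by linarith

lemma gp_Re: "Re (z / gp l) = Re z / (Q2 q - l)" unfolding gp_def by (rule Re_divide_of_real)

definition D :: "real \<Rightarrow> nat \<Rightarrow> complex" where "D l n = (1 - ph l (psi n)) / gp l"

definition g :: "nat \<Rightarrow> real" where "g n = Re (Lim F (\<lambda>l. D l n))"

lemma psi_inB: "inB (psi n)" using psi_inB0 by (simp add: inB0_def)

lemma gap_zero: "(gp \<longlongrightarrow> 0) F"
proof -
  have "((\<lambda>l. of_real (Q2 q - l) :: complex) \<longlongrightarrow> of_real (Q2 q - Q2 q)) F" by (intro tendsto_intros)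
  then show ?thesis by (simp add: gp_def[abs_def])
qed

lemma D_rec:
  assumes c: "(\<Sum>m\<le>Suc n. c m) = 1" "psi n * psi 1 \<simeq> (\<Sum>m\<le>Suc n. scl (of_real (c m)) (psi m))"
    and l: "0 < l" "l < Q2 q"
  shows "of_real (c (Suc n)) * (D l (Suc n) - D l n) = ph l (psi n) / of_real kap + (\<Sum>m<n. of_real (c m) * (D l n - D l m))"
proof -
  let ?e = "gp l :: complex" and ?k = "of_real kap :: complex"
  have e0: "?e \<noteq> 0" by (rule gp_nz[OF l(2)])
  have k0: "?k \<noteq> 0" using kap_pos by simp
  have ph: "ph l (psi m) = 1 - ?e * D l m" for m using e0 by (simp add: D_def)
  have "?k * ph l (psi n * psi 1) = of_real (l + kt) * ph l (psi n)" by (rule ph_psi1[OF l psi_inB])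
  also have "of_real (l + kt) = ?k - ?e" by (simp only: gp_def kap_def kt_def of_real_diff[symmetric]) simp
  finally have "?k * ph l (psi n * psi 1) = ?k * (ph l (psi n) - ?e * ph l (psi n) / ?k)"
    using k0 by (simp add: left_diff_distrib right_diff_distrib)
  then have 1: "ph l (psi n * psi 1) = ph l (psi n) - ?e * ph l (psi n) / ?k"
    using k0 by (simp only: mult_cancel_left simp_thms)
  have "ph l (psi n * psi 1) = (\<Sum>m\<le>Suc n. of_real (c m) * ph l (psi m))"
    unfolding ph_eqv[OF l c(2)] by (subst ph_sum[OF l]) (simp_all only: inB_scl psi_inB ph_scl[OF l])
  also have "\<dots> = of_real (\<Sum>m\<le>Suc n. c m) - ?e * (\<Sum>m\<le>Suc n. of_real (c m) * D l m)"
    unfolding ph of_real_sum sum_distrib_left by (simp only: sum_subtractf[symmetric]) (simp only: right_diff_distrib mult_1_right mult.left_commute)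
  finally have P: "ph l (psi n * psi 1) = of_real (\<Sum>m\<le>Suc n. c m) - ?e * (\<Sum>m\<le>Suc n. of_real (c m) * D l m)" .
  \<comment> \<open>Cancels the terms free of the gap e, so that what remains is a multiple of e and
    can be divided by it.\<close>
  have aux: "e * S = e * (E + X / k)" if "P = 1 - e * S" "P = X - e * X / k" "X = 1 - e * E" for e S E X k P :: complex
  proof -
    have "1 - X = e * E" "e * S = 1 - P" using that(1,3) by simp_all
    then have "e * S = e * E + e * X / k" using that(2) by simp
    then show ?thesis by (simp add: distrib_left)
  qed
  have "?e * (\<Sum>m\<le>Suc n. of_real (c m) * D l m) = ?e * (D l n + ph l (psi n) / ?k)"
    using P[unfolded c(1) of_real_1] 1 ph[of n] by (rule aux)
  then have 2: "(\<Sum>m\<le>Suc n. of_real (c m) * D l m) = D l n + ph l (psi n) / ?k" using e0 by (simp only: mult_cancel_left simp_thms)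
  \<comment> \<open>Subtracting \<open>D l n\<close>, with coefficients of sum 1, removes the term m
    = n.\<close>
  have "(\<Sum>m\<le>Suc n. of_real (c m) * (D l m - D l n)) = (\<Sum>m\<le>Suc n. of_real (c m) * D l m) - of_real (\<Sum>m\<le>Suc n. c m) * D l n"
    by (simp only: right_diff_distrib sum_subtractf sum_distrib_right of_real_sum)
  then have 3: "(\<Sum>m\<le>Suc n. of_real (c m) * (D l m - D l n)) = ph l (psi n) / ?k" unfolding 2 c(1) by simp
  have "(\<Sum>m\<le>Suc n. of_real (c m) * (D l m - D l n)) = of_real (c (Suc n)) * (D l (Suc n) - D l n) + (\<Sum>m<n. of_real (c m) * (D l m - D l n))"
    by (simp add: lessThan_Suc_atMost[symmetric])
  moreover have "(\<Sum>m<n. of_real (c m) * (D l m - D l n)) = - (\<Sum>m<n. of_real (c m) * (D l n - D l m))"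
    unfolding sum_negf[symmetric] by (intro sum.cong refl) (simp add: algebra_simps)
  ultimately show ?thesis using 3 by (simp add: algebra_simps)
qed

lemma D_zero: "0 < l \<Longrightarrow> l < Q2 q \<Longrightarrow> D l 0 = 0"
  using ph_eqv[OF _ _ psi_zero, of l] by (simp add: D_def ph_one)

text \<open>Limits and growth have to be proved together: passing to n + 1 divides by the top fusion
  coefficient, and its positivity comes from monotonicity of \<open>g\<close> up to n.\<close>

lemma D_lim: "((\<lambda>l. D l n) \<longlongrightarrow> of_real (g n)) F \<and> (\<forall>m<n. g m + 1 / kap \<le> g (Suc m))"
proof (induction n rule: less_induct)
  case (less n)
  have gI: "((\<lambda>l. D l n) \<longlongrightarrow> of_real (g n)) F \<and> g n = r" if "((\<lambda>l. D l n) \<longlongrightarrow> of_real r) F" for r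
  proof -
    have "Lim F (\<lambda>l. D l n) = of_real r" by (rule tendsto_Lim[OF _ that]) simp
    then show ?thesis using that by (simp add: g_def)
  qed
  show ?case
  proof (cases n)
    case 0
    have "((\<lambda>l. D l n) \<longlongrightarrow> of_real 0) F" by (rule lim_congI[where g = "\<lambda>_. 0"]) (use 0 in \<open>simp_all add: D_zero\<close>)
    then show ?thesis using gI 0 by blast
  next
    case (Suc k)
    have L: "((\<lambda>l. D l m) \<longlongrightarrow> of_real (g m)) F" if "m \<le> k" for m using less[of m] that Suc by simp
    have mono: "g m \<le> g j" if "m \<le> j" "j \<le> k" for m j
      using that
    proof (induction j)
      case (Suc j)
      have "g j + 1 / kap \<le> g (Suc j)" using less[of "Suc j"] Suc.prems \<open>n = Suc k\<close> by simp
      then have "g j \<le> g (Suc j)" using kap_pos by (smt (verit) zero_less_divide_1_iff)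
      then show ?case using Suc by (cases "m = Suc j") auto
    qed simp
    obtain c where c: "\<And>m. 0 \<le> c m" "(\<Sum>m\<le>Suc k. c m) = 1" "psi k * psi 1 \<simeq> (\<Sum>m\<le>Suc k. scl (of_real (c m)) (psi m))"
      using fusion[of k] by blast
    define R where "R = 1 / kap + (\<Sum>m<k. c m * (g k - g m))"
    have "0 \<le> c m * (g k - g m)" if "m < k" for m using c(1)[of m] mono[of m k] that by simp
    then have "0 \<le> (\<Sum>m<k. c m * (g k - g m))" by (intro sum_nonneg) simp
    then have R: "1 / kap \<le> R" unfolding R_def by simp
    have Rp: "0 < R" using R kap_pos by (smt (verit) zero_less_divide_1_iff)
    have phl: "((\<lambda>l. ph l (psi k)) \<longlongrightarrow> 1) F"
    proof -
      have "((\<lambda>l. 1 - gp l * D l k) \<longlongrightarrow> 1 - 0 * of_real (g k)) F"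
        by (intro tendsto_intros gap_zero L) simp
      then have "((\<lambda>l. 1 - gp l * D l k) \<longlongrightarrow> 1) F" by simp
      then show ?thesis by (rule lim_congI) (simp add: D_def gp_nz)
    qed
    have rhs: "((\<lambda>l. ph l (psi k) / of_real kap + (\<Sum>m<k. of_real (c m) * (D l k - D l m))) \<longlongrightarrow> of_real R) F"
    proof -
      have "((\<lambda>l. ph l (psi k) / of_real kap + (\<Sum>m<k. of_real (c m) * (D l k - D l m))) \<longlongrightarrow>
          1 / of_real kap + (\<Sum>m<k. of_real (c m) * (of_real (g k) - of_real (g m)))) F"
        using kap_pos by (intro tendsto_intros phl L) auto
      then show ?thesis unfolding R_def by simp
    qed
    then have lhs: "((\<lambda>l. of_real (c (Suc k)) * (D l (Suc k) - D l k)) \<longlongrightarrow> of_real R) F"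
      by (rule lim_congI) (rule D_rec[OF c(2,3)])
    \<comment> \<open>If the top coefficient were 0, the left side would vanish identically, against
      R > 0.\<close>
    have cp: "0 < c (Suc k)"
    proof (rule ccontr)
      assume "\<not> 0 < c (Suc k)"
      then have "c (Suc k) = 0" using c(1)[of "Suc k"] by simp
      then have "((\<lambda>l::real. 0::complex) \<longlongrightarrow> of_real R) F" using lhs by simp
      then have "(of_real R :: complex) = 0" using tendsto_unique[OF _ tendsto_const, of F 0 "of_real R"] by simp
      then show False using Rp by simp
    qed
    have c1: "c (Suc k) \<le> 1" using member_le_sum[of "Suc k" "{..Suc k}" c] c(1,2) by simp
    have "((\<lambda>l. of_real (c (Suc k)) * (D l (Suc k) - D l k) / of_real (c (Suc k)) + D l k) \<longlongrightarrow> of_real R / of_real (c (Suc k)) + of_real (g k)) F"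
      using cp by (intro tendsto_intros lhs L) auto
    then have "((\<lambda>l. D l n) \<longlongrightarrow> of_real (R / c (Suc k) + g k)) F" unfolding Suc using cp by simp
    from gI[OF this] have s: "((\<lambda>l. D l n) \<longlongrightarrow> of_real (g n)) F" "g n = R / c (Suc k) + g k" by blast+
    \<comment> \<open>The coefficients are nonnegative with sum 1, so dividing by the top one can
      only increase R.\<close>
    have "R \<le> R / c (Suc k)" using cp c1 Rp by (simp add: le_divide_eq mult_le_cancel_left1)
    then have "g k + 1 / kap \<le> g n" using R s(2) by simp
    then show ?thesis using s(1) less[of k] Suc by (auto simp: less_Suc_eq)
  qed
qed

lemma g_ge: "real n / kap \<le> g n"
proof (induction n)
  case 0
  have "((\<lambda>l. D l 0) \<longlongrightarrow> 0) F" by (rule lim_congI[where g = "\<lambda>_. 0"]) (simp_all add: D_zero)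
  then have "(of_real (g 0) :: complex) = 0" using tendsto_unique[of F "\<lambda>l. D l 0"] D_lim[of 0] by (metis trivial_limit_at_left_real)
  then show ?case by simp
next
  case (Suc n)
  then show ?case using D_lim[of "Suc n"] by (simp add: add_divide_distrib) (smt (verit) lessI)
qed

text \<open>The projection \<open>Ea\<close> of \<open>\<B>\<close> onto \<open>\<B>\<^sub>0\<close> reduces this to the \<open>\<psi>\<^sub>n\<close>.\<close>

lemma ph_diff_lim:
  assumes x: "inB x" shows "\<exists>k. ((\<lambda>l. (ph l x - eps x) / gp l) \<longlongrightarrow> k) F"
proof -
  define S where "S = {x. inB x \<and> (\<exists>k. ((\<lambda>l. (ph l x - eps x) / gp l) \<longlongrightarrow> k) F)}"
  have R: "x \<in> S" if "x \<in> RelIdeal q" for x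
  proof -
    have z: "eps x = 0" using Udual_eqv[OF Udual_eps, of x 0] that by (simp add: eqv_zero lfun_zero[OF lfun_eps])
    have "((\<lambda>l. (ph l x - eps x) / gp l) \<longlongrightarrow> 0) F"
      by (rule lim_congI[where g = "\<lambda>_. 0"])
        (use ph_eqv[of _ x 0] that z in \<open>simp_all add: eqv_zero ph_zero\<close>)
    then show ?thesis using inB_Rel[OF that] unfolding S_def by blast
  qed
  have P: "psi n \<in> S" for n
  proof -
    have "((\<lambda>l. - D l n) \<longlongrightarrow> - of_real (g n)) F" using D_lim by (intro tendsto_minus) blast
    moreover have "- D l n = (ph l (psi n) - eps (psi n)) / gp l" for l
      unfolding D_def eps_psi minus_divide_left by simp
    ultimately show ?thesis using psi_inB unfolding S_def by auto
  qed
  have A: "x + y \<in> S" if xy: "x \<in> S" "y \<in> S" for x y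
  proof -
    obtain k k' where k: "inB x" "inB y" "((\<lambda>l. (ph l x - eps x) / gp l) \<longlongrightarrow> k) F"
      "((\<lambda>l. (ph l y - eps y) / gp l) \<longlongrightarrow> k') F" using xy unfolding S_def by blast
    have "((\<lambda>l. (ph l (x + y) - eps (x + y)) / gp l) \<longlongrightarrow> k + k') F"
      by (rule lim_congI[OF tendsto_add[OF k(3,4)]])
        (simp_all add: ph_add k lfun_add[OF lfun_eps] add_divide_distrib[symmetric])
    then show ?thesis using inB_add k(1,2) unfolding S_def by blast
  qed
  have C: "scl c x \<in> S" if xS: "x \<in> S" for c x
  proof -
    obtain k where k: "inB x" "((\<lambda>l. (ph l x - eps x) / gp l) \<longlongrightarrow> k) F" using xS unfolding S_def by blast
    have "((\<lambda>l. (ph l (scl c x) - eps (scl c x)) / gp l) \<longlongrightarrow> c * k) F"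
      by (rule lim_congI[OF tendsto_mult_left[OF k(2), of c]])
        (simp_all add: ph_scl k lfun_scl[OF lfun_eps] right_diff_distrib)
    then show ?thesis using inB_scl k(1) unfolding S_def by blast
  qed
  have "Ea (ind a) x \<in> S"
    using Ea_PSp[OF x] unfolding PSp_def
  proof (rule fa.span_induct)
    show "fa.subspace {y. y \<in> S}" unfolding fa.subspace_def using R[OF Rel_zero] A C by simp
  qed (use R P in blast)
  then obtain k where "((\<lambda>l. (ph l (Ea (ind a) x) - eps (Ea (ind a) x)) / gp l) \<longlongrightarrow> k) F"
    unfolding S_def by blast
  then have "((\<lambda>l. (ph l x - eps x) / gp l) \<longlongrightarrow> k) F"
    by (rule lim_congI[where g = "\<lambda>l. (ph l (Ea (ind a) x) - eps (Ea (ind a) x)) / gp l"])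
      (simp_all add: ph_Ea x Ea_eps)
  then show ?thesis by blast
qed

lemma ph_lim: assumes x: "inB x" shows "((\<lambda>l. ph l x) \<longlongrightarrow> eps x) F"
proof -
  obtain k where k: "((\<lambda>l. (ph l x - eps x) / gp l) \<longlongrightarrow> k) F" using ph_diff_lim[OF x] by blast
  have "((\<lambda>l. gp l * ((ph l x - eps x) / gp l) + eps x) \<longlongrightarrow> 0 * k + eps x) F"
    by (intro tendsto_intros gap_zero k)
  then have "((\<lambda>l. gp l * ((ph l x - eps x) / gp l) + eps x) \<longlongrightarrow> eps x) F" by simp
  then show ?thesis
    by (rule lim_congI[where g = "\<lambda>l. gp l * ((ph l x - eps x) / gp l) + eps x"]) (simp_all add: gp_nz)
qed

section \<open>The limit inner product\<close>

definition C :: "real \<Rightarrow> real" where "C l = qbrace q (a + 2) / qbrace q a / (qbrace q (2 * a + 1) + l)"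

lemma qbrace_pos: "0 < qbrace q c" unfolding qbrace_def using q_pos by (intro add_pos_pos) simp_all

lemma C_pos: "0 < l \<Longrightarrow> 0 < C l" unfolding C_def using qbrace_pos by (intro divide_pos_pos add_pos_pos)

lemma C_lim: "((\<lambda>l. of_real (C l) :: complex) \<longlongrightarrow> of_real (C (Q2 q))) F"
  unfolding C_def using qbrace_pos[of "2 * a + 1"] Q2_pos
  by (intro tendsto_of_real tendsto_divide tendsto_add tendsto_const tendsto_ident_at) linarith

text \<open>The rescaled state: \<open>C l\<close> is the factor of the scaling that stays finite
  and positive at the limit, while the vanishing gap is kept apart.\<close>

definition sc :: "real \<Rightarrow> falg \<Rightarrow> complex" where "sc l x = of_real (C l) * (ph l x / gp l)"

lemma scaled_sc: "0 < l \<Longrightarrow> l < Q2 q \<Longrightarrow> inB x \<Longrightarrow> inB y \<Longrightarrow> scaled_ip q a ip l (cl l x) (cl l y) = sc l (star x * y)"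
  unfolding scaled_ip_def sc_def C_def gp_def by (simp only: ip_ph of_real_divide of_real_mult divide_inverse mult_ac of_real_inverse)

lemma sc_lim: assumes "inB x" "eps x = 0" shows "\<exists>k. ((\<lambda>l. sc l x) \<longlongrightarrow> k) F"
  using ph_diff_lim[OF assms(1)] tendsto_mult[OF C_lim] unfolding sc_def assms(2) diff_zero by blast

lemma sc_add: "0 < l \<Longrightarrow> l < Q2 q \<Longrightarrow> inB x \<Longrightarrow> inB y \<Longrightarrow> sc l (x + y) = sc l x + sc l y"
  unfolding sc_def by (simp add: ph_add add_divide_distrib distrib_left)

lemma sc_pos: "0 < l \<Longrightarrow> l < Q2 q \<Longrightarrow> inB x \<Longrightarrow> 0 \<le> Re (sc l (star x * x))"
  unfolding sc_def using C_pos[of l] ph_pos[of l x] by (simp add: gp_Re)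

text \<open>Modulo the ideal at l, an element d (A_a - (q + 1/q)) of the limiting ideal is - gap d.
  The gap cancels the denominator, and what remains tends to a multiple of the counit of x^* d,
  which is zero.\<close>

lemma sc_LI:
  assumes x: "inB x" "eps x = 0" and z: "z \<in> LeftIdeal q a (Q2 q)"
  shows "((\<lambda>l. sc l (star x * z)) \<longlongrightarrow> 0) F"
proof -
  obtain d where d: "inB d" "z \<simeq> d * Al (Q2 q)" using z unfolding LI_iff by blast
  have sx: "inB (star x)" by (rule inB_star[OF x(1)])
  have e: "sc l (star x * z) = - of_real (C l) * ph l (star x * d)" if l: "0 < l" "l < Q2 q" for l
  proof -
    have "star x * z \<simeq> star x * (d * Al (Q2 q))" by (rule eqv_mult[OF eqv_refl d(2)])
    also have "cst (of_real (Q2 q)) = (cst (of_real l) + cst (gp l) :: falg)"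
      unfolding cst_eq gp_def fa.scale_left_distrib[symmetric] of_real_add[symmetric] by simp
    also have "star x * (d * (A_elt q a - (cst (of_real l) + cst (gp l)))) = star x * d * Al l - scl (gp l) (star x * d)"
      by (simp add: cst_eq algebra_simps)
    finally have "ph l (star x * z) = ph l (star x * d * Al l - scl (gp l) (star x * d))" by (rule ph_eqv[OF l])
    also have "\<dots> = - (gp l * ph l (star x * d))"
      using sx d(1) Al_inB0[of l] by (simp add: ph_diff[OF l] ph_scl[OF l] ph_Al[OF l] inB_mult inB_scl inB0_def)
    finally show ?thesis using gp_nz[OF l(2)] by (simp add: sc_def)
  qed
  have "((\<lambda>l. - of_real (C l) * ph l (star x * d)) \<longlongrightarrow> - of_real (C (Q2 q)) * eps (star x * d)) F"
    using C_lim ph_lim[OF inB_mult[OF sx d(1)]] by (intro tendsto_mult tendsto_minus)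
  moreover have "eps (star x * d) = 0" using x(2) by (simp add: eps_mult eps_star)
  ultimately show ?thesis by (intro lim_congI[OF _ e]) simp_all
qed

lemma LI_eps: assumes "z \<in> LeftIdeal q a (Q2 q)" shows "eps z = 0"
proof -
  obtain d where d: "z \<simeq> d * Al (Q2 q)" using assms unfolding LI_iff by blast
  have "eps z = eps (d * Al (Q2 q))" by (rule Udual_eqv[OF Udual_eps d])
  also have "\<dots> = 0" by (simp only: eps_mult lfun_diff[OF lfun_eps] A_eps cst_eq lfun_scl[OF lfun_eps] eps_one) simp
  finally show ?thesis .
qed

lemma sc_cnj:
  assumes "0 < l" "l < Q2 q" "inB x" "inB y" shows "sc l (star y * x) = cnj (sc l (star x * y))"
  unfolding sc_def ph_cnj[OF assms] by (simp add: gp_def)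

text \<open>Makes the definite description in \<open>D2_inner\<close> meaningful: two
  representatives differ by an element of the limiting ideal, which need not lie in the ideals at l
  < q + 1/q.\<close>

lemma sc_indep:
  assumes x: "inB x" "eps x = 0" and y: "inB y" "eps y = 0" and d: "x' - x \<in> LeftIdeal q a (Q2 q)" "y' - y \<in> LeftIdeal q a (Q2 q)"
    and k: "((\<lambda>l. sc l (star x * y)) \<longlongrightarrow> k) F"
  shows "((\<lambda>l. sc l (star x' * y')) \<longlongrightarrow> k) F"
proof -
  let ?z = "x' - x" and ?w = "y' - y"
  note b = x(1) y(1) LI_inB[OF d(1)] LI_inB[OF d(2)]
  have 1: "((\<lambda>l. sc l (star ?z * y)) \<longlongrightarrow> 0) F"
  proof -
    have "((\<lambda>l. cnj (sc l (star y * ?z))) \<longlongrightarrow> cnj 0) F" by (rule tendsto_cnj[OF sc_LI[OF y d(1)]])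
    then have "((\<lambda>l. cnj (sc l (star y * ?z))) \<longlongrightarrow> 0) F" by simp
    then show ?thesis by (rule lim_congI) (simp_all add: sc_cnj[OF _ _ b(2,3)])
  qed
  have "((\<lambda>l. sc l (star x * y) + sc l (star x * ?w) + (sc l (star ?z * y) + sc l (star ?z * ?w))) \<longlongrightarrow> k + 0 + (0 + 0)) F"
    by (intro tendsto_add k 1 sc_LI x d b LI_eps)
  moreover have "sc l (star x' * y') = sc l (star x * y) + sc l (star x * ?w) + (sc l (star ?z * y) + sc l (star ?z * ?w))"
    if l: "0 < l" "l < Q2 q" for l
  proof -
    have "star x' * y' = (star x * y + star x * ?w) + (star ?z * y + star ?z * ?w)"
      by (simp add: algebra_simps star_diff)
    then show ?thesis using b by (simp only: sc_add[OF l] inB_add inB_mult inB_star)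
  qed
  ultimately show ?thesis by (intro lim_congI[where f = "\<lambda>l. sc l (star x' * y')"]) simp_all
qed

definition dev :: "falg \<Rightarrow> falg" where "dev b = b - cst (eps b)"

lemma dev_inB: "inB b \<Longrightarrow> inB (dev b)" unfolding dev_def by (intro inB_diff inB_cst)
lemma dev_eps: "eps (dev b) = 0" by (simp add: dev_def lfun_diff[OF lfun_eps] cst_eq lfun_scl[OF lfun_eps] eps_one)

lemma D2_inner_eq:
  assumes b: "inB b" and k: "((\<lambda>l. sc l (star (dev b) * dev b)) \<longlongrightarrow> k) F"
  shows "D2_inner q a ip (cocycle q a b) (cocycle q a b) = k"
proof -
  have lc: "((\<lambda>l. scaled_ip q a ip l (shifted_vec q a l b') (shifted_vec q a l b'')) \<longlongrightarrow> c) F \<longleftrightarrow>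
      ((\<lambda>l. sc l (star (dev b') * dev b'')) \<longlongrightarrow> c) F" if "inB b'" "inB b''" for b' b'' c
    by (rule lim_cong) (simp add: shifted_cl that dev_def[symmetric] scaled_sc dev_inB)
  show ?thesis unfolding D2_inner_def
  proof (rule the_equality)
    show "\<forall>b'\<in>podles q a. \<forall>b''\<in>podles q a. cocycle q a b' = cocycle q a b \<and> cocycle q a b'' = cocycle q a b \<longrightarrow>
       ((\<lambda>l. scaled_ip q a ip l (shifted_vec q a l b') (shifted_vec q a l b'')) \<longlongrightarrow> k) F"
    proof (intro ballI impI)
      fix b' b'' assume "b' \<in> podles q a" "b'' \<in> podles q a" and e: "cocycle q a b' = cocycle q a b \<and> cocycle q a b'' = cocycle q a b"
      then have i: "inB b'" "inB b''" by (simp_all add: podles_inB)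
      have "dev b' - dev b \<in> LeftIdeal q a (Q2 q)" "dev b'' - dev b \<in> LeftIdeal q a (Q2 q)"
        using e by (simp_all add: cocycle_cl b i dev_def[symmetric] cl_eq)
      then show "((\<lambda>l. scaled_ip q a ip l (shifted_vec q a l b') (shifted_vec q a l b'')) \<longlongrightarrow> k) F"
        unfolding lc[OF i] by (intro sc_indep[OF _ _ _ _ _ _ k] dev_inB dev_eps b)
    qed
    fix c assume c: "\<forall>b'\<in>podles q a. \<forall>b''\<in>podles q a. cocycle q a b' = cocycle q a b \<and> cocycle q a b'' = cocycle q a b \<longrightarrow>
       ((\<lambda>l. scaled_ip q a ip l (shifted_vec q a l b') (shifted_vec q a l b'')) \<longlongrightarrow> c) F"
    have "b \<in> podles q a" by (simp add: podles_inB b)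
    then have "((\<lambda>l. sc l (star (dev b) * dev b)) \<longlongrightarrow> c) F" using c by (intro lc[OF b b, THEN iffD1]) blast
    then show "c = k" using k tendsto_unique[of F] by (metis trivial_limit_at_left_real)
  qed
qed

lemma D2_norm_lim:
  assumes b: "inB b" shows "((\<lambda>l. Re (sc l (star (dev b) * dev b))) \<longlongrightarrow> (D2_norm q a ip (cocycle q a b))\<^sup>2) F"
proof -
  obtain k where k: "((\<lambda>l. sc l (star (dev b) * dev b)) \<longlongrightarrow> k) F"
    using sc_lim[of "star (dev b) * dev b"] by (auto simp: inB_mult inB_star dev_inB b eps_mult dev_eps)
  have r: "((\<lambda>l. Re (sc l (star (dev b) * dev b))) \<longlongrightarrow> Re k) F" by (rule tendsto_Re[OF k])
  \<comment> \<open>Squaring undoes the \<open>sqrt\<close> in \<open>D2_norm\<close> because the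
    limit is nonnegative.\<close>
  have "0 \<le> Re k" by (rule tendsto_lowerbound[OF r ev_l]) (simp_all add: sc_pos dev_inB b)
  then have "(D2_norm q a ip (cocycle q a b))\<^sup>2 = Re k" by (simp add: D2_norm_def D2_inner_eq[OF b k])
  then show ?thesis using r by simp
qed

section \<open>Summation over the eigenbasis and properness\<close>

definition um :: "nat \<Rightarrow> int \<Rightarrow> falg" where "um n j = mcoef (dd n) (u n) (\<eta> n j) (et n)"
definition js :: "nat \<Rightarrow> int set" where "js n = {- int n..int n}"

lemma um_inB: "inB (um n j)" unfolding um_def by (rule mcoef_inB)

lemma um_eps: "j \<in> js n \<Longrightarrow> eps (um n j) = (if j = 0 then 1 else 0)"
  unfolding um_def et_def[of n] using eta_inner[of j n 0] et_cvec[of n]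
  by (auto simp: eps_mcoef[OF u_corep] et_def js_def)

lemma js_sum: "(\<Sum>j\<in>js n. f j) = (\<Sum>k<dd n. f (int k - int n))"
  by (rule sum.reindex_bij_witness[of _ "\<lambda>k. int k - int n" "\<lambda>j. nat (j + int n)"]) (auto simp: js_def dd_def)

lemma sum3_rotate: "(\<Sum>k\<in>A. \<Sum>i\<in>B. \<Sum>j\<in>E. f k i j) = (\<Sum>i\<in>B. \<Sum>j\<in>E. \<Sum>k\<in>A. f k i j)" for f :: "'i \<Rightarrow> 'j \<Rightarrow> 'k \<Rightarrow> falg"
proof -
  have "(\<Sum>k\<in>A. \<Sum>i\<in>B. \<Sum>j\<in>E. f k i j) = (\<Sum>i\<in>B. \<Sum>k\<in>A. \<Sum>j\<in>E. f k i j)" by (rule sum.swap)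
  also have "\<dots> = (\<Sum>i\<in>B. \<Sum>j\<in>E. \<Sum>k\<in>A. f k i j)" by (rule sum.cong[OF refl], rule sum.swap)
  finally show ?thesis .
qed

lemma star_lincomb_mult:
  "star (\<Sum>i\<in>A. scl (f i) (c i)) * (\<Sum>i\<in>A. scl (h i) (c i)) = (\<Sum>i\<in>A. \<Sum>j\<in>A. scl (cnj (f i) * h j) (star (c i) * c j))"
  unfolding star_sum star_lin sum_product by (intro sum.cong refl) (simp add: mult.commute)

lemma eb_complete:
  assumes "i < dd n" "j < dd n" shows "(\<Sum>k<dd n. eb n k i * cnj (eb n k j)) = (if i = j then 1 else 0)"
proof -
  have "ud j i = (\<Sum>k<dd n. cinner (dd n) (eb n k) (ud j) * eb n k i)"
    by (rule fun_cong[OF eb_expand[OF ud_cvec[OF assms(2)]], of i])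
  also have "\<dots> = (\<Sum>k<dd n. eb n k i * cnj (eb n k j))"
    by (rule sum.cong[OF refl]) (simp only: cinner_ud_right[OF assms(2)] mult.commute)
  finally show ?thesis by (simp only: ud_apply)
qed

lemma sum_scl_delta: "(\<Sum>j<d. scl (if i = j then 1 else 0) (f j)) = (if i < d then f i else 0)" for f :: "nat \<Rightarrow> falg"
proof -
  have "(\<Sum>j<d. scl (if i = j then 1 else 0) (f j)) = (\<Sum>j<d. if j = i then f i else 0)"
    by (rule sum.cong[OF refl]) auto
  then show ?thesis by (simp add: sum.delta)
qed

lemma mcoef_star_sum:
  assumes w: "unitary_corep q d v"
  shows "(\<Sum>i<d. star (mcoef d v (ud i) y) * mcoef d v (ud i) y) \<simeq> scl (cinner d y y) 1"
proof -
  have c: "mcoef d v (ud i) y = (\<Sum>k<d. scl (y k) (v i k))" if "i < d" for i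
  proof -
    have "mcoef d v (ud i) y = (\<Sum>i'<d. \<Sum>k<d. scl (if i = i' then 1 else 0) (scl (y k) (v i' k)))"
      unfolding mcoef_def by (intro sum.cong refl) (auto simp: ud_apply)
    also have "\<dots> = (\<Sum>i'<d. scl (if i = i' then 1 else 0) (\<Sum>k<d. scl (y k) (v i' k)))" by (simp only: scl_sum)
    finally show ?thesis using that by (simp only: sum_scl_delta if_True)
  qed
  have "(\<Sum>i<d. star (mcoef d v (ud i) y) * mcoef d v (ud i) y) = (\<Sum>i<d. \<Sum>k<d. \<Sum>l<d. scl (cnj (y k) * y l) (star (v i k) * v i l))"
  proof (rule sum.cong[OF refl])
    fix i assume "i \<in> {..<d}"
    then have i: "i < d" by simp
    show "star (mcoef d v (ud i) y) * mcoef d v (ud i) y = (\<Sum>k<d. \<Sum>l<d. scl (cnj (y k) * y l) (star (v i k) * v i l))"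
      unfolding c[OF i] by (rule star_lincomb_mult)
  qed
  also have "\<dots> = (\<Sum>k<d. \<Sum>l<d. scl (cnj (y k) * y l) (\<Sum>i<d. star (v i k) * v i l))"
    unfolding scl_sum by (rule sum3_rotate)
  also have "\<dots> \<simeq> (\<Sum>k<d. \<Sum>l<d. scl (cnj (y k) * y l) (if k = l then 1 else 0))"
  proof -
    have "(\<Sum>i<d. star (v i k) * v i l) \<simeq> (if k = l then 1 else 0)" if "k \<in> {..<d}" "l \<in> {..<d}" for k l
      using w that unfolding unitary_corep_def eqv_def by blast
    then show ?thesis by (intro eqv_sum eqv_scl)
  qed
  also have "(\<Sum>k<d. \<Sum>l<d. scl (cnj (y k) * y l) (if k = l then 1 else 0)) = (\<Sum>k<d. scl (cnj (y k) * y k) (1::falg))"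
  proof (rule sum.cong[OF refl])
    fix k assume "k \<in> {..<d}"
    moreover have "(\<Sum>l<d. scl (cnj (y k) * y l) (if k = l then 1 else 0)) = (\<Sum>l<d. if l = k then scl (cnj (y k) * y k) 1 else (0::falg))"
      by (rule sum.cong[OF refl]) auto
    ultimately show "(\<Sum>l<d. scl (cnj (y k) * y l) (if k = l then 1 else 0)) = scl (cnj (y k) * y k) (1::falg)" by (simp add: sum.delta)
  qed
  also have "\<dots> = scl (cinner d y y) 1" unfolding cinner_def by (rule fa.scale_sum_left[symmetric])
  finally show ?thesis .
qed

text \<open>Unitarity of a column of \<open>u n\<close>, transported from the unit vectors to the
  eigenbasis by \<open>eb_complete\<close>.\<close>

lemma um_unitary: "(\<Sum>j\<in>js n. star (um n j) * um n j) \<simeq> 1"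
proof -
  let ?d = "dd n"
  let ?c = "\<lambda>i. mcoef ?d (u n) (ud i) (et n)"
  have m: "um n (int k - int n) = (\<Sum>i<?d. scl (cnj (eb n k i)) (?c i))" if "k < ?d" for k
  proof -
    have "eb n k \<in> cvec ?d" using eb_onf that unfolding onf_def by blast
    then show ?thesis unfolding um_def eb_def[symmetric] by (rule mcoef_expand_left)
  qed
  have "(\<Sum>j\<in>js n. star (um n j) * um n j) = (\<Sum>k<?d. star (um n (int k - int n)) * um n (int k - int n))" by (rule js_sum)
  also have "\<dots> = (\<Sum>k<?d. \<Sum>i<?d. \<Sum>j<?d. scl (eb n k i * cnj (eb n k j)) (star (?c i) * ?c j))"
  proof (rule sum.cong[OF refl])
    fix k assume "k \<in> {..<?d}"
    then have k: "k < ?d" by simp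
    have "star (um n (int k - int n)) * um n (int k - int n) = (\<Sum>i<?d. \<Sum>j<?d. scl (cnj (cnj (eb n k i)) * cnj (eb n k j)) (star (?c i) * ?c j))"
      unfolding m[OF k] by (rule star_lincomb_mult)
    then show "star (um n (int k - int n)) * um n (int k - int n) = (\<Sum>i<?d. \<Sum>j<?d. scl (eb n k i * cnj (eb n k j)) (star (?c i) * ?c j))"
      by (simp only: complex_cnj_cnj)
  qed
  also have "\<dots> = (\<Sum>i<?d. \<Sum>j<?d. \<Sum>k<?d. scl (eb n k i * cnj (eb n k j)) (star (?c i) * ?c j))" by (rule sum3_rotate)
  also have "\<dots> = (\<Sum>i<?d. \<Sum>j<?d. scl (if i = j then 1 else 0) (star (?c i) * ?c j))"
  proof (rule sum.cong[OF refl], rule sum.cong[OF refl])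
    fix i j assume "i \<in> {..<?d}" "j \<in> {..<?d}"
    then have "(\<Sum>k<?d. eb n k i * cnj (eb n k j)) = (if i = j then 1 else 0)" by (intro eb_complete) simp_all
    then show "(\<Sum>k<?d. scl (eb n k i * cnj (eb n k j)) (star (?c i) * ?c j)) = scl (if i = j then 1 else 0) (star (?c i) * ?c j)"
      by (simp only: fa.scale_sum_left[symmetric])
  qed
  also have "\<dots> = (\<Sum>i<?d. star (?c i) * ?c i)"
    by (rule sum.cong[OF refl]) (simp only: sum_scl_delta lessThan_iff if_True)
  finally have e: "(\<Sum>j\<in>js n. star (um n j) * um n j) = (\<Sum>i<?d. star (?c i) * ?c i)" .
  show ?thesis unfolding e using mcoef_star_sum[OF u_corep, of n "et n"] by (simp only: et_norm fa.scale_one)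
qed

text \<open>Only j = 0 has nonzero counit, so subtracting counits changes the unitarity sum by 1 -
  u_0^* - u_0; invariance of the state under Phi_0 replaces u_0 by psi_n.\<close>

lemma sum_norms:
  assumes l: "0 < l" "l < Q2 q"
  shows "(\<Sum>j\<in>js n. Re (sc l (star (dev (um n j)) * dev (um n j)))) = C l * (2 * Re (D l n))"
proof -
  have d: "star (dev (um n j)) * dev (um n j) =
    star (um n j) * um n j + (if j = 0 then 1 - star (um n 0) - um n 0 else 0)" if "j \<in> js n" for j
  proof (cases "j = 0")
    case True
    then have e: "dev (um n j) = um n 0 - 1" using um_eps[OF that] by (simp add: dev_def cst_eq)
    show ?thesis unfolding e using True by (simp add: star_diff star_one algebra_simps)
  next
    case False
    then have "dev (um n j) = um n j" using um_eps[OF that] by (simp add: dev_def cst_eq)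
    then show ?thesis using False by simp
  qed
  have 0: "0 \<in> js n" "finite (js n)" by (simp_all add: js_def)
  have u0: "ph l (um n 0) = ph l (psi n)"
  proof -
    have "ph l (um n 0) = ph l (Ea (ind a) (um n 0))" by (simp add: ph_Ea[OF l] um_inB)
    also have "\<dots> = ph l (scl (eps (um n 0)) (psi n))"
      unfolding um_def et_def[symmetric] by (rule ph_eqv[OF l Ea_mcoef[OF et_cvec]])
    finally show ?thesis using um_eps[OF 0(1)] by simp
  qed
  note B = um_inB inB_star[OF um_inB] inB_one
  have "(\<Sum>j\<in>js n. ph l (star (dev (um n j)) * dev (um n j))) = ph l (\<Sum>j\<in>js n. star (dev (um n j)) * dev (um n j))"
    by (rule ph_sum[OF l, symmetric]) (intro inB_mult inB_star dev_inB um_inB)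
  also have "(\<Sum>j\<in>js n. star (dev (um n j)) * dev (um n j))
      = (\<Sum>j\<in>js n. star (um n j) * um n j) + (\<Sum>j\<in>js n. if j = 0 then 1 - star (um n 0) - um n 0 else 0)"
    unfolding sum.distrib[symmetric] by (rule sum.cong[OF refl d])
  also have "(\<Sum>j\<in>js n. if j = 0 then 1 - star (um n 0) - um n 0 else 0) = 1 - star (um n 0) - um n 0"
    using 0 by (simp add: sum.delta)
  also have "ph l ((\<Sum>j\<in>js n. star (um n j) * um n j) + (1 - star (um n 0) - um n 0)) = ph l (1 + (1 - star (um n 0) - um n 0))"
    by (rule ph_eqv[OF l eqv_add[OF um_unitary eqv_refl]])
  also have "\<dots> = 2 - (ph l (psi n) + cnj (ph l (psi n)))"
    using B by (simp add: ph_add[OF l] ph_diff[OF l] ph_one[OF l] ph_star[OF l] u0 inB_diff)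
  finally have e: "(\<Sum>j\<in>js n. ph l (star (dev (um n j)) * dev (um n j))) = 2 - (ph l (psi n) + cnj (ph l (psi n)))" .
  have "(\<Sum>j\<in>js n. Re (sc l (star (dev (um n j)) * dev (um n j)))) = Re (of_real (C l) * ((\<Sum>j\<in>js n. ph l (star (dev (um n j)) * dev (um n j))) / gp l))"
    by (simp only: sc_def sum_divide_distrib sum_distrib_left Re_sum)
  also have "\<dots> = C l * (2 * Re (D l n))"
    unfolding e D_def by (simp add: gp_Re)
  finally show ?thesis .
qed

definition tot :: "nat \<Rightarrow> real" where "tot n = (\<Sum>j\<in>js n. (D2_norm q a ip (cocycle q a (um n j)))\<^sup>2)"

lemma tot_eq: "tot n = C (Q2 q) * (2 * g n)"
proof -
  have 1: "((\<lambda>l. \<Sum>j\<in>js n. Re (sc l (star (dev (um n j)) * dev (um n j)))) \<longlongrightarrow> tot n) F"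
    unfolding tot_def by (intro tendsto_sum D2_norm_lim um_inB)
  have "((\<lambda>l. C l * (2 * Re (D l n))) \<longlongrightarrow> C (Q2 q) * (2 * Re (of_real (g n)))) F"
    using tendsto_Re[OF C_lim] by (intro tendsto_intros conjunct1[OF D_lim]) simp
  then have h: "((\<lambda>l. C l * (2 * Re (D l n))) \<longlongrightarrow> C (Q2 q) * (2 * g n)) F" by (simp only: Re_complex_of_real)
  have "((\<lambda>l. \<Sum>j\<in>js n. Re (sc l (star (dev (um n j)) * dev (um n j)))) \<longlongrightarrow> C (Q2 q) * (2 * g n)) F"
    by (rule lim_congI[OF h]) (rule sum_norms)
  from tendsto_unique[OF trivial_limit_at_left_real 1 this] show ?thesis .
qed

lemma tot_ge: "C (Q2 q) * 2 / kap * real n \<le> tot n"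
proof -
  have "C (Q2 q) * 2 * (real n / kap) \<le> C (Q2 q) * 2 * g n"
    using C_pos[OF Q2_pos] by (intro mult_left_mono g_ge) simp
  then show ?thesis by (simp add: tot_eq)
qed

lemma proper: "filterlim tot at_top sequentially"
proof -
  have "0 < C (Q2 q) * 2 / kap" using C_pos[OF Q2_pos] kap_pos by simp
  then have "filterlim (\<lambda>n. C (Q2 q) * 2 / kap * real n) at_top sequentially"
    by (rule filterlim_tendsto_pos_mult_at_top[OF tendsto_const _ filterlim_real_sequentially])
  then show ?thesis by (rule filterlim_at_top_mono) (rule always_eventually, rule allI, rule tot_ge)
qed

section \<open>Exclusion of coboundaries\<close>

lemma parallelogram:
  assumes l: "0 < l" "l < Q2 q" and x: "inB x" and y: "inB y"
  shows "Re (sc l (star (x - y) * (x - y))) \<le> 2 * Re (sc l (star x * x)) + 2 * Re (sc l (star y * y))"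
proof -
  have "sc l (star (x + y) * (x + y)) + sc l (star (x - y) * (x - y)) =
      sc l (star (x + y) * (x + y) + star (x - y) * (x - y))"
    using x y by (simp add: sc_add[OF l] inB_mult inB_star inB_add inB_diff)
  also have "star (x + y) * (x + y) + star (x - y) * (x - y) = (star x * x + star x * x) + (star y * y + star y * y)"
    by (simp add: star_diff star_lin algebra_simps)
  also have "sc l ((star x * x + star x * x) + (star y * y + star y * y)) = 2 * sc l (star x * x) + 2 * sc l (star y * y)"
    using x y by (simp add: sc_add[OF l] inB_mult inB_star inB_add)
  finally have e: "sc l (star (x + y) * (x + y)) + sc l (star (x - y) * (x - y))
      = 2 * sc l (star x * x) + 2 * sc l (star y * y)" .
  have "Re (sc l (star (x + y) * (x + y))) + Re (sc l (star (x - y) * (x - y)))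
      = 2 * Re (sc l (star x * x)) + 2 * Re (sc l (star y * y))"
    unfolding plus_complex.sel(1)[symmetric] e by (simp only: plus_complex.sel mult_2)
  then show ?thesis using sc_pos[OF l inB_add[OF x y]] by linarith
qed

text \<open>The bound is uniform in n: unitarity contracts the sum over u_j b to a single norm, and
  the counit subtracts b for j = 0 only. Each of the two enters twice, hence the 4.\<close>

lemma sc_sum_bound:
  assumes l: "0 < l" "l < Q2 q" and b: "inB b"
  shows "(\<Sum>j\<in>js n. Re (sc l (star (dev (um n j) * b) * (dev (um n j) * b)))) \<le> 4 * Re (sc l (star b * b))"
proof -
  let ?r = "Re (sc l (star b * b))"
  let ?y = "\<lambda>j. if j = 0 then b else 0"
  have yB: "inB (?y j)" for j using b inB_zero by simp
  have d: "dev (um n j) * b = um n j * b - ?y j" if "j \<in> js n" for j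
    by (simp add: dev_def um_eps[OF that] left_diff_distrib cst_eq)
  have 0: "0 \<in> js n" "finite (js n)" by (simp_all add: js_def)
  have z: "sc l 0 = 0" by (simp add: sc_def ph_zero[OF l])
  have "(\<Sum>j\<in>js n. sc l (star (um n j * b) * (um n j * b))) = sc l (star b * b)"
  proof -
    have "(\<Sum>j\<in>js n. ph l (star (um n j * b) * (um n j * b))) = ph l (\<Sum>j\<in>js n. star (um n j * b) * (um n j * b))"
      by (rule ph_sum[OF l, symmetric]) (intro inB_mult inB_star um_inB b)
    also have "(\<Sum>j\<in>js n. star (um n j * b) * (um n j * b)) = star b * (\<Sum>j\<in>js n. star (um n j) * um n j) * b"
      by (simp add: star_mult sum_distrib_left sum_distrib_right mult.assoc)
    also have "ph l (star b * (\<Sum>j\<in>js n. star (um n j) * um n j) * b) = ph l (star b * 1 * b)"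
      by (intro ph_eqv[OF l] eqv_mult eqv_refl um_unitary)
    finally show ?thesis by (simp add: sc_def sum_divide_distrib[symmetric] sum_distrib_left[symmetric])
  qed
  then have 1: "(\<Sum>j\<in>js n. Re (sc l (star (um n j * b) * (um n j * b)))) = ?r" by (simp only: Re_sum[symmetric])
  have "(\<Sum>j\<in>js n. Re (sc l (star (dev (um n j) * b) * (dev (um n j) * b))))
      \<le> (\<Sum>j\<in>js n. 2 * Re (sc l (star (um n j * b) * (um n j * b))) + 2 * Re (sc l (star (?y j) * ?y j)))"
    by (rule sum_mono) (simp only: d parallelogram[OF l inB_mult[OF um_inB b] yB])
  also have "\<dots> = 2 * ?r + 2 * (\<Sum>j\<in>js n. Re (sc l (star (?y j) * ?y j)))"
    unfolding sum.distrib sum_distrib_left[symmetric] 1 ..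
  also have "(\<Sum>j\<in>js n. Re (sc l (star (?y j) * ?y j))) = (\<Sum>j\<in>js n. if j = 0 then ?r else 0)"
    by (rule sum.cong[OF refl]) (simp add: z)
  also have "\<dots> = ?r" using 0 by (simp add: sum.delta)
  finally show ?thesis by simp
qed

lemma not_coboundary: "\<not> (\<exists>\<xi>\<in>D2 q a. \<forall>b\<in>podles q a. cocycle q a b = cobdry q a \<xi> b)"
proof
  assume "\<exists>\<xi>\<in>D2 q a. \<forall>b\<in>podles q a. cocycle q a b = cobdry q a \<xi> b"
  then obtain \<xi> where \<xi>: "\<xi> \<in> D2 q a" "\<And>b. inB b \<Longrightarrow> cocycle q a b = cobdry q a \<xi> b" by (auto simp: podles_inB)
  obtain b where b: "inB b" "eps b = 0" "\<xi> = cl (Q2 q) b" using D2_cl[OF \<xi>(1)] by blast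
  obtain k where k: "((\<lambda>l. sc l (star b * b)) \<longlongrightarrow> k) F"
    using sc_lim[of "star b * b"] b by (auto simp: inB_mult inB_star eps_mult)
  have "tot n \<le> 4 * Re k" for n
  proof -
    have j: "((\<lambda>l. Re (sc l (star (dev (um n j) * b) * (dev (um n j) * b)))) \<longlongrightarrow> (D2_norm q a ip (cocycle q a (um n j)))\<^sup>2) F" for j
    proof -
      let ?x = "dev (um n j)"
      have xB: "inB ?x" by (rule dev_inB[OF um_inB])
      have "cl (Q2 q) ?x = cl (Q2 q) (?x * b)"
        using \<xi>(2)[OF um_inB, of n j] by (simp add: b(3) cobdry_cl um_inB cocycle_cl dev_def[symmetric])
      \<comment> \<open>The coboundary identity says that u_j - \<epsilon>(u_j) and its product with
        b have the same class, so \<open>sc_indep\<close> equates the limits of their norms.\<close>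
      then have d: "?x * b - ?x \<in> LeftIdeal q a (Q2 q)" by (metis cl_eq)
      obtain c where c: "((\<lambda>l. sc l (star ?x * ?x)) \<longlongrightarrow> c) F"
        using sc_lim[of "star ?x * ?x"] by (auto simp: inB_mult inB_star xB eps_mult dev_eps)
      have "((\<lambda>l. sc l (star (?x * b) * (?x * b))) \<longlongrightarrow> c) F"
        by (rule sc_indep[OF xB dev_eps xB dev_eps d d c])
      from tendsto_Re[OF this] have "((\<lambda>l. Re (sc l (star (?x * b) * (?x * b)))) \<longlongrightarrow> Re c) F" .
      moreover have "Re c = (D2_norm q a ip (cocycle q a (um n j)))\<^sup>2"
        using tendsto_unique[OF _ tendsto_Re[OF c] D2_norm_lim[OF um_inB]] by simp
      ultimately show ?thesis by simp
    qed
    have A: "((\<lambda>l. \<Sum>j\<in>js n. Re (sc l (star (dev (um n j) * b) * (dev (um n j) * b)))) \<longlongrightarrow> tot n) F"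
      unfolding tot_def by (intro tendsto_sum j)
    have B: "((\<lambda>l. 4 * Re (sc l (star b * b))) \<longlongrightarrow> 4 * Re k) F" by (intro tendsto_intros k)
    show ?thesis by (rule tendsto_le[OF _ B A ev_l]) (simp_all only: sc_sum_bound b(1) trivial_limit_at_left_real simp_thms)
  qed
  then have "eventually (\<lambda>n. tot n \<le> 4 * Re k) sequentially" by simp
  moreover have "eventually (\<lambda>n. 4 * Re k < tot n) sequentially" using proper by (simp add: filterlim_at_top_dense)
  ultimately have "eventually (\<lambda>n::nat. False) sequentially" by (rule eventually_elim2) simp
  then show False by simp
qed

end

theorem theorem5p4:
  fixes q a :: real
    and u :: "nat \<Rightarrow> nat \<Rightarrow> nat \<Rightarrow> falg"
    and \<eta> :: "nat \<Rightarrow> int \<Rightarrow> nat \<Rightarrow> complex"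
    and ip :: "real \<Rightarrow> falg set \<Rightarrow> falg set \<Rightarrow> complex"
  assumes "0 < q" and "q < 1"
    and "\<And>n. irred_unitary_corep q (2 * n + 1) (u n)"
    and "\<And>n. eigenvectors q a n (u n) (\<eta> n)"
    and "\<And>l. 0 < l \<Longrightarrow> l < Q2 q \<Longrightarrow> invariant_inner q a l (ip l)"
  shows "filterlim
           (\<lambda>n. \<Sum>j = - int n..int n.
              (D2_norm q a ip (cocycle q a (mcoef (2 * n + 1) (u n) (\<eta> n j) (\<eta> n 0))))\<^sup>2)
           at_top sequentially
       \<and> \<not> (\<exists>\<xi>\<in>D2 q a. \<forall>b\<in>podles q a. cocycle q a b = cobdry q a \<xi> b)"
proof -
  interpret sqm q a u \<eta> ip by unfold_locales (fact assms)+
  show ?thesis using proper not_coboundary unfolding tot_def[abs_def] um_def js_def dd_def et_def by blast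
qed

end
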